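(* Let $G$ be a countable discrete group with 2-cocycle $c$. Suppose $S$ is maximal among abelian subgroups of $G$ on which $c$ is symmetric, and that $S$ is normal and immediately centralizing. Put $B=C^*_r(S,c)$, let $\alpha$ be the action of $G/S$ on $\widehat B$ given by $\alpha_{[g]}=\alpha_{\delta_g}$, and assume $\alpha$ is topologically free. Let $\mathcal{K}=(G/S)\,{}_\alpha\!\ltimes\widehat B$ be the transformation groupoid, let $R(S)=\{r_{[g]}:[g]\in G/S\}$, $r_{[g]}\in[g]$, be any choice of coset representatives for $G/S$, and let $\sigma$ be the 2-cocycle on $\mathcal{K}$ given by $$\sigma\bigl(([g],\alpha_h(y)),([h],y)\bigr)=\frac{\bigl(\delta_{r_{[gh]}}^*\delta_{r_{[g]}}\delta_{r_{[h]}}\bigr)(y)}{\bigl|\bigl(\delta_{r_{[gh]}}^*\delta_{r_{[g]}}\delta_{r_{[h]}}\bigr)(y)\bigr|}.$$ Then the Cartan pair $(C^*_r(\mathcal{K},\mathcal{K}\times_\sigma\mathbb{T}),C_0(\widehat B))$ is isomorphic to the pair $(C^*_r(G,c),C^*_r(S,c))$; that is, there is a $*$-isomorphism of $C^*_r(G,c)$ onto $C^*_r(\mathcal{K},\mathcal{K}\times_\sigma\mathbb{T})$ carrying $C^*_r(S,c)$ onto $C_0(\mathcal{K}^{(0)})=C_0(\widehat B)$.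
   Context: 2-cocycles. A 2-cocycle on a groupoid $\mathcal{K}$ is $\sigma:\mathcal{K}^{(2)}\to\mathbb{T}$ (with $\mathcal{K}^{(2)}$ the set of composable pairs) such that $\sigma(\gamma,s(\gamma))=\sigma(r(\gamma),\gamma)=1$ and $\sigma(g,hk)\sigma(h,k)=\sigma(gh,k)\sigma(g,h)$. In particular a 2-cocycle on a group $G$ is $c:G\times G\to\mathbb{T}$ with $c(g,e)=c(e,g)=1$ and $c(g,hk)c(h,k)=c(gh,k)c(g,h)$; it is symmetric on $S$ if $c(s,t)=c(t,s)$ for all $s,t\in S$. $C^*_r(G,c)$ is the completion of $C_c(G)$, with $\delta_g\delta_h=c(g,h)\delta_{gh}$ and $\delta_g^*=\overline{c(g,g^{-1})}\delta_{g^{-1}}$, in the operator norm of its left regular representation on $\ell^2(G)$, $\delta_g\,e_h=c(g,h)e_{gh}$. $C^*_r(S,c)$ is viewed as the closure of $C_c(S)$ in $C^*_r(G,c)$. Immediately centralizing. $\nu\in G$ is $k$-centralizing for $S$ if for every $t\in S$ there is $j\in\{1,\dots,k\}$ with $\nu t^j=t^j\nu$; $S$ is immediately centralizing if for every $k\ge1$ each $k$-centralizing element is $1$-centralizing. Under the hypotheses on $G$, $S$, $c$ above, $(A,B)=(C^*_r(G,c),C^*_r(S,c))$ is a Cartan pair: $B$ is maximal abelian in $A$, is the range of a faithful conditional expectation, has normalizer $N(B)=\{n\in A:nbn^*,n^*bn\in B\ \forall b\in B\}$ generating $A$, and contains an approximate identity for $A$. The action. Identify $B\cong C_0(\widehat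 B)$ by Gelfand duality, writing $b(x)$ for the value of $b\in B$ at $x\in\widehat B$. Each $\delta_g$ is a unitary in $N(B)$, and there is a unique homeomorphism $\alpha_g=\alpha_{\delta_g}$ of $\widehat B$ with $\delta_g^*b\delta_g=b\circ\alpha_g$ for all $b\in B$; it depends only on $[g]\in G/S$, and $[g]\mapsto\alpha_{[g]}:=\alpha_g$ is an action of $G/S$. It is topologically free if for every finite $F\subseteq(G/S)\setminus\{e\}$ the set $\{x\in\widehat B:\alpha_q(x)\ne x\ \forall q\in F\}$ is dense in $\widehat B$. Note $\delta_{r_{[gh]}}^*\delta_{r_{[g]}}\delta_{r_{[h]}}\in B$, so it can be evaluated at $y\in\widehat B$. Groupoids. $\mathcal{K}=(G/S)\times\widehat B$ with the product topology ($G/S$ discrete), $s([g],x)=x$, $r([g],x)=\alpha_g(x)$, $([g],\alpha_h(y))([h],y)=([gh],y)$; its unit space is identified with $\widehat B$. $\mathcal{K}\times_\sigma\mathbb{T}$ is the twist over $\mathcal{K}$ which as a space is $\mathcal{K}\times\mathbb{T}$, with multiplication $(\gamma,t)(\eta,s)=(\gamma\eta,\sigma(\gamma,\eta)ts)$ and $\mathbb{T}$ acting on the second coordinate. For a twist $\Sigma$ over $\mathcal{K}$ (so $\Sigma/\mathbb{T}\cong\mathcal{K}$ and $\Sigma^{(0)}=\mathcal{K}^{(0)}$), $C^*_r(\mathcal{K},\Sigma)$ is the completion of $\{f\in C_c(\Sigma):f(z\gamma)=\overline zf(\gamma)\ \forall z\in\mathbb{T}\}$, with $f*h(\gamma)=\sum_{\eta}f(\tilde\eta)h(\tilde\eta^{-1}\gamma)$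 (sum over $\eta\in\mathcal{K}$ with $r(\eta)=r(\gamma)$, $\tilde\eta\in\Sigma$ any lift of $\eta$) and $f^*(\gamma)=\overline{f(\gamma^{-1})}$, in the supremum over units $u$ of the operator norms of its representations, by the same convolution formula, on the Hilbert spaces of $\mathbb{T}$-equivariant functions on $s^{-1}(u)\subseteq\Sigma$ that are square-summable modulo $\mathbb{T}$. $C_0(\mathcal{K}^{(0)})$ sits in $C^*_r(\mathcal{K},\Sigma)$ as the equivariant functions supported on $\mathbb{T}\cdot\Sigma^{(0)}$. *)

theory Defs
  imports "HOL-Analysis.Analysis" "HOL-Algebra.Coset"
begin

section \<open>Normed star-algebras and their completions\<close>

record 'a star_algebra = "'a partial_object" +
  alg_add :: "'a \<Rightarrow> 'a \<Rightarrow> 'a"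
  alg_scale :: "complex \<Rightarrow> 'a \<Rightarrow> 'a"
  alg_mult :: "'a \<Rightarrow> 'a \<Rightarrow> 'a"
  alg_star :: "'a \<Rightarrow> 'a"
  alg_norm :: "'a \<Rightarrow> real"

definition alg_dist :: "('a, 'm) star_algebra_scheme \<Rightarrow> 'a \<Rightarrow> 'a \<Rightarrow> real" where
  "alg_dist A a b = alg_norm A (alg_add A a (alg_scale A (-1) b))"

definition alg_Cauchy :: "('a, 'm) star_algebra_scheme \<Rightarrow> (nat \<Rightarrow> 'a) set" where
  "alg_Cauchy A = {X. (\<forall>n. X n \<in> carrier A) \<and>
     (\<forall>e>0. \<exists>N. \<forall>m\<ge>N. \<forall>n\<ge>N. alg_dist A (X m) (X n) < e)}"

definition null_rel :: "('a, 'm) star_algebra_scheme \<Rightarrow> ((nat \<Rightarrow> 'a) \<times> (nat \<Rightarrow> 'a)) set" where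
  "null_rel A = {(X, Y). X \<in> alg_Cauchy A \<and> Y \<in> alg_Cauchy A \<and>
     (\<lambda>n. alg_dist A (X n) (Y n)) \<longlonglongrightarrow> 0}"

definition completion :: "('a, 'm) star_algebra_scheme \<Rightarrow> (nat \<Rightarrow> 'a) set star_algebra" where
  "completion A = \<lparr>
     carrier = alg_Cauchy A // null_rel A,
     alg_add = (\<lambda>P Q. \<Union>X\<in>P. \<Union>Y\<in>Q. null_rel A `` {\<lambda>n. alg_add A (X n) (Y n)}),
     alg_scale = (\<lambda>z P. \<Union>X\<in>P. null_rel A `` {\<lambda>n. alg_scale A z (X n)}),
     alg_mult = (\<lambda>P Q. \<Union>X\<in>P. \<Union>Y\<in>Q. null_rel A `` {\<lambda>n. alg_mult A (X n) (Y n)}),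
     alg_star = (\<lambda>P. \<Union>X\<in>P. null_rel A `` {\<lambda>n. alg_star A (X n)}),
     alg_norm = (\<lambda>P. THE l. \<forall>X\<in>P. (\<lambda>n. alg_norm A (X n)) \<longlonglongrightarrow> l)\<rparr>"

definition completion_emb :: "('a, 'm) star_algebra_scheme \<Rightarrow> 'a \<Rightarrow> (nat \<Rightarrow> 'a) set" where
  "completion_emb A a = null_rel A `` {\<lambda>n. a}"

definition norm_closure :: "('a, 'm) star_algebra_scheme \<Rightarrow> 'a set \<Rightarrow> 'a set" where
  "norm_closure A D = {a \<in> carrier A. \<forall>e>0. \<exists>d\<in>D. alg_dist A a d < e}"

definition star_iso ::
    "('a, 'm) star_algebra_scheme \<Rightarrow> ('b, 'n) star_algebra_scheme \<Rightarrow> ('a \<Rightarrow> 'b) \<Rightarrow> bool" where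
  "star_iso A B \<Phi> \<longleftrightarrow> bij_betw \<Phi> (carrier A) (carrier B) \<and>
     (\<forall>a\<in>carrier A. \<forall>b\<in>carrier A. \<Phi> (alg_add A a b) = alg_add B (\<Phi> a) (\<Phi> b)) \<and>
     (\<forall>z. \<forall>a\<in>carrier A. \<Phi> (alg_scale A z a) = alg_scale B z (\<Phi> a)) \<and>
     (\<forall>a\<in>carrier A. \<forall>b\<in>carrier A. \<Phi> (alg_mult A a b) = alg_mult B (\<Phi> a) (\<Phi> b)) \<and>
     (\<forall>a\<in>carrier A. \<Phi> (alg_star A a) = alg_star B (\<Phi> a))"

section \<open>The Gelfand spectrum\<close>

text \<open>Characters are made extensional so that the weak-star topology is the subspace topology
  of the product topology. The value of b at x is the application of x to b.\<close>

definition characters :: "('a, 'm) star_algebra_scheme \<Rightarrow> ('a \<Rightarrow> complex) set" where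
  "characters B = {x \<in> extensional (carrier B).
     (\<forall>a\<in>carrier B. \<forall>b\<in>carrier B. x (alg_add B a b) = x a + x b) \<and>
     (\<forall>z. \<forall>a\<in>carrier B. x (alg_scale B z a) = z * x a) \<and>
     (\<forall>a\<in>carrier B. \<forall>b\<in>carrier B. x (alg_mult B a b) = x a * x b) \<and>
     (\<exists>a\<in>carrier B. x a \<noteq> 0)}"

definition spectrum_top :: "('a, 'm) star_algebra_scheme \<Rightarrow> ('a \<Rightarrow> complex) topology" where
  "spectrum_top B = subtopology (product_topology (\<lambda>_. euclidean) (carrier B)) (characters B)"

section \<open>Twisted group algebras\<close>

abbreviation circle :: "complex set" where
  "circle \<equiv> sphere 0 1"

definition group_2cocycle :: "('a, 'm) monoid_scheme \<Rightarrow> ('a \<Rightarrow> 'a \<Rightarrow> complex) \<Rightarrow> bool" where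
  "group_2cocycle G c \<longleftrightarrow>
     (\<forall>g\<in>carrier G. \<forall>h\<in>carrier G. c g h \<in> circle) \<and>
     (\<forall>g\<in>carrier G. c g \<one>\<^bsub>G\<^esub> = 1 \<and> c \<one>\<^bsub>G\<^esub> g = 1) \<and>
     (\<forall>g\<in>carrier G. \<forall>h\<in>carrier G. \<forall>k\<in>carrier G.
        c g (h \<otimes>\<^bsub>G\<^esub> k) * c h k = c (g \<otimes>\<^bsub>G\<^esub> h) k * c g h)"

definition symmetric_on :: "'a set \<Rightarrow> ('a \<Rightarrow> 'a \<Rightarrow> complex) \<Rightarrow> bool" where
  "symmetric_on S c \<longleftrightarrow> (\<forall>s\<in>S. \<forall>t\<in>S. c s t = c t s)"

definition symmetric_abelian_subgroup ::
    "('a, 'm) monoid_scheme \<Rightarrow> ('a \<Rightarrow> 'a \<Rightarrow> complex) \<Rightarrow> 'a set \<Rightarrow> bool" where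
  "symmetric_abelian_subgroup G c S \<longleftrightarrow> subgroup S G \<and>
     (\<forall>s\<in>S. \<forall>t\<in>S. s \<otimes>\<^bsub>G\<^esub> t = t \<otimes>\<^bsub>G\<^esub> s) \<and> symmetric_on S c"

definition maximal_symmetric_abelian ::
    "('a, 'm) monoid_scheme \<Rightarrow> ('a \<Rightarrow> 'a \<Rightarrow> complex) \<Rightarrow> 'a set \<Rightarrow> bool" where
  "maximal_symmetric_abelian G c S \<longleftrightarrow> symmetric_abelian_subgroup G c S \<and>
     (\<forall>H. symmetric_abelian_subgroup G c H \<and> S \<subseteq> H \<longrightarrow> H = S)"

definition centralizing :: "('a, 'm) monoid_scheme \<Rightarrow> 'a set \<Rightarrow> nat \<Rightarrow> 'a \<Rightarrow> bool" where
  "centralizing G S k \<nu> \<longleftrightarrow>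
     (\<forall>t\<in>S. \<exists>j\<in>{1..k}. \<nu> \<otimes>\<^bsub>G\<^esub> (t [^]\<^bsub>G\<^esub> j) = (t [^]\<^bsub>G\<^esub> j) \<otimes>\<^bsub>G\<^esub> \<nu>)"

definition immediately_centralizing :: "('a, 'm) monoid_scheme \<Rightarrow> 'a set \<Rightarrow> bool" where
  "immediately_centralizing G S \<longleftrightarrow>
     (\<forall>k\<ge>1. \<forall>\<nu>\<in>carrier G. centralizing G S k \<nu> \<longrightarrow> centralizing G S 1 \<nu>)"

text \<open>Functions on a set are represented by functions on the whole type that vanish off it.\<close>

definition Cc_group :: "'a set \<Rightarrow> ('a \<Rightarrow> complex) set" where
  "Cc_group S = {f. finite {g. f g \<noteq> 0} \<and> {g. f g \<noteq> 0} \<subseteq> S}"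

definition delta :: "'a \<Rightarrow> 'a \<Rightarrow> complex" where
  "delta g = (\<lambda>h. if h = g then 1 else 0)"

text \<open>The bilinear extension of \<open>\<delta>\<^sub>g \<delta>\<^sub>h = c(g,h) \<delta>\<^sub>g\<^sub>h\<close>. For finitely supported f and \<open>\<xi>\<close> in
  \<open>\<ell>\<^sup>2(G)\<close> the same formula gives the left regular representation
  \<open>\<delta>\<^sub>g e\<^sub>h = c(g,h) e\<^sub>g\<^sub>h\<close>.\<close>

definition twisted_conv ::
    "('a, 'm) monoid_scheme \<Rightarrow> ('a \<Rightarrow> 'a \<Rightarrow> complex) \<Rightarrow>
     ('a \<Rightarrow> complex) \<Rightarrow> ('a \<Rightarrow> complex) \<Rightarrow> 'a \<Rightarrow> complex" where
  "twisted_conv G c f \<xi> k = (if k \<in> carrier G then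
     (\<Sum>g | g \<in> carrier G \<and> f g \<noteq> 0. f g * \<xi> (inv\<^bsub>G\<^esub> g \<otimes>\<^bsub>G\<^esub> k) * c g (inv\<^bsub>G\<^esub> g \<otimes>\<^bsub>G\<^esub> k)) else 0)"

text \<open>The conjugate-linear extension of
  \<open>\<delta>\<^sub>g\<^sup>* = cnj (c(g, g\<^sup>-\<^sup>1)) \<delta>\<close> at \<open>g\<^sup>-\<^sup>1\<close>.\<close>

definition twisted_star ::
    "('a, 'm) monoid_scheme \<Rightarrow> ('a \<Rightarrow> 'a \<Rightarrow> complex) \<Rightarrow> ('a \<Rightarrow> complex) \<Rightarrow> 'a \<Rightarrow> complex" where
  "twisted_star G c f k =
     (if k \<in> carrier G then cnj (f (inv\<^bsub>G\<^esub> k)) * cnj (c (inv\<^bsub>G\<^esub> k) k) else 0)"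

definition l2_space :: "'a set \<Rightarrow> ('a \<Rightarrow> complex) set" where
  "l2_space I = {\<xi>. (\<forall>i. i \<notin> I \<longrightarrow> \<xi> i = 0) \<and> (\<lambda>i. (cmod (\<xi> i))\<^sup>2) summable_on I}"

definition l2_norm :: "'a set \<Rightarrow> ('a \<Rightarrow> complex) \<Rightarrow> real" where
  "l2_norm I \<xi> = sqrt (\<Sum>\<^sub>\<infinity>i\<in>I. (cmod (\<xi> i))\<^sup>2)"

definition op_norm :: "'v set \<Rightarrow> ('v \<Rightarrow> real) \<Rightarrow> ('v \<Rightarrow> 'v) \<Rightarrow> real" where
  "op_norm H N T = (SUP \<xi>\<in>{\<xi>\<in>H. N \<xi> \<le> 1}. N (T \<xi>))"

definition group_algebra ::
    "('a, 'm) monoid_scheme \<Rightarrow> ('a \<Rightarrow> 'a \<Rightarrow> complex) \<Rightarrow> ('a \<Rightarrow> complex) star_algebra" where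
  "group_algebra G c = \<lparr>
     carrier = Cc_group (carrier G),
     alg_add = (\<lambda>f h g. f g + h g),
     alg_scale = (\<lambda>z f g. z * f g),
     alg_mult = twisted_conv G c,
     alg_star = twisted_star G c,
     alg_norm = (\<lambda>f. op_norm (l2_space (carrier G)) (l2_norm (carrier G)) (twisted_conv G c f))\<rparr>"

definition Cr_group ::
    "('a, 'm) monoid_scheme \<Rightarrow> ('a \<Rightarrow> 'a \<Rightarrow> complex) \<Rightarrow> (nat \<Rightarrow> 'a \<Rightarrow> complex) set star_algebra" where
  "Cr_group G c = completion (group_algebra G c)"

definition Cr_subgroup ::
    "('a, 'm) monoid_scheme \<Rightarrow> ('a \<Rightarrow> 'a \<Rightarrow> complex) \<Rightarrow> 'a set \<Rightarrow>
     (nat \<Rightarrow> 'a \<Rightarrow> complex) set star_algebra" where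
  "Cr_subgroup G c S = (Cr_group G c)
     \<lparr>carrier := norm_closure (Cr_group G c) (completion_emb (group_algebra G c) ` Cc_group S)\<rparr>"

definition delta_elt ::
    "('a, 'm) monoid_scheme \<Rightarrow> ('a \<Rightarrow> 'a \<Rightarrow> complex) \<Rightarrow> 'a \<Rightarrow> (nat \<Rightarrow> 'a \<Rightarrow> complex) set" where
  "delta_elt G c g = completion_emb (group_algebra G c) (delta g)"

section \<open>The action of the quotient group on the spectrum\<close>

type_synonym 'a dual_point = "(nat \<Rightarrow> 'a \<Rightarrow> complex) set \<Rightarrow> complex"

definition dual_top ::
    "('a, 'm) monoid_scheme \<Rightarrow> ('a \<Rightarrow> 'a \<Rightarrow> complex) \<Rightarrow> 'a set \<Rightarrow> 'a dual_point topology" where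
  "dual_top G c S = spectrum_top (Cr_subgroup G c S)"

text \<open>Since \<open>b(x) = x b\<close>, the defining identity \<open>\<delta>\<^sub>g\<^sup>* b \<delta>\<^sub>g = b \<circ> \<alpha>\<^sub>g\<close> (all b) evaluated at x says
  precisely that the character \<open>\<alpha>\<^sub>g(x)\<close> sends b to \<open>x (\<delta>\<^sub>g\<^sup>* b \<delta>\<^sub>g)\<close>.\<close>

definition dual_homeo ::
    "('a, 'm) monoid_scheme \<Rightarrow> ('a \<Rightarrow> 'a \<Rightarrow> complex) \<Rightarrow> 'a set \<Rightarrow> 'a \<Rightarrow>
     'a dual_point \<Rightarrow> 'a dual_point" where
  "dual_homeo G c S g x = (let A = Cr_group G c; d = delta_elt G c g in
     (\<lambda>b\<in>carrier (Cr_subgroup G c S). x (alg_mult A (alg_mult A (alg_star A d) b) d)))"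

definition dual_action ::
    "('a, 'm) monoid_scheme \<Rightarrow> ('a \<Rightarrow> 'a \<Rightarrow> complex) \<Rightarrow> 'a set \<Rightarrow> 'a set \<Rightarrow>
     'a dual_point \<Rightarrow> 'a dual_point" where
  "dual_action G c S q x = (THE y. \<forall>g\<in>q. y = dual_homeo G c S g x)"

definition topologically_free ::
    "('q, 'm) monoid_scheme \<Rightarrow> 'x topology \<Rightarrow> ('q \<Rightarrow> 'x \<Rightarrow> 'x) \<Rightarrow> bool" where
  "topologically_free Q X \<alpha> \<longleftrightarrow> (\<forall>F. finite F \<and> F \<subseteq> carrier Q - {\<one>\<^bsub>Q\<^esub>} \<longrightarrow>
     X closure_of {x \<in> topspace X. \<forall>q\<in>F. \<alpha> q x \<noteq> x} = topspace X)"

section \<open>Groupoids, twists and reduced twisted groupoid algebras\<close>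

text \<open>Units are regarded as arrows.\<close>

record 'a groupoid =
  arrow_top :: "'a topology"
  src :: "'a \<Rightarrow> 'a"
  rng :: "'a \<Rightarrow> 'a"
  gmult :: "'a \<Rightarrow> 'a \<Rightarrow> 'a"

definition arrows :: "('a, 'm) groupoid_scheme \<Rightarrow> 'a set" where
  "arrows K = topspace (arrow_top K)"

definition units :: "('a, 'm) groupoid_scheme \<Rightarrow> 'a set" where
  "units K = src K ` arrows K"

definition ginv :: "('a, 'm) groupoid_scheme \<Rightarrow> 'a \<Rightarrow> 'a" where
  "ginv K a = (THE b. b \<in> arrows K \<and> src K b = rng K a \<and> rng K b = src K a \<and>
     gmult K b a = src K a \<and> gmult K a b = rng K a)"

definition transformation_groupoid ::
    "('q, 'm) monoid_scheme \<Rightarrow> 'x topology \<Rightarrow> ('q \<Rightarrow> 'x \<Rightarrow> 'x) \<Rightarrow> ('q \<times> 'x) groupoid" where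
  "transformation_groupoid Q X \<alpha> = \<lparr>
     arrow_top = prod_topology (discrete_topology (carrier Q)) X,
     src = (\<lambda>(q, x). (\<one>\<^bsub>Q\<^esub>, x)),
     rng = (\<lambda>(q, x). (\<one>\<^bsub>Q\<^esub>, \<alpha> q x)),
     gmult = (\<lambda>(q, x) (p, y). (q \<otimes>\<^bsub>Q\<^esub> p, y))\<rparr>"

text \<open>A twist over a groupoid carries its quotient map onto the base and the circle action.\<close>

record ('a, 'k) twist = "'a groupoid" +
  proj :: "'a \<Rightarrow> 'k"
  act :: "complex \<Rightarrow> 'a \<Rightarrow> 'a"

text \<open>The identity over the unit u for the multiplication below is \<open>(u, cnj (\<sigma>(u,u)))\<close>; it is
  \<open>(u, 1)\<close> when \<open>\<sigma>\<close> is normalized. The general form is needed because the cocycle attached to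
  coset representatives is normalized only if S itself is represented by the identity.\<close>

definition cocycle_twist ::
    "('k, 'm) groupoid_scheme \<Rightarrow> ('k \<Rightarrow> 'k \<Rightarrow> complex) \<Rightarrow> ('k \<times> complex, 'k) twist" where
  "cocycle_twist K \<sigma> = \<lparr>
     arrow_top = prod_topology (arrow_top K) (top_of_set circle),
     src = (\<lambda>(\<gamma>, t). (src K \<gamma>, cnj (\<sigma> (src K \<gamma>) (src K \<gamma>)))),
     rng = (\<lambda>(\<gamma>, t). (rng K \<gamma>, cnj (\<sigma> (rng K \<gamma>) (rng K \<gamma>)))),
     gmult = (\<lambda>(\<gamma>, t) (\<eta>, s). (gmult K \<gamma> \<eta>, \<sigma> \<gamma> \<eta> * t * s)),
     proj = fst,
     act = (\<lambda>z (\<gamma>, t). (\<gamma>, z * t))\<rparr>"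

definition lift :: "('a, 'k, 'n) twist_scheme \<Rightarrow> 'k \<Rightarrow> 'a" where
  "lift \<Sigma> \<eta> = (SOME a. a \<in> arrows \<Sigma> \<and> proj \<Sigma> a = \<eta>)"

definition equivariant :: "('a, 'k, 'n) twist_scheme \<Rightarrow> ('a \<Rightarrow> complex) \<Rightarrow> bool" where
  "equivariant \<Sigma> f \<longleftrightarrow> (\<forall>z\<in>circle. \<forall>a\<in>arrows \<Sigma>. f (act \<Sigma> z a) = cnj z * f a)"

definition Cc_twist :: "('a, 'k, 'n) twist_scheme \<Rightarrow> ('a \<Rightarrow> complex) set" where
  "Cc_twist \<Sigma> = {f. (\<forall>a. a \<notin> arrows \<Sigma> \<longrightarrow> f a = 0) \<and>
     continuous_map (arrow_top \<Sigma>) euclidean f \<and>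
     compactin (arrow_top \<Sigma>) (arrow_top \<Sigma> closure_of {a \<in> arrows \<Sigma>. f a \<noteq> 0}) \<and>
     equivariant \<Sigma> f}"

definition twist_conv ::
    "('k, 'm) groupoid_scheme \<Rightarrow> ('a, 'k, 'n) twist_scheme \<Rightarrow>
     ('a \<Rightarrow> complex) \<Rightarrow> ('a \<Rightarrow> complex) \<Rightarrow> 'a \<Rightarrow> complex" where
  "twist_conv K \<Sigma> f h a = (if a \<in> arrows \<Sigma> then
     (\<Sum>\<^sub>\<infinity>\<eta>\<in>{\<eta> \<in> arrows K. rng K \<eta> = rng K (proj \<Sigma> a)}.
        f (lift \<Sigma> \<eta>) * h (gmult \<Sigma> (ginv \<Sigma> (lift \<Sigma> \<eta>)) a)) else 0)"

definition twist_star :: "('a, 'k, 'n) twist_scheme \<Rightarrow> ('a \<Rightarrow> complex) \<Rightarrow> 'a \<Rightarrow> complex" where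
  "twist_star \<Sigma> f a = (if a \<in> arrows \<Sigma> then cnj (f (ginv \<Sigma> a)) else 0)"

definition fibre_norm ::
    "('k, 'm) groupoid_scheme \<Rightarrow> ('a, 'k, 'n) twist_scheme \<Rightarrow> 'a \<Rightarrow> ('a \<Rightarrow> complex) \<Rightarrow> real" where
  "fibre_norm K \<Sigma> u \<xi> =
     sqrt (\<Sum>\<^sub>\<infinity>\<eta>\<in>{\<eta> \<in> arrows K. src K \<eta> = proj \<Sigma> u}. (cmod (\<xi> (lift \<Sigma> \<eta>)))\<^sup>2)"

definition fibre_space ::
    "('k, 'm) groupoid_scheme \<Rightarrow> ('a, 'k, 'n) twist_scheme \<Rightarrow> 'a \<Rightarrow> ('a \<Rightarrow> complex) set" where
  "fibre_space K \<Sigma> u = {\<xi>. (\<forall>a. \<not> (a \<in> arrows \<Sigma> \<and> src \<Sigma> a = u) \<longrightarrow> \<xi> a = 0) \<and>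
     equivariant \<Sigma> \<xi> \<and>
     (\<lambda>\<eta>. (cmod (\<xi> (lift \<Sigma> \<eta>)))\<^sup>2) summable_on {\<eta> \<in> arrows K. src K \<eta> = proj \<Sigma> u}}"

definition twist_algebra ::
    "('k, 'm) groupoid_scheme \<Rightarrow> ('a, 'k, 'n) twist_scheme \<Rightarrow> ('a \<Rightarrow> complex) star_algebra" where
  "twist_algebra K \<Sigma> = \<lparr>
     carrier = Cc_twist \<Sigma>,
     alg_add = (\<lambda>f h a. f a + h a),
     alg_scale = (\<lambda>z f a. z * f a),
     alg_mult = twist_conv K \<Sigma>,
     alg_star = twist_star \<Sigma>,
     alg_norm = (\<lambda>f. SUP u\<in>units \<Sigma>.
        op_norm (fibre_space K \<Sigma> u) (fibre_norm K \<Sigma> u) (twist_conv K \<Sigma> f))\<rparr>"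

definition Cr_twist ::
    "('k, 'm) groupoid_scheme \<Rightarrow> ('a, 'k, 'n) twist_scheme \<Rightarrow>
     (nat \<Rightarrow> 'a \<Rightarrow> complex) set star_algebra" where
  "Cr_twist K \<Sigma> = completion (twist_algebra K \<Sigma>)"

text \<open>The copy of \<open>C\<^sub>0\<close> of the unit space: the closure of the compactly supported equivariant
  functions living on the circle orbits of units (for a compact unit space the closure adds
  nothing).\<close>

definition C0_units ::
    "('k, 'm) groupoid_scheme \<Rightarrow> ('a, 'k, 'n) twist_scheme \<Rightarrow> (nat \<Rightarrow> 'a \<Rightarrow> complex) set set" where
  "C0_units K \<Sigma> = norm_closure (Cr_twist K \<Sigma>) (completion_emb (twist_algebra K \<Sigma>) `
     {f \<in> Cc_twist \<Sigma>. \<forall>a. f a \<noteq> 0 \<longrightarrow> (\<exists>z\<in>circle. \<exists>u\<in>units \<Sigma>. a = act \<Sigma> z u)})"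

section \<open>The groupoid and cocycle attached to a normal subgroup\<close>

definition coset_groupoid ::
    "('a, 'm) monoid_scheme \<Rightarrow> ('a \<Rightarrow> 'a \<Rightarrow> complex) \<Rightarrow> 'a set \<Rightarrow>
     ('a set \<times> 'a dual_point) groupoid" where
  "coset_groupoid G c S =
     transformation_groupoid (G Mod S) (dual_top G c S) (dual_action G c S)"

definition coset_cocycle ::
    "('a, 'm) monoid_scheme \<Rightarrow> ('a \<Rightarrow> 'a \<Rightarrow> complex) \<Rightarrow> 'a set \<Rightarrow> ('a set \<Rightarrow> 'a) \<Rightarrow>
     'a set \<times> 'a dual_point \<Rightarrow> 'a set \<times> 'a dual_point \<Rightarrow> complex" where
  "coset_cocycle G c S r = (\<lambda>(q, x) (p, y).
     let A = Cr_group G c; d = delta_elt G c;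
         v = y (alg_mult A (alg_mult A (alg_star A (d (r (q \<otimes>\<^bsub>G Mod S\<^esub> p)))) (d (r q))) (d (r p)))
     in v / complex_of_real (cmod v))"

end

theory Submission
  imports Defs
begin

text \<open>A finitely supported f on G is cut into its restrictions to the cosets q of S, and the
  restriction to q is translated into S by \<open>\<delta>\<^sub>r\<^sub>q\<^sup>*\<close> and evaluated at the twisted characters of S,
  that is, at the points of the spectrum of B. This gives a function on the transformation groupoid,
  and \<open>\<delta>\<^sub>g \<delta>\<^sub>h = c(g,h) \<delta>\<^sub>g\<^sub>h\<close> turns into convolution with respect to the cocycle. The transform
  does not decrease norms, as averaging the fibre norms over enough characters recovers the norm
  of \<open>\<ell>\<^sup>2(G)\<close>, and does not increase them, as S is abelian and its Folner sets carry approximate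
  eigenvectors for every twisted character. By the Stone-Weierstrass theorem its range is dense,
  also in the functions on the unit space, so it extends to the required isomorphism of the
  completions.\<close>

section \<open>Completions of seminormed star-algebras\<close>

text \<open>An injective homomorphism on a dense subalgebra need not preserve reduced norms, so the
  norm equality has to come from explicit estimates in both directions. What links the two sides is
  a quadratic form: for a finitely supported vector a on G, the squared norm of its slice at \<psi>
  has the kernel \<open>ker h g \<psi>\<close>, the value at \<psi> of \<delta>(h)* \<delta>(g).
  Averaging over \<psi> kills its off-diagonal part, and testing on Folner vectors reproduces it up
  to the factor \<open>card F\<close>. The chain rule for \<open>ker\<close> also carries all
  phases, so that action, cocycle and transform obey one calculus. The representative
  \<open>r S\<close> is an arbitrary element of S. The cocycle is therefore not normalized, and the
  phase of \<delta>(\<open>r S\<close>) appears in units, inverses and adjoints. Twisted characters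
  exist because c, being symmetric on S, defines an abelian extension of S by the circle, and the
  circle is divisible, hence a direct factor. A multiplicative functional on B is contractive for
  purely algebraic reasons, hence unimodular on each \<delta>(s); this is why the spectrum consists
  of twisted characters only.\<close>

locale seminormed_star_algebra =
  fixes A :: "('i \<Rightarrow> complex) star_algebra"
  assumes add_eq: "alg_add A = (\<lambda>f h i. f i + h i)"
    and scale_eq: "alg_scale A = (\<lambda>z f i. z * f i)"
    and zero_closed: "(\<lambda>_. 0) \<in> carrier A"
    and add_closed: "f \<in> carrier A \<Longrightarrow> h \<in> carrier A \<Longrightarrow> (\<lambda>i. f i + h i) \<in> carrier A"
    and scale_closed: "f \<in> carrier A \<Longrightarrow> (\<lambda>i. z * f i) \<in> carrier A"
    and mult_closed: "f \<in> carrier A \<Longrightarrow> h \<in> carrier A \<Longrightarrow> alg_mult A f h \<in> carrier A"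
    and star_closed: "f \<in> carrier A \<Longrightarrow> alg_star A f \<in> carrier A"
    and mult_diff_left: "f \<in> carrier A \<Longrightarrow> f' \<in> carrier A \<Longrightarrow> h \<in> carrier A \<Longrightarrow>
      alg_mult A (\<lambda>i. f i - f' i) h = (\<lambda>i. alg_mult A f h i - alg_mult A f' h i)"
    and mult_diff_right: "f \<in> carrier A \<Longrightarrow> h \<in> carrier A \<Longrightarrow> h' \<in> carrier A \<Longrightarrow>
      alg_mult A f (\<lambda>i. h i - h' i) = (\<lambda>i. alg_mult A f h i - alg_mult A f h' i)"
    and star_diff: "f \<in> carrier A \<Longrightarrow> f' \<in> carrier A \<Longrightarrow>
      alg_star A (\<lambda>i. f i - f' i) = (\<lambda>i. alg_star A f i - alg_star A f' i)"
    and norm_triangle: "f \<in> carrier A \<Longrightarrow> h \<in> carrier A \<Longrightarrow>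
      alg_norm A (\<lambda>i. f i + h i) \<le> alg_norm A f + alg_norm A h"
    and norm_scale: "f \<in> carrier A \<Longrightarrow> alg_norm A (\<lambda>i. z * f i) = cmod z * alg_norm A f"
    and norm_mult: "f \<in> carrier A \<Longrightarrow> h \<in> carrier A \<Longrightarrow>
      alg_norm A (alg_mult A f h) \<le> alg_norm A f * alg_norm A h"
    and norm_star: "f \<in> carrier A \<Longrightarrow> alg_norm A (alg_star A f) = alg_norm A f"
begin

abbreviation N where "N \<equiv> alg_norm A"
abbreviation C where "C \<equiv> completion A"
abbreviation cls where "cls X \<equiv> null_rel A `` {X}"

lemma diff_closed: "f \<in> carrier A \<Longrightarrow> h \<in> carrier A \<Longrightarrow> (\<lambda>i. f i - h i) \<in> carrier A"
  using add_closed[OF _ scale_closed[of h "-1"], of f] by simp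

lemma alg_dist_eq: "alg_dist A f h = N (\<lambda>i. f i - h i)"
  by (simp add: alg_dist_def add_eq scale_eq)

lemma norm_zero: "N (\<lambda>_. 0) = 0"
  using norm_scale[OF zero_closed, of 0] by simp

lemma norm_minus: "f \<in> carrier A \<Longrightarrow> N (\<lambda>i. - f i) = N f"
  using norm_scale[of f "-1"] by simp

lemma norm_nonneg: assumes "f \<in> carrier A" shows "0 \<le> N f"
  using norm_triangle[OF assms scale_closed[OF assms, of "-1"]] norm_minus[OF assms] norm_zero
  by simp

lemma dist_commute: "f \<in> carrier A \<Longrightarrow> h \<in> carrier A \<Longrightarrow> N (\<lambda>i. f i - h i) = N (\<lambda>i. h i - f i)"
  using norm_minus[OF diff_closed, of f h] by simp

lemma dist_triangle:
  assumes "f \<in> carrier A" "h \<in> carrier A" "k \<in> carrier A"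
  shows "N (\<lambda>i. f i - k i) \<le> N (\<lambda>i. f i - h i) + N (\<lambda>i. h i - k i)"
  using norm_triangle[OF diff_closed[OF assms(1,2)] diff_closed[OF assms(2,3)]] by simp

lemma norm_diff_le:
  assumes "f \<in> carrier A" "h \<in> carrier A"
  shows "\<bar>N f - N h\<bar> \<le> N (\<lambda>i. f i - h i)"
  using norm_triangle[OF diff_closed[OF assms] assms(2)]
    norm_triangle[OF diff_closed[OF assms(2,1)] assms(1)] dist_commute[OF assms] by simp

lemma dist_diff_le:
  assumes "f \<in> carrier A" "h \<in> carrier A" "f' \<in> carrier A" "h' \<in> carrier A"
  shows "\<bar>N (\<lambda>i. f i - h i) - N (\<lambda>i. f' i - h' i)\<bar> \<le> N (\<lambda>i. f i - f' i) + N (\<lambda>i. h i - h' i)"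
  using dist_triangle[of f f' h] dist_triangle[of f' h' h] dist_triangle[of f' f h']
    dist_triangle[of f h h'] dist_commute[of f f'] dist_commute[of h h'] assms by simp

lemma add_dist_le:
  assumes "f \<in> carrier A" "h \<in> carrier A" "f' \<in> carrier A" "h' \<in> carrier A"
  shows "N (\<lambda>i. (f i + h i) - (f' i + h' i)) \<le> N (\<lambda>i. f i - f' i) + N (\<lambda>i. h i - h' i)"
  using norm_triangle[OF diff_closed[OF assms(1,3)] diff_closed[OF assms(2,4)]]
  by (simp add: algebra_simps)

lemma mult_dist_le:
  assumes "f \<in> carrier A" "h \<in> carrier A" "f' \<in> carrier A" "h' \<in> carrier A"
  shows "N (\<lambda>i. alg_mult A f h i - alg_mult A f' h' i)
    \<le> N (\<lambda>i. f i - f' i) * N h + N f' * N (\<lambda>i. h i - h' i)"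
proof -
  have "N (\<lambda>i. alg_mult A f h i - alg_mult A f' h i) \<le> N (\<lambda>i. f i - f' i) * N h"
    using norm_mult[OF diff_closed[OF assms(1,3)] assms(2)] mult_diff_left[OF assms(1,3,2)] by simp
  moreover have "N (\<lambda>i. alg_mult A f' h i - alg_mult A f' h' i) \<le> N f' * N (\<lambda>i. h i - h' i)"
    using norm_mult[OF assms(3) diff_closed[OF assms(2,4)]] mult_diff_right[OF assms(3,2,4)] by simp
  ultimately show ?thesis
    using dist_triangle[OF mult_closed[OF assms(1,2)] mult_closed[OF assms(3,2)] mult_closed[OF assms(3,4)]]
    by linarith
qed

section \<open>Cauchy sequences modulo null sequences\<close>

lemma Cauchy_closed: "X \<in> alg_Cauchy A \<Longrightarrow> X n \<in> carrier A"
  by (simp add: alg_Cauchy_def)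

lemma Cauchy_iff:
  "X \<in> alg_Cauchy A \<longleftrightarrow> (\<forall>n. X n \<in> carrier A) \<and>
     (\<forall>e>0. \<exists>M. \<forall>m\<ge>M. \<forall>n\<ge>M. N (\<lambda>i. X m i - X n i) < e)"
  by (simp add: alg_Cauchy_def alg_dist_eq)

lemma null_rel_iff:
  "(X, Y) \<in> null_rel A \<longleftrightarrow> X \<in> alg_Cauchy A \<and> Y \<in> alg_Cauchy A \<and>
     (\<lambda>n. N (\<lambda>i. X n i - Y n i)) \<longlonglongrightarrow> 0"
  by (simp add: null_rel_def alg_dist_eq)

lemma equiv_null_rel: "equiv (alg_Cauchy A) (null_rel A)"
proof (rule equivI)
  show "null_rel A \<subseteq> alg_Cauchy A \<times> alg_Cauchy A"
    by (auto simp: null_rel_iff)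
  show "refl_on (alg_Cauchy A) (null_rel A)"
    by (auto simp: refl_on_def null_rel_iff norm_zero)
  show "sym (null_rel A)"
    by (auto simp: sym_def null_rel_iff dist_commute[OF Cauchy_closed Cauchy_closed])
  show "trans (null_rel A)"
  proof (rule transI)
    fix X Y Z assume XY: "(X, Y) \<in> null_rel A" and YZ: "(Y, Z) \<in> null_rel A"
    then have c: "X n \<in> carrier A" "Y n \<in> carrier A" "Z n \<in> carrier A" for n
      by (auto simp: null_rel_iff Cauchy_closed)
    have "(\<lambda>n. N (\<lambda>i. X n i - Y n i) + N (\<lambda>i. Y n i - Z n i)) \<longlonglongrightarrow> 0"
      using XY YZ tendsto_add[of _ "0::real" _ _ 0] by (force simp: null_rel_iff)
    then have "(\<lambda>n. N (\<lambda>i. X n i - Z n i)) \<longlonglongrightarrow> 0"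
      by (rule Lim_null_comparison[rotated])
        (use c in \<open>auto simp: norm_nonneg diff_closed intro!: always_eventually dist_triangle\<close>)
    then show "(X, Z) \<in> null_rel A"
      using XY YZ by (auto simp: null_rel_iff)
  qed
qed

lemma cls_eq_iff: "X \<in> alg_Cauchy A \<Longrightarrow> Y \<in> alg_Cauchy A \<Longrightarrow>
    cls X = cls Y \<longleftrightarrow> (\<lambda>n. N (\<lambda>i. X n i - Y n i)) \<longlonglongrightarrow> 0"
  using eq_equiv_class_iff[OF equiv_null_rel] by (simp add: null_rel_iff)

lemma carrier_completion: "carrier C = cls ` alg_Cauchy A"
  by (auto simp: completion_def quotient_def)

lemma cls_closed: "X \<in> alg_Cauchy A \<Longrightarrow> cls X \<in> carrier C"
  by (auto simp: carrier_completion)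

lemma Cauchy_const: "f \<in> carrier A \<Longrightarrow> (\<lambda>n. f) \<in> alg_Cauchy A"
  by (simp add: Cauchy_iff norm_zero)

lemma Cauchy_shift: "X \<in> alg_Cauchy A \<Longrightarrow> (\<lambda>n. X (n + k)) \<in> alg_Cauchy A"
  unfolding Cauchy_iff by (meson trans_le_add1)

text \<open>Dropping an initial segment of a representative turns a bound that holds eventually into
  one that holds throughout. \<open>quasi_inverse_exists\<close> relies on this for the bound
  \<rho>, and again for its recursion.\<close>

lemma cls_shift: assumes "X \<in> alg_Cauchy A" shows "cls (\<lambda>n. X (n + k)) = cls X"
proof -
  have "(\<lambda>n. N (\<lambda>i. X (n + k) i - X n i)) \<longlonglongrightarrow> 0"
  proof (rule LIMSEQ_I)
    fix e :: real assume "e > 0"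
    then obtain M where "\<forall>m\<ge>M. \<forall>n\<ge>M. N (\<lambda>i. X m i - X n i) < e"
      using assms by (auto simp: Cauchy_iff)
    then show "\<exists>M. \<forall>n\<ge>M. norm (N (\<lambda>i. X (n + k) i - X n i) - 0) < e"
      using assms by (auto simp: norm_nonneg diff_closed Cauchy_closed intro!: exI[of _ M])
  qed
  then show ?thesis
    using assms Cauchy_shift by (simp add: cls_eq_iff)
qed

lemma Cauchy_bounded: assumes "X \<in> alg_Cauchy A" obtains K where "K > 0" "\<And>n. N (X n) \<le> K"
proof -
  obtain M where M: "\<And>m n. m \<ge> M \<Longrightarrow> n \<ge> M \<Longrightarrow> N (\<lambda>i. X m i - X n i) < 1"
    using assms unfolding Cauchy_iff by (meson zero_less_one)
  define K where "K = (\<Sum>n\<le>M. N (X n)) + 1"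
  have nn: "0 \<le> N (X n)" for n
    using assms by (simp add: Cauchy_closed norm_nonneg)
  have le: "N (X n) \<le> (\<Sum>n\<le>M. N (X n))" if "n \<le> M" for n
    using that nn by (intro member_le_sum) auto
  have "N (X n) \<le> K" for n
  proof (cases "n \<le> M")
    case True then show ?thesis using le by (simp add: K_def add_increasing2)
  next
    case False
    then have "N (\<lambda>i. X n i - X M i) < 1" by (intro M) auto
    then show ?thesis
      using norm_diff_le[of "X n" "X M"] le[of M] assms by (simp add: Cauchy_closed K_def)
  qed
  moreover have "K > 0" using nn by (simp add: K_def sum_nonneg add_nonneg_pos)
  ultimately show ?thesis using that by blast
qed

text \<open>Every operation is jointly Lipschitz along Cauchy sequences, with a constant depending
  on bounds of the sequences. The lemma is phrased for two arguments; unary operations pass the same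
  sequence twice.\<close>

lemma Cauchy_comparison:
  assumes "X \<in> alg_Cauchy A" "Y \<in> alg_Cauchy A" "\<And>n. Z n \<in> carrier A" "K > 0"
    and "\<And>m n. N (\<lambda>i. Z m i - Z n i) \<le> K * (N (\<lambda>i. X m i - X n i) + N (\<lambda>i. Y m i - Y n i))"
  shows "Z \<in> alg_Cauchy A"
  unfolding Cauchy_iff
proof safe
  fix e :: real assume "e > 0"
  then have e: "e / (2 * K) > 0" using \<open>K > 0\<close> by simp
  obtain M1 where M1: "\<forall>m\<ge>M1. \<forall>n\<ge>M1. N (\<lambda>i. X m i - X n i) < e / (2 * K)"
    using e assms(1) unfolding Cauchy_iff by blast
  obtain M2 where M2: "\<forall>m\<ge>M2. \<forall>n\<ge>M2. N (\<lambda>i. Y m i - Y n i) < e / (2 * K)"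
    using e assms(2) unfolding Cauchy_iff by blast
  have "N (\<lambda>i. Z m i - Z n i) < e" if "m \<ge> max M1 M2" "n \<ge> max M1 M2" for m n
  proof -
    have "N (\<lambda>i. X m i - X n i) + N (\<lambda>i. Y m i - Y n i) < e / K"
      using M1[rule_format, of m n] M2[rule_format, of m n] that \<open>K > 0\<close>
      by (simp add: field_simps)
    then have "K * (N (\<lambda>i. X m i - X n i) + N (\<lambda>i. Y m i - Y n i)) < e"
      using \<open>K > 0\<close> by (simp add: field_simps)
    then show ?thesis using assms(5)[of m n] by linarith
  qed
  then show "\<exists>M. \<forall>m\<ge>M. \<forall>n\<ge>M. N (\<lambda>i. Z m i - Z n i) < e" by blast
qed (use assms in auto)

text \<open>The counterpart of \<open>Cauchy_comparison\<close> for two representatives of one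
  class: the same Lipschitz estimate shows that an operation respects
  \<open>null_rel\<close>.\<close>

lemma null_comparison:
  assumes "(X, X') \<in> null_rel A" "(Y, Y') \<in> null_rel A" "Z \<in> alg_Cauchy A" "Z' \<in> alg_Cauchy A"
    and "\<And>n. N (\<lambda>i. Z n i - Z' n i) \<le> K * (N (\<lambda>i. X n i - X' n i) + N (\<lambda>i. Y n i - Y' n i))"
  shows "cls Z = cls Z'"
proof -
  have "(\<lambda>n. K * (N (\<lambda>i. X n i - X' n i) + N (\<lambda>i. Y n i - Y' n i))) \<longlonglongrightarrow> K * (0 + 0)"
    using assms by (intro tendsto_intros) (auto simp: null_rel_iff)
  then have "(\<lambda>n. N (\<lambda>i. Z n i - Z' n i)) \<longlonglongrightarrow> 0"
    by (intro Lim_null_comparison[where f = "\<lambda>n. N (\<lambda>i. Z n i - Z' n i)"])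
      (use assms in \<open>auto simp: norm_nonneg diff_closed Cauchy_closed intro!: always_eventually\<close>)
  then show ?thesis using assms by (simp add: cls_eq_iff)
qed

lemma Cauchy_add:
  assumes "X \<in> alg_Cauchy A" "Y \<in> alg_Cauchy A" shows "(\<lambda>n i. X n i + Y n i) \<in> alg_Cauchy A"
  by (rule Cauchy_comparison[OF assms, of _ 1])
    (use assms in \<open>auto simp: Cauchy_closed add_closed intro: add_dist_le\<close>)

lemma Cauchy_scale:
  assumes "X \<in> alg_Cauchy A" shows "(\<lambda>n i. z * X n i) \<in> alg_Cauchy A"
proof (rule Cauchy_comparison[OF assms assms, of _ "cmod z + 1"])
  fix m n
  have "N (\<lambda>i. z * X m i - z * X n i) = cmod z * N (\<lambda>i. X m i - X n i)"
    using norm_scale[OF diff_closed, of "X m" "X n" z] assms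
    by (simp add: Cauchy_closed right_diff_distrib)
  also have "\<dots> \<le> (cmod z + 1) * (N (\<lambda>i. X m i - X n i) + N (\<lambda>i. X m i - X n i))"
    using assms by (intro mult_mono) (auto simp: norm_nonneg diff_closed Cauchy_closed)
  finally show "N (\<lambda>i. z * X m i - z * X n i) \<le> \<dots>" .
qed (use assms in \<open>auto simp: Cauchy_closed scale_closed add_nonneg_pos\<close>)

lemma Cauchy_star:
  assumes "X \<in> alg_Cauchy A" shows "(\<lambda>n. alg_star A (X n)) \<in> alg_Cauchy A"
  by (rule Cauchy_comparison[OF assms assms, of _ 1])
    (use assms in \<open>auto simp: Cauchy_closed star_closed norm_star diff_closed norm_nonneg
      simp flip: star_diff\<close>)

lemma mult_dist_bound:
  assumes "f \<in> carrier A" "h \<in> carrier A" "f' \<in> carrier A" "h' \<in> carrier A"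
    and "N h \<le> K" "N f' \<le> L"
  shows "N (\<lambda>i. alg_mult A f h i - alg_mult A f' h' i)
    \<le> (K + L) * (N (\<lambda>i. f i - f' i) + N (\<lambda>i. h i - h' i))"
proof -
  have "0 \<le> N (\<lambda>i. f i - f' i)" "0 \<le> N (\<lambda>i. h i - h' i)" "0 \<le> N h" "0 \<le> N f'"
    using assms by (auto simp: norm_nonneg diff_closed)
  moreover from this have "N (\<lambda>i. f i - f' i) * N h + N f' * N (\<lambda>i. h i - h' i)
    \<le> N (\<lambda>i. f i - f' i) * (K + L) + (K + L) * N (\<lambda>i. h i - h' i)"
    using assms by (intro add_mono mult_mono) auto
  ultimately show ?thesis
    using mult_dist_le[OF assms(1-4)] by (simp add: algebra_simps)
qed

lemma Cauchy_mult:
  assumes "X \<in> alg_Cauchy A" "Y \<in> alg_Cauchy A"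
  shows "(\<lambda>n. alg_mult A (X n) (Y n)) \<in> alg_Cauchy A"
proof -
  obtain K where K: "K > 0" "\<And>n. N (X n) \<le> K" using Cauchy_bounded assms by metis
  obtain L where L: "L > 0" "\<And>n. N (Y n) \<le> L" using Cauchy_bounded assms by metis
  show ?thesis
    by (rule Cauchy_comparison[OF assms, of _ "L + K"])
      (use assms K L in \<open>auto simp: Cauchy_closed mult_closed intro!: mult_dist_bound\<close>)
qed

lemma null_rel_refl: "X \<in> alg_Cauchy A \<Longrightarrow> (X, X) \<in> null_rel A"
  by (simp add: null_rel_iff norm_zero)

text \<open>The operations of \<open>completion\<close> are unions over all representatives. Such a
  union is a single class only because the result respects \<open>null_rel\<close>, and congruence
  lets any chosen representatives compute it. The next three lemmas follow the same pattern.\<close>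

lemma add_cls:
  assumes "X \<in> alg_Cauchy A" "Y \<in> alg_Cauchy A"
  shows "alg_add C (cls X) (cls Y) = cls (\<lambda>n i. X n i + Y n i)"
proof -
  have "congruent2 (null_rel A) (null_rel A) (\<lambda>X Y. cls (\<lambda>n i. X n i + Y n i))"
  proof (rule congruent2I')
    fix X X' Y Y' assume *: "(X, X') \<in> null_rel A" "(Y, Y') \<in> null_rel A"
    then have "X \<in> alg_Cauchy A" "X' \<in> alg_Cauchy A" "Y \<in> alg_Cauchy A" "Y' \<in> alg_Cauchy A"
      by (auto simp: null_rel_iff)
    then show "cls (\<lambda>n i. X n i + Y n i) = cls (\<lambda>n i. X' n i + Y' n i)"
      by (intro null_comparison[OF *, of _ _ 1])
        (auto intro: Cauchy_add add_dist_le simp: Cauchy_closed)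
  qed
  from UN_equiv_class2[OF equiv_null_rel equiv_null_rel this assms] show ?thesis
    by (simp add: completion_def add_eq)
qed

lemma mult_cls:
  assumes "X \<in> alg_Cauchy A" "Y \<in> alg_Cauchy A"
  shows "alg_mult C (cls X) (cls Y) = cls (\<lambda>n. alg_mult A (X n) (Y n))"
proof -
  have "congruent2 (null_rel A) (null_rel A) (\<lambda>X Y. cls (\<lambda>n. alg_mult A (X n) (Y n)))"
  proof (rule congruent2I')
    fix X X' Y Y' assume *: "(X, X') \<in> null_rel A" "(Y, Y') \<in> null_rel A"
    then have c: "X \<in> alg_Cauchy A" "X' \<in> alg_Cauchy A" "Y \<in> alg_Cauchy A" "Y' \<in> alg_Cauchy A"
      by (auto simp: null_rel_iff)
    obtain K where K: "K > 0" "\<And>n. N (X' n) \<le> K" using Cauchy_bounded c by metis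
    obtain L where L: "L > 0" "\<And>n. N (Y n) \<le> L" using Cauchy_bounded c by metis
    show "cls (\<lambda>n. alg_mult A (X n) (Y n)) = cls (\<lambda>n. alg_mult A (X' n) (Y' n))"
      by (rule null_comparison[OF *, of _ _ "L + K"])
        (use c K L in \<open>auto intro!: Cauchy_mult mult_dist_bound simp: Cauchy_closed\<close>)
  qed
  from UN_equiv_class2[OF equiv_null_rel equiv_null_rel this assms] show ?thesis
    by (simp add: completion_def)
qed

lemma scale_cls:
  assumes "X \<in> alg_Cauchy A"
  shows "alg_scale C z (cls X) = cls (\<lambda>n i. z * X n i)"
proof -
  have "congruent (null_rel A) (\<lambda>X. cls (\<lambda>n i. z * X n i))"
  proof (rule congruentI)
    fix X X' assume *: "(X, X') \<in> null_rel A"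
    then have c: "X \<in> alg_Cauchy A" "X' \<in> alg_Cauchy A"
      by (auto simp: null_rel_iff)
    have "N (\<lambda>i. z * X n i - z * X' n i) = cmod z * N (\<lambda>i. X n i - X' n i)" for n
      using norm_scale[OF diff_closed, of "X n" "X' n" z] c
      by (simp add: Cauchy_closed right_diff_distrib)
    then show "cls (\<lambda>n i. z * X n i) = cls (\<lambda>n i. z * X' n i)"
      using * c by (intro null_comparison[OF * *, of _ _ "cmod z"])
        (auto intro!: Cauchy_scale mult_left_mono simp: Cauchy_closed norm_nonneg diff_closed)
  qed
  from UN_equiv_class[OF equiv_null_rel this assms] show ?thesis
    by (simp add: completion_def scale_eq)
qed

lemma star_cls:
  assumes "X \<in> alg_Cauchy A"
  shows "alg_star C (cls X) = cls (\<lambda>n. alg_star A (X n))"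
proof -
  have "congruent (null_rel A) (\<lambda>X. cls (\<lambda>n. alg_star A (X n)))"
  proof (rule congruentI)
    fix X X' assume *: "(X, X') \<in> null_rel A"
    then have c: "X \<in> alg_Cauchy A" "X' \<in> alg_Cauchy A"
      by (auto simp: null_rel_iff)
    have "N (\<lambda>i. alg_star A (X n) i - alg_star A (X' n) i) = N (\<lambda>i. X n i - X' n i)" for n
      using c norm_star[OF diff_closed, of "X n" "X' n"] star_diff[of "X n" "X' n"]
      by (simp add: Cauchy_closed)
    then show "cls (\<lambda>n. alg_star A (X n)) = cls (\<lambda>n. alg_star A (X' n))"
      using * c by (intro null_comparison[OF * *, of _ _ 1])
        (auto intro!: Cauchy_star simp: Cauchy_closed norm_nonneg diff_closed)
  qed
  from UN_equiv_class[OF equiv_null_rel this assms] show ?thesis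
    by (simp add: completion_def)
qed

text \<open>The definite description in \<open>completion\<close> asks for one limit shared by all
  representatives; it exists because norms of a Cauchy sequence converge, and it is shared because a
  null difference does not move it.\<close>

lemma norm_cls:
  assumes "X \<in> alg_Cauchy A"
  shows "(\<lambda>n. N (X n)) \<longlonglongrightarrow> alg_norm C (cls X)"
proof -
  have "Cauchy (\<lambda>n. N (X n))"
    unfolding Cauchy_def
  proof (intro allI impI)
    fix e :: real assume "e > 0"
    then obtain M where "\<forall>m\<ge>M. \<forall>n\<ge>M. N (\<lambda>i. X m i - X n i) < e"
      using assms by (auto simp: Cauchy_iff)
    then show "\<exists>M. \<forall>m\<ge>M. \<forall>n\<ge>M. dist (N (X m)) (N (X n)) < e"
      using norm_diff_le[OF Cauchy_closed Cauchy_closed, OF assms assms]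
      unfolding dist_real_def by (blast intro: le_less_trans)
  qed
  then obtain l where l: "(\<lambda>n. N (X n)) \<longlonglongrightarrow> l"
    using Cauchy_convergent convergent_def by blast
  have all: "(\<lambda>n. N (Y n)) \<longlonglongrightarrow> l" if "Y \<in> cls X" for Y
  proof -
    have Y: "Y \<in> alg_Cauchy A" "(\<lambda>n. N (\<lambda>i. X n i - Y n i)) \<longlonglongrightarrow> 0"
      using that by (auto simp: null_rel_iff)
    have "(\<lambda>n. N (X n) - N (Y n)) \<longlonglongrightarrow> 0"
      by (rule Lim_null_comparison[OF _ Y(2)])
        (use norm_diff_le assms Y(1) in \<open>auto simp: Cauchy_closed\<close>)
    from tendsto_diff[OF l this] show ?thesis by simp
  qed
  have "X \<in> cls X" using assms null_rel_refl by auto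
  then have "(THE l. \<forall>Y\<in>cls X. (\<lambda>n. N (Y n)) \<longlonglongrightarrow> l) = l"
    using all by (intro the_equality) (auto intro: LIMSEQ_unique)
  then show ?thesis using l by (simp add: completion_def)
qed

lemma dist_cls:
  assumes "X \<in> alg_Cauchy A" "Y \<in> alg_Cauchy A"
  shows "(\<lambda>n. N (\<lambda>i. X n i - Y n i)) \<longlonglongrightarrow> alg_dist C (cls X) (cls Y)"
proof -
  have "(\<lambda>n i. X n i + -1 * Y n i) \<in> alg_Cauchy A"
    by (rule Cauchy_add[OF assms(1) Cauchy_scale[OF assms(2)]])
  from norm_cls[OF this] show ?thesis
    unfolding alg_dist_def scale_cls[OF assms(2)] add_cls[OF assms(1) Cauchy_scale[OF assms(2)]]
    by simp
qed

lemma emb_eq: "completion_emb A f = cls (\<lambda>n. f)"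
  by (simp add: completion_emb_def)

lemma emb_closed: "f \<in> carrier A \<Longrightarrow> completion_emb A f \<in> carrier C"
  by (simp add: emb_eq cls_closed Cauchy_const)

lemma emb_dist:
  assumes "f \<in> carrier A" "h \<in> carrier A"
  shows "alg_dist C (completion_emb A f) (completion_emb A h) = N (\<lambda>i. f i - h i)"
  using LIMSEQ_unique[OF dist_cls[OF Cauchy_const Cauchy_const] tendsto_const] assms
  by (simp add: emb_eq)

lemma emb_norm:
  assumes "f \<in> carrier A"
  shows "alg_norm C (completion_emb A f) = N f"
  using LIMSEQ_unique[OF norm_cls[OF Cauchy_const] tendsto_const] assms
  by (simp add: emb_eq)

lemma completion_dist_triangle:
  assumes "P \<in> carrier C" "Q \<in> carrier C" "R \<in> carrier C"
  shows "alg_dist C P R \<le> alg_dist C P Q + alg_dist C Q R"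
proof -
  obtain X Y Z where *: "X \<in> alg_Cauchy A" "Y \<in> alg_Cauchy A" "Z \<in> alg_Cauchy A"
    and eq: "P = cls X" "Q = cls Y" "R = cls Z"
    using assms by (auto simp: carrier_completion)
  show ?thesis
    unfolding eq
    by (rule LIMSEQ_le[OF dist_cls tendsto_add[OF dist_cls dist_cls]])
      (use * in \<open>auto intro!: dist_triangle simp: Cauchy_closed\<close>)
qed

lemma completion_dist_commute:
  assumes "P \<in> carrier C" "Q \<in> carrier C"
  shows "alg_dist C P Q = alg_dist C Q P"
proof -
  obtain X Y where *: "X \<in> alg_Cauchy A" "Y \<in> alg_Cauchy A" and eq: "P = cls X" "Q = cls Y"
    using assms by (auto simp: carrier_completion)
  have "(\<lambda>n. N (\<lambda>i. X n i - Y n i)) = (\<lambda>n. N (\<lambda>i. Y n i - X n i))"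
    using * by (intro ext dist_commute Cauchy_closed)
  then have "(\<lambda>n. N (\<lambda>i. X n i - Y n i)) \<longlonglongrightarrow> alg_dist C Q P"
    using dist_cls[OF *(2,1)] eq by simp
  from LIMSEQ_unique[OF dist_cls[OF *] this] show ?thesis by (simp add: eq)
qed

lemma emb_tendsto:
  assumes "X \<in> alg_Cauchy A" "e > 0"
  shows "\<exists>M. \<forall>n\<ge>M. alg_dist C (cls X) (completion_emb A (X n)) < e"
proof -
  obtain M where M: "\<forall>m\<ge>M. \<forall>n\<ge>M. N (\<lambda>i. X m i - X n i) < e / 2"
    using assms unfolding Cauchy_iff by (meson half_gt_zero)
  have "alg_dist C (cls X) (completion_emb A (X n)) \<le> e / 2" if "n \<ge> M" for n
    unfolding emb_eq
    by (rule LIMSEQ_le_const2[OF dist_cls[OF assms(1) Cauchy_const]])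
      (use assms M that in \<open>auto simp: Cauchy_closed intro!: exI[of _ M] less_imp_le\<close>)
  then show ?thesis using assms(2) by (intro exI[of _ M]) fastforce
qed

text \<open>A point of the closure has approximants in D at distance less than 1/(n+1), and these
  form a representative of the point. Subalgebras given as closures can thus be handled by sequences
  from a space of functions.\<close>

lemma closure_eq:
  assumes D: "D \<subseteq> carrier A"
  shows "norm_closure C (completion_emb A ` D) = cls ` {X \<in> alg_Cauchy A. \<forall>n. X n \<in> D}"
proof (intro equalityI subsetI)
  fix P assume P: "P \<in> norm_closure C (completion_emb A ` D)"
  then obtain Y where Y: "Y \<in> alg_Cauchy A" "P = cls Y"
    by (auto simp: norm_closure_def carrier_completion)
  have PC: "P \<in> carrier C" using P by (simp add: norm_closure_def)
  have "\<exists>f\<in>D. alg_dist C P (completion_emb A f) < 1 / Suc n" for n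
    using P by (force simp: norm_closure_def)
  then obtain X where X: "\<And>n. X n \<in> D" "\<And>n. alg_dist C P (completion_emb A (X n)) < 1 / Suc n"
    by metis
  have XA: "X n \<in> carrier A" for n using X D by auto
  have small: "\<exists>M. \<forall>n\<ge>M. alg_dist C P (completion_emb A (X n)) < e" if e: "e > 0" for e
  proof -
    obtain M where "1 / Suc M < e" by (rule nat_approx_posE[OF e])
    then have "alg_dist C P (completion_emb A (X n)) < e" if "n \<ge> M" for n
      using X(2)[of n] that le_less_trans[of "1 / Suc n" "1 / Suc M" e]
      by (simp add: frac_le)
    then show ?thesis by blast
  qed
  have "X \<in> alg_Cauchy A"
    unfolding Cauchy_iff
  proof safe
    fix e :: real assume "e > 0"
    then obtain M where M: "\<forall>n\<ge>M. alg_dist C P (completion_emb A (X n)) < e / 2"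
      using small[of "e/2"] by auto
    have "N (\<lambda>i. X m i - X n i) < e" if "m \<ge> M" "n \<ge> M" for m n
    proof -
      have "N (\<lambda>i. X m i - X n i) \<le> alg_dist C (completion_emb A (X m)) P + alg_dist C P (completion_emb A (X n))"
        unfolding emb_dist[OF XA XA, symmetric]
        by (intro completion_dist_triangle PC emb_closed XA)
      also have "\<dots> < e / 2 + e / 2"
        unfolding completion_dist_commute[OF emb_closed[OF XA] PC]
        using M that by (intro add_strict_mono) auto
      finally show ?thesis by simp
    qed
    then show "\<exists>M. \<forall>m\<ge>M. \<forall>n\<ge>M. N (\<lambda>i. X m i - X n i) < e" by blast
  qed (rule XA)
  moreover have "P = cls X"
  proof -
    have "alg_dist C P (cls X) < e" if e: "e > 0" for e
    proof -
      obtain M1 where M1: "\<forall>n\<ge>M1. alg_dist C P (completion_emb A (X n)) < e / 2"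
        using small[of "e/2"] e by auto
      obtain M2 where M2: "\<forall>n\<ge>M2. alg_dist C (cls X) (completion_emb A (X n)) < e / 2"
        using emb_tendsto[OF \<open>X \<in> alg_Cauchy A\<close>, of "e/2"] e by auto
      let ?n = "max M1 M2"
      have "alg_dist C P (cls X) \<le> alg_dist C P (completion_emb A (X ?n)) + alg_dist C (completion_emb A (X ?n)) (cls X)"
        by (intro completion_dist_triangle PC emb_closed XA cls_closed \<open>X \<in> alg_Cauchy A\<close>)
      also have "\<dots> < e / 2 + e / 2"
        using M1 M2 completion_dist_commute[OF emb_closed[OF XA] cls_closed[OF \<open>X \<in> alg_Cauchy A\<close>], of ?n]
        by (intro add_strict_mono) auto
      finally show ?thesis by simp
    qed
    moreover have "alg_dist C P (cls X) \<ge> 0"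
      unfolding Y(2)
      by (rule LIMSEQ_le_const[OF dist_cls])
        (use Y \<open>X \<in> alg_Cauchy A\<close> in \<open>auto simp: norm_nonneg diff_closed Cauchy_closed\<close>)
    ultimately have "alg_dist C P (cls X) = 0" by (metis less_irrefl less_eq_real_def)
    then show ?thesis
      using dist_cls[OF Y(1) \<open>X \<in> alg_Cauchy A\<close>] cls_eq_iff[OF Y(1) \<open>X \<in> alg_Cauchy A\<close>] Y(2) by simp
  qed
  ultimately show "P \<in> cls ` {X \<in> alg_Cauchy A. \<forall>n. X n \<in> D}" using X by blast
next
  fix P assume "P \<in> cls ` {X \<in> alg_Cauchy A. \<forall>n. X n \<in> D}"
  then obtain X where X: "X \<in> alg_Cauchy A" "\<And>n. X n \<in> D" "P = cls X" by auto
  have "\<exists>d\<in>completion_emb A ` D. alg_dist C (cls X) d < e" if "e > 0" for e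
    using emb_tendsto[OF X(1) that] X(2) by blast
  then show "P \<in> norm_closure C (completion_emb A ` D)"
    using X(1,3) cls_closed by (auto simp: norm_closure_def)
qed

lemma closure_carrier: "norm_closure C (completion_emb A ` carrier A) = carrier C"
  by (subst closure_eq) (auto simp: carrier_completion Cauchy_closed)

text \<open>The solution Q of Q = P + P Q is the Neumann series; it is approximated by the recursion
  \<open>Z\<^sub>n\<^sub>+\<^sub>1 = X\<^sub>n + X\<^sub>n Z\<^sub>n\<close>, which contracts for any representative X with norms bounded by
  some \<open>\<rho> < 1\<close>.\<close>

lemma quasi_inverse_exists:
  assumes D: "D \<subseteq> carrier A" and D0: "(\<lambda>_. 0) \<in> D"
    and D_add: "\<And>f h. f \<in> D \<Longrightarrow> h \<in> D \<Longrightarrow> (\<lambda>i. f i + h i) \<in> D"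
    and D_mult: "\<And>f h. f \<in> D \<Longrightarrow> h \<in> D \<Longrightarrow> alg_mult A f h \<in> D"
    and P: "P \<in> norm_closure C (completion_emb A ` D)" "alg_norm C P < 1"
  shows "\<exists>Q\<in>norm_closure C (completion_emb A ` D). Q = alg_add C P (alg_mult C P Q)"
proof -
  obtain \<rho> where \<rho>: "alg_norm C P < \<rho>" "\<rho> < 1" using P(2) dense by blast
  obtain X0 where X0: "X0 \<in> alg_Cauchy A" "\<And>n. X0 n \<in> D" "P = cls X0"
    using P(1) unfolding closure_eq[OF D] by auto
  have "eventually (\<lambda>n. N (X0 n) < \<rho>) sequentially"
    using order_tendstoD(2)[OF norm_cls[OF X0(1)]] \<rho> X0(3) by blast
  then obtain k where k: "\<And>n. n \<ge> k \<Longrightarrow> N (X0 n) < \<rho>"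
    by (auto simp: eventually_sequentially)
  define X where "X n = X0 (n + k)" for n
  have X: "X \<in> alg_Cauchy A" "\<And>n. X n \<in> D" "P = cls X" "\<And>n. N (X n) \<le> \<rho>"
    using X0 k Cauchy_shift[of X0 k] cls_shift[of X0 k] by (auto simp: X_def[abs_def] less_imp_le)
  have \<rho>0: "0 \<le> \<rho>" using X(4)[of 0] norm_nonneg[OF Cauchy_closed[OF X(1)], of 0] by linarith
  define Z where "Z = rec_nat (\<lambda>_. 0) (\<lambda>n z i. X n i + alg_mult A (X n) z i)"
  have Z0: "Z 0 = (\<lambda>_. 0)" and ZS: "Z (Suc n) = (\<lambda>i. X n i + alg_mult A (X n) (Z n) i)" for n
    by (simp_all add: Z_def)
  have ZD: "Z n \<in> D" for n
    by (induction n) (auto simp: Z0 ZS D0 intro!: D_add D_mult X)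
  have XA: "X n \<in> carrier A" and ZA: "Z n \<in> carrier A" for n using X ZD D by auto
  \<comment> \<open>The sum of the geometric series in \<rho>, that is, the fixed point of t = 1 +
    \<rho> t. It bounds every iterate and is reproduced by the recursive estimate
    \<open>step\<close>.\<close>
  define K where "K = 1 / (1 - \<rho>)"
  have K: "K > 0" "1 + \<rho> * K = K" using \<rho> by (auto simp: K_def field_simps)
  have ZK: "N (Z n) \<le> K" for n
  proof (induction n)
    case 0 then show ?case using K by (simp add: Z0 norm_zero)
  next
    case (Suc n)
    have "N (Z (Suc n)) \<le> N (X n) + N (X n) * N (Z n)"
      unfolding ZS using norm_triangle[OF XA mult_closed[OF XA ZA]] norm_mult[OF XA ZA, of n n]
      by (meson add_left_mono order_trans)
    also have "\<dots> \<le> \<rho> + \<rho> * K"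
      using Suc X(4) \<rho>0 norm_nonneg ZA by (intro add_mono mult_mono) auto
    finally show ?case using K \<rho> by linarith
  qed
  have step: "N (\<lambda>i. Z (Suc m) i - Z (Suc n) i)
      \<le> (1 + K) * N (\<lambda>i. X m i - X n i) + \<rho> * N (\<lambda>i. Z m i - Z n i)" for m n
  proof -
    have "N (\<lambda>i. Z (Suc m) i - Z (Suc n) i)
      \<le> N (\<lambda>i. X m i - X n i) + N (\<lambda>i. alg_mult A (X m) (Z m) i - alg_mult A (X n) (Z n) i)"
      unfolding ZS by (intro add_dist_le XA mult_closed ZA)
    also have "\<dots> \<le> N (\<lambda>i. X m i - X n i) + (N (\<lambda>i. X m i - X n i) * N (Z m) + N (X n) * N (\<lambda>i. Z m i - Z n i))"
      by (intro add_left_mono mult_dist_le XA ZA)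
    also have "\<dots> \<le> N (\<lambda>i. X m i - X n i) + (N (\<lambda>i. X m i - X n i) * K + \<rho> * N (\<lambda>i. Z m i - Z n i))"
      using X(4) ZK XA ZA by (intro add_left_mono add_mono mult_left_mono mult_right_mono norm_nonneg diff_closed) auto
    finally show ?thesis by (simp add: algebra_simps)
  qed
  have ZC: "Z \<in> alg_Cauchy A"
    unfolding Cauchy_iff
  proof safe
    fix e :: real assume e: "e > 0"
    \<comment> \<open>Summing the error \<epsilon> along the geometric series costs the factor K,
      which makes e / 2; the other half is left for the decaying term.\<close>
    define \<epsilon> where "\<epsilon> = e / (2 * K)"
    have \<epsilon>: "\<epsilon> > 0" "\<epsilon> * K = e / 2" using e K by (auto simp: \<epsilon>_def)
    then have "\<epsilon> / (1 + K) > 0" using K by simp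
    then obtain M where M: "\<forall>m\<ge>M. \<forall>n\<ge>M. N (\<lambda>i. X m i - X n i) < \<epsilon> / (1 + K)"
      using X(1) unfolding Cauchy_iff by blast
    have M': "(1 + K) * N (\<lambda>i. X m i - X n i) \<le> \<epsilon>" if "m \<ge> M" "n \<ge> M" for m n
      using M[rule_format, OF that] K by (simp add: field_simps)
    \<comment> \<open>After j applications of \<open>step\<close> beyond the index M the crude
      initial distance 2 K has been contracted by \<rho>^j, while the contributions of X stay below
      \<epsilon> K.\<close>
    have *: "N (\<lambda>i. Z (M + j + m) i - Z (M + j + n) i) \<le> \<epsilon> * K + \<rho> ^ j * (2 * K)" for j m n
    proof (induction j)
      case 0
      have "N (\<lambda>i. Z (M + m) i - Z (M + n) i) \<le> N (Z (M + m)) + N (Z (M + n))"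
        using dist_triangle[OF ZA zero_closed ZA, of "M + m" "M + n"] norm_minus[OF ZA] by simp
      then show ?case using ZK[of "M + m"] ZK[of "M + n"] \<epsilon> e by simp
    next
      case (Suc j)
      have "N (\<lambda>i. Z (M + Suc j + m) i - Z (M + Suc j + n) i)
        \<le> \<epsilon> + \<rho> * N (\<lambda>i. Z (M + j + m) i - Z (M + j + n) i)"
        using step[of "M + j + m" "M + j + n"] M'[of "M + j + m" "M + j + n"] by simp
      also have "\<dots> \<le> \<epsilon> + \<rho> * (\<epsilon> * K + \<rho> ^ j * (2 * K))"
        using Suc \<rho>0 by (intro add_left_mono mult_left_mono)
      also have "\<epsilon> + \<rho> * (\<epsilon> * K + \<rho> ^ j * (2 * K)) = \<epsilon> * (1 + \<rho> * K) + \<rho> ^ Suc j * (2 * K)"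
        by (simp add: algebra_simps)
      also note K(2)
      finally show ?case .
    qed
    have "(\<lambda>j. \<rho> ^ j * (2 * K)) \<longlonglongrightarrow> 0 * (2 * K)"
      using \<rho> \<rho>0 by (intro tendsto_intros LIMSEQ_realpow_zero) auto
    then have "eventually (\<lambda>j. \<rho> ^ j * (2 * K) < e / 2) sequentially"
      using e by (intro order_tendstoD) auto
    then obtain j where j: "\<rho> ^ j * (2 * K) < e / 2" by (auto simp: eventually_sequentially)
    have "N (\<lambda>i. Z m i - Z n i) < e" if "m \<ge> M + j" "n \<ge> M + j" for m n
      using *[of j "m - (M + j)" "n - (M + j)"] that j \<epsilon> by simp
    then show "\<exists>M. \<forall>m\<ge>M. \<forall>n\<ge>M. N (\<lambda>i. Z m i - Z n i) < e" by blast
  qed (rule ZA)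
  \<comment> \<open>The shifted sequence has the same class, which turns the recursion into the
    fixed-point equation.\<close>
  have "cls (\<lambda>n. Z (n + 1)) = cls Z" by (rule cls_shift[OF ZC])
  then have "cls Z = alg_add C P (alg_mult C P (cls Z))"
    using X(1,3) ZC by (simp add: mult_cls add_cls Cauchy_mult ZS)
  then show ?thesis
    using ZC ZD by (auto simp: closure_eq[OF D])
qed

end

section \<open>Extension of a dense isometric homomorphism to completions\<close>

locale dense_isometry = A: seminormed_star_algebra A + B: seminormed_star_algebra B
  for A :: "('i \<Rightarrow> complex) star_algebra" and B :: "('j \<Rightarrow> complex) star_algebra" +
  fixes \<Psi> :: "('i \<Rightarrow> complex) \<Rightarrow> 'j \<Rightarrow> complex"
  assumes map_closed: "f \<in> carrier A \<Longrightarrow> \<Psi> f \<in> carrier B"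
    and map_add: "f \<in> carrier A \<Longrightarrow> h \<in> carrier A \<Longrightarrow> \<Psi> (\<lambda>i. f i + h i) = (\<lambda>j. \<Psi> f j + \<Psi> h j)"
    and map_scale: "f \<in> carrier A \<Longrightarrow> \<Psi> (\<lambda>i. z * f i) = (\<lambda>j. z * \<Psi> f j)"
    and map_mult: "f \<in> carrier A \<Longrightarrow> h \<in> carrier A \<Longrightarrow> \<Psi> (alg_mult A f h) = alg_mult B (\<Psi> f) (\<Psi> h)"
    and map_star: "f \<in> carrier A \<Longrightarrow> \<Psi> (alg_star A f) = alg_star B (\<Psi> f)"
    and map_norm: "f \<in> carrier A \<Longrightarrow> alg_norm B (\<Psi> f) = alg_norm A f"
    and map_dense: "k \<in> carrier B \<Longrightarrow> e > 0 \<Longrightarrow> \<exists>f\<in>carrier A. alg_norm B (\<lambda>j. k j - \<Psi> f j) < e"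
begin

lemma map_diff: "f \<in> carrier A \<Longrightarrow> h \<in> carrier A \<Longrightarrow> \<Psi> (\<lambda>i. f i - h i) = (\<lambda>j. \<Psi> f j - \<Psi> h j)"
  using map_add[OF _ A.scale_closed[of h "-1"], of f] map_scale[of h "-1"] by simp

lemma map_dist: "f \<in> carrier A \<Longrightarrow> h \<in> carrier A \<Longrightarrow>
    B.N (\<lambda>j. \<Psi> f j - \<Psi> h j) = A.N (\<lambda>i. f i - h i)"
  using map_norm[OF A.diff_closed] by (simp add: map_diff)

lemma map_Cauchy: "X \<in> alg_Cauchy A \<Longrightarrow> (\<lambda>n. \<Psi> (X n)) \<in> alg_Cauchy B"
  by (simp add: A.Cauchy_iff B.Cauchy_iff map_closed map_dist)

definition ext where "ext P = (\<Union>X\<in>P. B.cls (\<lambda>n. \<Psi> (X n)))"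

lemma ext_cls: assumes "X \<in> alg_Cauchy A" shows "ext (A.cls X) = B.cls (\<lambda>n. \<Psi> (X n))"
proof -
  have "congruent (null_rel A) (\<lambda>X. B.cls (\<lambda>n. \<Psi> (X n)))"
    by (rule congruentI)
      (auto simp: A.null_rel_iff B.cls_eq_iff map_Cauchy map_dist A.Cauchy_closed)
  from UN_equiv_class[OF A.equiv_null_rel this assms] show ?thesis by (simp add: ext_def)
qed

text \<open>As \<Psi> is isometric, approximants in D to a Cauchy sequence in E are Cauchy
  themselves. With D and E the whole carriers this yields surjectivity; with D the functions on S
  and E the functions on the unit space it yields the statement about the subalgebras.\<close>

lemma ext_closure:
  assumes "D \<subseteq> carrier A" "E \<subseteq> carrier B" "\<Psi> ` D \<subseteq> E"
    and dense: "\<And>h e. h \<in> E \<Longrightarrow> e > 0 \<Longrightarrow> \<exists>f\<in>D. B.N (\<lambda>j. h j - \<Psi> f j) < e"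
  shows "ext ` norm_closure A.C (completion_emb A ` D) = norm_closure B.C (completion_emb B ` E)"
proof (intro equalityI subsetI)
  fix P assume "P \<in> ext ` norm_closure A.C (completion_emb A ` D)"
  then show "P \<in> norm_closure B.C (completion_emb B ` E)"
    using assms(3) by (fastforce simp: A.closure_eq[OF assms(1)] B.closure_eq[OF assms(2)] ext_cls
        intro!: imageI map_Cauchy)
next
  fix P assume "P \<in> norm_closure B.C (completion_emb B ` E)"
  then obtain Y where Y: "Y \<in> alg_Cauchy B" "\<And>n. Y n \<in> E" "P = B.cls Y"
    by (auto simp: B.closure_eq[OF assms(2)])
  have "\<exists>f\<in>D. B.N (\<lambda>j. Y n j - \<Psi> f j) < 1 / Suc n" for n
    using dense[OF Y(2)] by simp
  then obtain X where X: "\<And>n. X n \<in> D" "\<And>n. B.N (\<lambda>j. Y n j - \<Psi> (X n) j) < 1 / Suc n"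
    by metis
  have XA: "X n \<in> carrier A" for n using X assms(1) by auto
  note XB = map_closed[OF XA]
  note YB = B.Cauchy_closed[OF Y(1)]
  have null: "(\<lambda>n. B.N (\<lambda>j. Y n j - \<Psi> (X n) j)) \<longlonglongrightarrow> 0"
    by (rule Lim_null_comparison[OF _ LIMSEQ_inverse_real_of_nat])
      (use X(2) in \<open>auto simp: B.norm_nonneg B.diff_closed XB YB inverse_eq_divide less_imp_le
        intro!: always_eventually\<close>)
  have "X \<in> alg_Cauchy A"
    unfolding A.Cauchy_iff
  proof safe
    fix e :: real assume e: "e > 0"
    then obtain M1 where M1: "\<forall>m\<ge>M1. \<forall>n\<ge>M1. B.N (\<lambda>i. Y m i - Y n i) < e / 3"
      using Y(1) unfolding B.Cauchy_iff by (meson divide_pos_pos zero_less_numeral)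
    have "eventually (\<lambda>n. B.N (\<lambda>j. Y n j - \<Psi> (X n) j) < e / 3) sequentially"
      using null e by (intro order_tendstoD) auto
    then obtain M2 where M2: "\<forall>n\<ge>M2. B.N (\<lambda>j. Y n j - \<Psi> (X n) j) < e / 3"
      by (auto simp: eventually_sequentially)
    have "A.N (\<lambda>i. X m i - X n i) < e" if "m \<ge> max M1 M2" "n \<ge> max M1 M2" for m n
    proof -
      have "B.N (\<lambda>j. \<Psi> (X m) j - \<Psi> (X n) j)
        \<le> B.N (\<lambda>j. Y m j - \<Psi> (X m) j) + B.N (\<lambda>j. Y m j - Y n j) + B.N (\<lambda>j. Y n j - \<Psi> (X n) j)"
        using B.dist_diff_le[OF XB XB YB YB, of m n m n]
          B.dist_commute[OF YB XB, of m m] B.dist_commute[OF YB XB, of n n] by linarith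
      also have "\<dots> < e / 3 + e / 3 + e / 3"
        using M1 M2 that by (intro add_strict_mono) auto
      finally show ?thesis by (simp add: map_dist XA)
    qed
    then show "\<exists>M. \<forall>m\<ge>M. \<forall>n\<ge>M. A.N (\<lambda>i. X m i - X n i) < e" by blast
  qed (rule XA)
  moreover have "P = ext (A.cls X)"
    using null Y \<open>X \<in> alg_Cauchy A\<close> by (simp add: ext_cls B.cls_eq_iff map_Cauchy)
  ultimately show "P \<in> ext ` norm_closure A.C (completion_emb A ` D)"
    using X(1) by (auto simp: A.closure_eq[OF assms(1)])
qed

lemma star_iso_ext: "star_iso A.C B.C ext"
  unfolding star_iso_def
proof (intro conjI ballI allI)
  have "ext ` carrier A.C = carrier B.C"
    using ext_closure[OF order_refl order_refl _ map_dense] map_closed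
    by (simp add: A.closure_carrier B.closure_carrier image_subset_iff)
  moreover have "inj_on ext (carrier A.C)"
  proof (rule inj_onI)
    fix P Q assume "P \<in> carrier A.C" "Q \<in> carrier A.C" and eq: "ext P = ext Q"
    then obtain X Y where XY: "X \<in> alg_Cauchy A" "Y \<in> alg_Cauchy A" and PQ: "P = A.cls X" "Q = A.cls Y"
      by (auto simp: A.carrier_completion)
    then show "P = Q"
      using eq unfolding PQ ext_cls[OF XY(1)] ext_cls[OF XY(2)] A.cls_eq_iff[OF XY]
        B.cls_eq_iff[OF map_Cauchy map_Cauchy, OF XY]
      by (simp add: map_dist A.Cauchy_closed)
  qed
  ultimately show "bij_betw ext (carrier A.C) (carrier B.C)" by (simp add: bij_betw_def)
qed (auto simp: A.carrier_completion ext_cls A.add_cls B.add_cls A.scale_cls B.scale_cls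
    A.mult_cls B.mult_cls A.star_cls B.star_cls map_Cauchy A.Cauchy_add A.Cauchy_scale
    A.Cauchy_mult A.Cauchy_star map_add map_scale map_mult map_star A.Cauchy_closed)

end

section \<open>Operators on square-summable functions\<close>

lemma Cc_groupD: "\<xi> \<in> Cc_group I \<Longrightarrow> finite {i. \<xi> i \<noteq> 0}" "\<xi> \<in> Cc_group I \<Longrightarrow> i \<notin> I \<Longrightarrow> \<xi> i = 0"
  by (auto simp: Cc_group_def)

lemma Cc_groupI: "finite J \<Longrightarrow> J \<subseteq> I \<Longrightarrow> (\<And>i. \<xi> i \<noteq> 0 \<Longrightarrow> i \<in> J) \<Longrightarrow> \<xi> \<in> Cc_group I"
  by (auto simp: Cc_group_def intro: finite_subset[of _ J])

lemma L2_set_sum_le: "finite P \<Longrightarrow> L2_set (\<lambda>i. \<Sum>p\<in>P. f p i) J \<le> (\<Sum>p\<in>P. L2_set (f p) J)"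
proof (induction rule: finite_induct)
  case empty then show ?case by (simp add: L2_set_def)
next
  case (insert p P)
  then show ?case using L2_set_triangle_ineq[of "f p" "\<lambda>i. \<Sum>p\<in>P. f p i" J] by simp
qed

lemma L2_set_le_l2_norm:
  assumes "\<xi> \<in> l2_space I" "finite J" "J \<subseteq> I"
  shows "L2_set (\<lambda>i. cmod (\<xi> i)) J \<le> l2_norm I \<xi>"
  unfolding L2_set_def l2_norm_def
  using assms by (intro real_sqrt_le_mono finite_sum_le_infsum) (auto simp: l2_space_def)

lemma l2_norm_nonneg: "0 \<le> l2_norm I \<xi>"
  by (simp add: l2_norm_def infsum_nonneg)

text \<open>Membership and norm bound are both tested on finite sets, so that estimates of vectors
  reduce to the finite-dimensional \<open>L2_set\<close>.\<close>

lemma l2_spaceI: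
  assumes "\<And>i. i \<notin> I \<Longrightarrow> \<xi> i = 0"
    and "\<And>J. finite J \<Longrightarrow> J \<subseteq> I \<Longrightarrow> L2_set (\<lambda>i. cmod (\<xi> i)) J \<le> K"
  shows "\<xi> \<in> l2_space I" "l2_norm I \<xi> \<le> K"
proof -
  have K: "0 \<le> K" using assms(2)[of "{}"] by (simp add: L2_set_def)
  have le: "(\<Sum>i\<in>J. (cmod (\<xi> i))\<^sup>2) \<le> K\<^sup>2" if "finite J" "J \<subseteq> I" for J
    using assms(2)[OF that] K by (simp add: L2_set_def real_le_lsqrt sqrt_le_D)
  have s: "(\<lambda>i. (cmod (\<xi> i))\<^sup>2) summable_on I"
    using le by (intro nonneg_bdd_above_summable_on bdd_aboveI[of _ "K\<^sup>2"]) auto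
  then show "\<xi> \<in> l2_space I" using assms(1) by (simp add: l2_space_def)
  have "(\<Sum>\<^sub>\<infinity>i\<in>I. (cmod (\<xi> i))\<^sup>2) \<le> K\<^sup>2"
    using s le by (intro infsum_le_finite_sums) auto
  then show "l2_norm I \<xi> \<le> K"
    unfolding l2_norm_def using K by (simp add: real_le_lsqrt infsum_nonneg)
qed

lemma l2_norm_finite:
  assumes "finite J" "J \<subseteq> I" "\<And>i. \<xi> i \<noteq> 0 \<Longrightarrow> i \<in> J"
  shows "l2_norm I \<xi> = L2_set (\<lambda>i. cmod (\<xi> i)) J"
proof -
  have "(\<Sum>\<^sub>\<infinity>i\<in>I. (cmod (\<xi> i))\<^sup>2) = (\<Sum>\<^sub>\<infinity>i\<in>J. (cmod (\<xi> i))\<^sup>2)"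
    using assms by (intro infsum_cong_neutral) auto
  then show ?thesis using assms by (simp add: l2_norm_def L2_set_def)
qed

lemma Cc_group_l2:
  assumes "\<xi> \<in> Cc_group I"
  shows "\<xi> \<in> l2_space I"
proof -
  have "L2_set (\<lambda>i. cmod (\<xi> i)) J \<le> L2_set (\<lambda>i. cmod (\<xi> i)) {i. \<xi> i \<noteq> 0}" if "finite J" for J
  proof -
    have "(\<Sum>i\<in>J. (cmod (\<xi> i))\<^sup>2) = (\<Sum>i\<in>J \<inter> {i. \<xi> i \<noteq> 0}. (cmod (\<xi> i))\<^sup>2)"
      using that by (intro sum.mono_neutral_right) auto
    also have "\<dots> \<le> (\<Sum>i\<in>{i. \<xi> i \<noteq> 0}. (cmod (\<xi> i))\<^sup>2)"
      using Cc_groupD[OF assms] by (intro sum_mono2) auto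
    finally show ?thesis unfolding L2_set_def by (rule real_sqrt_le_mono)
  qed
  then show ?thesis
    using assms by (intro l2_spaceI) (auto simp: Cc_groupD)
qed

lemma l2_norm_scale: "l2_norm I (\<lambda>i. z * \<xi> i) = cmod z * l2_norm I \<xi>"
  by (simp add: l2_norm_def norm_mult power_mult_distrib infsum_cmult_right' real_sqrt_mult)

lemma l2_norm_triangle:
  assumes "\<xi> \<in> Cc_group I" "\<eta> \<in> Cc_group I"
  shows "l2_norm I (\<lambda>i. \<xi> i + \<eta> i) \<le> l2_norm I \<xi> + l2_norm I \<eta>"
proof -
  define J where "J = {i. \<xi> i \<noteq> 0} \<union> {i. \<eta> i \<noteq> 0}"
  have J: "finite J" "J \<subseteq> I" using assms by (auto simp: J_def Cc_group_def)
  have "l2_norm I (\<lambda>i. \<xi> i + \<eta> i) = L2_set (\<lambda>i. cmod (\<xi> i + \<eta> i)) J"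
    "l2_norm I \<xi> = L2_set (\<lambda>i. cmod (\<xi> i)) J" "l2_norm I \<eta> = L2_set (\<lambda>i. cmod (\<eta> i)) J"
    by (intro l2_norm_finite J; auto simp: J_def)+
  moreover have "L2_set (\<lambda>i. cmod (\<xi> i + \<eta> i)) J \<le> L2_set (\<lambda>i. cmod (\<xi> i) + cmod (\<eta> i)) J"
    by (intro L2_set_mono norm_triangle_ineq) auto
  ultimately show ?thesis
    using L2_set_triangle_ineq[of "\<lambda>i. cmod (\<xi> i)" "\<lambda>i. cmod (\<eta> i)" J] by simp
qed

lemma Cauchy_Schwarz_Cc:
  assumes "\<xi> \<in> Cc_group I" "\<eta> \<in> Cc_group I" "finite J" "J \<subseteq> I"
  shows "cmod (\<Sum>i\<in>J. \<xi> i * cnj (\<eta> i)) \<le> l2_norm I \<xi> * l2_norm I \<eta>"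
proof -
  have "cmod (\<Sum>i\<in>J. \<xi> i * cnj (\<eta> i)) \<le> (\<Sum>i\<in>J. \<bar>cmod (\<xi> i)\<bar> * \<bar>cmod (\<eta> i)\<bar>)"
    by (rule order_trans[OF norm_sum]) (simp add: norm_mult)
  also have "\<dots> \<le> L2_set (\<lambda>i. cmod (\<xi> i)) J * L2_set (\<lambda>i. cmod (\<eta> i)) J"
    by (rule L2_set_mult_ineq)
  also have "\<dots> \<le> l2_norm I \<xi> * l2_norm I \<eta>"
    using assms by (intro mult_mono L2_set_le_l2_norm Cc_group_l2)
      (auto simp: l2_norm_nonneg)
  finally show ?thesis .
qed

text \<open>Finite sums of weighted injective substitutions. The left regular representation of G
  and the fibre representations over G/S both have this shape. Such an operator has norm at most the
  sum of the K p, and each value of \<open>T \<xi>\<close> reads only finitely many coordinates of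
  \<xi>.\<close>

locale weighted_translations =
  fixes I :: "'i set" and P :: "'p set" and a :: "'p \<Rightarrow> 'i \<Rightarrow> complex" and \<phi> :: "'p \<Rightarrow> 'i \<Rightarrow> 'i"
    and K :: "'p \<Rightarrow> real" and T :: "('i \<Rightarrow> complex) \<Rightarrow> 'i \<Rightarrow> complex"
  assumes finite: "finite P"
    and maps: "p \<in> P \<Longrightarrow> i \<in> I \<Longrightarrow> \<phi> p i \<in> I"
    and inj: "p \<in> P \<Longrightarrow> inj_on (\<phi> p) I"
    and bound: "p \<in> P \<Longrightarrow> i \<in> I \<Longrightarrow> cmod (a p i) \<le> K p"
    and nonneg: "p \<in> P \<Longrightarrow> 0 \<le> K p"
    and T_eq: "T \<xi> i = (if i \<in> I then \<Sum>p\<in>P. a p i * \<xi> (\<phi> p i) else 0)"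
begin

lemma bounded:
  assumes \<xi>: "\<xi> \<in> l2_space I"
  shows "T \<xi> \<in> l2_space I" "l2_norm I (T \<xi>) \<le> (\<Sum>p\<in>P. K p) * l2_norm I \<xi>"
proof -
  have "L2_set (\<lambda>i. cmod (T \<xi> i)) J \<le> (\<Sum>p\<in>P. K p) * l2_norm I \<xi>" if J: "finite J" "J \<subseteq> I" for J
  proof -
    have "L2_set (\<lambda>i. cmod (T \<xi> i)) J \<le> L2_set (\<lambda>i. \<Sum>p\<in>P. K p * cmod (\<xi> (\<phi> p i))) J"
    proof (rule L2_set_mono)
      fix i assume i: "i \<in> J"
      have "cmod (\<Sum>p\<in>P. a p i * \<xi> (\<phi> p i)) \<le> (\<Sum>p\<in>P. K p * cmod (\<xi> (\<phi> p i)))"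
        using i J bound by (intro sum_norm_le) (auto simp: norm_mult intro!: mult_right_mono)
      then show "cmod (T \<xi> i) \<le> (\<Sum>p\<in>P. K p * cmod (\<xi> (\<phi> p i)))"
        using i J by (auto simp: T_eq)
    qed simp
    also have "\<dots> \<le> (\<Sum>p\<in>P. L2_set (\<lambda>i. K p * cmod (\<xi> (\<phi> p i))) J)"
      by (rule L2_set_sum_le[OF finite])
    also have "\<dots> \<le> (\<Sum>p\<in>P. K p * l2_norm I \<xi>)"
    proof (rule sum_mono)
      fix p assume p: "p \<in> P"
      have "L2_set (\<lambda>i. cmod (\<xi> (\<phi> p i))) J = L2_set (\<lambda>i. cmod (\<xi> i)) (\<phi> p ` J)"
        using inj[OF p] J unfolding L2_set_def by (subst sum.reindex) (auto intro: inj_on_subset)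
      also have "\<dots> \<le> l2_norm I \<xi>"
        using maps[OF p] J by (intro L2_set_le_l2_norm \<xi>) auto
      finally show "L2_set (\<lambda>i. K p * cmod (\<xi> (\<phi> p i))) J \<le> K p * l2_norm I \<xi>"
        using nonneg[OF p] by (simp add: L2_set_right_distrib[symmetric] mult_left_mono)
    qed
    finally show ?thesis by (simp add: sum_distrib_right)
  qed
  then show "T \<xi> \<in> l2_space I" "l2_norm I (T \<xi>) \<le> (\<Sum>p\<in>P. K p) * l2_norm I \<xi>"
    by (rule l2_spaceI[rotated]; simp add: T_eq)+
qed

text \<open>On a finite set J the values of \<open>T \<xi>\<close> depend only on \<xi> over the
  union of the translates of J. Truncating \<xi> to that finite set leaves them unchanged and does
  not increase the norm.\<close>

lemma bound_extends:
  assumes M: "\<And>\<xi>. \<xi> \<in> Cc_group I \<Longrightarrow> l2_norm I (T \<xi>) \<le> M * l2_norm I \<xi>"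
    and "0 \<le> M" and \<xi>: "\<xi> \<in> l2_space I"
  shows "l2_norm I (T \<xi>) \<le> M * l2_norm I \<xi>"
proof (rule l2_spaceI)
  fix J assume J: "finite J" "J \<subseteq> I"
  define J' where "J' = (\<Union>p\<in>P. \<phi> p ` J)"
  have J': "finite J'" "J' \<subseteq> I" using finite J maps by (auto simp: J'_def)
  define \<eta> where "\<eta> i = (if i \<in> J' then \<xi> i else 0)" for i
  have \<eta>: "\<eta> \<in> Cc_group I" by (rule Cc_groupI[OF J']) (auto simp: \<eta>_def split: if_splits)
  have "\<phi> p i \<in> J'" if "p \<in> P" "i \<in> J" for p i using that by (auto simp: J'_def)
  then have "T \<xi> i = T \<eta> i" if "i \<in> J" for i
    using that by (simp add: T_eq \<eta>_def)
  then have "L2_set (\<lambda>i. cmod (T \<xi> i)) J = L2_set (\<lambda>i. cmod (T \<eta> i)) J"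
    by (intro L2_set_cong) auto
  also have "\<dots> \<le> l2_norm I (T \<eta>)"
    by (intro L2_set_le_l2_norm bounded Cc_group_l2 \<eta> J)
  also have "\<dots> \<le> M * l2_norm I \<eta>" by (rule M[OF \<eta>])
  also have "l2_norm I \<eta> = L2_set (\<lambda>i. cmod (\<eta> i)) J'"
    using J' by (intro l2_norm_finite) (auto simp: \<eta>_def split: if_splits)
  also have "\<dots> = L2_set (\<lambda>i. cmod (\<xi> i)) J'" by (intro L2_set_cong) (auto simp: \<eta>_def)
  also have "M * \<dots> \<le> M * l2_norm I \<xi>"
    using \<open>0 \<le> M\<close> by (intro mult_left_mono L2_set_le_l2_norm \<xi> J')
  finally show "L2_set (\<lambda>i. cmod (T \<xi> i)) J \<le> M * l2_norm I \<xi>" .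
qed (simp add: T_eq)

text \<open>Trades the supremum over the unit ball for an inequality between finitely supported
  vectors, the only form in which operator norms are used afterwards.\<close>

lemma op_norm_le_iff:
  assumes "0 \<le> M"
  shows "op_norm (l2_space I) (l2_norm I) T \<le> M \<longleftrightarrow>
    (\<forall>\<xi>\<in>Cc_group I. l2_norm I (T \<xi>) \<le> M * l2_norm I \<xi>)"
proof
  have zero: "(\<lambda>_. 0) \<in> {\<xi> \<in> l2_space I. l2_norm I \<xi> \<le> 1}"
    by (auto simp: l2_space_def l2_norm_def)
  {
    assume "\<forall>\<xi>\<in>Cc_group I. l2_norm I (T \<xi>) \<le> M * l2_norm I \<xi>"
    then have "l2_norm I (T \<xi>) \<le> M * l2_norm I \<xi>" if "\<xi> \<in> l2_space I" for \<xi>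
      using bound_extends[of M] assms that by blast
    then have "l2_norm I (T \<xi>) \<le> M" if "\<xi> \<in> l2_space I" "l2_norm I \<xi> \<le> 1" for \<xi>
      using that assms mult_left_mono[of "l2_norm I \<xi>" 1 M] by fastforce
    then show "op_norm (l2_space I) (l2_norm I) T \<le> M"
      unfolding op_norm_def using zero by (intro cSUP_least) auto
  }
  assume *: "op_norm (l2_space I) (l2_norm I) T \<le> M"
  show "\<forall>\<xi>\<in>Cc_group I. l2_norm I (T \<xi>) \<le> M * l2_norm I \<xi>"
  proof
    fix \<xi> assume \<xi>: "\<xi> \<in> Cc_group I"
    show "l2_norm I (T \<xi>) \<le> M * l2_norm I \<xi>"
    \<comment> \<open>A vector of norm zero cannot be normalized; for it the a priori bound already
      forces the image to have norm zero.\<close>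
    proof (cases "l2_norm I \<xi> = 0")
      case True
      then show ?thesis using bounded(2)[OF Cc_group_l2[OF \<xi>]] by simp
    next
      case False
      then have pos: "l2_norm I \<xi> > 0" using l2_norm_nonneg[of I \<xi>] by simp
      define \<eta> where "\<eta> i = complex_of_real (1 / l2_norm I \<xi>) * \<xi> i" for i
      have n: "l2_norm I \<eta> = 1"
        using pos unfolding \<eta>_def[abs_def] l2_norm_scale by (simp add: norm_divide)
      have "\<eta> \<in> Cc_group I"
        by (rule Cc_groupI[of "{i. \<xi> i \<noteq> 0}"]) (use \<xi> in \<open>auto simp: Cc_group_def \<eta>_def\<close>)
      then have \<eta>: "\<eta> \<in> l2_space I" by (rule Cc_group_l2)
      have "bdd_above ((\<lambda>\<xi>. l2_norm I (T \<xi>)) ` {\<xi> \<in> l2_space I. l2_norm I \<xi> \<le> 1})"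
      proof (rule bdd_aboveI2)
        fix \<xi> assume "\<xi> \<in> {\<xi> \<in> l2_space I. l2_norm I \<xi> \<le> 1}"
        then show "l2_norm I (T \<xi>) \<le> (\<Sum>p\<in>P. K p)"
          using bounded(2)[of \<xi>] mult_left_mono[of "l2_norm I \<xi>" 1 "\<Sum>p\<in>P. K p"] nonneg
          by (force simp: sum_nonneg)
      qed
      then have "l2_norm I (T \<eta>) \<le> M"
        using * \<eta> n unfolding op_norm_def by (intro order_trans[OF cSUP_upper *[unfolded op_norm_def]]) auto
      moreover have "T \<eta> = (\<lambda>i. complex_of_real (1 / l2_norm I \<xi>) * T \<xi> i)"
        unfolding \<eta>_def[abs_def] by (auto simp: T_eq sum_divide_distrib intro!: ext)
      then have "l2_norm I (T \<eta>) = 1 / l2_norm I \<xi> * l2_norm I (T \<xi>)"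
        using pos by (simp only: l2_norm_scale) (simp add: norm_divide)
      ultimately show ?thesis using pos by (simp add: field_simps)
    qed
  qed
qed

end

section \<open>Twisted crossed products by discrete groups\<close>

lemma (in group) inv_mult_cancel:
  assumes "g \<in> carrier G" "h \<in> carrier G"
  shows "inv g \<otimes> (g \<otimes> h) = h" "g \<otimes> (inv g \<otimes> h) = h"
  using assms by (simp_all flip: m_assoc)

text \<open>The substitution q = p m between two finite index sets that need not correspond to each
  other, as long as the summand vanishes wherever they fail to match.\<close>

lemma (in group) sum_shift:
  assumes p: "p \<in> carrier G" and J: "finite J1" "J1 \<subseteq> carrier G" "finite J2" "J2 \<subseteq> carrier G"
    and zero: "\<And>m. m \<in> carrier G \<Longrightarrow> m \<notin> J2 \<or> p \<otimes> m \<notin> J1 \<Longrightarrow> g m (p \<otimes> m) = 0"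
  shows "(\<Sum>q\<in>J1. g (inv p \<otimes> q) q) = (\<Sum>m\<in>J2. g m (p \<otimes> m))"
proof (rule sum.reindex_bij_witness_not_neutral[where S' = "{q\<in>J1. inv p \<otimes> q \<notin> J2}"
      and T' = "{m\<in>J2. p \<otimes> m \<notin> J1}" and i = "\<lambda>m. p \<otimes> m" and j = "\<lambda>q. inv p \<otimes> q"])
  fix q assume q: "q \<in> {q\<in>J1. inv p \<otimes> q \<notin> J2}"
  then have "q \<in> carrier G" using J by auto
  then show "g (inv p \<otimes> q) q = 0"
    using zero[of "inv p \<otimes> q"] q p by (simp add: inv_mult_cancel)
qed (use assms in \<open>auto simp: inv_mult_cancel subset_iff\<close>)

text \<open>Instantiated twice: for G/S acting on twisted characters with the coset cocycle, and for
  G acting on a single point with c. Both reduced norms thereby become instances of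
  \<open>nrm\<close>. The values \<sigma> \<one> \<one> x are arbitrary unimodular numbers, as the
  coset cocycle requires.\<close>

locale twisted_action = group Q for Q :: "('q, 'm) monoid_scheme" (structure) +
  fixes X :: "'x set" and \<alpha> :: "'q \<Rightarrow> 'x \<Rightarrow> 'x" and \<sigma> :: "'q \<Rightarrow> 'q \<Rightarrow> 'x \<Rightarrow> complex"
  assumes act_closed: "p \<in> carrier Q \<Longrightarrow> x \<in> X \<Longrightarrow> \<alpha> p x \<in> X"
    and act_one: "x \<in> X \<Longrightarrow> \<alpha> \<one> x = x"
    and act_mult: "p \<in> carrier Q \<Longrightarrow> q \<in> carrier Q \<Longrightarrow> x \<in> X \<Longrightarrow> \<alpha> (p \<otimes> q) x = \<alpha> p (\<alpha> q x)"
    and cocycle_circle: "p \<in> carrier Q \<Longrightarrow> q \<in> carrier Q \<Longrightarrow> x \<in> X \<Longrightarrow> cmod (\<sigma> p q x) = 1"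
    and cocycle: "p \<in> carrier Q \<Longrightarrow> q \<in> carrier Q \<Longrightarrow> k \<in> carrier Q \<Longrightarrow> x \<in> X \<Longrightarrow>
      \<sigma> p (q \<otimes> k) x * \<sigma> q k x = \<sigma> (p \<otimes> q) k x * \<sigma> p q (\<alpha> k x)"
    and nonempty: "X \<noteq> {}"
begin

text \<open>X is a bare set here, so uniform boundedness takes the place of continuity; continuous
  coefficients are singled out later as \<open>cont_coeffs\<close>.\<close>

definition coeffs :: "('q \<Rightarrow> 'x \<Rightarrow> complex) set" where
  "coeffs = {F. finite {p. F p \<noteq> (\<lambda>_. 0)} \<and> (\<forall>p x. F p x \<noteq> 0 \<longrightarrow> p \<in> carrier Q \<and> x \<in> X) \<and>
     (\<exists>K. \<forall>p x. cmod (F p x) \<le> K)}"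

text \<open>The fibre representation at x: \<xi> m is the coordinate at the arrow (m, x), and F p is
  evaluated at the range of that arrow.\<close>

definition reg :: "'x \<Rightarrow> ('q \<Rightarrow> 'x \<Rightarrow> complex) \<Rightarrow> ('q \<Rightarrow> complex) \<Rightarrow> 'q \<Rightarrow> complex" where
  "reg x F \<xi> q = (if q \<in> carrier Q then
     \<Sum>p | F p \<noteq> (\<lambda>_. 0). F p (\<alpha> (inv p \<otimes> q) x) * \<sigma> p (inv p \<otimes> q) x * \<xi> (inv p \<otimes> q) else 0)"

definition conv :: "('q \<Rightarrow> 'x \<Rightarrow> complex) \<Rightarrow> ('q \<Rightarrow> 'x \<Rightarrow> complex) \<Rightarrow> 'q \<Rightarrow> 'x \<Rightarrow> complex" where
  "conv F H q x = (if x \<in> X then reg x F (\<lambda>m. H m x) q else 0)"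

text \<open>The conjugated phase is the one with which the inverse of an arrow lifts to the twist.
  Its factor \<sigma> \<one> \<one> x accounts for the unit over x and is 1 when \<sigma> is
  normalized.\<close>

definition adj :: "('q \<Rightarrow> 'x \<Rightarrow> complex) \<Rightarrow> 'q \<Rightarrow> 'x \<Rightarrow> complex" where
  "adj F q x = (if q \<in> carrier Q \<and> x \<in> X
     then cnj (\<sigma> (inv q) q x * \<sigma> \<one> \<one> x) * cnj (F (inv q) (\<alpha> q x)) else 0)"

definition nrm :: "('q \<Rightarrow> 'x \<Rightarrow> complex) \<Rightarrow> real" where
  "nrm F = (SUP x\<in>X. op_norm (l2_space (carrier Q)) (l2_norm (carrier Q)) (reg x F))"

abbreviation n2 where "n2 \<equiv> l2_norm (carrier Q)"

lemma coeffs_supp: "F \<in> coeffs \<Longrightarrow> finite {p. F p \<noteq> (\<lambda>_. 0)} \<and> {p. F p \<noteq> (\<lambda>_. 0)} \<subseteq> carrier Q"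
  by (force simp: coeffs_def)

lemma coeffs_nonzeroD:
  assumes "F \<in> coeffs" shows "F p \<noteq> (\<lambda>_. 0) \<Longrightarrow> p \<in> carrier Q" "F p x \<noteq> 0 \<Longrightarrow> x \<in> X"
    "F p x \<noteq> 0 \<Longrightarrow> F p \<noteq> (\<lambda>_. 0)"
  using assms by (force simp: coeffs_def)+

lemma coeffsI:
  assumes "finite P" "P \<subseteq> carrier Q" "\<And>p x. F p x \<noteq> 0 \<Longrightarrow> p \<in> P \<and> x \<in> X"
    and "\<And>p x. p \<in> P \<Longrightarrow> x \<in> X \<Longrightarrow> cmod (F p x) \<le> K p"
  shows "F \<in> coeffs"
proof -
  have "cmod (F p x) \<le> (\<Sum>p\<in>P. \<bar>K p\<bar>)" for p x
  proof (cases "p \<in> P \<and> x \<in> X")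
    case True
    then show ?thesis
      using assms(4)[of p x] member_le_sum[of p P "\<lambda>p. \<bar>K p\<bar>"] assms(1) by fastforce
  next
    case False
    then have "F p x = 0" using assms(3) by blast
    then show ?thesis by (simp add: sum_nonneg)
  qed
  moreover have "finite {p. F p \<noteq> (\<lambda>_. 0)}"
    using assms(3) by (intro finite_subset[OF _ assms(1)]) (auto simp: fun_eq_iff)
  ultimately show ?thesis using assms unfolding coeffs_def by blast
qed

lemma reg_eq:
  assumes "finite P" "\<And>p x. F p x \<noteq> 0 \<Longrightarrow> p \<in> P"
  shows "reg x F \<xi> q = (if q \<in> carrier Q then
     \<Sum>p\<in>P. F p (\<alpha> (inv p \<otimes> q) x) * \<sigma> p (inv p \<otimes> q) x * \<xi> (inv p \<otimes> q) else 0)"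
proof -
  have "{p. F p \<noteq> (\<lambda>_. 0)} \<subseteq> P" using assms(2) by (auto simp: fun_eq_iff)
  then show ?thesis
    unfolding reg_def using assms(1)
    by (auto intro!: sum.mono_neutral_left)
qed

abbreviation weighted_reg where
  "weighted_reg P K F x \<equiv> weighted_translations (carrier Q) P
    (\<lambda>p q. F p (\<alpha> (inv p \<otimes> q) x) * \<sigma> p (inv p \<otimes> q) x) (\<lambda>p q. inv p \<otimes> q) K (reg x F)"

lemma reg_weighted_translations:
  assumes F: "F \<in> coeffs" and x: "x \<in> X"
    and P: "finite P" "P \<subseteq> carrier Q" "\<And>p x. F p x \<noteq> 0 \<Longrightarrow> p \<in> P"
    and K: "\<And>p x. p \<in> P \<Longrightarrow> x \<in> X \<Longrightarrow> cmod (F p x) \<le> K p"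
  shows "weighted_reg P K F x"
proof
  show "finite P" by (rule P)
next
  fix p q assume p: "p \<in> P" and q: "q \<in> carrier Q"
  then have "p \<in> carrier Q" using P(2) by auto
  then show "cmod (F p (\<alpha> (inv p \<otimes> q) x) * \<sigma> p (inv p \<otimes> q) x) \<le> K p"
    using p q x K[OF p act_closed, of "inv p \<otimes> q" x] by (simp add: norm_mult cocycle_circle)
next
  fix p assume p: "p \<in> P"
  then show "0 \<le> K p" using K[OF p x] norm_ge_zero[of "F p x"] by linarith
  show "inj_on ((\<otimes>) (inv p)) (carrier Q)"
    using p P(2) by (auto intro!: inj_onI)
qed (use P in \<open>auto simp: reg_eq\<close>)

lemma coeffs_weighted:
  assumes F: "F \<in> coeffs"
  shows "\<exists>P K. finite P \<and> (\<forall>x\<in>X. weighted_reg P K F x)"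
proof -
  let ?P = "{p. F p \<noteq> (\<lambda>_. 0)}"
  obtain K where K: "\<And>p x. cmod (F p x) \<le> K" using F by (auto simp: coeffs_def)
  have "weighted_reg ?P (\<lambda>_. K) F x" if "x \<in> X" for x
    using F that K by (intro reg_weighted_translations) (auto simp: coeffs_supp)
  then show ?thesis using F coeffs_supp by blast
qed

text \<open>The bounds in \<open>weighted_reg\<close> do not depend on x. Hence the supremum over
  the fibres is finite, and an upper bound for it is the same as a bound in every fibre.\<close>

lemma nrm_le_iff:
  assumes F: "F \<in> coeffs" and M: "0 \<le> M"
  shows "nrm F \<le> M \<longleftrightarrow> (\<forall>x\<in>X. \<forall>\<xi>\<in>Cc_group (carrier Q). n2 (reg x F \<xi>) \<le> M * n2 \<xi>)"
proof -
  obtain P K where P: "finite P" and w: "\<And>x. x \<in> X \<Longrightarrow> weighted_reg P K F x"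
    using coeffs_weighted[OF F] by blast
  let ?o = "\<lambda>x. op_norm (l2_space (carrier Q)) n2 (reg x F)"
  have o: "?o x \<le> M' \<longleftrightarrow> (\<forall>\<xi>\<in>Cc_group (carrier Q). n2 (reg x F \<xi>) \<le> M' * n2 \<xi>)"
    if "x \<in> X" "0 \<le> M'" for x M'
    by (rule weighted_translations.op_norm_le_iff[OF w[OF that(1)] that(2)])
  have nn: "0 \<le> (\<Sum>p\<in>P. K p)"
    using nonempty weighted_translations.nonneg[OF w] by (intro sum_nonneg) auto
  have "bdd_above (?o ` X)"
  proof (rule bdd_aboveI2)
    fix x assume x: "x \<in> X"
    show "?o x \<le> (\<Sum>p\<in>P. K p)"
      unfolding o[OF x nn] using weighted_translations.bounded(2)[OF w[OF x] Cc_group_l2] by blast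
  qed
  then have "nrm F \<le> M \<longleftrightarrow> (\<forall>x\<in>X. ?o x \<le> M)"
    unfolding nrm_def by (rule cSUP_le_iff[OF nonempty])
  then show ?thesis using o M by simp
qed

lemma nrm_nonneg: assumes "F \<in> coeffs" shows "0 \<le> nrm F"
proof -
  obtain x where x: "x \<in> X" using nonempty by auto
  obtain P K where P: "finite P" and w: "\<And>x. x \<in> X \<Longrightarrow> weighted_reg P K F x"
    using coeffs_weighted[OF assms] by blast
  let ?o = "\<lambda>x. op_norm (l2_space (carrier Q)) n2 (reg x F)"
  have nn: "0 \<le> (\<Sum>p\<in>P. K p)"
    using nonempty weighted_translations.nonneg[OF w] by (intro sum_nonneg) auto
  have o: "?o y \<le> (\<Sum>p\<in>P. K p)" if y: "y \<in> X" for y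
    unfolding weighted_translations.op_norm_le_iff[OF w[OF y] nn]
    using weighted_translations.bounded(2)[OF w[OF y] Cc_group_l2] by blast
  have "n2 (reg x F (\<lambda>_. 0)) \<le> op_norm (l2_space (carrier Q)) n2 (reg x F)"
    unfolding op_norm_def
  proof (rule cSUP_upper)
    show "(\<lambda>_. 0) \<in> {\<xi> \<in> l2_space (carrier Q). n2 \<xi> \<le> 1}"
      by (auto simp: l2_space_def l2_norm_def)
    show "bdd_above ((\<lambda>\<xi>. n2 (reg x F \<xi>)) ` {\<xi> \<in> l2_space (carrier Q). n2 \<xi> \<le> 1})"
    proof (rule bdd_aboveI2)
      fix \<xi> assume "\<xi> \<in> {\<xi> \<in> l2_space (carrier Q). n2 \<xi> \<le> 1}"
      then show "n2 (reg x F \<xi>) \<le> (\<Sum>p\<in>P. K p)"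
        using weighted_translations.bounded(2)[OF w[OF x], of \<xi>] mult_left_mono[of "n2 \<xi>" 1, OF _ nn]
        by force
    qed
  qed
  then have "0 \<le> ?o x" using l2_norm_nonneg[of "carrier Q" "reg x F (\<lambda>_. 0)"] by linarith
  also have "?o x \<le> nrm F"
    unfolding nrm_def using o x by (intro cSUP_upper bdd_aboveI2) auto
  finally show ?thesis .
qed

lemma reg_bound: "F \<in> coeffs \<Longrightarrow> x \<in> X \<Longrightarrow> \<xi> \<in> Cc_group (carrier Q) \<Longrightarrow>
    n2 (reg x F \<xi>) \<le> nrm F * n2 \<xi>"
  using nrm_le_iff[OF _ nrm_nonneg] by blast

lemma nrm_le_sum:
  assumes "finite P" "P \<subseteq> carrier Q" "F \<in> coeffs" "\<And>p x. F p x \<noteq> 0 \<Longrightarrow> p \<in> P"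
    and K: "\<And>p x. p \<in> P \<Longrightarrow> x \<in> X \<Longrightarrow> cmod (F p x) \<le> K p"
  shows "nrm F \<le> (\<Sum>p\<in>P. K p)"
proof -
  obtain x where x: "x \<in> X" using nonempty by auto
  have "0 \<le> K p" if "p \<in> P" for p
    using K[OF that x] norm_ge_zero[of "F p x"] by linarith
  then have "0 \<le> (\<Sum>p\<in>P. K p)" by (rule sum_nonneg)
  then show ?thesis
    using weighted_translations.bounded(2)[OF reg_weighted_translations[OF assms(3) _ assms(1,2,4) K]]
    by (simp add: nrm_le_iff assms Cc_group_l2)
qed

lemma reg_supp:
  assumes F: "F \<in> coeffs" and nz: "reg x F \<xi> q \<noteq> 0"
  shows "q \<in> (\<lambda>(p, m). p \<otimes> m) ` ({p. F p \<noteq> (\<lambda>_. 0)} \<times> {m. \<xi> m \<noteq> 0})"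
proof -
  have q: "q \<in> carrier Q" using nz by (auto simp: reg_def split: if_splits)
  have "\<exists>p\<in>{p. F p \<noteq> (\<lambda>_. 0)}. \<xi> (inv p \<otimes> q) \<noteq> 0"
  proof (rule ccontr)
    assume "\<not> ?thesis"
    then have "reg x F \<xi> q = 0" unfolding reg_def by (auto intro!: sum.neutral)
    then show False using nz by simp
  qed
  then obtain p where p: "F p \<noteq> (\<lambda>_. 0)" "\<xi> (inv p \<otimes> q) \<noteq> 0" by auto
  then have "q = p \<otimes> (inv p \<otimes> q)"
    using coeffs_supp[OF F] q by (auto simp: inv_mult_cancel)
  then show ?thesis using p by (auto intro!: image_eqI[of _ _ "(p, inv p \<otimes> q)"])
qed

lemma reg_Cc:
  assumes F: "F \<in> coeffs" and \<xi>: "\<xi> \<in> Cc_group (carrier Q)"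
  shows "reg x F \<xi> \<in> Cc_group (carrier Q)"
proof (rule Cc_groupI[of "(\<lambda>(p, m). p \<otimes> m) ` ({p. F p \<noteq> (\<lambda>_. 0)} \<times> {m. \<xi> m \<noteq> 0})"])
  show "finite ((\<lambda>(p, m). p \<otimes> m) ` ({p. F p \<noteq> (\<lambda>_. 0)} \<times> {m. \<xi> m \<noteq> 0}))"
    using coeffs_supp[OF F] Cc_groupD[OF \<xi>] by simp
  show "(\<lambda>(p, m). p \<otimes> m) ` ({p. F p \<noteq> (\<lambda>_. 0)} \<times> {m. \<xi> m \<noteq> 0}) \<subseteq> carrier Q"
    using coeffs_supp[OF F] \<xi> by (auto simp: Cc_group_def)
qed (rule reg_supp[OF F])

lemma coeffs_slice: "F \<in> coeffs \<Longrightarrow> (\<lambda>m. F m x) \<in> Cc_group (carrier Q)"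
  using coeffs_supp[of F] by (intro Cc_groupI[of "{p. F p \<noteq> (\<lambda>_. 0)}"]) auto

lemma reg_add:
  assumes "F \<in> coeffs" "H \<in> coeffs"
  shows "reg x (\<lambda>p x. F p x + H p x) \<xi> = (\<lambda>q. reg x F \<xi> q + reg x H \<xi> q)"
proof
  fix q
  let ?P = "{p. F p \<noteq> (\<lambda>_. 0)} \<union> {p. H p \<noteq> (\<lambda>_. 0)}"
  have P: "finite ?P" using assms by (simp add: coeffs_supp)
  show "reg x (\<lambda>p x. F p x + H p x) \<xi> q = reg x F \<xi> q + reg x H \<xi> q"
    by (subst (1 2 3) reg_eq[OF P]) (auto simp: sum.distrib algebra_simps)
qed

lemma reg_scale:
  assumes "F \<in> coeffs"
  shows "reg x (\<lambda>p x. z * F p x) \<xi> = (\<lambda>q. z * reg x F \<xi> q)"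
proof
  fix q
  let ?P = "{p. F p \<noteq> (\<lambda>_. 0)}"
  have P: "finite ?P" using assms by (simp add: coeffs_supp)
  show "reg x (\<lambda>p x. z * F p x) \<xi> q = z * reg x F \<xi> q"
    by (subst (1 2) reg_eq[OF P]) (auto simp: sum_distrib_left algebra_simps)
qed

lemma reg_diff_right: "reg x F (\<lambda>m. \<xi> m - \<eta> m) = (\<lambda>q. reg x F \<xi> q - reg x F \<eta> q)"
  by (auto simp: reg_def sum_subtractf algebra_simps intro!: ext)

lemma coeffs_add: assumes "F \<in> coeffs" "H \<in> coeffs" shows "(\<lambda>p x. F p x + H p x) \<in> coeffs"
proof -
  obtain K L where "\<And>p x. cmod (F p x) \<le> K" "\<And>p x. cmod (H p x) \<le> L"
    using assms by (auto simp: coeffs_def)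
  then have "cmod (F p x + H p x) \<le> K + L" for p x
    using norm_triangle_mono by blast
  then show ?thesis
    using coeffs_supp[OF assms(1)] coeffs_nonzeroD[OF assms(1)]
      coeffs_supp[OF assms(2)] coeffs_nonzeroD[OF assms(2)]
    by (intro coeffsI[of "{p. F p \<noteq> (\<lambda>_. 0)} \<union> {p. H p \<noteq> (\<lambda>_. 0)}" _ "\<lambda>_. K + L"])
      (auto, metis add.right_neutral)
qed

lemma coeffs_scale: assumes "F \<in> coeffs" shows "(\<lambda>p x. z * F p x) \<in> coeffs"
proof -
  obtain K where "\<And>p x. cmod (F p x) \<le> K" using assms by (auto simp: coeffs_def)
  then have "cmod (z * F p x) \<le> cmod z * K" for p x
    by (simp add: norm_mult mult_left_mono)
  then show ?thesis
    using coeffs_supp[OF assms] coeffs_nonzeroD[OF assms]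
    by (intro coeffsI[of "{p. F p \<noteq> (\<lambda>_. 0)}" _ "\<lambda>_. cmod z * K"]) auto
qed

lemma coeffs_diff:
  assumes "F \<in> coeffs" "H \<in> coeffs" shows "(\<lambda>p x. F p x - H p x) \<in> coeffs"
  using coeffs_add[OF assms(1) coeffs_scale[OF assms(2), of "-1"]] by simp

lemma reg_diff:
  assumes "F \<in> coeffs" "H \<in> coeffs"
  shows "reg x (\<lambda>p x. F p x - H p x) \<xi> = (\<lambda>q. reg x F \<xi> q - reg x H \<xi> q)"
  using reg_add[OF assms(1) coeffs_scale[OF assms(2), of "-1"], of x \<xi>]
    reg_scale[OF assms(2), of x "-1" \<xi>] by simp

lemma conv_diff_left:
  assumes "F \<in> coeffs" "F' \<in> coeffs"
  shows "conv (\<lambda>p x. F p x - F' p x) H = (\<lambda>q x. conv F H q x - conv F' H q x)"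
  using assms by (auto simp: conv_def reg_diff intro!: ext)

lemma conv_diff_right: "conv F (\<lambda>p x. H p x - H' p x) = (\<lambda>q x. conv F H q x - conv F H' q x)"
  by (auto simp: conv_def reg_diff_right intro!: ext)

lemma adj_diff: "adj (\<lambda>p x. F p x - F' p x) = (\<lambda>q x. adj F q x - adj F' q x)"
  by (auto simp: adj_def right_diff_distrib intro!: ext)

lemma conv_coeffs:
  assumes F: "F \<in> coeffs" and H: "H \<in> coeffs"
  shows "conv F H \<in> coeffs"
proof -
  let ?P = "{p. F p \<noteq> (\<lambda>_. 0)}" and ?R = "{p. H p \<noteq> (\<lambda>_. 0)}"
  let ?J = "(\<lambda>(p, m). p \<otimes> m) ` (?P \<times> ?R)"
  obtain K L where K: "\<And>p x. cmod (F p x) \<le> K" and L: "\<And>p x. cmod (H p x) \<le> L"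
    using F H by (auto simp: coeffs_def)
  have P: "finite ?P" "?P \<subseteq> carrier Q" using coeffs_supp[OF F] by auto
  show ?thesis
  proof (rule coeffsI)
    show "finite ?J" "?J \<subseteq> carrier Q"
      using coeffs_supp[OF F] coeffs_supp[OF H] by auto
    fix q x
    {
      assume nz: "conv F H q x \<noteq> 0"
      then have x: "x \<in> X" and "reg x F (\<lambda>m. H m x) q \<noteq> 0" by (auto simp: conv_def split: if_splits)
      moreover from reg_supp[OF F this(2)] obtain p m where "p \<in> ?P" "H m x \<noteq> 0" "q = p \<otimes> m" by auto
      moreover from this have "m \<in> ?R" by auto
      ultimately show "q \<in> ?J \<and> x \<in> X" by blast
    }
    assume q: "q \<in> ?J" and x: "x \<in> X"
    have q: "q \<in> carrier Q"
      using q coeffs_supp[OF F] coeffs_supp[OF H] by auto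
    have KL: "0 \<le> K" using K order_trans norm_ge_zero by blast
    have "cmod (F p (\<alpha> (inv p \<otimes> q) x) * \<sigma> p (inv p \<otimes> q) x * H (inv p \<otimes> q) x) \<le> K * 1 * L"
      if "p \<in> ?P" for p
    proof -
      have "p \<in> carrier Q" using that P(2) by blast
      then show ?thesis
        using x q K L KL unfolding norm_mult by (intro mult_mono) (auto simp: cocycle_circle)
    qed
    then have "cmod (conv F H q x) \<le> (\<Sum>p\<in>?P. K * 1 * L)"
      unfolding conv_def reg_def if_P[OF x] if_P[OF q] by (rule sum_norm_le)
    then show "cmod (conv F H q x) \<le> (\<lambda>_. \<Sum>p\<in>?P. K * 1 * L) q" by simp
  qed
qed

lemma adj_coeffs:
  assumes F: "F \<in> coeffs"
  shows "adj F \<in> coeffs"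
proof -
  let ?P = "{p. F p \<noteq> (\<lambda>_. 0)}"
  obtain K where K: "\<And>p x. cmod (F p x) \<le> K" using F by (auto simp: coeffs_def)
  have P: "finite ?P" "?P \<subseteq> carrier Q" using coeffs_supp[OF F] by auto
  show ?thesis
  proof (rule coeffsI)
    show "finite ((\<lambda>p. inv p) ` ?P)" "(\<lambda>p. inv p) ` ?P \<subseteq> carrier Q" using P by auto
    fix q x
    {
      assume nz: "adj F q x \<noteq> 0"
      then have "q = inv (inv q)" "inv q \<in> ?P" "x \<in> X" by (auto simp: adj_def split: if_splits)
      then show "q \<in> (\<lambda>p. inv p) ` ?P \<and> x \<in> X" by blast
    }
    assume "q \<in> (\<lambda>p. inv p) ` ?P" "x \<in> X"
    then show "cmod (adj F q x) \<le> (\<lambda>_. K) q"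
      using K P by (auto simp: adj_def norm_mult cocycle_circle)
  qed
qed

text \<open>Multiplicativity of the fibre representations is the cocycle identity at (m, n, k),
  where k is \<open>inv n \<otimes> (inv m \<otimes> q)\<close>; the substitution p = m n brings
  both double sums to the same index set.\<close>

lemma reg_conv:
  assumes F: "F \<in> coeffs" and H: "H \<in> coeffs" and x: "x \<in> X" and \<xi>: "\<xi> \<in> Cc_group (carrier Q)"
  shows "reg x (conv F H) \<xi> = reg x F (reg x H \<xi>)"
proof
  fix q
  let ?P = "{p. F p \<noteq> (\<lambda>_. 0)}" and ?R = "{p. H p \<noteq> (\<lambda>_. 0)}"
  let ?J = "(\<lambda>(p, m). p \<otimes> m) ` (?P \<times> ?R)"
  have P: "finite ?P" "?P \<subseteq> carrier Q" and R: "finite ?R" "?R \<subseteq> carrier Q"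
    using coeffs_supp[OF F] coeffs_supp[OF H] by auto
  have J: "finite ?J" "?J \<subseteq> carrier Q" using P R by auto
  have supp: "p \<in> ?J" if "conv F H p y \<noteq> 0" for p y
  proof -
    have "reg y F (\<lambda>m. H m y) p \<noteq> 0" using that by (auto simp: conv_def split: if_splits)
    from reg_supp[OF F this] obtain m n where "m \<in> ?P" "H n y \<noteq> 0" "p = m \<otimes> n" by auto
    moreover from this have "n \<in> ?R" by auto
    ultimately show ?thesis by blast
  qed
  show "reg x (conv F H) \<xi> q = reg x F (reg x H \<xi>) q"
  proof (cases "q \<in> carrier Q")
    case False then show ?thesis by (simp add: reg_def)
  next
    case q: True
    define g where "g m n p = F m (\<alpha> (inv m \<otimes> q) x) * \<sigma> m (inv m \<otimes> p) (\<alpha> (inv p \<otimes> q) x)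
      * H n (\<alpha> (inv p \<otimes> q) x) * \<sigma> p (inv p \<otimes> q) x * \<xi> (inv p \<otimes> q)" for m n p
    have "reg x (conv F H) \<xi> q = (\<Sum>p\<in>?J. \<Sum>m\<in>?P. g m (inv m \<otimes> p) p)"
    proof -
      have "conv F H p (\<alpha> (inv p \<otimes> q) x) * \<sigma> p (inv p \<otimes> q) x * \<xi> (inv p \<otimes> q)
        = (\<Sum>m\<in>?P. g m (inv m \<otimes> p) p)" if "p \<in> ?J" for p
      proof -
        have p: "p \<in> carrier Q" using that J by auto
        have *: "\<alpha> (inv m \<otimes> p) (\<alpha> (inv p \<otimes> q) x) = \<alpha> (inv m \<otimes> q) x" if "m \<in> ?P" for m
        proof -
          have m: "m \<in> carrier Q" using that P by auto
          have "(inv m \<otimes> p) \<otimes> (inv p \<otimes> q) = inv m \<otimes> q"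
            using m p q by (simp add: m_assoc inv_mult_cancel)
          then show ?thesis using act_mult[of "inv m \<otimes> p" "inv p \<otimes> q" x] m p q x by simp
        qed
        show ?thesis
          using p q x * by (simp add: conv_def reg_def act_closed g_def sum_distrib_right)
      qed
      then show ?thesis
        using q by (simp add: reg_eq[OF J(1) supp])
    qed
    also have "\<dots> = (\<Sum>m\<in>?P. \<Sum>p\<in>?J. g m (inv m \<otimes> p) p)" by (rule sum.swap)
    also have "\<dots> = (\<Sum>m\<in>?P. \<Sum>n\<in>?R. g m n (m \<otimes> n))"
    proof (rule sum.cong)
      fix m assume m: "m \<in> ?P"
      show "(\<Sum>p\<in>?J. g m (inv m \<otimes> p) p) = (\<Sum>n\<in>?R. g m n (m \<otimes> n))"
      proof (rule sum_shift)
        show "m \<in> carrier Q" using m P by auto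
        fix n assume "n \<in> carrier Q" "n \<notin> ?R \<or> m \<otimes> n \<notin> ?J"
        then have "H n = (\<lambda>_. 0)" using m by auto
        then show "g m n (m \<otimes> n) = 0" by (simp add: g_def)
      qed (use J R in auto)
    qed simp
    also have "\<dots> = (\<Sum>m\<in>?P. F m (\<alpha> (inv m \<otimes> q) x) * \<sigma> m (inv m \<otimes> q) x * reg x H \<xi> (inv m \<otimes> q))"
    proof (rule sum.cong)
      fix m assume "m \<in> ?P"
      then have m: "m \<in> carrier Q" using P by auto
      have "g m n (m \<otimes> n) = F m (\<alpha> (inv m \<otimes> q) x) * \<sigma> m (inv m \<otimes> q) x *
        (H n (\<alpha> (inv n \<otimes> (inv m \<otimes> q)) x) * \<sigma> n (inv n \<otimes> (inv m \<otimes> q)) x * \<xi> (inv n \<otimes> (inv m \<otimes> q)))"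
        if "n \<in> ?R" for n
      proof -
        have n: "n \<in> carrier Q" using that R by auto
        define k where "k = inv n \<otimes> (inv m \<otimes> q)"
        have k: "k \<in> carrier Q" "inv (m \<otimes> n) \<otimes> q = k" "n \<otimes> k = inv m \<otimes> q"
          using m n q by (auto simp: k_def inv_mult_group m_assoc inv_mult_cancel)
        have "\<sigma> m n (\<alpha> k x) * \<sigma> (m \<otimes> n) k x = \<sigma> m (n \<otimes> k) x * \<sigma> n k x"
          using cocycle[OF m n k(1) x] by (simp add: mult.commute)
        then show ?thesis
          using m n k(1) unfolding g_def k_def[symmetric] k(2) k(3)[symmetric]
          by (simp add: inv_mult_cancel)
      qed
      then show "(\<Sum>n\<in>?R. g m n (m \<otimes> n)) = F m (\<alpha> (inv m \<otimes> q) x) * \<sigma> m (inv m \<otimes> q) x * reg x H \<xi> (inv m \<otimes> q)"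
        using m q by (simp add: reg_def sum_distrib_left)
    qed simp
    also have "\<dots> = reg x F (reg x H \<xi>) q"
      using q by (simp add: reg_def[of x F])
    finally show ?thesis .
  qed
qed

text \<open>The cocycle identity at (\<one>, \<one>, q) after cancelling a nonzero factor. Without
  normalization the values at units need not be 1, but all of them are determined by \<sigma> \<one>
  \<one>.\<close>

lemma cocycle_one_left:
  assumes "q \<in> carrier Q" "x \<in> X"
  shows "\<sigma> \<one> q x = \<sigma> \<one> \<one> (\<alpha> q x)"
proof -
  have "\<sigma> \<one> q x * \<sigma> \<one> q x = \<sigma> \<one> q x * \<sigma> \<one> \<one> (\<alpha> q x)"
    using cocycle[of \<one> \<one> q x] assms by simp
  moreover have "\<sigma> \<one> q x \<noteq> 0" using cocycle_circle[of \<one> q x] assms by auto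
  ultimately show ?thesis by simp
qed

lemma cocycle_one_right:
  assumes "q \<in> carrier Q" "x \<in> X"
  shows "\<sigma> q \<one> x = \<sigma> \<one> \<one> x"
proof -
  have "\<sigma> q \<one> x * \<sigma> \<one> \<one> x = \<sigma> q \<one> x * \<sigma> q \<one> x"
    using cocycle[of q \<one> \<one> x] assms by (simp add: act_one)
  moreover have "\<sigma> q \<one> x \<noteq> 0" using cocycle_circle[of q \<one> x] assms by auto
  ultimately show ?thesis by simp
qed

text \<open>The cocycle identity at (p, \<open>inv p\<close>, \<open>p \<otimes> m\<close>). It is
  what makes the phase chosen in \<open>adj\<close> cancel against the phases in
  \<open>reg\<close>.\<close>

lemma cocycle_inverse:
  assumes "p \<in> carrier Q" "m \<in> carrier Q" "x \<in> X"
  shows "\<sigma> p (inv p) (\<alpha> (p \<otimes> m) x) * \<sigma> \<one> \<one> (\<alpha> (p \<otimes> m) x) = \<sigma> p m x * \<sigma> (inv p) (p \<otimes> m) x"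
  using cocycle[of p "inv p" "p \<otimes> m" x] assms cocycle_one_left[of "p \<otimes> m" x]
  by (simp add: inv_mult_cancel mult.commute)

text \<open>Says that \<open>adj F\<close> acts as the Hilbert space adjoint of F in each fibre,
  with the inner products written as sums over finite sets containing the supports.\<close>

lemma reg_adj:
  assumes F: "F \<in> coeffs" and x: "x \<in> X" and J: "finite J1" "J1 \<subseteq> carrier Q" "finite J2" "J2 \<subseteq> carrier Q"
    and \<xi>: "\<And>q. \<xi> q \<noteq> 0 \<Longrightarrow> q \<in> J2" and \<theta>: "\<And>q. \<theta> q \<noteq> 0 \<Longrightarrow> q \<in> J1"
  shows "(\<Sum>q\<in>J1. reg x F \<xi> q * cnj (\<theta> q)) = (\<Sum>m\<in>J2. \<xi> m * cnj (reg x (adj F) \<theta> m))"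
proof -
  let ?P = "{p. F p \<noteq> (\<lambda>_. 0)}"
  have P: "finite ?P" "?P \<subseteq> carrier Q" using coeffs_supp[OF F] by auto
  have inj: "inj_on (\<lambda>p. inv p) ?P"
  proof (rule inj_onI)
    fix p q assume "p \<in> ?P" "q \<in> ?P" "inv p = inv q"
    then have "inv (inv p) = inv (inv q)" "p \<in> carrier Q" "q \<in> carrier Q" using P(2) by auto
    then show "p = q" by simp
  qed
  have P': "finite ((\<lambda>p. inv p) ` ?P)" using P by simp
  have supp: "p \<in> (\<lambda>p. inv p) ` ?P" if "adj F p y \<noteq> 0" for p y
  proof -
    have "p = inv (inv p)" "inv p \<in> ?P" using that by (auto simp: adj_def split: if_splits)
    then show ?thesis by blast
  qed
  define g where "g p m q = F p (\<alpha> m x) * \<sigma> p m x * \<xi> m * cnj (\<theta> q)" for p m q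
  have "(\<Sum>q\<in>J1. reg x F \<xi> q * cnj (\<theta> q)) = (\<Sum>q\<in>J1. \<Sum>p\<in>?P. g p (inv p \<otimes> q) q)"
    using J by (intro sum.cong) (auto simp: reg_def g_def sum_distrib_right)
  also have "\<dots> = (\<Sum>p\<in>?P. \<Sum>q\<in>J1. g p (inv p \<otimes> q) q)" by (rule sum.swap)
  also have "\<dots> = (\<Sum>p\<in>?P. \<Sum>m\<in>J2. g p m (p \<otimes> m))"
  proof (rule sum.cong)
    fix p assume p: "p \<in> ?P"
    show "(\<Sum>q\<in>J1. g p (inv p \<otimes> q) q) = (\<Sum>m\<in>J2. g p m (p \<otimes> m))"
      using p P J \<xi> \<theta> by (intro sum_shift) (auto simp: g_def)
  qed simp
  also have "\<dots> = (\<Sum>m\<in>J2. \<Sum>p\<in>?P. g p m (p \<otimes> m))" by (rule sum.swap)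
  also have "\<dots> = (\<Sum>m\<in>J2. \<xi> m * cnj (reg x (adj F) \<theta> m))"
  proof (rule sum.cong)
    fix m assume "m \<in> J2"
    then have m: "m \<in> carrier Q" using J by auto
    have "g p m (p \<otimes> m) = \<xi> m * cnj (adj F (inv p) (\<alpha> (inv (inv p) \<otimes> m) x) *
        \<sigma> (inv p) (inv (inv p) \<otimes> m) x * \<theta> (inv (inv p) \<otimes> m))" if "p \<in> ?P" for p
    proof -
      have p: "p \<in> carrier Q" using that P by auto
      have "cmod (\<sigma> (inv p) (p \<otimes> m) x) = 1" using p m x by (simp add: cocycle_circle)
      then have 1: "\<sigma> (inv p) (p \<otimes> m) x * cnj (\<sigma> (inv p) (p \<otimes> m) x) = 1"
        by (simp add: complex_norm_square[symmetric])
      have "\<alpha> (inv p) (\<alpha> (p \<otimes> m) x) = \<alpha> m x"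
        using act_mult[of "inv p" "p \<otimes> m" x] p m x by (simp add: inv_mult_cancel)
      then have "cnj (adj F (inv p) (\<alpha> (p \<otimes> m) x)) =
        \<sigma> p m x * \<sigma> (inv p) (p \<otimes> m) x * F p (\<alpha> m x)"
        using p m x cocycle_inverse[of p m x] by (simp add: adj_def act_closed)
      then show ?thesis
        using p 1 by (simp add: g_def algebra_simps)
    qed
    then show "(\<Sum>p\<in>?P. g p m (p \<otimes> m)) = \<xi> m * cnj (reg x (adj F) \<theta> m)"
      using m by (simp add: reg_eq[OF P' supp] sum.reindex[OF inj] sum_distrib_left)
  qed simp
  finally show ?thesis .
qed

lemma nrm_triangle:
  assumes F: "F \<in> coeffs" and H: "H \<in> coeffs"
  shows "nrm (\<lambda>p x. F p x + H p x) \<le> nrm F + nrm H"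
proof -
  have "n2 (reg x (\<lambda>p x. F p x + H p x) \<xi>) \<le> (nrm F + nrm H) * n2 \<xi>"
    if "x \<in> X" "\<xi> \<in> Cc_group (carrier Q)" for x \<xi>
    using l2_norm_triangle[OF reg_Cc[OF F that(2)] reg_Cc[OF H that(2)], of x x]
      reg_bound[OF F that] reg_bound[OF H that]
    by (simp add: reg_add[OF F H] algebra_simps)
  then show ?thesis
    using F H by (subst nrm_le_iff) (auto simp: nrm_nonneg coeffs_add)
qed

lemma nrm_scale:
  assumes F: "F \<in> coeffs"
  shows "nrm (\<lambda>p x. z * F p x) = cmod z * nrm F"
proof -
  have le: "nrm (\<lambda>p x. z * F p x) \<le> cmod z * nrm F" if F: "F \<in> coeffs" for z F
    using F reg_bound[OF F] nrm_nonneg[OF F]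
    by (subst nrm_le_iff)
      (auto simp: coeffs_scale reg_scale l2_norm_scale mult.assoc intro!: mult_left_mono)
  show ?thesis
  proof (cases "z = 0")
    case True
    then show ?thesis using le[OF F, of 0] nrm_nonneg[OF coeffs_scale[OF F], of 0] by simp
  next
    case False
    have "nrm (\<lambda>p x. inverse z * (z * F p x)) \<le> cmod (inverse z) * nrm (\<lambda>p x. z * F p x)"
      by (rule le[OF coeffs_scale[OF F]])
    then have "cmod z * nrm F \<le> nrm (\<lambda>p x. z * F p x)"
      using False by (simp add: norm_divide field_simps flip: mult.assoc)
    then show ?thesis using le[OF F, of z] by simp
  qed
qed

lemma nrm_conv:
  assumes F: "F \<in> coeffs" and H: "H \<in> coeffs"
  shows "nrm (conv F H) \<le> nrm F * nrm H"
proof -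
  have "n2 (reg x (conv F H) \<xi>) \<le> nrm F * nrm H * n2 \<xi>"
    if x: "x \<in> X" and \<xi>: "\<xi> \<in> Cc_group (carrier Q)" for x \<xi>
  proof -
    have "n2 (reg x F (reg x H \<xi>)) \<le> nrm F * n2 (reg x H \<xi>)"
      by (rule reg_bound[OF F x reg_Cc[OF H \<xi>]])
    also have "\<dots> \<le> nrm F * (nrm H * n2 \<xi>)"
      by (intro mult_left_mono reg_bound H x \<xi> nrm_nonneg F)
    finally show ?thesis by (simp add: reg_conv[OF F H x \<xi>] mult.assoc)
  qed
  then show ?thesis
    using F H by (subst nrm_le_iff) (auto simp: conv_coeffs nrm_nonneg)
qed

lemma n2_square:
  assumes "finite J" "J \<subseteq> carrier Q" "\<And>q. \<xi> q \<noteq> 0 \<Longrightarrow> q \<in> J"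
  shows "complex_of_real ((n2 \<xi>)\<^sup>2) = (\<Sum>q\<in>J. \<xi> q * cnj (\<xi> q))"
proof -
  have "(n2 \<xi>)\<^sup>2 = (\<Sum>q\<in>J. (cmod (\<xi> q))\<^sup>2)"
    using l2_norm_finite[OF assms(1,2), of \<xi>] assms(3) by (simp add: L2_set_def sum_nonneg)
  then show ?thesis by (simp add: complex_norm_square[symmetric] del: of_real_power)
qed

text \<open>With T the operator of F and T* that of its adjoint, ||T* \<theta>||^2 = <T T* \<theta>,
  \<theta>> is at most ||T|| ||T* \<theta>|| ||\<theta>||, and one factor cancels. The pairing in
  \<open>reg_adj\<close> can be read from either side, which gives both inequalities.\<close>

lemma nrm_adj:
  assumes F: "F \<in> coeffs"
  shows "nrm (adj F) = nrm F"
proof (rule antisym)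
  have sq: "n \<le> M * l" if "n\<^sup>2 \<le> M * n * l" "0 \<le> n" "0 \<le> M * l" for n M l :: real
  proof (cases "n = 0")
    case False
    then have "n * n \<le> n * (M * l)" "n > 0" using that by (auto simp: power2_eq_square algebra_simps)
    then show ?thesis by simp
  qed (use that in simp)
  note A = adj_coeffs[OF F]
  have "n2 (reg x (adj F) \<theta>) \<le> nrm F * n2 \<theta>" if x: "x \<in> X" and \<theta>: "\<theta> \<in> Cc_group (carrier Q)" for x \<theta>
  proof -
    let ?\<xi> = "reg x (adj F) \<theta>"
    have \<xi>: "?\<xi> \<in> Cc_group (carrier Q)" by (rule reg_Cc[OF A \<theta>])
    let ?J2 = "{q. ?\<xi> q \<noteq> 0}" and ?J1 = "{q. \<theta> q \<noteq> 0}"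
    have J: "finite ?J1" "?J1 \<subseteq> carrier Q" "finite ?J2" "?J2 \<subseteq> carrier Q"
      using \<theta> \<xi> by (auto simp: Cc_group_def)
    have "complex_of_real ((n2 ?\<xi>)\<^sup>2) = (\<Sum>q\<in>?J2. ?\<xi> q * cnj (?\<xi> q))"
      using J by (intro n2_square) auto
    also have "\<dots> = (\<Sum>q\<in>?J1. reg x F ?\<xi> q * cnj (\<theta> q))"
      using J by (intro reg_adj[OF F x, symmetric]) auto
    finally have "(n2 ?\<xi>)\<^sup>2 = cmod (\<Sum>q\<in>?J1. reg x F ?\<xi> q * cnj (\<theta> q))"
      by (metis norm_of_real abs_of_nonneg zero_le_power2)
    also have "\<dots> \<le> n2 (reg x F ?\<xi>) * n2 \<theta>"
      by (intro Cauchy_Schwarz_Cc reg_Cc F \<xi> \<theta> J)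
    also have "\<dots> \<le> nrm F * n2 ?\<xi> * n2 \<theta>"
      by (intro mult_right_mono reg_bound F x \<xi> l2_norm_nonneg)
    finally show ?thesis
      by (rule sq) (auto simp: l2_norm_nonneg nrm_nonneg F)
  qed
  then show "nrm (adj F) \<le> nrm F"
    using F A by (subst nrm_le_iff) (auto simp: nrm_nonneg)
  have "n2 (reg x F \<xi>) \<le> nrm (adj F) * n2 \<xi>" if x: "x \<in> X" and \<xi>: "\<xi> \<in> Cc_group (carrier Q)" for x \<xi>
  proof -
    let ?\<theta> = "reg x F \<xi>"
    have \<theta>: "?\<theta> \<in> Cc_group (carrier Q)" by (rule reg_Cc[OF F \<xi>])
    let ?J2 = "{q. \<xi> q \<noteq> 0}" and ?J1 = "{q. ?\<theta> q \<noteq> 0}"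
    have J: "finite ?J1" "?J1 \<subseteq> carrier Q" "finite ?J2" "?J2 \<subseteq> carrier Q"
      using \<theta> \<xi> by (auto simp: Cc_group_def)
    have "complex_of_real ((n2 ?\<theta>)\<^sup>2) = (\<Sum>q\<in>?J1. ?\<theta> q * cnj (?\<theta> q))"
      using J by (intro n2_square) auto
    also have "\<dots> = (\<Sum>q\<in>?J2. \<xi> q * cnj (reg x (adj F) ?\<theta> q))"
      using J by (intro reg_adj[OF F x]) auto
    finally have "(n2 ?\<theta>)\<^sup>2 = cmod (\<Sum>q\<in>?J2. \<xi> q * cnj (reg x (adj F) ?\<theta> q))"
      by (metis norm_of_real abs_of_nonneg zero_le_power2)
    also have "\<dots> \<le> n2 \<xi> * n2 (reg x (adj F) ?\<theta>)"
      by (intro Cauchy_Schwarz_Cc reg_Cc A \<xi> \<theta> J)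
    also have "\<dots> \<le> n2 \<xi> * (nrm (adj F) * n2 ?\<theta>)"
      by (intro mult_left_mono reg_bound A x \<theta> l2_norm_nonneg)
    finally have "(n2 ?\<theta>)\<^sup>2 \<le> nrm (adj F) * n2 ?\<theta> * n2 \<xi>" by (simp add: algebra_simps)
    then show ?thesis
      by (rule sq) (auto simp: l2_norm_nonneg nrm_nonneg A)
  qed
  then show "nrm F \<le> nrm (adj F)"
    using F A by (subst nrm_le_iff) (auto simp: nrm_nonneg)
qed

end

section \<open>Divisible subgroups and extension of characters\<close>

text \<open>The nonnegative generator of a subgroup of the integers. The value m = 0 belongs to the
  trivial subgroup and later stands for an element of infinite order.\<close>

lemma int_subgroup_multiples:
  fixes V :: "int set"
  assumes "0 \<in> V" and diff: "\<And>a b. a \<in> V \<Longrightarrow> b \<in> V \<Longrightarrow> a - b \<in> V"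
  shows "\<exists>m::nat. int m \<in> V \<and> (\<forall>n\<in>V. int m dvd n)"
proof (cases "V \<subseteq> {0}")
  case True then show ?thesis using assms(1) by (intro exI[of _ 0]) auto
next
  case False
  then obtain a where "a \<in> V" "a \<noteq> 0" by auto
  then have "\<bar>a\<bar> \<in> V" using diff[OF assms(1), of a] by (auto simp: abs_if)
  then have ex: "\<exists>k::nat. k > 0 \<and> int k \<in> V" using \<open>a \<noteq> 0\<close> by (intro exI[of _ "nat \<bar>a\<bar>"]) auto
  define m where "m = (LEAST k::nat. k > 0 \<and> int k \<in> V)"
  have m: "m > 0" "int m \<in> V" using LeastI_ex[OF ex] by (auto simp: m_def)
  have neg: "- a \<in> V" if "a \<in> V" for a using diff[OF assms(1) that] by simp
  have mult: "int m * int j \<in> V" for j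
  proof (induction j)
    case (Suc j)
    then show ?case using diff[OF Suc neg[OF m(2)]] by (simp add: algebra_simps)
  qed (simp add: assms)
  have mult': "int m * k \<in> V" for k
    using mult[of "nat \<bar>k\<bar>"] neg[OF mult[of "nat \<bar>k\<bar>"]] by (cases "k \<ge> 0") auto
  have "int m dvd n" if "n \<in> V" for n
  proof -
    have "n mod int m \<in> V"
      using diff[OF that mult'[of "n div int m"]] by (simp add: minus_mult_div_eq_mod)
    then have "\<not> (n mod int m > 0)"
      using not_less_Least[of "nat (n mod int m)" "\<lambda>k. k > 0 \<and> int k \<in> V"] m
      by (auto simp: m_def[symmetric] nat_less_iff)
    moreover have "0 \<le> n mod int m" using m by simp
    ultimately show ?thesis by (simp add: dvd_eq_mod_eq_0)
  qed
  then show ?thesis using m by blast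
qed

lemma (in group) subgroup_int_pow_closed:
  assumes H: "subgroup H G" "h \<in> H" shows "h [^] (n::int) \<in> H"
proof -
  have hG: "h \<in> carrier G" using H by (rule subgroup.mem_carrier)
  have pow: "h [^] k \<in> H" for k :: nat
  proof (induction k)
    case 0 show ?case by (simp add: subgroup.one_closed[OF H(1)])
  next
    case (Suc k)
    then show ?case using subgroup.m_closed[OF H(1) Suc H(2)] by simp
  qed
  show ?thesis
  proof (cases n rule: int_cases2)
    case (nonneg k) then show ?thesis using pow[of k] by (simp only: int_pow_int)
  next
    case (nonpos k)
    then show ?thesis using subgroup.m_inv_closed[OF H(1) pow[of k]] hG by (simp only: int_pow_neg_int)
  qed
qed

lemma (in comm_group) subgroup_adjoin:
  assumes R: "subgroup R G" and e: "e \<in> carrier G"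
  shows "subgroup {r \<otimes> e [^] (n::int) | r n. r \<in> R} G"
proof
  have sub: "R \<subseteq> carrier G" using R by (rule subgroup.subset)
  show "{r \<otimes> e [^] (n::int) | r n. r \<in> R} \<subseteq> carrier G" using sub e by auto
  show "\<one> \<in> {r \<otimes> e [^] (n::int) | r n. r \<in> R}"
    using subgroup.one_closed[OF R] by (auto intro!: exI[of _ \<one>] exI[of _ "0::int"])
  fix x assume "x \<in> {r \<otimes> e [^] (n::int) | r n. r \<in> R}"
  then obtain r and n :: int where x: "x = r \<otimes> e [^] n" "r \<in> R" by auto
  then have "inv x = inv r \<otimes> e [^] (- n)"
    using sub e by (auto simp: inv_mult int_pow_neg)
  then show "inv x \<in> {r \<otimes> e [^] (n::int) | r n. r \<in> R}"
    using x subgroup.m_inv_closed[OF R] by blast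
  fix y assume "y \<in> {r \<otimes> e [^] (n::int) | r n. r \<in> R}"
  then obtain s and k :: int where y: "y = s \<otimes> e [^] k" "s \<in> R" by auto
  have "r \<in> carrier G" "s \<in> carrier G" using x y sub by auto
  then have "x \<otimes> y = (r \<otimes> s) \<otimes> e [^] (n + k)"
    using e by (simp add: x y int_pow_mult m_ac)
  then show "x \<otimes> y \<in> {r \<otimes> e [^] (n::int) | r n. r \<in> R}"
    using x y subgroup.m_closed[OF R] by blast
qed

text \<open>A divisible subgroup is a direct factor. Zorn's lemma gives a maximal R above R0 meeting
  Z trivially. If R Z were not everything, an element outside could be corrected by a root taken in
  Z so that adjoining it to R still meets Z trivially.\<close>

lemma (in comm_group) divisible_complement:
  assumes Z: "subgroup Z G" and div: "\<And>z n. z \<in> Z \<Longrightarrow> n > 0 \<Longrightarrow> \<exists>w\<in>Z. w [^] (n::nat) = z"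
    and R0: "subgroup R0 G" "R0 \<inter> Z = {\<one>}"
  obtains R where "subgroup R G" "R0 \<subseteq> R" "R \<inter> Z = {\<one>}" "R <#> Z = carrier G"
proof -
  define \<A> where "\<A> = {R. subgroup R G \<and> R0 \<subseteq> R \<and> R \<inter> Z = {\<one>}}"
  have "\<exists>M\<in>\<A>. \<forall>X\<in>\<A>. M \<subseteq> X \<longrightarrow> X = M"
  proof (rule subset_Zorn_nonempty)
    show "\<A> \<noteq> {}" using R0 by (auto simp: \<A>_def)
    fix \<C> assume "\<C> \<noteq> {}" and chain: "subset.chain \<A> \<C>"
    then have \<C>: "\<And>R. R \<in> \<C> \<Longrightarrow> subgroup R G \<and> R0 \<subseteq> R \<and> R \<inter> Z = {\<one>}"
      by (auto simp: subset.chain_def \<A>_def)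
    have "subgroup (\<Union>\<C>) G"
    proof
      show "\<Union>\<C> \<subseteq> carrier G" using \<C> subgroup.subset by blast
      show "\<one> \<in> \<Union>\<C>" using \<C> \<open>\<C> \<noteq> {}\<close> subgroup.one_closed by blast
      fix x assume x: "x \<in> \<Union>\<C>"
      then obtain R where "R \<in> \<C>" "x \<in> R" by blast
      then show "inv x \<in> \<Union>\<C>" using subgroup.m_inv_closed[of R G x] \<C>[of R] by blast
      fix y assume "y \<in> \<Union>\<C>"
      then obtain R where "R \<in> \<C>" "x \<in> R" "y \<in> R"
        using x chain unfolding subset.chain_def by blast
      then show "x \<otimes> y \<in> \<Union>\<C>" using \<C>[of R] subgroup.m_closed[of R G x y] by blast
    qed
    then show "\<Union>\<C> \<in> \<A>" using \<C> \<open>\<C> \<noteq> {}\<close> by (auto simp: \<A>_def)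
  qed
  then obtain R where R: "subgroup R G" "R0 \<subseteq> R" "R \<inter> Z = {\<one>}"
    and max: "\<And>X. subgroup X G \<Longrightarrow> R0 \<subseteq> X \<Longrightarrow> X \<inter> Z = {\<one>} \<Longrightarrow> R \<subseteq> X \<Longrightarrow> X = R"
    by (auto simp: \<A>_def)
  note RC = subgroup.subset[OF R(1)] and ZC = subgroup.subset[OF Z]
  have RZ: "subgroup (R <#> Z) G" by (rule mult_subgroups[OF R(1) Z])
  have RRZ: "r \<in> R <#> Z" if "r \<in> R" for r
    using that subgroup.one_closed[OF Z] RC unfolding set_mult_def by force
  have ZRZ: "z \<in> R <#> Z" if "z \<in> Z" for z
    using that subgroup.one_closed[OF R(1)] ZC unfolding set_mult_def by force
  have "e \<in> R <#> Z" if e: "e \<in> carrier G" for e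
  proof (rule ccontr)
    assume ne: "e \<notin> R <#> Z"
    \<comment> \<open>The property to be secured: whenever a power of the new element falls into R
      Z, it already lies in R. It is exactly what keeps the enlarged subgroup disjoint from Z
      outside the identity.\<close>
    have "\<exists>e'\<in>carrier G. e' \<notin> R <#> Z \<and> (\<forall>n::int. e' [^] n \<in> R <#> Z \<longrightarrow> e' [^] n \<in> R)"
    proof -
      define V where "V = {n::int. e [^] n \<in> R <#> Z}"
      have "\<exists>m::nat. int m \<in> V \<and> (\<forall>n\<in>V. int m dvd n)"
      proof (rule int_subgroup_multiples)
        show "0 \<in> V" using subgroup.one_closed[OF RZ] by (simp add: V_def)
        show "a - b \<in> V" if "a \<in> V" "b \<in> V" for a b
          using that subgroup.m_closed[OF RZ _ subgroup.m_inv_closed[OF RZ]] e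
          by (simp add: V_def int_pow_diff)
      qed
      then obtain m :: nat where m: "int m \<in> V" "\<And>n. n \<in> V \<Longrightarrow> int m dvd n" by blast
      show ?thesis
      proof (cases "m = 0")
        case True
        then have "e [^] n \<in> R" if "e [^] n \<in> R <#> Z" for n :: int
          using m(2)[of n] that subgroup.one_closed[OF R(1)] by (simp add: V_def)
        then show ?thesis using e ne by blast
      next
        case False
        obtain r z where rz: "r \<in> R" "z \<in> Z" "e [^] int m = r \<otimes> z"
          using m(1) by (auto simp: V_def set_mult_def)
        obtain w where w: "w \<in> Z" "w [^] m = z" using div[OF rz(2)] False by auto
        have wC: "w \<in> carrier G" and rC: "r \<in> carrier G" and zC: "z \<in> carrier G"
          using w rz ZC RC by auto
        \<comment> \<open>With e^m = r z and w^m = z this gives e'^m = r. Any power of e' in R Z has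
          an exponent divisible by m, so it is a power of r.\<close>
        define e' where "e' = e \<otimes> inv w"
        have e': "e' \<in> carrier G" using e wC by (simp add: e'_def)
        have e_eq: "e = e' \<otimes> w" using e wC by (simp add: e'_def m_assoc)
        have "e' \<notin> R <#> Z"
          using ne subgroup.m_closed[OF RZ _ ZRZ[OF w(1)]] e_eq by auto
        moreover have "e' [^] n \<in> R" if n: "e' [^] n \<in> R <#> Z" for n :: int
        proof -
          have "w [^] n \<in> Z" using subgroup_int_pow_closed[OF Z w(1)] .
          then have "e [^] n \<in> R <#> Z"
            unfolding e_eq int_pow_distrib[OF e' wC] by (intro subgroup.m_closed[OF RZ] n ZRZ)
          then obtain k where k: "n = int m * k" using m(2)[of n] by (auto simp: V_def dvd_def)
          have "e' [^] int m = e [^] int m \<otimes> inv (w [^] int m)"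
            unfolding e'_def int_pow_distrib[OF e inv_closed[OF wC]] int_pow_inv[OF wC] ..
          also have "\<dots> = (r \<otimes> z) \<otimes> inv z"
            using w(2) by (simp only: rz(3)) (simp add: int_pow_int)
          also have "\<dots> = r" using rC zC by (simp add: m_assoc)
          finally have "e' [^] n = r [^] k"
            using e' by (simp add: k int_pow_pow[symmetric])
          then show ?thesis using subgroup_int_pow_closed[OF R(1) rz(1)] by simp
        qed
        ultimately show ?thesis using e' by blast
      qed
    qed
    then obtain e' where e': "e' \<in> carrier G" "e' \<notin> R <#> Z"
      and pow: "\<And>n::int. e' [^] n \<in> R <#> Z \<Longrightarrow> e' [^] n \<in> R" by blast
    define R' where "R' = {r \<otimes> e' [^] (n::int) | r n. r \<in> R}"
    have sub: "subgroup R' G" unfolding R'_def by (rule subgroup_adjoin[OF R(1) e'(1)])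
    have RR': "R \<subseteq> R'"
    proof
      fix r assume "r \<in> R"
      then show "r \<in> R'" unfolding R'_def using RC
        by (intro CollectI exI[of _ r] exI[of _ "0::int"]) auto
    qed
    have "x = \<one>" if x: "x \<in> R'" "x \<in> Z" for x
    proof -
      obtain r and n :: int where r: "x = r \<otimes> e' [^] n" "r \<in> R" using x by (auto simp: R'_def)
      have rC: "r \<in> carrier G" using r RC by auto
      then have "e' [^] n = inv r \<otimes> x" using e' by (simp add: r m_assoc[symmetric])
      also have "\<dots> \<in> R <#> Z"
        using r x subgroup.m_inv_closed[OF R(1)] by (auto simp: set_mult_def)
      finally have "e' [^] n \<in> R" by (rule pow)
      then have "x \<in> R" using r subgroup.m_closed[OF R(1)] by simp
      then show ?thesis using x R(3) by blast
    qed
    then have "R' \<inter> Z = {\<one>}" using subgroup.one_closed[OF sub] subgroup.one_closed[OF Z] by blast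
    then have "R' = R" using max[OF sub] R(2) RR' by blast
    moreover have "e' \<in> R'"
      unfolding R'_def using e' subgroup.one_closed[OF R(1)]
      by (intro CollectI exI[of _ \<one>] exI[of _ "1::int"]) auto
    ultimately show False using e'(2) RRZ by blast
  qed
  then have "R <#> Z = carrier G" using subgroup.subset[OF RZ] by auto
  then show ?thesis using that R by blast
qed

section \<open>Twisted characters of an abelian group\<close>

lemma circle_root:
  assumes "cmod z = 1" "n > (0::nat)" shows "\<exists>w. cmod w = 1 \<and> w ^ n = z"
proof -
  have "cis (Arg z) = z" using cis_Arg[of z] assms by (cases "z = 0") (auto simp: sgn_eq)
  then have "cis (Arg z / n) ^ n = z" using assms by (simp add: Complex.DeMoivre)
  then show ?thesis by (metis norm_cis)
qed

text \<open>The one-dimensional unitary representations of \<delta>(s) \<delta>(t) = c(s,t)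
  \<delta>(st); for c = 1 they are the ordinary characters. The value 0 off H makes equality of
  functions mean equality on H.\<close>

definition twisted_chars :: "('a, 'm) monoid_scheme \<Rightarrow> ('a \<Rightarrow> 'a \<Rightarrow> complex) \<Rightarrow> ('a \<Rightarrow> complex) set" where
  "twisted_chars H c = {\<psi>. (\<forall>s\<in>carrier H. cmod (\<psi> s) = 1) \<and> (\<forall>s. s \<notin> carrier H \<longrightarrow> \<psi> s = 0) \<and>
     (\<forall>s\<in>carrier H. \<forall>t\<in>carrier H. \<psi> s * \<psi> t = c s t * \<psi> (s \<otimes>\<^bsub>H\<^esub> t))}"

locale symmetric_cocycle = comm_group H for H :: "('a, 'm) monoid_scheme" (structure) +
  fixes c :: "'a \<Rightarrow> 'a \<Rightarrow> complex"
  assumes cocycle: "group_2cocycle H c" and symmetric: "symmetric_on (carrier H) c"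
begin

lemma cocycle_norm: "s \<in> carrier H \<Longrightarrow> t \<in> carrier H \<Longrightarrow> cmod (c s t) = 1"
  using cocycle by (auto simp: group_2cocycle_def)

lemma cocycle_unit: "s \<in> carrier H \<Longrightarrow> t \<in> carrier H \<Longrightarrow> c s t * cnj (c s t) = 1"
  using cocycle_norm by (simp add: complex_norm_square[symmetric])

text \<open>The central extension of H by the circle in which the graphs of twisted characters are the
  complements of the circle.\<close>

definition ext_group :: "('a \<times> complex) monoid" where
  "ext_group = \<lparr>carrier = carrier H \<times> circle,
     monoid.mult = (\<lambda>(s, z) (t, w). (s \<otimes> t, z * w * cnj (c s t))), one = (\<one>, 1)\<rparr>"

lemma ext_group_simps:
  "carrier ext_group = carrier H \<times> circle" "\<one>\<^bsub>ext_group\<^esub> = (\<one>, 1)"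
  "(s, z) \<otimes>\<^bsub>ext_group\<^esub> (t, w) = (s \<otimes> t, z * w * cnj (c s t))"
  by (simp_all add: ext_group_def)

lemma comm_group_ext_group: "comm_group ext_group"
proof (rule comm_groupI)
  fix x y assume x: "x \<in> carrier ext_group" and y: "y \<in> carrier ext_group"
  then show "x \<otimes>\<^bsub>ext_group\<^esub> y \<in> carrier ext_group"
    by (auto simp: ext_group_simps cocycle_norm norm_mult)
  show "x \<otimes>\<^bsub>ext_group\<^esub> y = y \<otimes>\<^bsub>ext_group\<^esub> x"
    using x y symmetric by (auto simp: ext_group_simps symmetric_on_def m_comm)
  fix z assume z: "z \<in> carrier ext_group"
  have "cnj (c g h) * cnj (c (g \<otimes> h) k) = cnj (c h k) * cnj (c g (h \<otimes> k))"
    if "g \<in> carrier H" "h \<in> carrier H" "k \<in> carrier H" for g h k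
  proof -
    have "c g h * c (g \<otimes> h) k = c h k * c g (h \<otimes> k)"
      using cocycle that by (simp add: group_2cocycle_def mult.commute)
    then show ?thesis by (metis complex_cnj_mult)
  qed
  then show "x \<otimes>\<^bsub>ext_group\<^esub> y \<otimes>\<^bsub>ext_group\<^esub> z = x \<otimes>\<^bsub>ext_group\<^esub> (y \<otimes>\<^bsub>ext_group\<^esub> z)"
    using x y z by (auto simp: ext_group_simps m_assoc mult.assoc mult.left_commute)
next
  show "\<one>\<^bsub>ext_group\<^esub> \<in> carrier ext_group" by (simp add: ext_group_simps)
next
  fix x assume "x \<in> carrier ext_group"
  then obtain s z where x: "x = (s, z)" "s \<in> carrier H" "cmod z = 1" by (auto simp: ext_group_simps)
  then show "\<one>\<^bsub>ext_group\<^esub> \<otimes>\<^bsub>ext_group\<^esub> x = x"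
    using cocycle by (auto simp: ext_group_simps group_2cocycle_def)
  have "(inv s, cnj z * c (inv s) s) \<otimes>\<^bsub>ext_group\<^esub> x = \<one>\<^bsub>ext_group\<^esub>"
    using x cocycle_unit[of "inv s" s] by (simp add: ext_group_simps complex_norm_square[symmetric] mult_ac)
  moreover have "(inv s, cnj z * c (inv s) s) \<in> carrier ext_group"
    using x by (simp add: ext_group_simps norm_mult cocycle_norm)
  ultimately show "\<exists>y\<in>carrier ext_group. y \<otimes>\<^bsub>ext_group\<^esub> x = \<one>\<^bsub>ext_group\<^esub>" by blast
qed

text \<open>A complement of the circle meets every fibre over H in exactly one point, so it is the
  graph of a function, and closure under multiplication is the twisted relation. The subgroup R0
  prescribes values: a complement containing it extends the partial twisted character.\<close>

lemma twisted_char_exists: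
  assumes R0: "subgroup R0 ext_group" "R0 \<inter> ({\<one>} \<times> circle) = {(\<one>, 1)}"
  shows "\<exists>\<psi>\<in>twisted_chars H c. \<forall>(s, z)\<in>R0. \<psi> s = z"
proof -
  interpret E: comm_group ext_group by (rule comm_group_ext_group)
  let ?Z = "{\<one>} \<times> circle"
  have c1: "c s \<one> = 1" "c \<one> s = 1" if "s \<in> carrier H" for s
    using cocycle that by (auto simp: group_2cocycle_def)
  have pow: "(\<one>, z) [^]\<^bsub>ext_group\<^esub> (n::nat) = (\<one>, z ^ n)" for z n
    by (induction n) (auto simp: ext_group_simps c1)
  have Z: "subgroup ?Z ext_group"
  proof (rule E.subgroupI)
    fix a assume a: "a \<in> ?Z"
    then obtain z where z: "a = (\<one>, z)" "cmod z = 1" by auto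
    have "inv\<^bsub>ext_group\<^esub> a = (\<one>, cnj z)"
      using z by (intro E.inv_equality) (auto simp: ext_group_simps c1 complex_norm_square[symmetric] mult.commute)
    then show "inv\<^bsub>ext_group\<^esub> a \<in> ?Z" using z by simp
    fix b assume "b \<in> ?Z"
    then show "a \<otimes>\<^bsub>ext_group\<^esub> b \<in> ?Z" using z by (auto simp: ext_group_simps c1 norm_mult)
  qed (auto simp: ext_group_simps intro!: exI[of _ 1])
  obtain R where R: "subgroup R ext_group" "R0 \<subseteq> R" "R \<inter> ?Z = {\<one>\<^bsub>ext_group\<^esub>}"
    "R <#>\<^bsub>ext_group\<^esub> ?Z = carrier ext_group"
  proof (rule E.divisible_complement[OF Z _ R0(1)])
    show "\<exists>w\<in>?Z. w [^]\<^bsub>ext_group\<^esub> n = z" if z: "z \<in> ?Z" and n: "n > 0" for z and n :: nat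
    proof -
      obtain u where u: "z = (\<one>, u)" "cmod u = 1" using z by auto
      obtain w where "cmod w = 1" "w ^ n = u" using circle_root[OF u(2) n] by auto
      then show ?thesis using u by (intro bexI[of _ "(\<one>, w)"]) (auto simp: pow)
    qed
    show "R0 \<inter> ?Z = {\<one>\<^bsub>ext_group\<^esub>}" using R0(2) by (simp add: ext_group_simps)
  qed
  have RC: "R \<subseteq> carrier ext_group" by (rule subgroup.subset[OF R(1)])
  have ex1: "\<exists>!z. (s, z) \<in> R" if s: "s \<in> carrier H" for s
  proof -
    have "(s, 1) \<in> R <#>\<^bsub>ext_group\<^esub> ?Z" using s by (simp add: R(4) ext_group_simps)
    then obtain r z where rz: "r \<in> R" "cmod z = 1" "(s, 1) = r \<otimes>\<^bsub>ext_group\<^esub> (\<one>, z)"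
      by (auto simp: set_mult_def)
    obtain t v where r: "r = (t, v)" "t \<in> carrier H" using rz RC by (auto simp: ext_group_simps)
    have "t = s" using rz r by (auto simp: ext_group_simps c1)
    then have ex: "(s, v) \<in> R" using rz r by simp
    moreover have "w = v" if w: "(s, w) \<in> R" for w
    proof -
      have v1: "cmod v = 1" "cmod w = 1" using ex w RC by (auto simp: ext_group_simps)
      have "(s, w) = (s, v) \<otimes>\<^bsub>ext_group\<^esub> (\<one>, w * cnj v)"
        using s v1 by (simp add: ext_group_simps c1 mult.left_commute[of v] complex_norm_square[symmetric])
      moreover have "(\<one>, w * cnj v) \<in> carrier ext_group" "(s, v) \<in> carrier ext_group"
        using s v1 by (auto simp: ext_group_simps norm_mult)
      ultimately have "(\<one>, w * cnj v) = inv\<^bsub>ext_group\<^esub> (s, v) \<otimes>\<^bsub>ext_group\<^esub> (s, w)"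
        by (simp add: E.m_assoc[symmetric])
      also have "\<dots> \<in> R" using ex w R(1) by (simp add: subgroup.m_closed subgroup.m_inv_closed)
      finally have "(\<one>, w * cnj v) \<in> R \<inter> ?Z" using v1 by (simp add: norm_mult)
      then have "w * cnj v = 1" unfolding R(3) by (simp add: ext_group_simps)
      then have "w * (cnj v * v) = v" by (simp add: mult.assoc[symmetric])
      then show ?thesis using v1 by (simp add: complex_norm_square[symmetric] mult.commute[of "cnj v"])
    qed
    ultimately show ?thesis by blast
  qed
  define \<psi> where "\<psi> s = (if s \<in> carrier H then THE z. (s, z) \<in> R else 0)" for s
  have \<psi>R: "(s, \<psi> s) \<in> R" if "s \<in> carrier H" for s
    using theI'[OF ex1[OF that]] that by (simp add: \<psi>_def)
  have \<psi>_eq: "\<psi> s = z" if "(s, z) \<in> R" for s z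
    using that RC ex1[of s] \<psi>R[of s] by (auto simp: ext_group_simps)
  have "\<psi> s * \<psi> t = c s t * \<psi> (s \<otimes> t)" if s: "s \<in> carrier H" and t: "t \<in> carrier H" for s t
  proof -
    have "(s \<otimes> t, \<psi> s * \<psi> t * cnj (c s t)) \<in> R"
      using subgroup.m_closed[OF R(1) \<psi>R[OF s] \<psi>R[OF t]] by (simp add: ext_group_simps)
    from \<psi>_eq[OF this] show ?thesis
      using cocycle_unit[OF s t] by (simp add: mult.left_commute[of "c s t"])
  qed
  moreover have "cmod (\<psi> s) = 1" if "s \<in> carrier H" for s
    using \<psi>R[OF that] RC by (auto simp: ext_group_simps)
  ultimately have "\<psi> \<in> twisted_chars H c"
    by (auto simp: twisted_chars_def \<psi>_def)
  then show ?thesis using \<psi>_eq R(2) by blast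
qed

lemma twisted_chars_nonempty: "twisted_chars H c \<noteq> {}"
proof -
  interpret E: comm_group ext_group by (rule comm_group_ext_group)
  have "subgroup {(\<one>, 1)} ext_group"
    using E.triv_subgroup by (simp add: ext_group_simps)
  then show ?thesis using twisted_char_exists[of "{(\<one>, 1)}"] by auto
qed

end

text \<open>The value at s0 may be any root of unity compatible with the order of s0. It is
  prescribed on the cyclic subgroup generated by (s0, \<zeta>) of the untwisted extension and
  extended by \<open>twisted_char_exists\<close>.\<close>

lemma (in comm_group) character_separates:
  assumes s0: "s0 \<in> carrier G" "s0 \<noteq> \<one>"
  shows "\<exists>\<theta>\<in>twisted_chars G (\<lambda>_ _. 1). \<theta> s0 \<noteq> 1"
proof -
  interpret symmetric_cocycle G "\<lambda>_ _. 1"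
    by unfold_locales (auto simp: group_2cocycle_def symmetric_on_def)
  interpret E: comm_group ext_group by (rule comm_group_ext_group)
  have "\<exists>m::nat. int m \<in> {n. s0 [^] n = \<one>} \<and> (\<forall>n\<in>{n. s0 [^] n = \<one>}. int m dvd n)"
    by (rule int_subgroup_multiples) (use s0 in \<open>auto simp: int_pow_diff\<close>)
  then obtain m :: nat where m: "s0 [^] int m = \<one>" "\<And>n::int. s0 [^] n = \<one> \<Longrightarrow> int m dvd n"
    by blast
  have m1: "m \<noteq> 1" using m(1) s0 by auto
  \<comment> \<open>Here m is the order of s0, with 0 for infinite order. A primitive m-th root of
    unity differs from 1 since m is not 1; for infinite order any value other than 1 would
    do.\<close>
  define \<zeta> where "\<zeta> = (if m = 0 then -1 else cis (2 * pi / m))"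
  have \<zeta>m: "\<zeta> ^ m = 1" by (simp add: \<zeta>_def Complex.DeMoivre)
  have \<zeta>: "cmod \<zeta> = 1" by (simp add: \<zeta>_def)
  then have \<zeta>0: "\<zeta> \<noteq> 0" by auto
  have "\<zeta> \<noteq> 1"
  proof (cases "m = 0")
    case False
    then have "m \<ge> 2" using m1 by linarith
    then show ?thesis
    proof (cases "m = 2")
      case True then show ?thesis by (simp add: \<zeta>_def)
    next
      case ne: False
      then have "2 * pi / m < pi" "0 < 2 * pi / m" using \<open>m \<ge> 2\<close> by (auto simp: field_simps)
      then have "sin (2 * pi / m) > 0" by (intro sin_gt_zero)
      then show ?thesis using False by (auto simp: \<zeta>_def complex_eq_iff)
    qed
  qed (simp add: \<zeta>_def)
  let ?R0 = "{r \<otimes>\<^bsub>ext_group\<^esub> (s0, \<zeta>) [^]\<^bsub>ext_group\<^esub> (n::int) | r n. r \<in> {\<one>\<^bsub>ext_group\<^esub>}}"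
  have e: "(s0, \<zeta>) \<in> carrier ext_group" using s0 \<zeta> by (simp add: ext_group_simps)
  have sub: "subgroup ?R0 ext_group"
    by (rule E.subgroup_adjoin[OF E.triv_subgroup e])
  have pow_nat: "(s0, \<zeta>) [^]\<^bsub>ext_group\<^esub> n = (s0 [^] n, \<zeta> ^ n)" for n :: nat
    by (induction n) (auto simp: ext_group_simps mult.commute)
  have pow: "(s0, \<zeta>) [^]\<^bsub>ext_group\<^esub> n = (s0 [^] n, \<zeta> powi n)" for n :: int
  proof (cases "n \<ge> 0")
    case True
    then obtain k where "n = int k" using zero_le_imp_eq_int by blast
    then show ?thesis by (simp add: int_pow_int pow_nat)
  next
    case False
    then obtain k where n: "n = - int k" by (metis int_cases2 zero_le_imp_eq_int of_nat_0_le_iff)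
    have "inv\<^bsub>ext_group\<^esub> (s0 [^] k, \<zeta> ^ k) = (inv (s0 [^] k), inverse (\<zeta> ^ k))"
      using s0 \<zeta> \<zeta>0 by (intro E.inv_equality) (auto simp: ext_group_simps norm_inverse norm_power)
    then show ?thesis
      using e s0 by (simp add: n E.int_pow_neg int_pow_neg int_pow_int pow_nat power_int_minus)
  qed
  have triv: "?R0 \<inter> ({\<one>} \<times> circle) = {(\<one>, 1)}"
  proof (intro equalityI subsetI)
    fix x assume x: "x \<in> ?R0 \<inter> ({\<one>} \<times> circle)"
    then obtain n :: int where "x = \<one>\<^bsub>ext_group\<^esub> \<otimes>\<^bsub>ext_group\<^esub> (s0, \<zeta>) [^]\<^bsub>ext_group\<^esub> n" by auto
    then have xn: "x = (s0 [^] n, \<zeta> powi n)"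
      using e by (simp add: E.l_one[OF E.int_pow_closed[OF e]] flip: pow)
    then have "s0 [^] n = \<one>" using x by auto
    then obtain k where "n = int m * k" using m(2) by (auto simp: dvd_def)
    then have "\<zeta> powi n = 1" by (simp add: power_int_mult \<zeta>m)
    then show "x \<in> {(\<one>, 1)}" using xn \<open>s0 [^] n = \<one>\<close> by simp
  next
    fix x :: "'a \<times> complex" assume "x \<in> {(\<one>, 1)}"
    then show "x \<in> ?R0 \<inter> ({\<one>} \<times> circle)"
      using subgroup.one_closed[OF sub] by (simp add: ext_group_simps)
  qed
  have in_R0: "(s0, \<zeta>) \<in> ?R0"
    by (intro CollectI exI[of _ "\<one>\<^bsub>ext_group\<^esub>"] exI[of _ "1::int"])
      (use e in \<open>simp add: E.int_pow_1\<close>)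
  obtain \<psi> where \<psi>: "\<psi> \<in> twisted_chars G (\<lambda>_ _. 1)" "\<forall>(s, z)\<in>?R0. \<psi> s = z"
    using twisted_char_exists[OF sub triv] by blast
  have "\<psi> s0 = \<zeta>" using bspec[OF \<psi>(2) in_R0] by simp
  then show ?thesis using \<psi>(1) \<open>\<zeta> \<noteq> 1\<close> by blast
qed

section \<open>Averages over characters and Folner sets\<close>

lemma (in symmetric_cocycle) twisted_char_times_power:
  assumes "\<psi> \<in> twisted_chars H c" "\<theta> \<in> twisted_chars H (\<lambda>_ _. 1)"
  shows "(\<lambda>s. \<psi> s * \<theta> s ^ j) \<in> twisted_chars H c"
proof -
  have "\<psi> s * \<theta> s ^ j * (\<psi> t * \<theta> t ^ j) = c s t * (\<psi> (s \<otimes> t) * \<theta> (s \<otimes> t) ^ j)"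
    if "s \<in> carrier H" "t \<in> carrier H" for s t
  proof -
    have "\<psi> s * \<psi> t = c s t * \<psi> (s \<otimes> t)" "\<theta> s * \<theta> t = \<theta> (s \<otimes> t)"
      using assms that by (auto simp: twisted_chars_def)
    then show ?thesis by (metis mult.assoc mult.left_commute power_mult_distrib)
  qed
  then show ?thesis using assms by (auto simp: twisted_chars_def norm_mult norm_power)
qed

text \<open>A finitary substitute for the orthogonality of characters under Haar measure on the
  dual. For each new point s0 the current list is multiplied by the powers of a character \<theta>
  with \<theta> s0 different from 1. At s0 a geometric sum appears, and at the older points the
  relative bound survives. Lists are used because equal products must be counted with
  multiplicity.\<close>

lemma (in symmetric_cocycle) averages_vanish:
  fixes \<epsilon> :: real
  assumes "finite D" "D \<subseteq> carrier H - {\<one>}" "\<epsilon> > 0"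
  shows "\<exists>xs. xs \<noteq> [] \<and> set xs \<subseteq> twisted_chars H c \<and>
    (\<forall>s\<in>D. cmod (\<Sum>\<psi>\<leftarrow>xs. \<psi> s) \<le> \<epsilon> * length xs)"
  using assms(1,2)
proof (induction rule: finite_induct)
  case empty
  then show ?case using twisted_chars_nonempty by (metis empty_iff ex_in_conv list.simps(15) insert_subset list.set(1) empty_subsetI list.distinct(1))
next
  case (insert s0 D)
  then obtain xs where xs: "xs \<noteq> []" "set xs \<subseteq> twisted_chars H c"
    "\<forall>s\<in>D. cmod (\<Sum>\<psi>\<leftarrow>xs. \<psi> s) \<le> \<epsilon> * length xs" by blast
  have s0: "s0 \<in> carrier H" "s0 \<noteq> \<one>" using insert by auto
  obtain \<theta> where \<theta>: "\<theta> \<in> twisted_chars H (\<lambda>_ _. 1)" "\<theta> s0 \<noteq> 1"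
    using character_separates[OF s0] by auto
  have \<theta>1: "cmod (\<theta> s) = 1" if "s \<in> carrier H" for s using \<theta> that by (auto simp: twisted_chars_def)
  \<comment> \<open>The geometric sum at s0 never exceeds 2 / |1 - \<theta> s0|, however many powers
    are taken; n is large enough for this to be at most \<epsilon> n.\<close>
  obtain n :: nat where n: "2 / (cmod (1 - \<theta> s0) * \<epsilon>) < n" using reals_Archimedean2 by blast
  have pos: "cmod (1 - \<theta> s0) > 0" using \<theta>(2) by simp
  then have n2: "2 / cmod (1 - \<theta> s0) \<le> \<epsilon> * n" using n assms(3) by (simp add: field_simps)
  have n0: "n > 0"
  proof (rule ccontr)
    assume "\<not> n > 0"
    then have "2 / (cmod (1 - \<theta> s0) * \<epsilon>) < 0" using n by simp
    moreover have "2 / (cmod (1 - \<theta> s0) * \<epsilon>) > 0" using pos assms(3) by simp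
    ultimately show False by linarith
  qed
  \<comment> \<open>Multiplying every entry by \<theta>^j for j < n makes the total at each point
    factor into the geometric sum of \<theta> and the old total.\<close>
  define ys where "ys = concat (map (\<lambda>j. map (\<lambda>\<psi> s. \<psi> s * \<theta> s ^ j) xs) [0..<n])"
  have len: "length ys = n * length xs"
    by (simp add: ys_def length_concat o_def sum_list_triv)
  have sum: "(\<Sum>\<psi>\<leftarrow>ys. \<psi> s) = (\<Sum>j<n. \<theta> s ^ j) * (\<Sum>\<psi>\<leftarrow>xs. \<psi> s)" for s
  proof -
    have "(\<Sum>\<psi>\<leftarrow>concat (map (\<lambda>j. map (\<lambda>\<psi> s. \<psi> s * \<theta> s ^ j) xs) [0..<k]). \<psi> s)
      = (\<Sum>j<k. \<theta> s ^ j) * (\<Sum>\<psi>\<leftarrow>xs. \<psi> s)" for k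
      by (induction k) (auto simp: o_def sum_list_mult_const algebra_simps)
    then show ?thesis by (simp add: ys_def)
  qed
  have "cmod (\<Sum>\<psi>\<leftarrow>ys. \<psi> s) \<le> \<epsilon> * length ys" if s: "s \<in> insert s0 D" for s
  proof (cases "s = s0")
    case True
    have "cmod (\<Sum>\<psi>\<leftarrow>xs. \<psi> s) \<le> length xs"
    proof -
      have "cmod (\<Sum>\<psi>\<leftarrow>zs. \<psi> s) \<le> length zs" if "set zs \<subseteq> twisted_chars H c" for zs
        using that
      proof (induction zs)
        case (Cons z zs)
        then have "cmod (z s) = 1" using True s0 by (auto simp: twisted_chars_def)
        then show ?case using Cons norm_triangle_ineq[of "z s" "\<Sum>\<psi>\<leftarrow>zs. \<psi> s"] by auto
      qed simp
      then show ?thesis using xs by blast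
    qed
    moreover have "cmod (\<Sum>j<n. \<theta> s ^ j) \<le> \<epsilon> * n"
    proof -
      have "(1 - \<theta> s) * (\<Sum>j<n. \<theta> s ^ j) = 1 - \<theta> s ^ n"
        by (rule one_diff_power_eq[symmetric])
      then have "cmod (1 - \<theta> s) * cmod (\<Sum>j<n. \<theta> s ^ j) = cmod (1 - \<theta> s ^ n)"
        by (simp flip: norm_mult)
      also have "\<dots> \<le> 2"
        using norm_triangle_ineq4[of 1 "\<theta> s ^ n"] \<theta>1[OF s0(1)] True by (simp add: norm_power)
      finally have "cmod (\<Sum>j<n. \<theta> s ^ j) \<le> 2 / cmod (1 - \<theta> s0)"
        using pos True by (simp add: field_simps)
      then show ?thesis using n2 by linarith
    qed
    ultimately have "cmod (\<Sum>j<n. \<theta> s ^ j) * cmod (\<Sum>\<psi>\<leftarrow>xs. \<psi> s) \<le> (\<epsilon> * n) * length xs"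
      using assms(3) by (intro mult_mono) auto
    then show ?thesis by (simp add: sum len norm_mult)
  next
    case False
    then have sD: "s \<in> D" "s \<in> carrier H" using s insert.prems by auto
    have "cmod (\<Sum>j<n. \<theta> s ^ j) \<le> (\<Sum>j<n. 1)"
      using \<theta>1[OF sD(2)] by (intro sum_norm_le) (simp add: norm_power)
    then have "cmod (\<Sum>j<n. \<theta> s ^ j) * cmod (\<Sum>\<psi>\<leftarrow>xs. \<psi> s) \<le> n * (\<epsilon> * length xs)"
      using xs(3) sD by (intro mult_mono) auto
    then show ?thesis by (simp add: sum len norm_mult mult.left_commute)
  qed
  moreover have "ys \<noteq> []" using n0 xs(1) len by auto
  moreover have "set ys \<subseteq> twisted_chars H c"
    using xs(2) twisted_char_times_power[OF _ \<theta>(1)] by (auto simp: ys_def)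
  ultimately show ?case by blast
qed

section \<open>Folner sets in an abelian group\<close>

primrec word_box :: "('a, 'm) monoid_scheme \<Rightarrow> 'a list \<Rightarrow> nat \<Rightarrow> 'a set" where
  "word_box G [] n = {\<one>\<^bsub>G\<^esub>}"
| "word_box G (t # ts) n = (\<Union>j\<le>n. (\<lambda>g. t [^]\<^bsub>G\<^esub> j \<otimes>\<^bsub>G\<^esub> g) ` word_box G ts n)"

context comm_group
begin

lemma word_box_finite: "finite (word_box G ts n)"
  by (induction ts) auto

lemma word_box_closed: "set ts \<subseteq> carrier G \<Longrightarrow> word_box G ts n \<subseteq> carrier G"
  by (induction ts) auto

lemma word_box_one: "set ts \<subseteq> carrier G \<Longrightarrow> \<one> \<in> word_box G ts n"
proof (induction ts)
  case (Cons t ts)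
  then show ?case by (auto intro!: bexI[of _ 0] image_eqI[of _ _ \<one>])
qed simp

lemma word_box_mono: "word_box G ts n \<subseteq> word_box G ts (Suc n)"
proof (induction ts)
  case (Cons t ts)
  then show ?case by (fastforce simp: image_iff)
qed simp

text \<open>By commutativity the extra factor t moves to the place of t in the list, where it raises
  one exponent by 1.\<close>

lemma word_box_step:
  "set ts \<subseteq> carrier G \<Longrightarrow> t \<in> set ts \<Longrightarrow> g \<in> word_box G ts n \<Longrightarrow> t \<otimes> g \<in> word_box G ts (Suc n)"
proof (induction ts arbitrary: g)
  case (Cons u us)
  obtain j h where h: "j \<le> n" "h \<in> word_box G us n" "g = u [^] j \<otimes> h" using Cons.prems by auto
  have hC: "h \<in> carrier G" using word_box_closed[of us n] h Cons.prems by auto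
  have uC: "u \<in> carrier G" and tC: "t \<in> carrier G" using Cons.prems by auto
  show ?case
  proof (cases "t = u")
    case True
    have "t \<otimes> g = u [^] Suc j \<otimes> h"
      using h hC uC True by (simp add: m_ac)
    moreover have "h \<in> word_box G us (Suc n)" using h word_box_mono by auto
    ultimately show ?thesis using h by (auto intro!: bexI[of _ "Suc j"] simp del: nat_pow_Suc)
  next
    case False
    then have "t \<otimes> h \<in> word_box G us (Suc n)" using Cons h by auto
    moreover have "t \<otimes> g = u [^] j \<otimes> (t \<otimes> h)" using h hC uC tC by (simp add: m_ac)
    ultimately show ?thesis using h by (auto intro!: bexI[of _ j])
  qed
qed simp

lemma word_box_card: "card (word_box G ts n) \<le> (n + 1) ^ length ts"
proof (induction ts)
  case (Cons t ts)
  have "card (word_box G (t # ts) n) \<le> (\<Sum>j\<le>n. card ((\<lambda>g. t [^] j \<otimes> g) ` word_box G ts n))"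
    by (simp add: card_UN_le)
  also have "\<dots> \<le> (\<Sum>j\<le>n. (n + 1) ^ length ts)"
    by (intro sum_mono order_trans[OF card_image_le[OF word_box_finite] Cons])
  finally show ?case by simp
qed simp

text \<open>The boxes grow polynomially, so some box is almost as large as its successor.\<close>

lemma Folner:
  assumes D: "finite D" "D \<subseteq> carrier G" and \<epsilon>: "\<epsilon> > 0"
  shows "\<exists>F. finite F \<and> F \<noteq> {} \<and> F \<subseteq> carrier G \<and>
    (\<forall>t\<in>D. (1 - \<epsilon>) * real (card F) \<le> real (card {g\<in>F. t \<otimes> g \<in> F}))"
proof -
  obtain ts where ts: "set ts = D" using finite_list[OF D(1)] by auto
  let ?F = "word_box G ts"
  have tsC: "set ts \<subseteq> carrier G" using ts D by simp
  have pos: "card (?F n) > 0" for n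
    using word_box_one[OF tsC] word_box_finite by (auto simp: card_gt_0_iff)
  \<comment> \<open>Growth by the factor 1 + \<epsilon> at every stage would be exponential, whereas
    \<open>word_box_card\<close> bounds the size by a polynomial in n.\<close>
  have "\<exists>n. real (card (?F (Suc n))) \<le> (1 + \<epsilon>) * real (card (?F n))"
  proof (rule ccontr)
    assume "\<not> ?thesis"
    then have g: "(1 + \<epsilon>) * real (card (?F n)) \<le> real (card (?F (Suc n)))" for n
      by (meson linear)
    have "(1 + \<epsilon>) ^ n \<le> real (card (?F n))" for n
    proof (induction n)
      case 0 show ?case using pos[of 0] by simp
    next
      case (Suc n)
      then have "(1 + \<epsilon>) * (1 + \<epsilon>) ^ n \<le> (1 + \<epsilon>) * real (card (?F n))"
        using \<epsilon> by (intro mult_left_mono) auto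
      then show ?case using g[of n] by simp
    qed
    moreover have "real (card (?F n)) \<le> real (n + 1) ^ length ts" for n
      using word_box_card[of ts n] by (metis of_nat_le_iff of_nat_power)
    ultimately have le: "(1 + \<epsilon>) ^ n \<le> real (n + 1) ^ length ts" for n
      using order_trans by blast
    \<comment> \<open>The limit of x^k / exp x along x = ln (1 + \<epsilon>) (n + 1). The constant
      factor multiplied in below undoes the scaling of x and the shift from n to n + 1.\<close>
    have "(\<lambda>n. real (n + 1) ^ length ts / (1 + \<epsilon>) ^ n) \<longlonglongrightarrow> 0"
    proof -
      let ?a = "ln (1 + \<epsilon>)"
      have a: "?a > 0" using \<epsilon> by simp
      have "filterlim (\<lambda>n. ?a * real (n + 1)) at_top sequentially"
        by (rule filterlim_tendsto_pos_mult_at_top[OF tendsto_const a])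
          (use filterlim_compose[OF filterlim_real_sequentially filterlim_Suc] in simp)
      from filterlim_compose[OF tendsto_power_div_exp_0 this, of "length ts"]
      have "(\<lambda>n. (?a * real (n + 1)) ^ length ts / exp (?a * real (n + 1)) * ((1 + \<epsilon>) / ?a ^ length ts))
        \<longlonglongrightarrow> 0 * ((1 + \<epsilon>) / ?a ^ length ts)"
        by (intro tendsto_intros)
      moreover have "exp (?a * real (n + 1)) = (1 + \<epsilon>) * (1 + \<epsilon>) ^ n" for n
      proof -
        have "exp (?a * real (n + 1)) = exp ?a ^ (n + 1)"
          by (metis exp_of_nat_mult mult.commute)
        then show ?thesis using \<epsilon> by simp
      qed
      ultimately show ?thesis using a \<epsilon> by (simp add: power_mult_distrib)
    qed
    then have "eventually (\<lambda>n. real (n + 1) ^ length ts / (1 + \<epsilon>) ^ n < 1) sequentially"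
      by (rule order_tendstoD) simp
    then obtain n where "real (n + 1) ^ length ts / (1 + \<epsilon>) ^ n < 1"
      by (auto simp: eventually_sequentially)
    then have "real (n + 1) ^ length ts < (1 + \<epsilon>) ^ n" using \<epsilon> by (simp add: field_simps)
    then show False using le[of n] by linarith
  qed
  then obtain n where n: "real (card (?F (Suc n))) \<le> (1 + \<epsilon>) * real (card (?F n))" by blast
  have "(1 - \<epsilon>) * real (card (?F n)) \<le> real (card {g\<in>?F n. t \<otimes> g \<in> ?F n})" if t: "t \<in> D" for t
  proof -
    have FC: "?F n \<subseteq> carrier G" by (rule word_box_closed[OF tsC])
    have tC: "t \<in> carrier G" using t D by auto
    have inj: "inj_on ((\<otimes>) t) (carrier G)" using tC by (auto intro: inj_onI)
    \<comment> \<open>Both the box and its translate by t lie in the next box, which has at most (1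
      + \<epsilon>) times as many elements. Inclusion and exclusion leaves an overlap of at least 1
      - \<epsilon> of the box.\<close>
    have "card ((\<otimes>) t ` ?F n \<union> ?F n) \<le> card (?F (Suc n))"
      using word_box_step[OF tsC] t ts word_box_mono by (intro card_mono word_box_finite) auto
    moreover have "card ((\<otimes>) t ` ?F n \<inter> ?F n) = card {g\<in>?F n. t \<otimes> g \<in> ?F n}"
    proof -
      have "(\<otimes>) t ` ?F n \<inter> ?F n = (\<otimes>) t ` {g\<in>?F n. t \<otimes> g \<in> ?F n}" by auto
      then show ?thesis
        using FC by (metis (no_types, lifting) card_image inj inj_on_subset mem_Collect_eq subset_iff)
    qed
    moreover have "card ((\<otimes>) t ` ?F n) = card (?F n)"
      by (rule card_image[OF inj_on_subset[OF inj FC]])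
    ultimately have "2 * card (?F n) \<le> card (?F (Suc n)) + card {g\<in>?F n. t \<otimes> g \<in> ?F n}"
      using card_Un_Int[of "(\<otimes>) t ` ?F n" "?F n"] word_box_finite[of ts n] by simp
    then have "2 * real (card (?F n)) \<le> real (card (?F (Suc n))) + real (card {g\<in>?F n. t \<otimes> g \<in> ?F n})"
      by linarith
    then show ?thesis using n by (simp add: algebra_simps)
  qed
  moreover have "?F n \<noteq> {}" using word_box_one[OF tsC] by blast
  ultimately show ?thesis
    by (intro exI[of _ "?F n"] conjI word_box_finite word_box_closed tsC ballI)
qed

end

section \<open>The cocycle attached to coset representatives\<close>

text \<open>The choice r is arbitrary on every coset, also on S itself. Formulas at the unit coset
  therefore carry the phase \<open>ker (r S) \<one> \<psi>\<close>.\<close>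

locale cocycle_pair = normal S G for S :: "'a set" and G :: "('a, 'm) monoid_scheme" (structure) +
  fixes c :: "'a \<Rightarrow> 'a \<Rightarrow> complex" and r :: "'a set \<Rightarrow> 'a"
  assumes cocycle_c: "group_2cocycle G c"
    and symmetric_S: "symmetric_abelian_subgroup G c S"
    and rep: "q \<in> carrier (G Mod S) \<Longrightarrow> r q \<in> q"
begin

abbreviation T where "T \<equiv> twisted_chars (G\<lparr>carrier := S\<rparr>) c"

lemma c_norm: "g \<in> carrier G \<Longrightarrow> h \<in> carrier G \<Longrightarrow> cmod (c g h) = 1"
  using cocycle_c by (auto simp: group_2cocycle_def)

lemma c_one: "g \<in> carrier G \<Longrightarrow> c g \<one> = 1" "g \<in> carrier G \<Longrightarrow> c \<one> g = 1"
  using cocycle_c by (auto simp: group_2cocycle_def)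

lemma c_assoc: "g \<in> carrier G \<Longrightarrow> h \<in> carrier G \<Longrightarrow> k \<in> carrier G \<Longrightarrow>
    c g (h \<otimes> k) * c h k = c (g \<otimes> h) k * c g h"
  using cocycle_c by (auto simp: group_2cocycle_def)

lemma c_cnj: "g \<in> carrier G \<Longrightarrow> h \<in> carrier G \<Longrightarrow> c g h * cnj (c g h) = 1"
  using c_norm by (simp add: complex_norm_square[symmetric])

lemma c_nonzero: "g \<in> carrier G \<Longrightarrow> h \<in> carrier G \<Longrightarrow> c g h \<noteq> 0"
  using c_norm[of g h] by auto

lemma cnj_c: "g \<in> carrier G \<Longrightarrow> h \<in> carrier G \<Longrightarrow> cnj (c g h) = inverse (c g h)"
  using c_cnj[of g h] by (simp add: inverse_unique)

lemma S_carrier: "s \<in> S \<Longrightarrow> s \<in> carrier G"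
  by (rule mem_carrier)

sublocale H: symmetric_cocycle "G\<lparr>carrier := S\<rparr>" c
proof -
  have sub: "subgroup S G" by unfold_locales
  interpret H: group "G\<lparr>carrier := S\<rparr>" by (rule subgroup.subgroup_is_group[OF sub is_group])
  show "symmetric_cocycle (G\<lparr>carrier := S\<rparr>) c"
  proof unfold_locales
    show "\<And>x y. x \<in> carrier (G\<lparr>carrier := S\<rparr>) \<Longrightarrow> y \<in> carrier (G\<lparr>carrier := S\<rparr>) \<Longrightarrow>
      x \<otimes>\<^bsub>G\<lparr>carrier := S\<rparr>\<^esub> y = y \<otimes>\<^bsub>G\<lparr>carrier := S\<rparr>\<^esub> x"
      using symmetric_S by (simp add: symmetric_abelian_subgroup_def)
    show "group_2cocycle (G\<lparr>carrier := S\<rparr>) c"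
      using cocycle_c S_carrier by (auto simp: group_2cocycle_def)
    show "symmetric_on (carrier (G\<lparr>carrier := S\<rparr>)) c"
      using symmetric_S by (simp add: symmetric_abelian_subgroup_def)
  qed
qed

lemma T_norm: "\<psi> \<in> T \<Longrightarrow> s \<in> S \<Longrightarrow> cmod (\<psi> s) = 1"
  and T_off: "\<psi> \<in> T \<Longrightarrow> s \<notin> S \<Longrightarrow> \<psi> s = 0"
  and T_mult: "\<psi> \<in> T \<Longrightarrow> s \<in> S \<Longrightarrow> t \<in> S \<Longrightarrow> \<psi> s * \<psi> t = c s t * \<psi> (s \<otimes> t)"
  by (auto simp: twisted_chars_def)

lemma T_one: assumes "\<psi> \<in> T" shows "\<psi> \<one> = 1"
proof -
  have "\<psi> \<one> * \<psi> \<one> = \<psi> \<one>" using T_mult[OF assms, of \<one> \<one>] c_one by simp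
  moreover have "\<psi> \<one> \<noteq> 0" using T_norm[OF assms, of \<one>] by auto
  ultimately show ?thesis by simp
qed

lemma coset_eq_mem:
  assumes g: "g \<in> carrier G" shows "h \<in> carrier G \<and> S #> g = S #> h \<longleftrightarrow> h \<in> S #> g"
proof
  assume "h \<in> carrier G \<and> S #> g = S #> h"
  then show "h \<in> S #> g" using rcos_self[OF _ subgroup_axioms, of h] by simp
next
  assume h: "h \<in> S #> g"
  then show "h \<in> carrier G \<and> S #> g = S #> h"
    using repr_independence[OF h g subgroup_axioms] r_coset_subset_G[OF subset g] by blast
qed

text \<open>Elements of G/S are right cosets, whereas \<open>ker\<close> takes quotients on the
  left; normality of S makes the two conditions agree.\<close>

lemma coset_eq_iff:
  assumes "g \<in> carrier G" "h \<in> carrier G"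
  shows "S #> g = S #> h \<longleftrightarrow> inv g \<otimes> h \<in> S"
proof -
  have "S #> g = S #> h \<longleftrightarrow> h \<in> S #> g"
    using coset_eq_mem[OF assms(1), of h] assms(2) by simp
  also have "\<dots> \<longleftrightarrow> h \<otimes> inv g \<in> S" by (rule rcos_module[OF is_group assms])
  also have "\<dots> \<longleftrightarrow> inv g \<otimes> h \<in> S"
  proof
    assume "h \<otimes> inv g \<in> S"
    then have "inv g \<otimes> (h \<otimes> inv g) \<otimes> g \<in> S" by (rule inv_op_closed1[OF assms(1)])
    then show "inv g \<otimes> h \<in> S" using assms by (simp add: m_assoc)
  next
    assume "inv g \<otimes> h \<in> S"
    then have "g \<otimes> (inv g \<otimes> h) \<otimes> inv g \<in> S" by (rule inv_op_closed2[OF assms(1)])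
    then show "h \<otimes> inv g \<in> S" using assms by (simp add: m_assoc[symmetric])
  qed
  finally show ?thesis .
qed

lemma coset_mult: "g \<in> carrier G \<Longrightarrow> h \<in> carrier G \<Longrightarrow> (S #> g) <#> (S #> h) = S #> (g \<otimes> h)"
  by (rule rcos_sum)

lemma coset_mem: assumes "g \<in> carrier G" shows "h \<in> S #> g \<longleftrightarrow> h \<in> carrier G \<and> S #> h = S #> g"
  using coset_eq_mem[OF assms, of h] by auto

lemma rep_closed: "q \<in> carrier (G Mod S) \<Longrightarrow> r q \<in> carrier G"
  and rep_coset: "q \<in> carrier (G Mod S) \<Longrightarrow> S #> r q = q"
  using rep[of q] coset_mem by (auto simp: carrier_FactGroup)

lemma mem_coset: "q \<in> carrier (G Mod S) \<Longrightarrow> g \<in> q \<longleftrightarrow> g \<in> carrier G \<and> S #> g = q"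
  using coset_mem by (auto simp: carrier_FactGroup)

lemma coset_closed: "g \<in> carrier G \<Longrightarrow> S #> g \<in> carrier (G Mod S)"
  by (auto simp: carrier_FactGroup)

sublocale Q: group "G Mod S"
  by (rule factorgroup_is_group)

lemma rep_mult: "p \<in> carrier (G Mod S) \<Longrightarrow> q \<in> carrier (G Mod S) \<Longrightarrow> S #> (r p \<otimes> r q) = p <#> q"
  using coset_mult[of "r p" "r q"] by (simp add: rep_closed rep_coset)

text \<open>The value at the character \<open>\<psi>\<close> of \<open>\<delta>\<^sub>g\<^sup>* \<delta>\<^sub>h\<close>, for g and h in the same coset.\<close>

definition ker :: "'a \<Rightarrow> 'a \<Rightarrow> ('a \<Rightarrow> complex) \<Rightarrow> complex" where
  "ker g h \<psi> = \<psi> (inv g \<otimes> h) * cnj (c g (inv g \<otimes> h))"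

lemma ker_norm:
  assumes "g \<in> carrier G" "h \<in> carrier G" "S #> g = S #> h" "\<psi> \<in> T"
  shows "cmod (ker g h \<psi>) = 1"
  using assms coset_eq_iff[OF assms(1,2)] by (simp add: ker_def norm_mult T_norm c_norm)

lemma ker_self: "g \<in> carrier G \<Longrightarrow> \<psi> \<in> T \<Longrightarrow> ker g g \<psi> = 1"
  by (simp add: ker_def T_one c_one)

lemma ker_one: "s \<in> S \<Longrightarrow> ker \<one> s \<psi> = \<psi> s"
  by (simp add: ker_def c_one S_carrier)

text \<open>Evaluates (\<delta>(g)* \<delta>(h)) (\<delta>(h)* \<delta>(k)) = \<delta>(g)*
  \<delta>(k), which holds as \<delta>(h) is unitary. In coordinates it is the cocycle identity for
  c at g and the two quotients.\<close>

lemma ker_chain: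
  assumes g: "g \<in> carrier G" and h: "h \<in> carrier G" and k: "k \<in> carrier G"
    and gh: "S #> g = S #> h" and hk: "S #> h = S #> k" and \<psi>: "\<psi> \<in> T"
  shows "ker g h \<psi> * ker h k \<psi> = ker g k \<psi>"
proof -
  define s t where "s = inv g \<otimes> h" and "t = inv h \<otimes> k"
  have s: "s \<in> S" and t: "t \<in> S"
    using gh hk by (simp_all add: s_def t_def g h k flip: coset_eq_iff)
  note sc = S_carrier[OF s] and tc = S_carrier[OF t]
  have st: "inv g \<otimes> k = s \<otimes> t" and gs: "g \<otimes> s = h"
    using g h k by (simp_all add: s_def t_def m_assoc inv_mult_cancel)
  have "c g (s \<otimes> t) * c s t = c h t * c g s"
    using c_assoc[OF g sc tc] gs by simp
  then have "c s t * inverse (c g s) * inverse (c h t) = inverse (c g (s \<otimes> t))"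
    using c_nonzero g h sc tc by (simp add: field_simps)
  then have "\<psi> s * \<psi> t * inverse (c g s) * inverse (c h t) = \<psi> (s \<otimes> t) * inverse (c g (s \<otimes> t))"
    unfolding T_mult[OF \<psi> s t] by (simp add: mult_ac)
  then show ?thesis
    using g h sc tc unfolding ker_def st s_def[symmetric] t_def[symmetric]
    by (simp add: cnj_c mult_ac)
qed

text \<open>The element \<delta>(h)* \<delta>(g) is the adjoint of \<delta>(g)* \<delta>(h), and
  \<open>ker\<close> is unimodular.\<close>

lemma ker_commute:
  assumes "g \<in> carrier G" "h \<in> carrier G" "S #> g = S #> h" "\<psi> \<in> T"
  shows "ker h g \<psi> = cnj (ker g h \<psi>)"
proof -
  have "ker g h \<psi> * ker h g \<psi> = 1"
    using ker_chain[OF assms(1,2,1,3) assms(3)[symmetric] assms(4)] ker_self[OF assms(1,4)] by simp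
  moreover have "ker g h \<psi> * cnj (ker g h \<psi>) = 1"
    using ker_norm[OF assms] by (simp add: complex_norm_square[symmetric])
  ultimately show ?thesis by (metis mult_cancel_left zero_neq_one mult_zero_left)
qed

text \<open>Since \<delta>(kg) is a phase times \<delta>(k) \<delta>(g), the unitary \<delta>(k)
  cancels from \<delta>(kg)* \<delta>(kh) and only the two phases remain.\<close>

lemma ker_left:
  assumes g: "g \<in> carrier G" and h: "h \<in> carrier G" and k: "k \<in> carrier G"
  shows "ker (k \<otimes> g) (k \<otimes> h) \<psi> = c k g * cnj (c k h) * ker g h \<psi>"
proof -
  define s where "s = inv g \<otimes> h"
  have sc: "s \<in> carrier G" and gs: "g \<otimes> s = h"
    using g h by (simp_all add: s_def m_assoc inv_mult_cancel)
  have s': "inv (k \<otimes> g) \<otimes> (k \<otimes> h) = s"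
    using g h k by (simp add: s_def inv_mult_group m_assoc inv_mult_cancel)
  have "c k h * c g s = c (k \<otimes> g) s * c k g"
    using c_assoc[OF k g sc] gs by simp
  then have "inverse (c (k \<otimes> g) s) = c k g * inverse (c k h) * inverse (c g s)"
    using c_nonzero g h k sc by (simp add: field_simps)
  then show ?thesis
    unfolding ker_def s' s_def[symmetric] using g h k sc by (simp add: cnj_c mult_ac)
qed

text \<open>The value at \<psi> of \<delta>(k)* \<delta>(s) \<delta>(k), where \<delta>(s)
  \<delta>(k) has been replaced by c(s,k) \<delta>(sk). This is the dual action read on twisted
  characters.\<close>

definition act :: "'a \<Rightarrow> ('a \<Rightarrow> complex) \<Rightarrow> 'a \<Rightarrow> complex" where
  "act k \<psi> s = (if s \<in> S then c s k * ker k (s \<otimes> k) \<psi> else 0)"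

lemma coset_S_mult: "s \<in> S \<Longrightarrow> k \<in> carrier G \<Longrightarrow> S #> (s \<otimes> k) = S #> k"
  using coset_mult[of s k] coset_join2[OF S_carrier subgroup_axioms, of s] rcosets_mult_eq[of "S #> k"]
    rcosetsI[OF subset] S_carrier by simp

lemma coset_mult_S: "s \<in> S \<Longrightarrow> k \<in> carrier G \<Longrightarrow> S #> (k \<otimes> s) = S #> k"
  using coset_eq_iff[of k "k \<otimes> s"] S_carrier by (simp add: inv_mult_cancel)

text \<open>Up to the two phases, \<delta>(gk)* \<delta>(hk) is \<delta>(k)* (\<delta>(g)*
  \<delta>(h)) \<delta>(k). Conjugating the inner element by \<delta>(k) amounts to evaluating it at
  the translated character.\<close>

lemma ker_right:
  assumes g: "g \<in> carrier G" and h: "h \<in> carrier G" and k: "k \<in> carrier G"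
    and gh: "S #> g = S #> h" and \<psi>: "\<psi> \<in> T"
  shows "ker g h (act k \<psi>) = c h k * cnj (c g k) * ker (g \<otimes> k) (h \<otimes> k) \<psi>"
proof -
  define s where "s = inv g \<otimes> h"
  have s: "s \<in> S" and gs: "g \<otimes> s = h"
    using g h gh coset_eq_iff by (simp_all add: s_def m_assoc inv_mult_cancel)
  note sc = S_carrier[OF s]
  have hk: "h \<otimes> k = g \<otimes> (s \<otimes> k)" using g sc k gs by (simp add: m_assoc[symmetric])
  have "c g (s \<otimes> k) * c s k = c h k * c g s" using c_assoc[OF g sc k] gs by simp
  then have e: "c s k * inverse (c g s) = c h k * inverse (c g (s \<otimes> k))"
    using c_nonzero g k sc by (simp add: field_simps)
  have "ker g h (act k \<psi>) = ker k (s \<otimes> k) \<psi> * (c s k * inverse (c g s))"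
    using s g sc by (simp add: ker_def act_def s_def[symmetric] cnj_c)
  also have "\<dots> = c h k * cnj (c g k) * (c g k * cnj (c g (s \<otimes> k)) * ker k (s \<otimes> k) \<psi>)"
    unfolding e using g k sc c_nonzero by (simp add: cnj_c)
  finally show ?thesis
    unfolding hk using ker_left[of k "s \<otimes> k" g \<psi>] g k sc by simp
qed

lemma act_T:
  assumes k: "k \<in> carrier G" and \<psi>: "\<psi> \<in> T"
  shows "act k \<psi> \<in> T"
proof -
  have "act k \<psi> s * act k \<psi> t = c s t * act k \<psi> (s \<otimes> t)" if s: "s \<in> S" and t: "t \<in> S" for s t
  proof -
    note sc = S_carrier[OF s] and tc = S_carrier[OF t]
    have "ker k (s \<otimes> k) \<psi> * ker (s \<otimes> k) (s \<otimes> (t \<otimes> k)) \<psi> = ker k (s \<otimes> (t \<otimes> k)) \<psi>"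
      using s t sc tc k \<psi> by (intro ker_chain) (auto simp: coset_S_mult)
    moreover have "ker (s \<otimes> k) (s \<otimes> (t \<otimes> k)) \<psi> = c s k * inverse (c s (t \<otimes> k)) * ker k (t \<otimes> k) \<psi>"
      using ker_left[of k "t \<otimes> k" s \<psi>] sc tc k by (simp add: cnj_c)
    ultimately have "c s k * ker k (s \<otimes> k) \<psi> * ker k (t \<otimes> k) \<psi> = c s (t \<otimes> k) * ker k (s \<otimes> (t \<otimes> k)) \<psi>"
      using c_nonzero[of s "t \<otimes> k"] sc tc k by (simp add: field_simps)
    moreover have "c s (t \<otimes> k) * c t k = c (s \<otimes> t) k * c s t" by (rule c_assoc[OF sc tc k])
    ultimately have "(c s k * ker k (s \<otimes> k) \<psi>) * (c t k * ker k (t \<otimes> k) \<psi>)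
      = c s t * (c (s \<otimes> t) k * ker k (s \<otimes> (t \<otimes> k)) \<psi>)"
      by (metis mult.assoc mult.commute)
    then show ?thesis
      using s t sc tc k by (simp add: act_def m_assoc)
  qed
  moreover have "cmod (act k \<psi> s) = 1" if s: "s \<in> S" for s
    using s k \<psi> S_carrier[OF s] by (simp add: act_def norm_mult c_norm ker_norm coset_S_mult)
  ultimately show ?thesis by (auto simp: twisted_chars_def act_def)
qed

lemma act_mult:
  assumes h: "h \<in> carrier G" and g: "g \<in> carrier G" and \<psi>: "\<psi> \<in> T"
  shows "act h (act g \<psi>) = act (h \<otimes> g) \<psi>"
proof
  fix s
  show "act h (act g \<psi>) s = act (h \<otimes> g) \<psi> s"
  proof (cases "s \<in> S")
    case s: True
    note sc = S_carrier[OF s]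
    have "ker h (s \<otimes> h) (act g \<psi>) = c (s \<otimes> h) g * inverse (c h g) * ker (h \<otimes> g) (s \<otimes> h \<otimes> g) \<psi>"
      using ker_right[of h "s \<otimes> h" g \<psi>] h g \<psi> s sc by (simp add: coset_S_mult cnj_c)
    moreover have "c s (h \<otimes> g) * c h g = c (s \<otimes> h) g * c s h" by (rule c_assoc[OF sc h g])
    then have "c s h * (c (s \<otimes> h) g * inverse (c h g)) = c s (h \<otimes> g)"
      using c_nonzero[OF h g] by (simp add: field_simps)
    ultimately show ?thesis
      using s sc h g by (simp add: act_def m_assoc flip: mult.assoc)
  qed (simp add: act_def)
qed

text \<open>Two elements of one coset give unitaries that differ by a unitary of B. Since B is
  commutative, that factor does not affect the conjugation: it enters as
  \<open>ker g h \<psi> * ker h g \<psi>\<close>, which is 1.\<close>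

lemma act_coset:
  assumes h: "h \<in> carrier G" and g: "g \<in> carrier G" and gh: "S #> g = S #> h" and \<psi>: "\<psi> \<in> T"
  shows "act g \<psi> = act h \<psi>"
proof
  fix s
  show "act g \<psi> s = act h \<psi> s"
  proof (cases "s \<in> S")
    case s: True
    note sc = S_carrier[OF s]
    have "ker g (s \<otimes> g) \<psi> = ker g h \<psi> * ker h (s \<otimes> h) \<psi> * ker (s \<otimes> h) (s \<otimes> g) \<psi>"
    proof -
      have sh: "S #> h = S #> (s \<otimes> h)" and shg: "S #> (s \<otimes> h) = S #> (s \<otimes> g)"
        using coset_S_mult[OF s h] coset_S_mult[OF s g] gh by simp_all
      have "ker g h \<psi> * ker h (s \<otimes> h) \<psi> = ker g (s \<otimes> h) \<psi>"
        by (rule ker_chain[OF g h _ gh sh \<psi>]) (simp add: sc h)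
      moreover have "ker g (s \<otimes> h) \<psi> * ker (s \<otimes> h) (s \<otimes> g) \<psi> = ker g (s \<otimes> g) \<psi>"
        using gh sh by (intro ker_chain[OF g _ _ _ shg \<psi>]) (simp_all add: sc h g)
      ultimately show ?thesis by simp
    qed
    also have "ker (s \<otimes> h) (s \<otimes> g) \<psi> = c s h * inverse (c s g) * ker h g \<psi>"
      using ker_left[of h g s \<psi>] g h sc by (simp add: cnj_c)
    also have "ker g h \<psi> * ker h (s \<otimes> h) \<psi> * (c s h * inverse (c s g) * ker h g \<psi>)
      = (ker g h \<psi> * ker h g \<psi>) * (ker h (s \<otimes> h) \<psi> * (c s h * inverse (c s g)))"
      by (simp add: mult_ac)
    also have "ker g h \<psi> * ker h g \<psi> = 1"
      using ker_chain[OF g h g gh gh[symmetric] \<psi>] ker_self[OF g \<psi>] by simp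
    finally show ?thesis
      using s sc g c_nonzero by (simp add: act_def)
  qed (simp add: act_def)
qed

lemma act_one: assumes "\<psi> \<in> T" shows "act \<one> \<psi> = \<psi>"
proof
  fix s show "act \<one> \<psi> s = \<psi> s"
    using T_off[OF assms] by (cases "s \<in> S") (auto simp: act_def c_one S_carrier ker_one)
qed

abbreviation actq where "actq q \<equiv> act (r q)"

text \<open>The value at \<psi> of \<delta>(r(pq))* \<delta>(r p) \<delta>(r q). It is unimodular,
  so dividing by the modulus in \<open>coset_cocycle\<close> leaves it unchanged.\<close>

definition csc :: "'a set \<Rightarrow> 'a set \<Rightarrow> ('a \<Rightarrow> complex) \<Rightarrow> complex" where
  "csc p q \<psi> = c (r p) (r q) * ker (r (p <#> q)) (r p \<otimes> r q) \<psi>"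

text \<open>The relation \<open>\<delta>\<^sub>g \<delta>\<^sub>h = c(g,h) \<delta>\<^sub>g\<^sub>h\<close> with each factor translated by its representative and
  evaluated at \<open>\<psi>\<close>.\<close>

lemma ker_mult:
  assumes p: "p \<in> carrier (G Mod S)" and q: "q \<in> carrier (G Mod S)" and g: "g \<in> p" and h: "h \<in> q"
    and \<psi>: "\<psi> \<in> T"
  shows "c g h * ker (r (p <#> q)) (g \<otimes> h) \<psi> = ker (r p) g (actq q \<psi>) * ker (r q) h \<psi> * csc p q \<psi>"
proof -
  have pq: "p <#> q \<in> carrier (G Mod S)" using Q.m_closed[OF p q] by simp
  have gc: "g \<in> carrier G" "S #> g = p" and hc: "h \<in> carrier G" "S #> h = q"
    using g h mem_coset[OF p] mem_coset[OF q] by auto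
  note rp = rep_closed[OF p] rep_coset[OF p] and rq = rep_closed[OF q] rep_coset[OF q]
    and rpq = rep_closed[OF pq] rep_coset[OF pq]
  have cosets: "S #> (g \<otimes> h) = p <#> q" "S #> (g \<otimes> r q) = p <#> q" "S #> (r p \<otimes> r q) = p <#> q"
    using coset_mult[of g h] coset_mult[of g "r q"] coset_mult[of "r p" "r q"] gc hc rp rq by auto
  have 1: "ker (r p) g (actq q \<psi>) = c g (r q) * inverse (c (r p) (r q)) * ker (r p \<otimes> r q) (g \<otimes> r q) \<psi>"
    using ker_right[of "r p" g "r q" \<psi>] gc rp rq \<psi> by (simp add: cnj_c)
  have 2: "ker (g \<otimes> r q) (g \<otimes> h) \<psi> = c g (r q) * inverse (c g h) * ker (r q) h \<psi>"
    using ker_left[of "r q" h g \<psi>] gc hc rq by (simp add: cnj_c)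
  \<comment> \<open>The chain is routed through \<open>r p \<otimes> r q\<close> and
    \<open>g \<otimes> r q\<close>: its links yield the cocycle, the factor of g at the translated
    character, and the factor of h.\<close>
  have 3: "ker (r (p <#> q)) (g \<otimes> h) \<psi>
    = ker (r (p <#> q)) (r p \<otimes> r q) \<psi> * ker (r p \<otimes> r q) (g \<otimes> r q) \<psi> * ker (g \<otimes> r q) (g \<otimes> h) \<psi>"
    using ker_chain[of "r (p <#> q)" "r p \<otimes> r q" "g \<otimes> r q" \<psi>]
      ker_chain[of "r (p <#> q)" "g \<otimes> r q" "g \<otimes> h" \<psi>] gc hc rp rq rpq cosets \<psi> by simp
  show ?thesis
    unfolding 3 2 1 csc_def using gc hc rp rq c_nonzero by (simp add: field_simps)
qed

text \<open>The cocycle identity comes from applying \<open>ker_mult\<close> to the product of three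
  representatives bracketed in both ways. In each case one factor is the kernel of a representative
  against itself, which is 1, and associativity of c links the two results.\<close>

sublocale Tw: twisted_action "G Mod S" T "\<lambda>q. actq q" csc
proof
  fix p x assume p: "p \<in> carrier (G Mod S)" and x: "x \<in> T"
  show "actq p x \<in> T" by (rule act_T[OF rep_closed[OF p] x])
  fix q assume q: "q \<in> carrier (G Mod S)"
  have pq: "p <#> q \<in> carrier (G Mod S)" using Q.m_closed[OF p q] by simp
  show "actq (p \<otimes>\<^bsub>G Mod S\<^esub> q) x = actq p (actq q x)"
    using act_mult[OF rep_closed[OF p] rep_closed[OF q] x]
      act_coset[OF _ rep_closed[OF pq] _ x, of "r p \<otimes> r q"] p q pq
    by (simp add: rep_closed rep_coset rep_mult)
  show "cmod (csc p q x) = 1"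
    using p q pq x by (simp add: csc_def norm_mult c_norm rep_closed ker_norm rep_coset rep_mult)
  fix k assume k: "k \<in> carrier (G Mod S)"
  have qk: "q <#> k \<in> carrier (G Mod S)" using Q.m_closed[OF q k] by simp
  let ?g = "r p" and ?h = "r q" and ?k = "r k"
  have gc: "?g \<in> carrier G" and hc: "?h \<in> carrier G" and kc: "?k \<in> carrier G"
    using p q k rep_closed by auto
  have assoc: "p <#> q <#> k = p <#> (q <#> k)" using Q.m_assoc[OF p q k] by simp
  have y: "actq k x \<in> T" by (rule act_T[OF kc x])
  have actqk: "actq (q <#> k) x = actq q (actq k x)"
    using act_mult[OF hc kc x] act_coset[OF _ rep_closed[OF qk] _ x, of "?h \<otimes> ?k"] q k qk hc kc
    by (simp add: rep_coset rep_mult)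
  have "c ?g (?h \<otimes> ?k) * ker (r (p <#> (q <#> k))) (?g \<otimes> (?h \<otimes> ?k)) x
    = ker (r p) ?g (actq (q <#> k) x) * ker (r (q <#> k)) (?h \<otimes> ?k) x * csc p (q <#> k) x"
    using rep[OF p] rep_mult[OF q k] hc kc by (intro ker_mult p qk x) (auto simp: mem_coset[OF qk])
  then have E1: "c ?g (?h \<otimes> ?k) * ker (r (p <#> (q <#> k))) (?g \<otimes> (?h \<otimes> ?k)) x
    = ker (r (q <#> k)) (?h \<otimes> ?k) x * csc p (q <#> k) x"
    by (simp add: ker_self[OF gc] actqk act_T[OF hc y])
  have "c (?g \<otimes> ?h) ?k * ker (r (p <#> q <#> k)) (?g \<otimes> ?h \<otimes> ?k) x
    = ker (r (p <#> q)) (?g \<otimes> ?h) (actq k x) * ker (r k) ?k x * csc (p <#> q) k x"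
    using rep[OF k] rep_mult[OF p q] gc hc by (intro ker_mult pq k x) (auto simp: mem_coset[OF pq])
  then have E2: "c (?g \<otimes> ?h) ?k * ker (r (p <#> (q <#> k))) (?g \<otimes> (?h \<otimes> ?k)) x
    = ker (r (p <#> q)) (?g \<otimes> ?h) (actq k x) * csc (p <#> q) k x"
    by (simp add: ker_self[OF kc x] assoc m_assoc[OF gc hc kc])
  have "c (?g \<otimes> ?h) ?k \<noteq> 0" using c_nonzero gc hc kc by simp
  then have 1: "c ?g (?h \<otimes> ?k) * inverse (c (?g \<otimes> ?h) ?k) * (ker (r (p <#> q)) (?g \<otimes> ?h) (actq k x) * csc (p <#> q) k x)
     = ker (r (q <#> k)) (?h \<otimes> ?k) x * csc p (q <#> k) x"
    unfolding E1[symmetric] E2[symmetric] by simp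
  have 2: "c ?g (?h \<otimes> ?k) * c ?h ?k = c (?g \<otimes> ?h) ?k * c ?g ?h" by (rule c_assoc[OF gc hc kc])
  have "csc (p <#> q) k x * csc p q (actq k x) = csc p (q <#> k) x * csc q k x"
  proof -
    have "csc p (q <#> k) x * csc q k x
      = c ?h ?k * (ker (r (q <#> k)) (?h \<otimes> ?k) x * csc p (q <#> k) x)"
      by (simp add: csc_def[of q k] mult_ac)
    also have "\<dots> = c ?h ?k * (c ?g (?h \<otimes> ?k) * inverse (c (?g \<otimes> ?h) ?k) * (ker (r (p <#> q)) (?g \<otimes> ?h) (actq k x) * csc (p <#> q) k x))"
      by (simp only: 1)
    also have "\<dots> = (c ?g (?h \<otimes> ?k) * c ?h ?k) * inverse (c (?g \<otimes> ?h) ?k) * (ker (r (p <#> q)) (?g \<otimes> ?h) (actq k x) * csc (p <#> q) k x)"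
      by (simp add: mult_ac)
    also have "\<dots> = c ?g ?h * (ker (r (p <#> q)) (?g \<otimes> ?h) (actq k x) * csc (p <#> q) k x)"
      unfolding 2 using gc hc kc c_nonzero by simp
    also have "\<dots> = csc (p <#> q) k x * csc p q (actq k x)"
      by (simp add: csc_def[of p q] mult_ac)
    finally show ?thesis ..
  qed
  then show "csc p (q \<otimes>\<^bsub>G Mod S\<^esub> k) x * csc q k x = csc (p \<otimes>\<^bsub>G Mod S\<^esub> q) k x * csc p q (actq k x)"
    by simp
next
  fix x assume x: "x \<in> T"
  have "S \<in> carrier (G Mod S)" using Q.one_closed by simp
  then show "actq \<one>\<^bsub>G Mod S\<^esub> x = x"
    using act_coset[OF one_closed rep_closed _ x, of S] act_one[OF x]
    by (simp add: rep_coset subset)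
next
  show "T \<noteq> {}" by (rule H.twisted_chars_nonempty)
qed

sublocale Gp: twisted_action G "{()}" "\<lambda>_ x. x" "\<lambda>p q _. c p q"
  by unfold_locales (auto simp: c_norm c_assoc)

end

section \<open>The transform\<close>

declare [[simproc del: unit_eq]]

context cocycle_pair
begin

abbreviation Cc where "Cc \<equiv> Cc_group (carrier G)"
abbreviation \<kappa> where "\<kappa> g \<equiv> S #> g"
abbreviation supp :: "('a \<Rightarrow> complex) \<Rightarrow> 'a set" where "supp f \<equiv> {g. f g \<noteq> 0}"

lemma CcD: assumes "f \<in> Cc" shows "finite (supp f)" "supp f \<subseteq> carrier G" "f g \<noteq> 0 \<Longrightarrow> g \<in> carrier G"
  using assms by (auto simp: Cc_group_def)

section \<open>The twisted group algebra as a crossed product over one point\<close>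

definition unit_coeff :: "('a \<Rightarrow> complex) \<Rightarrow> 'a \<Rightarrow> unit \<Rightarrow> complex" where
  "unit_coeff f = (\<lambda>g _. f g)"

lemma unit_coeff_coeffs: assumes "f \<in> Cc" shows "unit_coeff f \<in> Gp.coeffs"
  by (rule Gp.coeffsI[of "supp f" _ "\<lambda>g. cmod (f g)"])
    (use CcD[OF assms] unit_eq in \<open>auto simp: unit_coeff_def\<close>)

lemma twisted_conv_reg:
  assumes "f \<in> Cc" shows "twisted_conv G c f \<xi> = Gp.reg () (unit_coeff f) \<xi>"
proof
  fix k
  have "{g \<in> carrier G. f g \<noteq> 0} = {p. unit_coeff f p \<noteq> (\<lambda>_. 0)}"
    using CcD(3)[OF assms] by (auto simp: unit_coeff_def fun_eq_iff)
  then show "twisted_conv G c f \<xi> k = Gp.reg () (unit_coeff f) \<xi> k"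
    unfolding twisted_conv_def Gp.reg_def by (simp add: unit_coeff_def mult_ac)
qed

lemma twisted_conv_eq:
  assumes "f \<in> Cc"
  shows "twisted_conv G c f \<xi> k = (if k \<in> carrier G then
    \<Sum>g\<in>supp f. f g * \<xi> (inv g \<otimes> k) * c g (inv g \<otimes> k) else 0)"
proof -
  have "{g \<in> carrier G. f g \<noteq> 0} = supp f"
    using CcD(3)[OF assms] by auto
  then show ?thesis by (simp add: twisted_conv_def)
qed

lemma twisted_conv_Cc: "f \<in> Cc \<Longrightarrow> h \<in> Cc \<Longrightarrow> twisted_conv G c f h \<in> Cc"
  by (simp add: twisted_conv_reg unit_coeff_coeffs Gp.reg_Cc)

lemma unit_coeff_conv:
  assumes "f \<in> Cc"
  shows "unit_coeff (twisted_conv G c f h) = Gp.conv (unit_coeff f) (unit_coeff h)"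
proof (intro ext)
  fix g and x :: unit
  have "x = ()" by (rule unit_eq)
  then show "unit_coeff (twisted_conv G c f h) g x = Gp.conv (unit_coeff f) (unit_coeff h) g x"
    unfolding unit_coeff_def[of "twisted_conv G c f h"]
    by (simp add: twisted_conv_reg[OF assms] Gp.conv_def unit_coeff_def[of h])
qed

lemma unit_coeff_star: "unit_coeff (twisted_star G c f) = Gp.adj (unit_coeff f)"
proof (intro ext)
  fix g and x :: unit
  have "x = ()" by (rule unit_eq)
  then show "unit_coeff (twisted_star G c f) g x = Gp.adj (unit_coeff f) g x"
    by (simp add: unit_coeff_def Gp.adj_def twisted_star_def c_one mult.commute)
qed

lemma twisted_star_Cc:
  assumes "f \<in> Cc" shows "twisted_star G c f \<in> Cc"
proof (rule Cc_groupI[of "(\<lambda>g. inv g) ` supp f"])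
  fix g assume "twisted_star G c f g \<noteq> 0"
  then have "g = inv (inv g)" "inv g \<in> supp f" by (auto simp: twisted_star_def split: if_splits)
  then show "g \<in> (\<lambda>g. inv g) ` supp f" by blast
qed (use CcD[OF assms] in auto)

lemma twisted_conv_assoc:
  assumes "f \<in> Cc" "h \<in> Cc" "a \<in> Cc"
  shows "twisted_conv G c (twisted_conv G c f h) a = twisted_conv G c f (twisted_conv G c h a)"
  using assms by (simp add: twisted_conv_reg[OF twisted_conv_Cc] unit_coeff_conv
      Gp.reg_conv unit_coeff_coeffs flip: twisted_conv_reg)

lemma Cc_add: "f \<in> Cc \<Longrightarrow> h \<in> Cc \<Longrightarrow> (\<lambda>g. f g + h g) \<in> Cc"
  by (rule Cc_groupI[of "supp f \<union> supp h"]) (auto simp: Cc_group_def)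

lemma Cc_scale: "f \<in> Cc \<Longrightarrow> (\<lambda>g. z * f g) \<in> Cc"
  by (rule Cc_groupI[of "supp f"]) (auto simp: Cc_group_def)

lemma Cc_diff: "f \<in> Cc \<Longrightarrow> h \<in> Cc \<Longrightarrow> (\<lambda>g. f g - h g) \<in> Cc"
  using Cc_add[OF _ Cc_scale[of h "-1"], of f] by simp

abbreviation gnorm :: "('a \<Rightarrow> complex) \<Rightarrow> real" where "gnorm \<equiv> alg_norm (group_algebra G c)"

lemma gnorm_eq:
  assumes "f \<in> Cc" shows "gnorm f = Gp.nrm (unit_coeff f)"
proof -
  have "twisted_conv G c f = Gp.reg () (unit_coeff f)" by (rule ext) (rule twisted_conv_reg[OF assms])
  then show ?thesis by (simp add: group_algebra_def Gp.nrm_def)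
qed

lemma group_algebra_simps:
  "carrier (group_algebra G c) = Cc" "alg_mult (group_algebra G c) = twisted_conv G c"
  "alg_star (group_algebra G c) = twisted_star G c"
  by (simp_all add: group_algebra_def)

sublocale GA: seminormed_star_algebra "group_algebra G c"
proof
  fix f f' h h' :: "'a \<Rightarrow> complex" and z :: complex
  assume f: "f \<in> carrier (group_algebra G c)"
  then have f: "f \<in> Cc" by (simp add: group_algebra_simps)
  show "(\<lambda>i. z * f i) \<in> carrier (group_algebra G c)"
    using f by (simp add: group_algebra_simps Cc_scale)
  show "alg_star (group_algebra G c) f \<in> carrier (group_algebra G c)"
    using f by (simp add: group_algebra_simps twisted_star_Cc)
  show "gnorm (\<lambda>i. z * f i) = cmod z * gnorm f"
    using f Gp.nrm_scale[OF unit_coeff_coeffs[OF f], of z]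
    by (simp add: gnorm_eq Cc_scale unit_coeff_def)
  show "gnorm (alg_star (group_algebra G c) f) = gnorm f"
    using f by (simp add: group_algebra_simps gnorm_eq twisted_star_Cc unit_coeff_star Gp.nrm_adj unit_coeff_coeffs)
  {
    assume "h \<in> carrier (group_algebra G c)"
    then have h: "h \<in> Cc" by (simp add: group_algebra_simps)
    show "(\<lambda>i. f i + h i) \<in> carrier (group_algebra G c)"
      using f h by (simp add: group_algebra_simps Cc_add)
    show "alg_mult (group_algebra G c) f h \<in> carrier (group_algebra G c)"
      using f h by (simp add: group_algebra_simps twisted_conv_Cc)
    show "gnorm (\<lambda>i. f i + h i) \<le> gnorm f + gnorm h"
      using Gp.nrm_triangle[OF unit_coeff_coeffs[OF f] unit_coeff_coeffs[OF h]] f h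
      by (simp add: gnorm_eq Cc_add unit_coeff_def)
    show "gnorm (alg_mult (group_algebra G c) f h) \<le> gnorm f * gnorm h"
      using Gp.nrm_conv[OF unit_coeff_coeffs[OF f] unit_coeff_coeffs[OF h]] f h
      by (simp add: group_algebra_simps gnorm_eq twisted_conv_Cc unit_coeff_conv)
    {
      assume "h' \<in> carrier (group_algebra G c)"
      show "alg_mult (group_algebra G c) f (\<lambda>i. h i - h' i)
        = (\<lambda>i. alg_mult (group_algebra G c) f h i - alg_mult (group_algebra G c) f h' i)"
        using f by (simp add: group_algebra_simps twisted_conv_reg Gp.reg_diff_right)
    }
  }
  {
    assume "f' \<in> carrier (group_algebra G c)"
    then have f': "f' \<in> Cc" by (simp add: group_algebra_simps)
    show "alg_star (group_algebra G c) (\<lambda>i. f i - f' i)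
      = (\<lambda>i. alg_star (group_algebra G c) f i - alg_star (group_algebra G c) f' i)"
      by (auto simp: group_algebra_simps twisted_star_def left_diff_distrib)
    show "alg_mult (group_algebra G c) (\<lambda>i. f i - f' i) h
      = (\<lambda>i. alg_mult (group_algebra G c) f h i - alg_mult (group_algebra G c) f' h i)"
      using Gp.reg_diff[OF unit_coeff_coeffs[OF f] unit_coeff_coeffs[OF f'], of "()" h] f f'
      by (simp add: group_algebra_simps twisted_conv_reg Cc_diff unit_coeff_def)
  }
qed (auto simp: group_algebra_def Cc_group_def)

section \<open>Algebraic properties of the transform\<close>

definition tr :: "('a \<Rightarrow> complex) \<Rightarrow> 'a set \<Rightarrow> ('a \<Rightarrow> complex) \<Rightarrow> complex" where
  "tr f q \<psi> = (if q \<in> carrier (G Mod S) \<and> \<psi> \<in> T then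
     \<Sum>g | f g \<noteq> 0 \<and> g \<in> q. f g * ker (r q) g \<psi> else 0)"

lemma tr_eq:
  assumes "finite J" "supp f \<subseteq> J" "q \<in> carrier (G Mod S)" "\<psi> \<in> T"
  shows "tr f q \<psi> = (\<Sum>g\<in>J. if g \<in> q then f g * ker (r q) g \<psi> else 0)"
proof -
  have "(\<Sum>g\<in>J. if g \<in> q then f g * ker (r q) g \<psi> else 0) =
    (\<Sum>g | f g \<noteq> 0 \<and> g \<in> q. if g \<in> q then f g * ker (r q) g \<psi> else 0)"
    using assms by (intro sum.mono_neutral_right) auto
  then show ?thesis using assms by (simp add: tr_def)
qed

lemma tr_nonzeroD:
  assumes f: "f \<in> Cc" and nz: "tr f q \<psi> \<noteq> 0"
  shows "q \<in> \<kappa> ` supp f" "\<psi> \<in> T"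
proof -
  have q: "q \<in> carrier (G Mod S)" "\<psi> \<in> T" using nz by (auto simp: tr_def split: if_splits)
  have "\<exists>g. f g \<noteq> 0 \<and> g \<in> q"
  proof (rule ccontr)
    assume "\<not> ?thesis"
    then have "{g. f g \<noteq> 0 \<and> g \<in> q} = {}" by blast
    then have "tr f q \<psi> = 0" by (simp only: tr_def sum.empty if_cancel)
    then show False using nz by simp
  qed
  then show "q \<in> \<kappa> ` supp f" using mem_coset[OF q(1)] by auto
  show "\<psi> \<in> T" by (rule q(2))
qed

lemma tr_bound:
  assumes f: "f \<in> Cc"
  shows "cmod (tr f q \<psi>) \<le> (\<Sum>g\<in>supp f. cmod (f g))"
proof (cases "q \<in> carrier (G Mod S) \<and> \<psi> \<in> T")
  case True
  then have "cmod (tr f q \<psi>) \<le> (\<Sum>g\<in>supp f. cmod (f g))"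
    using CcD[OF f] by (subst tr_eq[OF CcD(1)[OF f] order_refl])
      (auto intro!: sum_norm_le simp: norm_mult ker_norm rep_closed rep_coset mem_coset)
  then show ?thesis .
next
  case False
  then have "tr f q \<psi> = 0" by (auto simp: tr_def)
  then show ?thesis by (simp add: sum_nonneg)
qed

lemma tr_coeffs: assumes f: "f \<in> Cc" shows "tr f \<in> Tw.coeffs"
  by (rule Tw.coeffsI[of "\<kappa> ` supp f" _ "\<lambda>_. \<Sum>g\<in>supp f. cmod (f g)"])
    (use CcD[OF f] tr_nonzeroD[OF f] tr_bound[OF f] coset_closed in auto)

lemma tr_add:
  assumes "f \<in> Cc" "h \<in> Cc"
  shows "tr (\<lambda>g. f g + h g) q \<psi> = tr f q \<psi> + tr h q \<psi>"
proof (cases "q \<in> carrier (G Mod S) \<and> \<psi> \<in> T")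
  case True
  have J: "finite (supp f \<union> supp h)" using CcD assms by auto
  show ?thesis
    using True by (subst (1 2 3) tr_eq[OF J]) (auto simp: sum.distrib[symmetric] distrib_right intro!: sum.cong)
qed (auto simp: tr_def)

lemma tr_scale:
  assumes "f \<in> Cc"
  shows "tr (\<lambda>g. z * f g) q \<psi> = z * tr f q \<psi>"
proof (cases "q \<in> carrier (G Mod S) \<and> \<psi> \<in> T")
  case True
  show ?thesis
    using True by (subst (1 2) tr_eq[OF CcD(1)[OF assms]]) (auto simp: sum_distrib_left intro!: sum.cong)
qed (auto simp: tr_def)

lemma inv_coset: "g \<in> carrier G \<Longrightarrow> inv\<^bsub>G Mod S\<^esub> (\<kappa> g) = \<kappa> (inv g)"
  using inv_FactGroup[OF coset_closed] rcos_inv by simp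

text \<open>Taking slices at \<psi> intertwines left convolution by f with the fibre representation
  at \<psi>. Besides multiplicativity this yields the comparison of norms, as the slices of all a
  exhaust the finitely supported vectors on G/S.\<close>

lemma tr_conv:
  assumes f: "f \<in> Cc" and a: "a \<in> Cc" and \<psi>: "\<psi> \<in> T"
  shows "(\<lambda>q. tr (twisted_conv G c f a) q \<psi>) = Tw.reg \<psi> (tr f) (\<lambda>q. tr a q \<psi>)"
proof
  fix q
  let ?J = "(\<lambda>(g, h). g \<otimes> h) ` (supp f \<times> supp a)"
  show "tr (twisted_conv G c f a) q \<psi> = Tw.reg \<psi> (tr f) (\<lambda>q. tr a q \<psi>) q"
  proof (cases "q \<in> carrier (G Mod S)")
    case False then show ?thesis by (simp add: tr_def Tw.reg_def)
  next
    case q: True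
    note Sf = CcD[OF f] and Sa = CcD[OF a]
    have J: "finite ?J" "?J \<subseteq> carrier G" using Sf Sa by auto
    have suppJ: "supp (twisted_conv G c f a) \<subseteq> ?J"
    proof
      fix k assume "k \<in> supp (twisted_conv G c f a)"
      then have "Gp.reg () (unit_coeff f) a k \<noteq> 0" by (simp add: twisted_conv_reg f)
      from Gp.reg_supp[OF unit_coeff_coeffs[OF f] this] show "k \<in> ?J"
        by (auto simp: unit_coeff_def fun_eq_iff)
    qed
    define w where "w g h = (if g \<otimes> h \<in> q then f g * a h * (c g h * ker (r q) (g \<otimes> h) \<psi>) else 0)" for g h
    have "tr (twisted_conv G c f a) q \<psi> = (\<Sum>k\<in>?J. \<Sum>g\<in>supp f.
        (if k \<in> q then f g * a (inv g \<otimes> k) * (c g (inv g \<otimes> k) * ker (r q) k \<psi>) else 0))"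
      unfolding tr_eq[OF J(1) suppJ q \<psi>]
    proof (rule sum.cong)
      fix k assume "k \<in> ?J"
      then have "k \<in> carrier G" using J by blast
      then show "(if k \<in> q then twisted_conv G c f a k * ker (r q) k \<psi> else 0) = (\<Sum>g\<in>supp f.
        (if k \<in> q then f g * a (inv g \<otimes> k) * (c g (inv g \<otimes> k) * ker (r q) k \<psi>) else 0))"
        by (simp add: twisted_conv_eq f sum_distrib_right mult.assoc)
    qed simp
    also have "\<dots> = (\<Sum>g\<in>supp f. \<Sum>k\<in>?J.
        (if k \<in> q then f g * a (inv g \<otimes> k) * (c g (inv g \<otimes> k) * ker (r q) k \<psi>) else 0))"
      by (rule sum.swap)
    also have "\<dots> = (\<Sum>g\<in>supp f. \<Sum>h\<in>supp a. w g h)"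
    proof (rule sum.cong)
      fix g assume g: "g \<in> supp f"
      show "(\<Sum>k\<in>?J. (if k \<in> q then f g * a (inv g \<otimes> k) * (c g (inv g \<otimes> k) * ker (r q) k \<psi>) else 0))
        = (\<Sum>h\<in>supp a. w g h)"
        unfolding w_def
        by (rule sum_shift[of g _ _ "\<lambda>h k. if k \<in> q then f g * a h * (c g h * ker (r q) k \<psi>) else 0"])
          (use g Sf Sa J in auto)
    qed simp
    \<comment> \<open>The support of f is grouped by cosets. For g in the coset p, the product g h
      lies in q exactly when h lies in the coset p^-1 q, and \<open>ker_mult\<close> splits the
      kernel accordingly.\<close>
    also have "\<dots> = (\<Sum>p\<in>\<kappa> ` supp f. \<Sum>g\<in>{g\<in>supp f. \<kappa> g = p}. \<Sum>h\<in>supp a. w g h)"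
      by (rule sum.image_gen[OF Sf(1)])
    also have "\<dots> = (\<Sum>p\<in>\<kappa> ` supp f. tr f p (actq (inv\<^bsub>G Mod S\<^esub> p \<otimes>\<^bsub>G Mod S\<^esub> q) \<psi>)
      * csc p (inv\<^bsub>G Mod S\<^esub> p \<otimes>\<^bsub>G Mod S\<^esub> q) \<psi> * tr a (inv\<^bsub>G Mod S\<^esub> p \<otimes>\<^bsub>G Mod S\<^esub> q) \<psi>)"
    proof (rule sum.cong)
      fix p assume "p \<in> \<kappa> ` supp f"
      then have p: "p \<in> carrier (G Mod S)" using Sf coset_closed by auto
      define m where "m = inv\<^bsub>G Mod S\<^esub> p \<otimes>\<^bsub>G Mod S\<^esub> q"
      have m: "m \<in> carrier (G Mod S)" "p <#> m = q"
        using Q.m_closed[OF Q.inv_closed[OF p] q] Q.inv_mult_cancel(2)[OF p q] by (simp_all add: m_def)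
      have \<psi>': "actq m \<psi> \<in> T" by (rule Tw.act_closed[OF m(1) \<psi>])
      have "tr f p (actq m \<psi>) = (\<Sum>g\<in>{g\<in>supp f. \<kappa> g = p}. f g * ker (r p) g (actq m \<psi>))"
        using p \<psi>' Sf(3) by (auto simp: tr_def mem_coset intro!: sum.cong)
      moreover have "tr a m \<psi> = (\<Sum>h\<in>supp a. if h \<in> m then a h * ker (r m) h \<psi> else 0)"
        by (rule tr_eq[OF Sa(1) order_refl m(1) \<psi>])
      ultimately have "tr f p (actq m \<psi>) * csc p m \<psi> * tr a m \<psi>
        = (\<Sum>g\<in>{g\<in>supp f. \<kappa> g = p}. \<Sum>h\<in>supp a. f g * ker (r p) g (actq m \<psi>) * csc p m \<psi> * (if h \<in> m then a h * ker (r m) h \<psi> else 0))"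
        by (simp only: sum_distrib_right) (simp only: sum_distrib_left)
      also have "\<dots> = (\<Sum>g\<in>{g\<in>supp f. \<kappa> g = p}. \<Sum>h\<in>supp a. w g h)"
      proof (intro sum.cong refl)
        fix g h assume g: "g \<in> {g\<in>supp f. \<kappa> g = p}" and h: "h \<in> supp a"
        have gc: "g \<in> carrier G" "\<kappa> g = p" "g \<in> p" and hc: "h \<in> carrier G"
          using g h Sf Sa mem_coset[OF p] by auto
        have "g \<otimes> h \<in> q \<longleftrightarrow> p <#> \<kappa> h = p <#> m"
          using gc hc coset_mult[of g h] m(2) by (simp add: mem_coset[OF q])
        also have "\<dots> \<longleftrightarrow> h \<in> m"
          using Q.Units_l_cancel[OF _ coset_closed[OF hc] m(1), of p] p Q.Units_eq hc by (simp add: mem_coset[OF m(1)])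
        finally have iff: "g \<otimes> h \<in> q \<longleftrightarrow> h \<in> m" .
        show "f g * ker (r p) g (actq m \<psi>) * csc p m \<psi> * (if h \<in> m then a h * ker (r m) h \<psi> else 0) = w g h"
        proof (cases "h \<in> m")
          case True
          from ker_mult[OF p m(1) gc(3) True \<psi>]
          have "c g h * ker (r q) (g \<otimes> h) \<psi> = ker (r p) g (actq m \<psi>) * ker (r m) h \<psi> * csc p m \<psi>"
            by (simp add: m(2))
          then show ?thesis using True iff by (simp add: w_def mult_ac)
        qed (simp add: w_def iff)
      qed
      finally show "(\<Sum>g\<in>{g\<in>supp f. \<kappa> g = p}. \<Sum>h\<in>supp a. w g h) =
        tr f p (actq (inv\<^bsub>G Mod S\<^esub> p \<otimes>\<^bsub>G Mod S\<^esub> q) \<psi>)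
      * csc p (inv\<^bsub>G Mod S\<^esub> p \<otimes>\<^bsub>G Mod S\<^esub> q) \<psi> * tr a (inv\<^bsub>G Mod S\<^esub> p \<otimes>\<^bsub>G Mod S\<^esub> q) \<psi>"
        by (simp add: m_def)
    qed simp
    also have "\<dots> = Tw.reg \<psi> (tr f) (\<lambda>q. tr a q \<psi>) q"
      using q Tw.reg_eq[of "\<kappa> ` supp f" "tr f" \<psi> "\<lambda>q. tr a q \<psi>" q] Sf(1) tr_nonzeroD(1)[OF f] by simp
    finally show ?thesis .
  qed
qed

lemma tr_mult:
  assumes f: "f \<in> Cc" and h: "h \<in> Cc"
  shows "tr (twisted_conv G c f h) = Tw.conv (tr f) (tr h)"
proof (intro ext)
  fix q \<psi>
  show "tr (twisted_conv G c f h) q \<psi> = Tw.conv (tr f) (tr h) q \<psi>"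
  proof (cases "\<psi> \<in> T")
    case True
    then show ?thesis using tr_conv[OF f h True] by (simp add: Tw.conv_def fun_eq_iff)
  qed (simp add: tr_def Tw.conv_def)
qed

text \<open>At the unit coset the defining product is \<delta>(r S)* \<delta>(r S) \<delta>(r S),
  which is \<delta>(r S). The phase by which the cocycle fails to be normalized is therefore the
  value of the chosen representative.\<close>

lemma csc_one_one:
  assumes \<psi>: "\<psi> \<in> T" shows "csc S S \<psi> = cnj (ker (r S) \<one> \<psi>)"
proof -
  have S: "S \<in> carrier (G Mod S)" "S <#> S = S" using Q.one_closed Q.l_one[OF Q.one_closed] by simp_all
  note rS = rep_closed[OF S(1)] rep_coset[OF S(1)]
  have "ker (r S) (r S \<otimes> r S) \<psi> = cnj (c (r S) (r S)) * ker \<one> (r S) \<psi>"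
    using ker_left[OF one_closed rS(1) rS(1), of \<psi>] rS c_one by simp
  then have "csc S S \<psi> = ker \<one> (r S) \<psi>"
    using c_cnj[OF rS(1) rS(1)] by (simp add: csc_def S(2) flip: mult.assoc)
  then show ?thesis
    using ker_commute[OF rS(1) one_closed _ \<psi>] rS subset by simp
qed

lemma tr_star:
  assumes f: "f \<in> Cc"
  shows "tr (twisted_star G c f) = Tw.adj (tr f)"
proof (intro ext)
  fix q \<psi>
  show "tr (twisted_star G c f) q \<psi> = Tw.adj (tr f) q \<psi>"
  proof (cases "q \<in> carrier (G Mod S) \<and> \<psi> \<in> T")
    case False then show ?thesis by (auto simp: tr_def Tw.adj_def)
  next
    case True
    then have q: "q \<in> carrier (G Mod S)" and \<psi>: "\<psi> \<in> T" by auto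
    let ?p = "inv\<^bsub>G Mod S\<^esub> q"
    have p: "?p \<in> carrier (G Mod S)" "?p <#> q = S" using Q.inv_closed[OF q] Q.l_inv[OF q] by simp_all
    have \<psi>': "actq q \<psi> \<in> T" by (rule Tw.act_closed[OF q \<psi>])
    note Sf = CcD[OF f]
    have fin: "finite ((\<lambda>g. inv g) ` supp f)" using Sf by simp
    have inj: "inj_on (\<lambda>g. inv g) (supp f)"
    proof (rule inj_onI)
      fix g h assume "g \<in> supp f" "h \<in> supp f" "inv g = inv h"
      then have "inv (inv g) = inv (inv h)" "g \<in> carrier G" "h \<in> carrier G" using Sf by auto
      then show "g = h" by simp
    qed
    have sub: "supp (twisted_star G c f) \<subseteq> (\<lambda>g. inv g) ` supp f"
    proof
      fix g assume "g \<in> supp (twisted_star G c f)"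
      then have "g = inv (inv g)" "inv g \<in> supp f" by (auto simp: twisted_star_def split: if_splits)
      then show "g \<in> (\<lambda>g. inv g) ` supp f" by blast
    qed
    have "tr (twisted_star G c f) q \<psi> = (\<Sum>h\<in>supp f. if inv h \<in> q then
        cnj (f h) * (cnj (c h (inv h)) * ker (r q) (inv h) \<psi>) else 0)"
      unfolding tr_eq[OF fin sub q \<psi>] sum.reindex[OF inj] o_def
      using Sf by (intro sum.cong) (auto simp: twisted_star_def mult_ac)
    also have "\<dots> = (\<Sum>h\<in>supp f. cnj (csc ?p q \<psi> * csc S S \<psi>) *
        cnj (if h \<in> ?p then f h * ker (r ?p) h (actq q \<psi>) else 0))"
    proof (rule sum.cong)
      fix h assume "h \<in> supp f"
      then have h: "h \<in> carrier G" using Sf by auto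
      have "h \<in> ?p \<longleftrightarrow> \<kappa> h = ?p" using h by (simp add: mem_coset[OF p(1)])
      also have "\<dots> \<longleftrightarrow> inv\<^bsub>G Mod S\<^esub> (\<kappa> h) = q"
        using Q.inv_inv q coset_closed[OF h] by metis
      also have "\<dots> \<longleftrightarrow> inv h \<in> q" using h by (simp add: inv_coset mem_coset[OF q])
      finally have iff: "h \<in> ?p \<longleftrightarrow> inv h \<in> q" .
      show "(if inv h \<in> q then cnj (f h) * (cnj (c h (inv h)) * ker (r q) (inv h) \<psi>) else 0)
        = cnj (csc ?p q \<psi> * csc S S \<psi>) * cnj (if h \<in> ?p then f h * ker (r ?p) h (actq q \<psi>) else 0)"
      proof (cases "h \<in> ?p")
        case True
        let ?a = "ker (r ?p) h (actq q \<psi>)" and ?b = "ker (r q) (inv h) \<psi>" and ?s = "csc ?p q \<psi>"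
        have hq: "inv h \<in> q" using True iff by simp
        \<comment> \<open>This is \<open>ker_mult\<close> for h and its inverse, whose product is
          the identity. All factors are unimodular, so the relation can be solved for the conjugate
          phases demanded by \<open>Tw.adj\<close>.\<close>
        have "c h (inv h) * ker (r S) \<one> \<psi> = ?a * ?b * ?s"
          using ker_mult[OF p(1) q True hq \<psi>] h p(2) by simp
        moreover have "?a * cnj ?a = 1"
          using ker_norm[OF rep_closed[OF p(1)] h _ \<psi>'] True
          by (simp add: complex_norm_square[symmetric] rep_coset[OF p(1)] mem_coset[OF p(1)])
        moreover have "?s * cnj ?s = 1"
          using Tw.cocycle_circle[OF p(1) q \<psi>] by (simp add: complex_norm_square[symmetric])
        moreover have "c h (inv h) * cnj (c h (inv h)) = 1" using c_cnj h by simp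
        moreover have "cnj (csc S S \<psi>) = ker (r S) \<one> \<psi>" by (simp add: csc_one_one[OF \<psi>])
        ultimately have "cnj (c h (inv h)) * ?b = cnj ?s * cnj (csc S S \<psi>) * cnj ?a"
          by algebra
        then show ?thesis using True hq by (simp add: mult_ac)
      qed (simp add: iff)
    qed simp
    also have "\<dots> = Tw.adj (tr f) q \<psi>"
      using q \<psi> by (simp add: Tw.adj_def tr_eq[OF Sf(1) order_refl p(1) \<psi>'] sum_distrib_left)
    finally show ?thesis .
  qed
qed

end

section \<open>The transform is isometric\<close>

context cocycle_pair
begin

abbreviation qnorm where "qnorm \<equiv> l2_norm (carrier (G Mod S))"
abbreviation gnorm2 where "gnorm2 \<equiv> l2_norm (carrier G)"

lemma tr_slice: "a \<in> Cc \<Longrightarrow> (\<lambda>q. tr a q \<psi>) \<in> Cc_group (carrier (G Mod S))"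
  by (rule Tw.coeffs_slice[OF tr_coeffs])

text \<open>In |tr a q \<psi>|^2 the representative cancels: the conjugate of
  \<open>ker (r q) h \<psi>\<close> times \<open>ker (r q) g \<psi>\<close> is
  \<open>ker h g \<psi>\<close> by the chain rule. What remains is a quadratic form in a that does
  not involve r.\<close>

lemma qnorm_tr:
  assumes a: "a \<in> Cc" and \<psi>: "\<psi> \<in> T"
  shows "complex_of_real ((qnorm (\<lambda>q. tr a q \<psi>))\<^sup>2) =
    (\<Sum>g\<in>supp a. \<Sum>h\<in>supp a. if \<kappa> g = \<kappa> h then a g * cnj (a h) * ker h g \<psi> else 0)"
proof -
  note Sa = CcD[OF a]
  let ?w = "\<lambda>g h. if \<kappa> g = \<kappa> h then a g * cnj (a h) * ker h g \<psi> else 0"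
  have "complex_of_real ((qnorm (\<lambda>q. tr a q \<psi>))\<^sup>2) = (\<Sum>q\<in>\<kappa> ` supp a. tr a q \<psi> * cnj (tr a q \<psi>))"
    using Sa coset_closed tr_nonzeroD[OF a] by (intro Tw.n2_square) auto
  also have "\<dots> = (\<Sum>q\<in>\<kappa> ` supp a. \<Sum>g\<in>{g\<in>supp a. \<kappa> g = q}. \<Sum>h\<in>supp a. ?w g h)"
  proof (rule sum.cong)
    fix q assume "q \<in> \<kappa> ` supp a"
    then have q: "q \<in> carrier (G Mod S)" using Sa coset_closed by auto
    have 1: "tr a q \<psi> = (\<Sum>g\<in>{g\<in>supp a. \<kappa> g = q}. a g * ker (r q) g \<psi>)"
      using q \<psi> Sa(3) by (auto simp: tr_def mem_coset intro!: sum.cong)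
    have 2: "tr a q \<psi> = (\<Sum>h\<in>supp a. if \<kappa> h = q then a h * ker (r q) h \<psi> else 0)"
      unfolding tr_eq[OF Sa(1) order_refl q \<psi>] using Sa(3) by (auto simp: mem_coset[OF q] intro!: sum.cong)
    have "tr a q \<psi> * cnj (tr a q \<psi>) = (\<Sum>g\<in>{g\<in>supp a. \<kappa> g = q}. a g * ker (r q) g \<psi>) *
      cnj (\<Sum>h\<in>supp a. if \<kappa> h = q then a h * ker (r q) h \<psi> else 0)"
      using 1 2 by simp
    also have "\<dots> = (\<Sum>g\<in>{g\<in>supp a. \<kappa> g = q}. \<Sum>h\<in>supp a. a g * ker (r q) g \<psi> *
      cnj (if \<kappa> h = q then a h * ker (r q) h \<psi> else 0))"
      by (simp only: cnj_sum sum_product)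
    also have "\<dots> = (\<Sum>g\<in>{g\<in>supp a. \<kappa> g = q}. \<Sum>h\<in>supp a. ?w g h)"
    proof (intro sum.cong refl)
      fix g h assume g: "g \<in> {g\<in>supp a. \<kappa> g = q}" and h: "h \<in> supp a"
      have gc: "g \<in> carrier G" "\<kappa> g = q" and hc: "h \<in> carrier G" using g h Sa by auto
      show "a g * ker (r q) g \<psi> * cnj (if \<kappa> h = q then a h * ker (r q) h \<psi> else 0) = ?w g h"
      proof (cases "\<kappa> h = q")
        case True
        have rq: "r q \<in> carrier G" "\<kappa> (r q) = q" by (simp_all add: rep_closed rep_coset q)
        have "ker h g \<psi> = ker h (r q) \<psi> * ker (r q) g \<psi>"
          by (rule ker_chain[OF hc rq(1) gc(1) _ _ \<psi>, symmetric]) (simp_all add: True rq gc)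
        also have "ker h (r q) \<psi> = cnj (ker (r q) h \<psi>)"
          by (rule ker_commute[OF rq(1) hc _ \<psi>]) (simp add: True rq)
        finally show ?thesis using True gc by (simp add: mult_ac)
      qed (use gc in auto)
    qed
    finally show "tr a q \<psi> * cnj (tr a q \<psi>) = (\<Sum>g\<in>{g\<in>supp a. \<kappa> g = q}. \<Sum>h\<in>supp a. ?w g h)" .
  qed simp
  also have "\<dots> = (\<Sum>g\<in>supp a. \<Sum>h\<in>supp a. ?w g h)"
    by (rule sum.image_gen[OF Sa(1), symmetric])
  finally show ?thesis .
qed

lemma gnorm2_square:
  "a \<in> Cc \<Longrightarrow> complex_of_real ((gnorm2 a)\<^sup>2) = (\<Sum>g\<in>supp a. a g * cnj (a g))"
  using CcD[of a] by (intro Gp.n2_square) auto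

text \<open>By orthogonality of characters the average of the squared fibre norms is the squared norm.\<close>

lemma average_qnorm:
  fixes \<epsilon> :: real
  assumes a: "a \<in> Cc" and xs: "set xs \<subseteq> T"
    and D: "\<And>g h. g \<in> supp a \<Longrightarrow> h \<in> supp a \<Longrightarrow> g \<noteq> h \<Longrightarrow> \<kappa> g = \<kappa> h \<Longrightarrow>
      cmod (\<Sum>\<psi>\<leftarrow>xs. \<psi> (inv h \<otimes> g)) \<le> \<epsilon> * length xs"
    and "\<epsilon> \<ge> 0"
  shows "\<bar>(\<Sum>\<psi>\<leftarrow>xs. (qnorm (\<lambda>q. tr a q \<psi>))\<^sup>2) - length xs * (gnorm2 a)\<^sup>2\<bar>
    \<le> \<epsilon> * length xs * (\<Sum>g\<in>supp a. cmod (a g))\<^sup>2"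
proof -
  note Sa = CcD[OF a]
  have lin: "(\<Sum>\<psi>\<leftarrow>ys. \<Sum>g\<in>A. w \<psi> g) = (\<Sum>g\<in>A. \<Sum>\<psi>\<leftarrow>ys. w \<psi> g)" for ys :: "('a \<Rightarrow> complex) list" and A :: "'a set" and w :: "_ \<Rightarrow> _ \<Rightarrow> complex"
    by (induction ys) (auto simp: sum.distrib)
  define w where "w \<psi> g h = (if \<kappa> g = \<kappa> h then a g * cnj (a h) * ker h g \<psi> else 0)" for \<psi> g h
  \<comment> \<open>The deviation of the averaged form from the identity form. On the diagonal the
    kernel is 1 and the deviation vanishes; off the diagonal only averages of \<psi> at nontrivial
    elements of S occur.\<close>
  define e where "e g h = (\<Sum>\<psi>\<leftarrow>xs. w \<psi> g h) - (if g = h then length xs * (a g * cnj (a g)) else 0)" for g h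
  have "complex_of_real (\<Sum>\<psi>\<leftarrow>xs. (qnorm (\<lambda>q. tr a q \<psi>))\<^sup>2) = (\<Sum>\<psi>\<leftarrow>xs. \<Sum>g\<in>supp a. \<Sum>h\<in>supp a. w \<psi> g h)"
    using xs
  proof (induction xs)
    case (Cons \<psi> xs)
    then show ?case using qnorm_tr[OF a, of \<psi>] by (simp add: w_def)
  qed simp
  also have "\<dots> = (\<Sum>g\<in>supp a. \<Sum>h\<in>supp a. \<Sum>\<psi>\<leftarrow>xs. w \<psi> g h)"
    by (simp add: lin)
  finally have 1: "complex_of_real (\<Sum>\<psi>\<leftarrow>xs. (qnorm (\<lambda>q. tr a q \<psi>))\<^sup>2) = (\<Sum>g\<in>supp a. \<Sum>h\<in>supp a. \<Sum>\<psi>\<leftarrow>xs. w \<psi> g h)" .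
  have 2: "complex_of_real (length xs * (gnorm2 a)\<^sup>2) = (\<Sum>g\<in>supp a. \<Sum>h\<in>supp a. if g = h then length xs * (a g * cnj (a g)) else 0)"
    using gnorm2_square[OF a] Sa(1) by (simp add: sum_distrib_left)
  have "complex_of_real ((\<Sum>\<psi>\<leftarrow>xs. (qnorm (\<lambda>q. tr a q \<psi>))\<^sup>2) - length xs * (gnorm2 a)\<^sup>2)
    = (\<Sum>g\<in>supp a. \<Sum>h\<in>supp a. e g h)"
    unfolding of_real_diff 1 2 e_def by (simp only: sum_subtractf)
  then have "\<bar>(\<Sum>\<psi>\<leftarrow>xs. (qnorm (\<lambda>q. tr a q \<psi>))\<^sup>2) - length xs * (gnorm2 a)\<^sup>2\<bar>
    = cmod (\<Sum>g\<in>supp a. \<Sum>h\<in>supp a. e g h)"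
    by (metis norm_of_real real_norm_def)
  also have "\<dots> \<le> (\<Sum>g\<in>supp a. \<Sum>h\<in>supp a. \<epsilon> * length xs * (cmod (a g) * cmod (a h)))"
  proof (intro sum_norm_le)
    fix g h assume g: "g \<in> supp a" and h: "h \<in> supp a"
    have gc: "g \<in> carrier G" and hc: "h \<in> carrier G" using g h Sa by auto
    show "cmod (e g h) \<le> \<epsilon> * length xs * (cmod (a g) * cmod (a h))"
    proof (cases "g = h")
      case True
      have "(\<Sum>\<psi>\<leftarrow>xs. w \<psi> g g) = length xs * (a g * cnj (a g))"
        using xs
      proof (induction xs)
        case (Cons \<psi> xs)
        then show ?case by (simp add: w_def ker_self gc algebra_simps)
      qed simp
      then show ?thesis using True assms(4) by (simp add: e_def)
    next
      case False
      show ?thesis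
      proof (cases "\<kappa> g = \<kappa> h")
        case eq: True
        define k where "k = inv h \<otimes> g"
        have "(\<Sum>\<psi>\<leftarrow>xs. w \<psi> g h) = a g * cnj (a h) * cnj (c h k) * (\<Sum>\<psi>\<leftarrow>xs. \<psi> k)"
          unfolding w_def using eq
          by (simp add: ker_def k_def sum_list_const_mult[symmetric] mult_ac)
        then have "cmod (e g h) = cmod (a g) * cmod (a h) * cmod (\<Sum>\<psi>\<leftarrow>xs. \<psi> k)"
          using False gc hc by (simp add: e_def norm_mult c_norm k_def)
        also have "\<dots> \<le> cmod (a g) * cmod (a h) * (\<epsilon> * length xs)"
          unfolding k_def by (intro mult_left_mono D g h False eq) auto
        finally show ?thesis by (simp add: mult_ac)
      next
        case ne: False
        then have "(\<Sum>\<psi>\<leftarrow>xs. w \<psi> g h) = 0" by (induction xs) (auto simp: w_def)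
        then show ?thesis using False assms(4) by (simp add: e_def)
      qed
    qed
  qed
  also have "\<dots> = \<epsilon> * length xs * (\<Sum>g\<in>supp a. cmod (a g))\<^sup>2"
    by (simp only: power2_eq_square sum_product) (simp only: sum_distrib_left)
  finally show ?thesis .
qed

text \<open>The fibrewise inequalities are averaged over characters that are nearly orthogonal on
  the finitely many nontrivial quotients D of the two supports. The error is linear in \<epsilon>,
  with constants that depend on f, a and M alone.\<close>

lemma gnorm2_bound_if:
  assumes f: "f \<in> Cc" and a: "a \<in> Cc" and M: "0 \<le> M"
    and le: "\<And>\<psi>. \<psi> \<in> T \<Longrightarrow> qnorm (\<lambda>q. tr f q \<psi>) \<le> M * qnorm (\<lambda>q. tr a q \<psi>)"
  shows "gnorm2 f \<le> M * gnorm2 a"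
proof -
  define A B where "A = (\<Sum>g\<in>supp f. cmod (f g))\<^sup>2" and "B = (\<Sum>g\<in>supp a. cmod (a g))\<^sup>2"
  define D where "D = {inv h \<otimes> g | g h. (g \<in> supp f \<union> supp a \<and> h \<in> supp f \<union> supp a) \<and> g \<noteq> h \<and> \<kappa> g = \<kappa> h}"
  have fin: "finite (supp f \<union> supp a)" and sub: "supp f \<union> supp a \<subseteq> carrier G"
    using CcD[OF f] CcD[OF a] by auto
  have D: "finite D" "D \<subseteq> S - {\<one>}"
  proof -
    have "D \<subseteq> (\<lambda>(g, h). inv h \<otimes> g) ` ((supp f \<union> supp a) \<times> (supp f \<union> supp a))"
      unfolding D_def by auto
    then show "finite D" by (rule finite_subset) (intro finite_imageI finite_SigmaI fin)
    show "D \<subseteq> S - {\<one>}"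
    proof
      fix d assume "d \<in> D"
      then obtain g h where gh: "d = inv h \<otimes> g" "g \<in> carrier G" "h \<in> carrier G" "g \<noteq> h" "\<kappa> h = \<kappa> g"
        using sub unfolding D_def by blast
      moreover have "d \<noteq> \<one>"
        using gh(1-4) inv_mult_cancel(2)[of h g] by auto
      ultimately show "d \<in> S - {\<one>}" using coset_eq_iff[OF gh(3,2)] by blast
    qed
  qed
  have est: "(gnorm2 f)\<^sup>2 \<le> M\<^sup>2 * (gnorm2 a)\<^sup>2 + \<epsilon> * (A + M\<^sup>2 * B)" if \<epsilon>: "\<epsilon> > 0" for \<epsilon> :: real
  proof -
    obtain xs where xs: "xs \<noteq> []" "set xs \<subseteq> T" "\<forall>s\<in>D. cmod (\<Sum>\<psi>\<leftarrow>xs. \<psi> s) \<le> \<epsilon> * length xs"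
      using H.averages_vanish[OF D(1) _ \<epsilon>] D(2) by auto
    let ?n = "real (length xs)"
    have n: "?n > 0" using xs(1) by simp
    have 1: "\<bar>(\<Sum>\<psi>\<leftarrow>xs. (qnorm (\<lambda>q. tr f q \<psi>))\<^sup>2) - ?n * (gnorm2 f)\<^sup>2\<bar> \<le> \<epsilon> * ?n * A"
      unfolding A_def using \<epsilon> by (intro average_qnorm f xs(2) xs(3)[rule_format]) (auto simp: D_def)
    have 2: "\<bar>(\<Sum>\<psi>\<leftarrow>xs. (qnorm (\<lambda>q. tr a q \<psi>))\<^sup>2) - ?n * (gnorm2 a)\<^sup>2\<bar> \<le> \<epsilon> * ?n * B"
      unfolding B_def using \<epsilon> by (intro average_qnorm a xs(2) xs(3)[rule_format]) (auto simp: D_def)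
    have "(\<Sum>\<psi>\<leftarrow>xs. (qnorm (\<lambda>q. tr f q \<psi>))\<^sup>2) \<le> (\<Sum>\<psi>\<leftarrow>xs. M\<^sup>2 * (qnorm (\<lambda>q. tr a q \<psi>))\<^sup>2)"
    proof (rule sum_list_mono)
      fix \<psi> assume "\<psi> \<in> set xs"
      then have "(qnorm (\<lambda>q. tr f q \<psi>))\<^sup>2 \<le> (M * qnorm (\<lambda>q. tr a q \<psi>))\<^sup>2"
        using xs(2) by (intro power_mono le l2_norm_nonneg) auto
      then show "(qnorm (\<lambda>q. tr f q \<psi>))\<^sup>2 \<le> M\<^sup>2 * (qnorm (\<lambda>q. tr a q \<psi>))\<^sup>2"
        by (simp add: power_mult_distrib)
    qed
    also have "\<dots> = M\<^sup>2 * (\<Sum>\<psi>\<leftarrow>xs. (qnorm (\<lambda>q. tr a q \<psi>))\<^sup>2)"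
      by (rule sum_list_const_mult)
    also have "\<dots> \<le> M\<^sup>2 * (?n * (gnorm2 a)\<^sup>2 + \<epsilon> * ?n * B)"
      using 2 by (intro mult_left_mono) auto
    finally have "?n * (gnorm2 f)\<^sup>2 \<le> M\<^sup>2 * (?n * (gnorm2 a)\<^sup>2 + \<epsilon> * ?n * B) + \<epsilon> * ?n * A"
      using 1 by linarith
    also have "\<dots> = ?n * (M\<^sup>2 * (gnorm2 a)\<^sup>2 + \<epsilon> * (A + M\<^sup>2 * B))"
      by (simp add: algebra_simps)
    finally show ?thesis using n by simp
  qed
  have "(gnorm2 f)\<^sup>2 \<le> M\<^sup>2 * (gnorm2 a)\<^sup>2"
  proof (rule field_le_epsilon)
    fix e :: real assume e: "e > 0"
    have pos: "A + M\<^sup>2 * B + 1 > 0" by (simp add: A_def B_def add_nonneg_pos)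
    have "e / (A + M\<^sup>2 * B + 1) * (A + M\<^sup>2 * B) \<le> e"
      using e pos by (simp add: field_simps)
    then show "(gnorm2 f)\<^sup>2 \<le> M\<^sup>2 * (gnorm2 a)\<^sup>2 + e"
      using est[of "e / (A + M\<^sup>2 * B + 1)"] e pos by simp
  qed
  then have "(gnorm2 f)\<^sup>2 \<le> (M * gnorm2 a)\<^sup>2" by (simp add: power_mult_distrib)
  then show ?thesis by (rule power2_le_imp_le) (simp add: M l2_norm_nonneg)
qed

text \<open>An approximate eigenvector for \<open>\<psi>\<close> when F is a Folner set.\<close>

definition folner_vec :: "('a \<Rightarrow> complex) \<Rightarrow> 'a set \<Rightarrow> 'a \<Rightarrow> complex" where
  "folner_vec \<psi> F s = (if s \<in> F then cnj (\<psi> s) else 0)"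

lemma folner_vec_Cc: "finite F \<Longrightarrow> F \<subseteq> S \<Longrightarrow> folner_vec \<psi> F \<in> Cc"
  by (rule Cc_groupI[of F]) (auto simp: folner_vec_def S_carrier split: if_splits)

text \<open>Translating the vector by \<delta>(g) yields at k, wherever it does not vanish, the
  conjugate of \<open>ker g k \<psi>\<close>. Multiplying by the conjugate translate for h leaves
  \<open>ker h g \<psi>\<close>, which no longer depends on k.\<close>

lemma folner_term:
  assumes g: "g \<in> carrier G" and h: "h \<in> carrier G" and k: "k \<in> carrier G" and F: "F \<subseteq> S" and \<psi>: "\<psi> \<in> T"
  shows "folner_vec \<psi> F (inv g \<otimes> k) * c g (inv g \<otimes> k) * cnj (folner_vec \<psi> F (inv h \<otimes> k) * c h (inv h \<otimes> k))
    = (if inv g \<otimes> k \<in> F \<and> inv h \<otimes> k \<in> F then ker h g \<psi> else 0)"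
proof (cases "inv g \<otimes> k \<in> F \<and> inv h \<otimes> k \<in> F")
  case True
  then have gk: "\<kappa> g = \<kappa> k" and hk: "\<kappa> h = \<kappa> k" using F coset_eq_iff g h k by auto
  have "ker h g \<psi> = ker h k \<psi> * ker k g \<psi>"
    using gk hk by (intro ker_chain[OF h k g _ _ \<psi>, symmetric]) simp_all
  also have "ker k g \<psi> = cnj (ker g k \<psi>)" by (rule ker_commute[OF g k gk \<psi>])
  finally show ?thesis using True by (simp add: folner_vec_def ker_def mult_ac)
qed (auto simp: folner_vec_def)

text \<open>As the products in \<open>folner_term\<close> are constant in k, the sum over k is a
  count, and k = g s turns it into the overlap of F with a translate of F.\<close>

lemma folner_norm:
  assumes a: "a \<in> Cc" and \<psi>: "\<psi> \<in> T" and F: "finite F" "F \<subseteq> S"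
  shows "complex_of_real ((gnorm2 (twisted_conv G c a (folner_vec \<psi> F)))\<^sup>2) =
    (\<Sum>g\<in>supp a. \<Sum>h\<in>supp a. if \<kappa> g = \<kappa> h
       then a g * cnj (a h) * ker h g \<psi> * card {s\<in>F. (inv h \<otimes> g) \<otimes> s \<in> F} else 0)"
proof -
  note Sa = CcD[OF a]
  let ?b = "folner_vec \<psi> F"
  let ?J = "(\<lambda>(g, s). g \<otimes> s) ` (supp a \<times> F)"
  have FC: "F \<subseteq> carrier G" using F S_carrier by auto
  have J: "finite ?J" "?J \<subseteq> carrier G" using Sa F FC by auto
  have suppJ: "k \<in> ?J" if "twisted_conv G c a ?b k \<noteq> 0" for k
  proof -
    have "Gp.reg () (unit_coeff a) ?b k \<noteq> 0" using that by (simp add: twisted_conv_reg a)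
    from Gp.reg_supp[OF unit_coeff_coeffs[OF a] this] show ?thesis
      by (auto simp: unit_coeff_def fun_eq_iff folner_vec_def split: if_splits)
  qed
  have "complex_of_real ((gnorm2 (twisted_conv G c a ?b))\<^sup>2)
    = (\<Sum>k\<in>?J. twisted_conv G c a ?b k * cnj (twisted_conv G c a ?b k))"
    by (rule Gp.n2_square[OF J suppJ])
  also have "\<dots> = (\<Sum>k\<in>?J. \<Sum>g\<in>supp a. \<Sum>h\<in>supp a. a g * cnj (a h) *
    (if inv g \<otimes> k \<in> F \<and> inv h \<otimes> k \<in> F then ker h g \<psi> else 0))"
  proof (rule sum.cong)
    fix k assume "k \<in> ?J"
    then have k: "k \<in> carrier G" using J by blast
    have "twisted_conv G c a ?b k * cnj (twisted_conv G c a ?b k) =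
      (\<Sum>g\<in>supp a. \<Sum>h\<in>supp a. (a g * ?b (inv g \<otimes> k) * c g (inv g \<otimes> k)) * cnj (a h * ?b (inv h \<otimes> k) * c h (inv h \<otimes> k)))"
      using k by (simp add: twisted_conv_eq[OF a] sum_product)
    also have "\<dots> = (\<Sum>g\<in>supp a. \<Sum>h\<in>supp a. a g * cnj (a h) *
      (if inv g \<otimes> k \<in> F \<and> inv h \<otimes> k \<in> F then ker h g \<psi> else 0))"
    proof (intro sum.cong refl)
      fix g h assume "g \<in> supp a" "h \<in> supp a"
      then have "g \<in> carrier G" "h \<in> carrier G" using Sa by auto
      from folner_term[OF this k F(2) \<psi>, symmetric]
      show "(a g * ?b (inv g \<otimes> k) * c g (inv g \<otimes> k)) * cnj (a h * ?b (inv h \<otimes> k) * c h (inv h \<otimes> k))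
        = a g * cnj (a h) * (if inv g \<otimes> k \<in> F \<and> inv h \<otimes> k \<in> F then ker h g \<psi> else 0)"
        by (simp only:) (simp add: mult_ac)
    qed
    finally show "twisted_conv G c a ?b k * cnj (twisted_conv G c a ?b k) = \<dots>" .
  qed simp
  also have "\<dots> = (\<Sum>g\<in>supp a. \<Sum>k\<in>?J. \<Sum>h\<in>supp a. a g * cnj (a h) *
    (if inv g \<otimes> k \<in> F \<and> inv h \<otimes> k \<in> F then ker h g \<psi> else 0))"
    by (rule sum.swap)
  also have "\<dots> = (\<Sum>g\<in>supp a. \<Sum>h\<in>supp a. \<Sum>k\<in>?J. a g * cnj (a h) *
    (if inv g \<otimes> k \<in> F \<and> inv h \<otimes> k \<in> F then ker h g \<psi> else 0))"
    by (intro sum.cong refl sum.swap)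
  also have "\<dots> = (\<Sum>g\<in>supp a. \<Sum>h\<in>supp a. if \<kappa> g = \<kappa> h
       then a g * cnj (a h) * ker h g \<psi> * card {s\<in>F. (inv h \<otimes> g) \<otimes> s \<in> F} else 0)"
  proof (intro sum.cong refl)
    fix g h assume g: "g \<in> supp a" and h: "h \<in> supp a"
    then have gc: "g \<in> carrier G" and hc: "h \<in> carrier G" using Sa by auto
    have "(\<Sum>k\<in>?J. a g * cnj (a h) * (if inv g \<otimes> k \<in> F \<and> inv h \<otimes> k \<in> F then ker h g \<psi> else 0))
      = a g * cnj (a h) * ker h g \<psi> * card {k\<in>?J. inv g \<otimes> k \<in> F \<and> inv h \<otimes> k \<in> F}"
      using J(1) by (simp add: sum_distrib_left[symmetric] sum.If_cases Int_def)
    moreover have "card {k\<in>?J. inv g \<otimes> k \<in> F \<and> inv h \<otimes> k \<in> F} = card {s\<in>F. (inv h \<otimes> g) \<otimes> s \<in> F}"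
    proof (rule bij_betw_same_card[symmetric])
      show "bij_betw (\<lambda>s. g \<otimes> s) {s\<in>F. (inv h \<otimes> g) \<otimes> s \<in> F} {k\<in>?J. inv g \<otimes> k \<in> F \<and> inv h \<otimes> k \<in> F}"
      proof (rule bij_betwI[where g = "\<lambda>k. inv g \<otimes> k"])
        show "(\<lambda>s. g \<otimes> s) \<in> {s\<in>F. (inv h \<otimes> g) \<otimes> s \<in> F} \<rightarrow> {k\<in>?J. inv g \<otimes> k \<in> F \<and> inv h \<otimes> k \<in> F}"
        proof
          fix s assume s: "s \<in> {s\<in>F. (inv h \<otimes> g) \<otimes> s \<in> F}"
          then have sc: "s \<in> carrier G" using FC by auto
          have "g \<otimes> s \<in> ?J" using g s by (auto intro!: image_eqI[of _ _ "(g, s)"])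
          then show "g \<otimes> s \<in> {k\<in>?J. inv g \<otimes> k \<in> F \<and> inv h \<otimes> k \<in> F}"
            using s sc gc hc by (auto simp: inv_mult_cancel m_assoc)
        qed
        show "(\<lambda>k. inv g \<otimes> k) \<in> {k\<in>?J. inv g \<otimes> k \<in> F \<and> inv h \<otimes> k \<in> F} \<rightarrow> {s\<in>F. (inv h \<otimes> g) \<otimes> s \<in> F}"
        proof
          fix k assume k: "k \<in> {k\<in>?J. inv g \<otimes> k \<in> F \<and> inv h \<otimes> k \<in> F}"
          then have kc: "k \<in> carrier G" using J by blast
          then show "inv g \<otimes> k \<in> {s\<in>F. (inv h \<otimes> g) \<otimes> s \<in> F}"
            using k gc hc by (simp add: inv_mult_cancel m_assoc)
        qed
        show "inv g \<otimes> (g \<otimes> s) = s" if "s \<in> {s\<in>F. (inv h \<otimes> g) \<otimes> s \<in> F}" for s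
          using that FC gc by (auto simp: inv_mult_cancel)
        show "g \<otimes> (inv g \<otimes> k) = k" if "k \<in> {k\<in>?J. inv g \<otimes> k \<in> F \<and> inv h \<otimes> k \<in> F}" for k
          using that J(2) gc by (intro inv_mult_cancel) blast+
      qed
    qed
    moreover have "{s\<in>F. (inv h \<otimes> g) \<otimes> s \<in> F} = {}" if "\<kappa> g \<noteq> \<kappa> h"
    proof (rule ccontr)
      assume "\<not> ?thesis"
      then obtain s where s: "s \<in> S" "(inv h \<otimes> g) \<otimes> s \<in> S" using F by auto
      have "(inv h \<otimes> g) \<otimes> s \<otimes> inv s \<in> S"
        by (rule subgroup.m_closed[OF subgroup_axioms s(2) subgroup.m_inv_closed[OF subgroup_axioms s(1)]])
      then have "inv h \<otimes> g \<in> S" using gc hc S_carrier[OF s(1)] by (simp add: m_assoc)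
      then show False using that coset_eq_iff[OF hc gc] by simp
    qed
    ultimately show "(\<Sum>k\<in>?J. a g * cnj (a h) * (if inv g \<otimes> k \<in> F \<and> inv h \<otimes> k \<in> F then ker h g \<psi> else 0))
      = (if \<kappa> g = \<kappa> h then a g * cnj (a h) * ker h g \<psi> * card {s\<in>F. (inv h \<otimes> g) \<otimes> s \<in> F} else 0)"
      by (cases "\<kappa> g = \<kappa> h") auto
  qed
  finally show ?thesis .
qed

text \<open>The form in \<open>folner_norm\<close> differs from that of \<open>qnorm_tr\<close> by
  the overlap count in place of \<open>card F\<close>; the Folner condition says that the two
  numbers differ by at most \<epsilon> \<open>card F\<close>.\<close>

lemma folner_qnorm:
  fixes \<epsilon> :: real
  assumes a: "a \<in> Cc" and \<psi>: "\<psi> \<in> T" and F: "finite F" "F \<subseteq> S"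
    and D: "\<And>g h. g \<in> supp a \<Longrightarrow> h \<in> supp a \<Longrightarrow> \<kappa> g = \<kappa> h \<Longrightarrow>
      (1 - \<epsilon>) * real (card F) \<le> real (card {s\<in>F. (inv h \<otimes> g) \<otimes> s \<in> F})"
    and \<epsilon>: "\<epsilon> \<ge> 0"
  shows "\<bar>(gnorm2 (twisted_conv G c a (folner_vec \<psi> F)))\<^sup>2 - card F * (qnorm (\<lambda>q. tr a q \<psi>))\<^sup>2\<bar>
    \<le> \<epsilon> * card F * (\<Sum>g\<in>supp a. cmod (a g))\<^sup>2"
proof -
  note Sa = CcD[OF a]
  define e where "e g h = (if \<kappa> g = \<kappa> h then a g * cnj (a h) * ker h g \<psi> * (complex_of_real (real (card {s\<in>F. (inv h \<otimes> g) \<otimes> s \<in> F}) - card F)) else 0)" for g h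
  have "complex_of_real ((gnorm2 (twisted_conv G c a (folner_vec \<psi> F)))\<^sup>2 - card F * (qnorm (\<lambda>q. tr a q \<psi>))\<^sup>2)
    = (\<Sum>g\<in>supp a. \<Sum>h\<in>supp a. e g h)"
    unfolding of_real_diff of_real_mult folner_norm[OF a \<psi> F] qnorm_tr[OF a \<psi>] e_def
    by (simp add: sum_distrib_left sum_subtractf[symmetric])
      (intro sum.cong refl, simp add: algebra_simps)
  then have "\<bar>(gnorm2 (twisted_conv G c a (folner_vec \<psi> F)))\<^sup>2 - card F * (qnorm (\<lambda>q. tr a q \<psi>))\<^sup>2\<bar>
    = cmod (\<Sum>g\<in>supp a. \<Sum>h\<in>supp a. e g h)"
    by (metis norm_of_real real_norm_def)
  also have "\<dots> \<le> (\<Sum>g\<in>supp a. \<Sum>h\<in>supp a. \<epsilon> * card F * (cmod (a g) * cmod (a h)))"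
  proof (intro sum_norm_le)
    fix g h assume g: "g \<in> supp a" and h: "h \<in> supp a"
    have gc: "g \<in> carrier G" and hc: "h \<in> carrier G" using g h Sa by auto
    show "cmod (e g h) \<le> \<epsilon> * card F * (cmod (a g) * cmod (a h))"
    proof (cases "\<kappa> g = \<kappa> h")
      case True
      let ?N = "card {s\<in>F. (inv h \<otimes> g) \<otimes> s \<in> F}"
      have "?N \<le> card F" using F by (intro card_mono) auto
      moreover have "(1 - \<epsilon>) * real (card F) \<le> real ?N" by (rule D[OF g h True])
      ultimately have "\<bar>real ?N - card F\<bar> \<le> \<epsilon> * card F" by (simp add: algebra_simps)
      moreover have "cmod (e g h) = (cmod (a g) * cmod (a h)) * \<bar>real ?N - card F\<bar>"
      proof -
        have "e g h = a g * cnj (a h) * ker h g \<psi> * complex_of_real (real ?N - card F)"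
          using True by (simp add: e_def)
        then show ?thesis
          using ker_norm[OF hc gc True[symmetric] \<psi>]
          by (simp only: norm_mult complex_mod_cnj norm_of_real mult_1_right)
      qed
      ultimately have "cmod (e g h) \<le> (cmod (a g) * cmod (a h)) * (\<epsilon> * card F)"
        by (simp add: mult_left_mono)
      then show ?thesis by (simp add: mult_ac)
    qed (use \<epsilon> in \<open>simp add: e_def\<close>)
  qed
  also have "\<dots> = \<epsilon> * card F * (\<Sum>g\<in>supp a. cmod (a g))\<^sup>2"
    by (simp only: power2_eq_square sum_product) (simp only: sum_distrib_left)
  finally show ?thesis .
qed

text \<open>The hypothesis is tested on b = \<open>folner_vec \<psi> F\<close> and divided by
  \<open>card F\<close>. It ranges over all b because F changes with \<epsilon>, while the error
  constants A and B do not.\<close>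

lemma qnorm_bound_if:
  assumes f: "f \<in> Cc" and a: "a \<in> Cc" and M: "0 \<le> M" and \<psi>: "\<psi> \<in> T"
    and le: "\<And>b. b \<in> Cc \<Longrightarrow> gnorm2 (twisted_conv G c f b) \<le> M * gnorm2 (twisted_conv G c a b)"
  shows "qnorm (\<lambda>q. tr f q \<psi>) \<le> M * qnorm (\<lambda>q. tr a q \<psi>)"
proof -
  define A B where "A = (\<Sum>g\<in>supp f. cmod (f g))\<^sup>2" and "B = (\<Sum>g\<in>supp a. cmod (a g))\<^sup>2"
  define D where "D = {inv h \<otimes> g | g h. (g \<in> supp f \<union> supp a \<and> h \<in> supp f \<union> supp a) \<and> \<kappa> g = \<kappa> h}"
  have fin: "finite (supp f \<union> supp a)" and sub: "supp f \<union> supp a \<subseteq> carrier G"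
    using CcD[OF f] CcD[OF a] by auto
  have D: "finite D" "D \<subseteq> S"
  proof -
    have "D \<subseteq> (\<lambda>(g, h). inv h \<otimes> g) ` ((supp f \<union> supp a) \<times> (supp f \<union> supp a))"
      unfolding D_def by auto
    then show "finite D" by (rule finite_subset) (intro finite_imageI finite_SigmaI fin)
    show "D \<subseteq> S"
    proof
      fix d assume "d \<in> D"
      then obtain g h where gh: "d = inv h \<otimes> g" "g \<in> carrier G" "h \<in> carrier G" "\<kappa> h = \<kappa> g"
        using sub unfolding D_def by blast
      then show "d \<in> S" using coset_eq_iff[OF gh(3,2)] by blast
    qed
  qed
  have est: "(qnorm (\<lambda>q. tr f q \<psi>))\<^sup>2 \<le> M\<^sup>2 * (qnorm (\<lambda>q. tr a q \<psi>))\<^sup>2 + \<epsilon> * (A + M\<^sup>2 * B)" if \<epsilon>: "\<epsilon> > 0" for \<epsilon> :: real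
  proof -
    obtain F where F: "finite F" "F \<noteq> {}" "F \<subseteq> S"
      "\<forall>t\<in>D. (1 - \<epsilon>) * real (card F) \<le> real (card {s\<in>F. t \<otimes> s \<in> F})"
      using H.Folner[OF D(1) _ \<epsilon>] D(2) by auto
    let ?n = "real (card F)" and ?b = "folner_vec \<psi> F"
    have n: "?n > 0" using F by (simp add: card_gt_0_iff)
    have 1: "\<bar>(gnorm2 (twisted_conv G c f ?b))\<^sup>2 - ?n * (qnorm (\<lambda>q. tr f q \<psi>))\<^sup>2\<bar> \<le> \<epsilon> * ?n * A"
      unfolding A_def using \<epsilon> by (intro folner_qnorm f \<psi> F(1,3) F(4)[rule_format]) (auto simp: D_def)
    have 2: "\<bar>(gnorm2 (twisted_conv G c a ?b))\<^sup>2 - ?n * (qnorm (\<lambda>q. tr a q \<psi>))\<^sup>2\<bar> \<le> \<epsilon> * ?n * B"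
      unfolding B_def using \<epsilon> by (intro folner_qnorm a \<psi> F(1,3) F(4)[rule_format]) (auto simp: D_def)
    have "(gnorm2 (twisted_conv G c f ?b))\<^sup>2 \<le> (M * gnorm2 (twisted_conv G c a ?b))\<^sup>2"
      by (intro power_mono le folner_vec_Cc F l2_norm_nonneg)
    also have "\<dots> = M\<^sup>2 * (gnorm2 (twisted_conv G c a ?b))\<^sup>2" by (simp add: power_mult_distrib)
    also have "\<dots> \<le> M\<^sup>2 * (?n * (qnorm (\<lambda>q. tr a q \<psi>))\<^sup>2 + \<epsilon> * ?n * B)"
      using 2 by (intro mult_left_mono) auto
    finally have "?n * (qnorm (\<lambda>q. tr f q \<psi>))\<^sup>2 \<le> M\<^sup>2 * (?n * (qnorm (\<lambda>q. tr a q \<psi>))\<^sup>2 + \<epsilon> * ?n * B) + \<epsilon> * ?n * A"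
      using 1 by linarith
    also have "\<dots> = ?n * (M\<^sup>2 * (qnorm (\<lambda>q. tr a q \<psi>))\<^sup>2 + \<epsilon> * (A + M\<^sup>2 * B))"
      by (simp add: algebra_simps)
    finally show ?thesis using n by simp
  qed
  have "(qnorm (\<lambda>q. tr f q \<psi>))\<^sup>2 \<le> M\<^sup>2 * (qnorm (\<lambda>q. tr a q \<psi>))\<^sup>2"
  proof (rule field_le_epsilon)
    fix e :: real assume e: "e > 0"
    have pos: "A + M\<^sup>2 * B + 1 > 0" by (simp add: A_def B_def add_nonneg_pos)
    have "e / (A + M\<^sup>2 * B + 1) * (A + M\<^sup>2 * B) \<le> e"
      using e pos by (simp add: field_simps)
    then show "(qnorm (\<lambda>q. tr f q \<psi>))\<^sup>2 \<le> M\<^sup>2 * (qnorm (\<lambda>q. tr a q \<psi>))\<^sup>2 + e"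
      using est[of "e / (A + M\<^sup>2 * B + 1)"] e pos by simp
  qed
  then have "(qnorm (\<lambda>q. tr f q \<psi>))\<^sup>2 \<le> (M * qnorm (\<lambda>q. tr a q \<psi>))\<^sup>2" by (simp add: power_mult_distrib)
  then show ?thesis by (rule power2_le_imp_le) (simp add: M l2_norm_nonneg)
qed

lemma gnorm_bound: "f \<in> Cc \<Longrightarrow> a \<in> Cc \<Longrightarrow> gnorm2 (twisted_conv G c f a) \<le> gnorm f * gnorm2 a"
  using Gp.reg_bound[OF unit_coeff_coeffs, of f "()" a] by (simp add: gnorm_eq twisted_conv_reg)

text \<open>Left convolution by f commutes with right convolution by b. The bound by
  \<open>gnorm f\<close> therefore holds for f a b against a b for every b, as
  \<open>qnorm_bound_if\<close> demands.\<close>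

lemma qnorm_bound:
  assumes f: "f \<in> Cc" and a: "a \<in> Cc" and \<psi>: "\<psi> \<in> T"
  shows "qnorm (\<lambda>q. tr (twisted_conv G c f a) q \<psi>) \<le> gnorm f * qnorm (\<lambda>q. tr a q \<psi>)"
proof (rule qnorm_bound_if[OF twisted_conv_Cc[OF f a] a _ \<psi>])
  show "0 \<le> gnorm f" using GA.norm_nonneg f by (simp add: group_algebra_simps)
  show "gnorm2 (twisted_conv G c (twisted_conv G c f a) b) \<le> gnorm f * gnorm2 (twisted_conv G c a b)"
    if "b \<in> Cc" for b
    using f a that by (simp add: twisted_conv_assoc gnorm_bound twisted_conv_Cc)
qed

text \<open>The preimage a lives on the representatives, where \<open>ker (r q) (r q) \<psi>\<close>
  is 1. Bounds for slices thus cover all vectors that enter the fibre norm.\<close>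

lemma tr_slice_surj:
  assumes \<Xi>: "\<Xi> \<in> Cc_group (carrier (G Mod S))" and \<psi>: "\<psi> \<in> T"
  shows "\<exists>a\<in>Cc. (\<lambda>q. tr a q \<psi>) = \<Xi>"
proof
  define a where "a g = (if g \<in> carrier G \<and> r (\<kappa> g) = g then \<Xi> (\<kappa> g) else 0)" for g
  have fin: "finite (r ` {q. \<Xi> q \<noteq> 0})" using Cc_groupD[OF \<Xi>] by simp
  have sub: "q \<in> carrier (G Mod S)" if "\<Xi> q \<noteq> 0" for q using Cc_groupD(2)[OF \<Xi>] that by blast
  show a: "a \<in> Cc"
  proof (rule Cc_groupI[OF fin])
    show "r ` {q. \<Xi> q \<noteq> 0} \<subseteq> carrier G" using sub rep_closed by auto
    fix g assume "a g \<noteq> 0"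
    then have *: "r (\<kappa> g) = g" "\<kappa> g \<in> {q. \<Xi> q \<noteq> 0}" by (auto simp: a_def split: if_splits)
    show "g \<in> r ` {q. \<Xi> q \<noteq> 0}" by (rule image_eqI[where f = r and x = "\<kappa> g"]) (simp_all only: *)
  qed
  show "(\<lambda>q. tr a q \<psi>) = \<Xi>"
  proof
    fix q
    show "tr a q \<psi> = \<Xi> q"
    proof (cases "q \<in> carrier (G Mod S)")
      case False then show ?thesis using sub by (auto simp: tr_def)
    next
      case q: True
      have rq: "r q \<in> carrier G" "\<kappa> (r q) = q" by (simp_all add: rep_closed rep_coset q)
      have "tr a q \<psi> = (\<Sum>g\<in>supp a. if g \<in> q then a g * ker (r q) g \<psi> else 0)"
        by (rule tr_eq[OF CcD(1)[OF a] order_refl q \<psi>])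
      also have "\<dots> = (\<Sum>g\<in>{r q}. a g * ker (r q) g \<psi>)"
      proof (rule sum.mono_neutral_cong)
        fix g assume "g \<in> supp a - {r q}"
        then have "r (\<kappa> g) = g" "g \<noteq> r q" by (auto simp: a_def split: if_splits)
        then have "g \<notin> q" using mem_coset[OF q] by auto
        then show "(if g \<in> q then a g * ker (r q) g \<psi> else 0) = 0" by simp
      next
        fix g assume "g \<in> supp a \<inter> {r q}"
        then show "(if g \<in> q then a g * ker (r q) g \<psi> else 0) = a g * ker (r q) g \<psi>"
          using rep[OF q] by simp
      qed (use CcD[OF a] in auto)
      also have "\<dots> = \<Xi> q" using rq by (simp add: a_def ker_self \<psi>)
      finally show ?thesis .
    qed
  qed
qed

lemma tr_norm:
  assumes f: "f \<in> Cc"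
  shows "Tw.nrm (tr f) = gnorm f"
proof (rule antisym)
  have nn: "0 \<le> gnorm f" using GA.norm_nonneg f by (simp add: group_algebra_simps)
  have "qnorm (Tw.reg \<psi> (tr f) \<Xi>) \<le> gnorm f * qnorm \<Xi>"
    if \<psi>: "\<psi> \<in> T" and \<Xi>: "\<Xi> \<in> Cc_group (carrier (G Mod S))" for \<psi> \<Xi>
  proof -
    obtain a where a: "a \<in> Cc" and eq: "(\<lambda>q. tr a q \<psi>) = \<Xi>" using tr_slice_surj[OF \<Xi> \<psi>] by auto
    show ?thesis using qnorm_bound[OF f a \<psi>] tr_conv[OF f a \<psi>] eq by simp
  qed
  then show "Tw.nrm (tr f) \<le> gnorm f"
    using nn by (simp add: Tw.nrm_le_iff tr_coeffs f)
  have nn': "0 \<le> Tw.nrm (tr f)" by (rule Tw.nrm_nonneg[OF tr_coeffs[OF f]])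
  have "gnorm2 (twisted_conv G c f a) \<le> Tw.nrm (tr f) * gnorm2 a" if a: "a \<in> Cc" for a
  proof (rule gnorm2_bound_if[OF twisted_conv_Cc[OF f a] a nn'])
    show "qnorm (\<lambda>q. tr (twisted_conv G c f a) q \<psi>) \<le> Tw.nrm (tr f) * qnorm (\<lambda>q. tr a q \<psi>)"
      if \<psi>: "\<psi> \<in> T" for \<psi>
      using Tw.reg_bound[OF tr_coeffs[OF f] \<psi> tr_slice[OF a]] tr_conv[OF f a \<psi>] by simp
  qed
  then show "gnorm f \<le> Tw.nrm (tr f)"
    using nn' f by (simp add: gnorm_eq Gp.nrm_le_iff unit_coeff_coeffs twisted_conv_reg)
qed

end

lemma (in seminormed_star_algebra) completion_norm_scale:
  assumes "P \<in> carrier C"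
  shows "alg_norm C (alg_scale C z P) = cmod z * alg_norm C P"
proof -
  obtain X where X: "X \<in> alg_Cauchy A" "P = cls X" using assms by (auto simp: carrier_completion)
  have "(\<lambda>n. N (\<lambda>i. z * X n i)) \<longlonglongrightarrow> cmod z * alg_norm C P"
    unfolding X(2) using norm_scale[OF Cauchy_closed[OF X(1)]]
    by (simp only:) (intro tendsto_intros norm_cls X)
  then show ?thesis
    using LIMSEQ_unique[OF norm_cls[OF Cauchy_scale[OF X(1)]]] X by (simp add: scale_cls)
qed

text \<open>The fibre representation sends the point mass at the identity to a vector whose
  coordinate at q is F q x up to a phase. Consequently evaluation of the transform at a point is
  contractive.\<close>

lemma (in twisted_action) coeff_le_nrm:
  assumes F: "F \<in> coeffs" shows "cmod (F q x) \<le> nrm F"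
proof (cases "F q x = 0")
  case True then show ?thesis using nrm_nonneg[OF F] by simp
next
  case False
  then have q: "q \<in> carrier Q" and x: "x \<in> X" using F by (auto simp: coeffs_def)
  define \<xi> :: "'q \<Rightarrow> complex" where "\<xi> p = (if p = \<one> then 1 else 0)" for p
  have \<xi>: "\<xi> \<in> Cc_group (carrier Q)" by (rule Cc_groupI[of "{\<one>}"]) (auto simp: \<xi>_def split: if_splits)
  have "n2 \<xi> = L2_set (\<lambda>i. cmod (\<xi> i)) {\<one>}"
    by (rule l2_norm_finite) (auto simp: \<xi>_def split: if_splits)
  then have n: "n2 \<xi> = 1" by (simp add: \<xi>_def)
  have "reg x F \<xi> q = (\<Sum>p\<in>{p. F p \<noteq> (\<lambda>_. 0)}. if p = q then F q x * \<sigma> q \<one> x else 0)"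
  proof -
    have "inv p \<otimes> q = \<one> \<longleftrightarrow> p = q" if "F p \<noteq> (\<lambda>_. 0)" for p
    proof -
      have p: "p \<in> carrier Q" using coeffs_nonzeroD(1)[OF F that] .
      then show ?thesis using q inv_mult_cancel(2)[OF p q] by (metis l_inv r_one)
    qed
    then show ?thesis using q x by (auto simp: reg_def \<xi>_def act_one intro!: sum.cong)
  qed
  also have "\<dots> = F q x * \<sigma> q \<one> x"
    using False coeffs_supp[OF F] by (auto simp: sum.delta)
  finally have "cmod (F q x) = cmod (reg x F \<xi> q)"
    using q x by (simp add: norm_mult cocycle_circle)
  also have "\<dots> \<le> n2 (reg x F \<xi>)"
    using L2_set_le_l2_norm[OF Cc_group_l2[OF reg_Cc[OF F \<xi>]], of "{q}" x] q by simp
  also have "\<dots> \<le> nrm F" using reg_bound[OF F x \<xi>] n by simp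
  finally show ?thesis .
qed

section \<open>Characters of the commutative subalgebra\<close>

context cocycle_pair
begin

abbreviation CcS where "CcS \<equiv> Cc_group S"
abbreviation emb where "emb \<equiv> completion_emb (group_algebra G c)"
abbreviation BS where "BS \<equiv> carrier (Cr_subgroup G c S)"
abbreviation Sp where "Sp \<equiv> characters (Cr_subgroup G c S)"

lemma CcS_Cc: "f \<in> CcS \<Longrightarrow> f \<in> Cc"
  using subset by (auto simp: Cc_group_def)

lemma CcS_carrier: "CcS \<subseteq> carrier (group_algebra G c)"
  using CcS_Cc by (auto simp: group_algebra_simps)

lemma Cr_subgroup_simps:
  "alg_add (Cr_subgroup G c S) = alg_add GA.C" "alg_scale (Cr_subgroup G c S) = alg_scale GA.C"
  "alg_mult (Cr_subgroup G c S) = alg_mult GA.C" "alg_star (Cr_subgroup G c S) = alg_star GA.C"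
  "alg_norm (Cr_subgroup G c S) = alg_norm GA.C"
  by (simp_all add: Cr_subgroup_def Cr_group_def)

lemma BS_eq_closure: "BS = norm_closure GA.C (emb ` CcS)"
  by (simp add: Cr_subgroup_def Cr_group_def)

lemma BS_eq: "BS = GA.cls ` {X \<in> alg_Cauchy (group_algebra G c). \<forall>n. X n \<in> CcS}"
  unfolding BS_eq_closure by (rule GA.closure_eq[OF CcS_carrier])

lemma BS_clsI: "X \<in> alg_Cauchy (group_algebra G c) \<Longrightarrow> (\<And>n. X n \<in> CcS) \<Longrightarrow> GA.cls X \<in> BS"
  by (auto simp: BS_eq)

lemma BS_carrier: "P \<in> BS \<Longrightarrow> P \<in> carrier GA.C"
  by (auto simp: BS_eq GA.cls_closed)

lemma emb_BS: "f \<in> CcS \<Longrightarrow> emb f \<in> BS"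
  unfolding GA.emb_eq using CcS_carrier by (intro BS_clsI GA.Cauchy_const) auto

lemma delta_apply: "delta g h = (if h = g then 1 else 0)"
  by (simp add: delta_def)

lemma delta_Cc: "g \<in> carrier G \<Longrightarrow> delta g \<in> Cc"
  by (rule Cc_groupI[of "{g}"]) (auto simp: delta_apply split: if_splits)

lemma delta_CcS: "s \<in> S \<Longrightarrow> delta s \<in> CcS"
  by (rule Cc_groupI[of "{s}"]) (auto simp: delta_apply split: if_splits)

lemma CcS_add: "f \<in> CcS \<Longrightarrow> h \<in> CcS \<Longrightarrow> (\<lambda>g. f g + h g) \<in> CcS"
  by (rule Cc_groupI[of "supp f \<union> supp h"]) (auto simp: Cc_group_def)

lemma CcS_scale: "f \<in> CcS \<Longrightarrow> (\<lambda>g. z * f g) \<in> CcS"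
  by (rule Cc_groupI[of "supp f"]) (auto simp: Cc_group_def)

lemma CcS_conv:
  assumes f: "f \<in> CcS" and h: "h \<in> CcS"
  shows "twisted_conv G c f h \<in> CcS"
proof (rule Cc_groupI)
  let ?J = "(\<lambda>(g, h). g \<otimes> h) ` (supp f \<times> supp h)"
  show "finite ?J" "?J \<subseteq> S"
    using f h by (auto simp: Cc_group_def intro!: subgroup.m_closed[OF subgroup_axioms])
  fix k assume "twisted_conv G c f h k \<noteq> 0"
  then have "Gp.reg () (unit_coeff f) h k \<noteq> 0" by (simp add: twisted_conv_reg CcS_Cc f)
  from Gp.reg_supp[OF unit_coeff_coeffs[OF CcS_Cc[OF f]] this] show "k \<in> ?J"
    by (auto simp: unit_coeff_def fun_eq_iff)
qed

text \<open>One formula for two purposes: a = h gives the conjugation \<delta>(g)* f \<delta>(g)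
  behind the dual action, and f a point mass gives the product of three unitaries behind the
  cocycle.\<close>

lemma sandwich_delta:
  assumes f: "f \<in> Cc" and a: "a \<in> carrier G" and h: "h \<in> carrier G" and k: "k \<in> carrier G"
  shows "twisted_conv G c (twisted_conv G c (twisted_star G c (delta a)) f) (delta h) k
    = f (a \<otimes> k \<otimes> inv h) * c (a \<otimes> k \<otimes> inv h) h * cnj (c a k)"
proof -
  let ?d = "twisted_star G c (delta a)"
  have d: "?d \<in> Cc" by (rule twisted_star_Cc[OF delta_Cc[OF a]])
  have d_eq: "?d g = (if g = inv a then cnj (c a (inv a)) else 0)" for g
  proof (cases "g \<in> carrier G")
    case True
    then have "inv g = a \<longleftrightarrow> g = inv a" using a by auto
    then show ?thesis using True a by (auto simp: twisted_star_def delta_apply)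
  next
    case False
    then show ?thesis using a by (auto simp: twisted_star_def)
  qed
  have "c a (inv a) \<noteq> 0" using a c_nonzero by simp
  then have suppd: "supp ?d = {inv a}" by (auto simp: d_eq)
  let ?df = "twisted_conv G c ?d f"
  have df: "?df m = (if m \<in> carrier G then cnj (c a (inv a)) * f (a \<otimes> m) * c (inv a) (a \<otimes> m) else 0)" for m
    unfolding twisted_conv_eq[OF d] suppd using a by (simp add: d_eq)
  have dfC: "?df \<in> Cc" by (rule twisted_conv_Cc[OF d f])
  have iff: "inv g \<otimes> k = h \<longleftrightarrow> g = k \<otimes> inv h" if "g \<in> carrier G" for g
  proof
    assume "inv g \<otimes> k = h"
    then have "k = g \<otimes> h" using that k inv_mult_cancel(2)[OF that k] by simp
    then show "g = k \<otimes> inv h" using that h by (simp add: m_assoc)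
  next
    assume "g = k \<otimes> inv h"
    then show "inv g \<otimes> k = h" using h k by (simp add: inv_mult_group m_assoc)
  qed
  have kh: "inv (k \<otimes> inv h) \<otimes> k = h" using iff[of "k \<otimes> inv h"] h k by simp
  have "twisted_conv G c ?df (delta h) k =
    (\<Sum>g\<in>supp ?df. if g = k \<otimes> inv h then ?df g * c g h else 0)"
    using k CcD(3)[OF dfC] iff by (auto simp: twisted_conv_eq[OF dfC] delta_apply kh intro!: sum.cong)
  also have "\<dots> = ?df (k \<otimes> inv h) * c (k \<otimes> inv h) h"
    using CcD(1)[OF dfC] by (auto simp: sum.delta')
  also have "\<dots> = f (a \<otimes> k \<otimes> inv h) * (cnj (c a (inv a)) * c (inv a) (a \<otimes> k \<otimes> inv h) * c (k \<otimes> inv h) h)"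
    using a h k by (simp add: df m_assoc)
  also have "cnj (c a (inv a)) * c (inv a) (a \<otimes> k \<otimes> inv h) * c (k \<otimes> inv h) h
    = c (a \<otimes> k \<otimes> inv h) h * cnj (c a k)"
  \<comment> \<open>The phases are compared through the cocycle identities at (a^-1, s, h) and (a,
    a^-1, a k), where s h = a k.\<close>
  proof -
    define s where "s = a \<otimes> k \<otimes> inv h"
    have s: "s \<in> carrier G" "s \<otimes> h = a \<otimes> k" "inv a \<otimes> s = k \<otimes> inv h"
      using a h k by (simp_all add: s_def m_assoc inv_mult_cancel)
    have 1: "c (inv a) (a \<otimes> k) * c s h = c (k \<otimes> inv h) h * c (inv a) s"
      using c_assoc[of "inv a" s h] a h s by simp
    have 2: "c a k * c (inv a) (a \<otimes> k) = c a (inv a)"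
      using c_assoc[of a "inv a" "a \<otimes> k"] a k by (simp add: inv_mult_cancel c_one)
    have 3: "cnj (c a (inv a)) = inverse (c a (inv a))" "cnj (c a k) = inverse (c a k)"
      using a k by (simp_all add: cnj_c)
    have nz: "c a (inv a) \<noteq> 0" "c a k \<noteq> 0" using a k c_nonzero by simp_all
    have "c a k * (c (inv a) s * c (k \<otimes> inv h) h) = c a (inv a) * c s h"
      using 1 2 by (metis mult.assoc mult.commute)
    then show ?thesis
      unfolding s_def[symmetric] 3 using nz by (simp add: field_simps)
  qed
  finally show ?thesis by (simp add: mult.assoc)
qed

text \<open>Because the sum runs over S only, this is defined for every finitely supported f on G:
  it evaluates the restriction of f to S at \<psi>.\<close>

definition ev :: "('a \<Rightarrow> complex) \<Rightarrow> ('a \<Rightarrow> complex) \<Rightarrow> complex" where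
  "ev \<psi> f = (\<Sum>s | f s \<noteq> 0 \<and> s \<in> S. f s * \<psi> s)"

lemma ev_eq:
  assumes "finite J" "\<And>s. f s \<noteq> 0 \<Longrightarrow> s \<in> S \<Longrightarrow> s \<in> J" "J \<subseteq> S" shows "ev \<psi> f = (\<Sum>s\<in>J. f s * \<psi> s)"
  unfolding ev_def using assms by (intro sum.mono_neutral_left) auto

lemma unit_coset: "S \<in> carrier (G Mod S)" "S <#> S = S"
  using Q.one_closed Q.l_one[OF Q.one_closed] by simp_all

text \<open>Evaluation at \<psi> is the unit-coset component of the transform up to the phase of
  \<open>r S\<close>. Linearity, contractivity and multiplicativity of \<open>ev\<close> are
  inherited from the transform in this way.\<close>

lemma tr_unit_coset:
  assumes f: "f \<in> Cc" and \<psi>: "\<psi> \<in> T"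
  shows "tr f S \<psi> = ker (r S) \<one> \<psi> * ev \<psi> f"
proof -
  note rS = rep_closed[OF unit_coset(1)] rep_coset[OF unit_coset(1)]
  have *: "ker (r S) s \<psi> = ker (r S) \<one> \<psi> * \<psi> s" if s: "s \<in> S" for s
  proof -
    have "\<kappa> \<one> = \<kappa> s" using coset_S_mult[OF s one_closed] S_carrier[OF s] by simp
    then show ?thesis
      using ker_chain[of "r S" \<one> s \<psi>] rS S_carrier[OF s] subset \<psi> by (simp add: ker_one s)
  qed
  have "(\<Sum>s | f s \<noteq> 0 \<and> s \<in> S. f s * ker (r S) s \<psi>)
    = (\<Sum>s | f s \<noteq> 0 \<and> s \<in> S. ker (r S) \<one> \<psi> * (f s * \<psi> s))"
  proof (rule sum.cong)
    fix s assume "s \<in> {s. f s \<noteq> 0 \<and> s \<in> S}"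
    then have s: "s \<in> S" by simp
    show "f s * ker (r S) s \<psi> = ker (r S) \<one> \<psi> * (f s * \<psi> s)"
      by (subst *[OF s]) (simp add: mult_ac)
  qed simp
  then show ?thesis
    using unit_coset(1) \<psi> by (simp add: tr_def ev_def sum_distrib_left)
qed

lemma ker_unit_norm: "\<psi> \<in> T \<Longrightarrow> cmod (ker (r S) \<one> \<psi>) = 1"
  using ker_norm[of "r S" \<one>] rep_closed[OF unit_coset(1)] rep_coset[OF unit_coset(1)] subset by simp

lemma ev_bound:
  assumes f: "f \<in> Cc" and \<psi>: "\<psi> \<in> T" shows "cmod (ev \<psi> f) \<le> gnorm f"
  using Tw.coeff_le_nrm[OF tr_coeffs[OF f], of S \<psi>]
  by (simp add: tr_unit_coset[OF f \<psi>] norm_mult ker_unit_norm[OF \<psi>] tr_norm[OF f])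

lemma ev_add:
  assumes "f \<in> Cc" "h \<in> Cc" "\<psi> \<in> T" shows "ev \<psi> (\<lambda>g. f g + h g) = ev \<psi> f + ev \<psi> h"
proof -
  have "ker (r S) \<one> \<psi> \<noteq> 0" using ker_unit_norm[OF assms(3)] by auto
  moreover have "ker (r S) \<one> \<psi> * ev \<psi> (\<lambda>g. f g + h g) = ker (r S) \<one> \<psi> * (ev \<psi> f + ev \<psi> h)"
    using assms by (simp add: distrib_left tr_add Cc_add flip: tr_unit_coset)
  ultimately show ?thesis by simp
qed

lemma ev_scale:
  assumes "f \<in> Cc" "\<psi> \<in> T" shows "ev \<psi> (\<lambda>g. z * f g) = z * ev \<psi> f"
proof -
  have "ker (r S) \<one> \<psi> \<noteq> 0" using ker_unit_norm[OF assms(2)] by auto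
  moreover have "ker (r S) \<one> \<psi> * ev \<psi> (\<lambda>g. z * f g) = ker (r S) \<one> \<psi> * (z * ev \<psi> f)"
    using assms by (simp add: mult.left_commute[of _ z] tr_scale Cc_scale flip: tr_unit_coset)
  ultimately show ?thesis by simp
qed

lemma ev_diff: "f \<in> Cc \<Longrightarrow> h \<in> Cc \<Longrightarrow> \<psi> \<in> T \<Longrightarrow> ev \<psi> (\<lambda>g. f g - h g) = ev \<psi> f - ev \<psi> h"
  using ev_add[OF _ Cc_scale[of h "-1"], of f \<psi>] ev_scale[of h \<psi> "-1"] by simp

lemma tr_CcS_nonzeroD:
  assumes f: "f \<in> CcS" and nz: "tr f q \<psi> \<noteq> 0" shows "q = S"
proof -
  obtain s where s: "f s \<noteq> 0" "q = \<kappa> s" using tr_nonzeroD(1)[OF CcS_Cc[OF f] nz] by auto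
  then have "s \<in> S" using f by (auto simp: Cc_group_def)
  then show ?thesis using s coset_join2[OF S_carrier subgroup_axioms] by simp
qed

lemma ev_mult:
  assumes f: "f \<in> CcS" and h: "h \<in> CcS" and \<psi>: "\<psi> \<in> T"
  shows "ev \<psi> (twisted_conv G c f h) = ev \<psi> f * ev \<psi> h"
proof -
  let ?k = "ker (r S) \<one> \<psi>"
  note fC = CcS_Cc[OF f] and hC = CcS_Cc[OF h]
  have one: "inv\<^bsub>G Mod S\<^esub> S \<otimes>\<^bsub>G Mod S\<^esub> S = S" using Q.l_inv[OF unit_coset(1)] by simp
  have "?k * ev \<psi> (twisted_conv G c f h) = tr (twisted_conv G c f h) S \<psi>"
    by (simp add: tr_unit_coset twisted_conv_Cc fC hC \<psi>)
  also have "\<dots> = Tw.reg \<psi> (tr f) (\<lambda>q. tr h q \<psi>) S"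
    using tr_conv[OF fC hC \<psi>] by (simp add: fun_eq_iff)
  also have "\<dots> = (\<Sum>p\<in>{S}. tr f p (actq (inv\<^bsub>G Mod S\<^esub> p \<otimes>\<^bsub>G Mod S\<^esub> S) \<psi>)
      * csc p (inv\<^bsub>G Mod S\<^esub> p \<otimes>\<^bsub>G Mod S\<^esub> S) \<psi> * tr h (inv\<^bsub>G Mod S\<^esub> p \<otimes>\<^bsub>G Mod S\<^esub> S) \<psi>)"
    using Tw.reg_eq[of "{S}" "tr f" \<psi> _ S] tr_CcS_nonzeroD[OF f] unit_coset(1) by simp
  also have "\<dots> = tr f S (actq S \<psi>) * csc S S \<psi> * tr h S \<psi>"
  proof -
    have "(\<Sum>p\<in>{S}. w p) = w S" for w :: "'a set \<Rightarrow> complex" by simp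
    then show ?thesis by (simp only: one)
  qed
  also have "actq S \<psi> = \<psi>" using Tw.act_one[OF \<psi>] by simp
  also have "tr f S \<psi> * csc S S \<psi> * tr h S \<psi> = (?k * cnj ?k) * (?k * (ev \<psi> f * ev \<psi> h))"
    by (simp add: csc_one_one[OF \<psi>] tr_unit_coset fC hC \<psi> mult_ac)
  also have "?k * cnj ?k = 1" using ker_unit_norm[OF \<psi>] by (simp add: complex_norm_square[symmetric])
  finally show ?thesis using ker_unit_norm[OF \<psi>] by (metis mult_1 mult_cancel_left norm_zero zero_neq_one)
qed

lemma ev_delta: "s \<in> S \<Longrightarrow> ev \<psi> (delta s) = \<psi> s"
  by (subst ev_eq[of "{s}"]) (auto simp: delta_apply split: if_splits)

text \<open>The identity \<delta>(g)* b \<delta>(g) = b \<circ> \<alpha>(g) on finitely supported b.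
  Conjugation moves the mass of b at s to g^-1 s g, which stays in S by normality.\<close>

lemma ev_sandwich:
  assumes f: "f \<in> CcS" and \<psi>: "\<psi> \<in> T" and g: "g \<in> carrier G"
  shows "twisted_conv G c (twisted_conv G c (twisted_star G c (delta g)) f) (delta g) \<in> CcS" (is "?E \<in> CcS")
    and "ev \<psi> (twisted_conv G c (twisted_conv G c (twisted_star G c (delta g)) f) (delta g)) = ev (act g \<psi>) f"
proof -
  note fC = CcS_Cc[OF f]
  have EC: "?E \<in> Cc"
    using fC g by (intro twisted_conv_Cc twisted_star_Cc delta_Cc)
  have val: "?E k = f (g \<otimes> k \<otimes> inv g) * c (g \<otimes> k \<otimes> inv g) g * cnj (c g k)" if "k \<in> carrier G" for k
    by (rule sandwich_delta[OF fC g g that])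
  let ?J = "(\<lambda>s. inv g \<otimes> s \<otimes> g) ` supp f"
  have suppf: "supp f \<subseteq> S" "finite (supp f)" using f by (auto simp: Cc_group_def)
  have J: "finite ?J" "?J \<subseteq> S" using suppf inv_op_closed1[OF g] by auto
  have inJ: "k \<in> ?J" if "?E k \<noteq> 0" for k
  proof -
    have k: "k \<in> carrier G" using CcD(3)[OF EC that] .
    then have "f (g \<otimes> k \<otimes> inv g) \<noteq> 0" using val that by auto
    moreover have "k = inv g \<otimes> (g \<otimes> k \<otimes> inv g) \<otimes> g"
      using g k by (simp add: m_assoc inv_mult_cancel)
    ultimately show ?thesis by blast
  qed
  show "?E \<in> CcS" by (rule Cc_groupI[OF J inJ])
  have inj: "inj_on (\<lambda>s. inv g \<otimes> s \<otimes> g) (supp f)"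
  proof (rule inj_onI)
    fix s t assume st: "s \<in> supp f" "t \<in> supp f" "inv g \<otimes> s \<otimes> g = inv g \<otimes> t \<otimes> g"
    have "s \<in> carrier G" "t \<in> carrier G" using st(1,2) suppf(1) S_carrier by blast+
    then have "g \<otimes> (inv g \<otimes> s \<otimes> g) \<otimes> inv g = s" "g \<otimes> (inv g \<otimes> t \<otimes> g) \<otimes> inv g = t"
      using g by (simp_all add: m_assoc inv_mult_cancel)
    then show "s = t" unfolding st(3) by simp
  qed
  have "ev \<psi> ?E = (\<Sum>k\<in>?J. ?E k * \<psi> k)" by (rule ev_eq[OF J(1) inJ J(2)])
  also have "\<dots> = (\<Sum>s\<in>supp f. ?E (inv g \<otimes> s \<otimes> g) * \<psi> (inv g \<otimes> s \<otimes> g))"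
    by (simp add: sum.reindex[OF inj])
  also have "\<dots> = (\<Sum>s\<in>supp f. f s * act g \<psi> s)"
  proof (rule sum.cong)
    fix s assume "s \<in> supp f"
    then have s: "s \<in> S" "s \<in> carrier G" using suppf S_carrier by auto
    then have "g \<otimes> (inv g \<otimes> s \<otimes> g) \<otimes> inv g = s"
      using g by (simp add: m_assoc inv_mult_cancel)
    then show "?E (inv g \<otimes> s \<otimes> g) * \<psi> (inv g \<otimes> s \<otimes> g) = f s * act g \<psi> s"
      using s g val[of "inv g \<otimes> s \<otimes> g"] by (simp add: act_def ker_def m_assoc)
  qed simp
  also have "\<dots> = ev (act g \<psi>) f"
    by (rule ev_eq[symmetric]) (use suppf in auto)
  finally show "ev \<psi> ?E = ev (act g \<psi>) f" .
qed

text \<open>The continuous extension of \<open>ev \<psi>\<close> to classes. A representative is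
  picked arbitrarily; \<open>evC_cls\<close> shows by contractivity that any other gives the same
  limit.\<close>

definition evC :: "('a \<Rightarrow> complex) \<Rightarrow> (nat \<Rightarrow> 'a \<Rightarrow> complex) set \<Rightarrow> complex" where
  "evC \<psi> P = lim (\<lambda>n. ev \<psi> ((SOME X. X \<in> P) n))"

lemma evC_cls:
  assumes X: "X \<in> alg_Cauchy (group_algebra G c)" and \<psi>: "\<psi> \<in> T"
  shows "(\<lambda>n. ev \<psi> (X n)) \<longlonglongrightarrow> evC \<psi> (GA.cls X)"
proof -
  define Y where "Y = (SOME Y. Y \<in> GA.cls X)"
  have "X \<in> GA.cls X" using GA.null_rel_refl[OF X] by auto
  then have "Y \<in> GA.cls X" unfolding Y_def by (rule someI[of "\<lambda>Y. Y \<in> GA.cls X"])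
  then have Y: "Y \<in> alg_Cauchy (group_algebra G c)" "(\<lambda>n. gnorm (\<lambda>i. X n i - Y n i)) \<longlonglongrightarrow> 0"
    by (auto simp: GA.null_rel_iff)
  have XC: "X n \<in> Cc" and YC: "Y n \<in> Cc" for n
    using GA.Cauchy_closed[OF X] GA.Cauchy_closed[OF Y(1)] by (auto simp: group_algebra_simps)
  have bd: "dist (ev \<psi> f) (ev \<psi> h) \<le> gnorm (\<lambda>i. f i - h i)" if "f \<in> Cc" "h \<in> Cc" for f h
    using ev_bound[OF Cc_diff[OF that] \<psi>] ev_diff[OF that \<psi>] by (simp add: dist_norm)
  have "Cauchy (\<lambda>n. ev \<psi> (Y n))"
    unfolding Cauchy_def
  proof (intro allI impI)
    fix e :: real assume "e > 0"
    then obtain M where M: "\<forall>m\<ge>M. \<forall>n\<ge>M. gnorm (\<lambda>i. Y m i - Y n i) < e"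
      using Y(1) by (auto simp: GA.Cauchy_iff)
    have "dist (ev \<psi> (Y m)) (ev \<psi> (Y n)) < e" if "m \<ge> M" "n \<ge> M" for m n
      using bd[OF YC[of m] YC[of n]] M that by (meson le_less_trans)
    then show "\<exists>M. \<forall>m\<ge>M. \<forall>n\<ge>M. dist (ev \<psi> (Y m)) (ev \<psi> (Y n)) < e" by blast
  qed
  then have "(\<lambda>n. ev \<psi> (Y n)) \<longlonglongrightarrow> evC \<psi> (GA.cls X)"
    unfolding evC_def Y_def[symmetric] by (simp add: Cauchy_convergent flip: convergent_LIMSEQ_iff)
  moreover have "(\<lambda>n. ev \<psi> (X n) - ev \<psi> (Y n)) \<longlonglongrightarrow> 0"
    by (rule Lim_null_comparison[OF _ Y(2)])
      (use bd[OF XC YC] in \<open>auto simp: dist_norm\<close>)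
  ultimately show ?thesis using tendsto_add by fastforce
qed

lemma evC_emb:
  assumes f: "f \<in> Cc" and \<psi>: "\<psi> \<in> T" shows "evC \<psi> (emb f) = ev \<psi> f"
proof -
  have "(\<lambda>n. f) \<in> alg_Cauchy (group_algebra G c)"
    using f by (intro GA.Cauchy_const) (simp add: group_algebra_simps)
  from LIMSEQ_unique[OF evC_cls[OF this \<psi>] tendsto_const] show ?thesis by (simp add: GA.emb_eq)
qed

text \<open>Inverse to \<open>chi\<close>, which reads off the values on the unitaries \<delta>(s);
  together they identify T with the spectrum of B. The restriction is there because points of the
  spectrum are extensional functions.\<close>

definition char_of :: "('a \<Rightarrow> complex) \<Rightarrow> (nat \<Rightarrow> 'a \<Rightarrow> complex) set \<Rightarrow> complex" where
  "char_of \<psi> = restrict (evC \<psi>) BS"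

definition chi :: "((nat \<Rightarrow> 'a \<Rightarrow> complex) set \<Rightarrow> complex) \<Rightarrow> 'a \<Rightarrow> complex" where
  "chi x s = (if s \<in> S then x (emb (delta s)) else 0)"

lemma BS_rep:
  assumes "P \<in> BS"
  obtains X where "X \<in> alg_Cauchy (group_algebra G c)" "\<And>n. X n \<in> CcS" "\<And>n. X n \<in> Cc" "P = GA.cls X"
  using assms CcS_Cc by (auto simp: BS_eq)

lemma BS_ops:
  assumes X: "X \<in> alg_Cauchy (group_algebra G c)" "\<And>n. X n \<in> CcS"
    and Y: "Y \<in> alg_Cauchy (group_algebra G c)" "\<And>n. Y n \<in> CcS"
  shows "alg_add GA.C (GA.cls X) (GA.cls Y) \<in> BS" "alg_mult GA.C (GA.cls X) (GA.cls Y) \<in> BS"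
    "alg_scale GA.C z (GA.cls X) \<in> BS"
proof -
  show "alg_add GA.C (GA.cls X) (GA.cls Y) \<in> BS"
    unfolding GA.add_cls[OF X(1) Y(1)] using X Y by (intro BS_clsI GA.Cauchy_add CcS_add)
  show "alg_mult GA.C (GA.cls X) (GA.cls Y) \<in> BS"
    unfolding GA.mult_cls[OF X(1) Y(1)] using X Y CcS_conv
    by (intro BS_clsI GA.Cauchy_mult) (auto simp: group_algebra_simps)
  show "alg_scale GA.C z (GA.cls X) \<in> BS"
    unfolding GA.scale_cls[OF X(1)] using X by (intro BS_clsI GA.Cauchy_scale CcS_scale)
qed

lemma char_of_Sp:
  assumes \<psi>: "\<psi> \<in> T" shows "char_of \<psi> \<in> Sp"
  unfolding characters_def mem_Collect_eq Cr_subgroup_simps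
proof (intro conjI ballI allI)
  show "char_of \<psi> \<in> extensional BS" by (simp add: char_of_def)
  fix P assume "P \<in> BS"
  then obtain X where X: "X \<in> alg_Cauchy (group_algebra G c)" "\<And>n. X n \<in> CcS" "\<And>n. X n \<in> Cc" "P = GA.cls X"
    by (rule BS_rep) blast
  note eX = evC_cls[OF X(1) \<psi>]
  show "char_of \<psi> (alg_scale GA.C z P) = z * char_of \<psi> P" for z
  proof -
    have "(\<lambda>n. ev \<psi> (\<lambda>i. z * X n i)) \<longlonglongrightarrow> evC \<psi> (alg_scale GA.C z P)"
      unfolding X(4) GA.scale_cls[OF X(1)] by (rule evC_cls[OF GA.Cauchy_scale[OF X(1)] \<psi>])
    moreover have "(\<lambda>n. ev \<psi> (\<lambda>i. z * X n i)) \<longlonglongrightarrow> z * evC \<psi> P"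
      unfolding ev_scale[OF X(3) \<psi>] X(4) by (intro tendsto_intros eX)
    ultimately show ?thesis
      using LIMSEQ_unique \<open>P \<in> BS\<close> BS_ops(3)[OF X(1,2) X(1,2)] X(4) by (auto simp: char_of_def)
  qed
  fix R assume "R \<in> BS"
  then obtain Y where Y: "Y \<in> alg_Cauchy (group_algebra G c)" "\<And>n. Y n \<in> CcS" "\<And>n. Y n \<in> Cc" "R = GA.cls Y"
    by (rule BS_rep) blast
  note eY = evC_cls[OF Y(1) \<psi>]
  show "char_of \<psi> (alg_add GA.C P R) = char_of \<psi> P + char_of \<psi> R"
  proof -
    have "(\<lambda>n. ev \<psi> (\<lambda>i. X n i + Y n i)) \<longlonglongrightarrow> evC \<psi> (alg_add GA.C P R)"
      unfolding X(4) Y(4) GA.add_cls[OF X(1) Y(1)] by (rule evC_cls[OF GA.Cauchy_add[OF X(1) Y(1)] \<psi>])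
    moreover have "(\<lambda>n. ev \<psi> (\<lambda>i. X n i + Y n i)) \<longlonglongrightarrow> evC \<psi> P + evC \<psi> R"
      unfolding ev_add[OF X(3) Y(3) \<psi>] X(4) Y(4) by (intro tendsto_intros eX eY)
    ultimately show ?thesis
      using LIMSEQ_unique \<open>P \<in> BS\<close> \<open>R \<in> BS\<close> BS_ops(1)[OF X(1,2) Y(1,2)] X(4) Y(4) by (auto simp: char_of_def)
  qed
  show "char_of \<psi> (alg_mult GA.C P R) = char_of \<psi> P * char_of \<psi> R"
  proof -
    have "(\<lambda>n. ev \<psi> (twisted_conv G c (X n) (Y n))) \<longlonglongrightarrow> evC \<psi> (alg_mult GA.C P R)"
      unfolding X(4) Y(4) GA.mult_cls[OF X(1) Y(1)]
      using evC_cls[OF GA.Cauchy_mult[OF X(1) Y(1)] \<psi>] by (simp add: group_algebra_simps)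
    moreover have "(\<lambda>n. ev \<psi> (twisted_conv G c (X n) (Y n))) \<longlonglongrightarrow> evC \<psi> P * evC \<psi> R"
      unfolding ev_mult[OF X(2) Y(2) \<psi>] X(4) Y(4) by (intro tendsto_intros eX eY)
    ultimately show ?thesis
      using LIMSEQ_unique \<open>P \<in> BS\<close> \<open>R \<in> BS\<close> BS_ops(2)[OF X(1,2) Y(1,2)] X(4) Y(4) by (auto simp: char_of_def)
  qed
next
  have "char_of \<psi> (emb (delta \<one>)) = 1"
    using emb_BS[OF delta_CcS[of \<one>]] delta_Cc[of \<one>] \<psi>
    by (simp add: char_of_def evC_emb ev_delta T_one)
  then show "\<exists>P\<in>BS. char_of \<psi> P \<noteq> 0"
    using emb_BS[OF delta_CcS[of \<one>]] by (intro bexI[of _ "emb (delta \<one>)"]) auto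
qed

lemma chi_char_of: assumes "\<psi> \<in> T" shows "chi (char_of \<psi>) = \<psi>"
proof
  fix s show "chi (char_of \<psi>) s = \<psi> s"
    using assms T_off[OF assms] by (cases "s \<in> S")
      (auto simp: chi_def char_of_def emb_BS delta_CcS evC_emb delta_Cc S_carrier ev_delta)
qed

section \<open>Every character of B comes from a twisted character\<close>

lemma SpD:
  assumes "x \<in> Sp"
  shows "x \<in> extensional BS"
    "P \<in> BS \<Longrightarrow> R \<in> BS \<Longrightarrow> x (alg_add GA.C P R) = x P + x R"
    "P \<in> BS \<Longrightarrow> x (alg_scale GA.C z P) = z * x P"
    "P \<in> BS \<Longrightarrow> R \<in> BS \<Longrightarrow> x (alg_mult GA.C P R) = x P * x R"
    "\<exists>P\<in>BS. x P \<noteq> 0"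
  using assms unfolding characters_def Cr_subgroup_simps by blast+

lemma BS_op_closed:
  assumes "P \<in> BS" "R \<in> BS"
  shows "alg_add GA.C P R \<in> BS" "alg_mult GA.C P R \<in> BS" "alg_scale GA.C z P \<in> BS"
  using assms BS_ops unfolding BS_eq by auto

text \<open>Characters are automatically contractive, as 1 - b has a quasi-inverse when b has norm
  less than 1.\<close>

lemma Sp_contractive:
  assumes x: "x \<in> Sp" and P: "P \<in> BS"
  shows "cmod (x P) \<le> alg_norm GA.C P"
proof (rule ccontr)
  assume "\<not> ?thesis"
  then have gt: "alg_norm GA.C P < cmod (x P)" by simp
  obtain X where X: "X \<in> alg_Cauchy (group_algebra G c)" "P = GA.cls X" using P by (rule BS_rep)
  have "0 \<le> alg_norm GA.C P"
    unfolding X(2) by (rule LIMSEQ_le_const[OF GA.norm_cls[OF X(1)]])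
      (auto simp: GA.norm_nonneg GA.Cauchy_closed[OF X(1)])
  then have nz: "x P \<noteq> 0" using gt by auto
  \<comment> \<open>Scaled so that x R = 1 while the norm stays below 1. A solution U of U = R + R U
    would satisfy x U = 1 + x U.\<close>
  define R where "R = alg_scale GA.C (1 / x P) P"
  have R: "R \<in> BS" unfolding R_def by (rule BS_op_closed(3)[OF P P])
  have x1: "x R = 1" using SpD(3)[OF x P] nz by (simp add: R_def)
  have "alg_norm GA.C R = alg_norm GA.C P / cmod (x P)"
    unfolding R_def GA.completion_norm_scale[OF BS_carrier[OF P]] by (simp add: norm_divide)
  also have "\<dots> < 1" using gt nz by simp
  finally have "alg_norm GA.C R < 1" .
  then have "\<exists>Q\<in>norm_closure GA.C (emb ` CcS). Q = alg_add GA.C R (alg_mult GA.C R Q)"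
    using R CcS_conv CcS_add unfolding BS_eq_closure
    by (intro GA.quasi_inverse_exists[OF CcS_carrier]) (auto simp: group_algebra_simps Cc_group_def[of S])
  then obtain U where U: "U \<in> BS" "U = alg_add GA.C R (alg_mult GA.C R U)"
    unfolding BS_eq_closure by blast
  have "x U = x R + x (alg_mult GA.C R U)"
    using SpD(2)[OF x R BS_op_closed(2)[OF R U(1)]] U(2) by simp
  also have "x (alg_mult GA.C R U) = x R * x U" by (rule SpD(4)[OF x R U(1)])
  finally show False using x1 by simp
qed

lemma emb_add: "f \<in> Cc \<Longrightarrow> h \<in> Cc \<Longrightarrow> alg_add GA.C (emb f) (emb h) = emb (\<lambda>i. f i + h i)"
  and emb_scale: "f \<in> Cc \<Longrightarrow> alg_scale GA.C z (emb f) = emb (\<lambda>i. z * f i)"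
  and emb_mult: "f \<in> Cc \<Longrightarrow> h \<in> Cc \<Longrightarrow> alg_mult GA.C (emb f) (emb h) = emb (twisted_conv G c f h)"
  and emb_star: "f \<in> Cc \<Longrightarrow> alg_star GA.C (emb f) = emb (twisted_star G c f)"
  by (simp_all add: GA.emb_eq GA.add_cls GA.scale_cls GA.mult_cls GA.star_cls GA.Cauchy_const
      group_algebra_simps)

lemma conv_delta_left:
  assumes "g \<in> carrier G" shows "twisted_conv G c (delta g) h k =
    (if k \<in> carrier G then h (inv g \<otimes> k) * c g (inv g \<otimes> k) else 0)"
proof -
  have "supp (delta g) = {g}" by (auto simp: delta_apply)
  then show ?thesis by (simp add: twisted_conv_eq delta_Cc assms) (simp add: delta_apply)
qed

lemma conv_delta_delta:
  assumes g: "g \<in> carrier G" and h: "h \<in> carrier G"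
  shows "twisted_conv G c (delta g) (delta h) = (\<lambda>k. c g h * delta (g \<otimes> h) k)"
proof
  fix k
  have "inv g \<otimes> k = h \<longleftrightarrow> k = g \<otimes> h" if "k \<in> carrier G"
    using inv_mult_cancel[OF g h] inv_mult_cancel[OF g that] by auto
  then show "twisted_conv G c (delta g) (delta h) k = c g h * delta (g \<otimes> h) k"
    using g h by (auto simp: conv_delta_left delta_apply)
qed

lemma conv_delta_one: "f \<in> Cc \<Longrightarrow> twisted_conv G c (delta \<one>) f = f"
  by (rule ext) (auto simp: conv_delta_left c_one Cc_group_def)

lemma chi_one: assumes x: "x \<in> Sp" shows "x (emb (delta \<one>)) = 1"
proof -
  obtain P where P: "P \<in> BS" "x P \<noteq> 0" using SpD(5)[OF x] by auto
  obtain X where X: "X \<in> alg_Cauchy (group_algebra G c)" "\<And>n. X n \<in> CcS" "\<And>n. X n \<in> Cc" "P = GA.cls X"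
    using P(1) by (rule BS_rep) blast
  have d: "delta \<one> \<in> carrier (group_algebra G c)" using delta_Cc[of \<one>] by (simp add: group_algebra_simps)
  have "alg_mult GA.C (emb (delta \<one>)) P = P"
    unfolding X(4) GA.emb_eq GA.mult_cls[OF GA.Cauchy_const[OF d] X(1)]
    using X(3) by (simp add: group_algebra_simps conv_delta_one)
  then have "x (emb (delta \<one>)) * x P = x P"
    using SpD(4)[OF x emb_BS[OF delta_CcS[of \<one>]] P(1)] by simp
  then show ?thesis using P(2) by simp
qed

lemma gnorm_delta: assumes g: "g \<in> carrier G" shows "gnorm (delta g) \<le> 1"
proof -
  have "Gp.nrm (unit_coeff (delta g)) \<le> (\<Sum>p\<in>{g}. 1)"
    using g by (intro Gp.nrm_le_sum unit_coeff_coeffs delta_Cc)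
      (auto simp: unit_coeff_def delta_apply split: if_splits)
  then show ?thesis using g by (simp add: gnorm_eq delta_Cc)
qed

text \<open>By contractivity the values at s and at its inverse have modulus at most 1, while their
  product is the unimodular number c(s, s^-1). Both moduli are therefore 1.\<close>

lemma chi_T: assumes x: "x \<in> Sp" shows "chi x \<in> T"
proof -
  have mult: "chi x s * chi x t = c s t * chi x (s \<otimes> t)" if s: "s \<in> S" and t: "t \<in> S" for s t
  proof -
    note sc = S_carrier[OF s] and tc = S_carrier[OF t]
    have st: "s \<otimes> t \<in> S" by (rule subgroup.m_closed[OF subgroup_axioms s t])
    have "chi x s * chi x t = x (alg_mult GA.C (emb (delta s)) (emb (delta t)))"
      using SpD(4)[OF x emb_BS emb_BS, of "delta s" "delta t"] s t by (simp add: chi_def delta_CcS)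
    also have "alg_mult GA.C (emb (delta s)) (emb (delta t)) = alg_scale GA.C (c s t) (emb (delta (s \<otimes> t)))"
      using sc tc by (simp add: emb_mult emb_scale delta_Cc conv_delta_delta)
    also have "x \<dots> = c s t * chi x (s \<otimes> t)"
      using SpD(3)[OF x emb_BS, of "delta (s \<otimes> t)"] st by (simp add: chi_def delta_CcS)
    finally show ?thesis .
  qed
  have le: "cmod (chi x s) \<le> 1" if s: "s \<in> S" for s
  proof -
    have "cmod (chi x s) \<le> alg_norm GA.C (emb (delta s))"
      using Sp_contractive[OF x emb_BS[OF delta_CcS[OF s]]] s by (simp add: chi_def)
    also have "\<dots> = gnorm (delta s)"
      by (rule GA.emb_norm) (simp add: group_algebra_simps delta_Cc S_carrier s)
    also have "\<dots> \<le> 1" by (rule gnorm_delta[OF S_carrier[OF s]])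
    finally show ?thesis .
  qed
  have "cmod (chi x s) = 1" if s: "s \<in> S" for s
  proof -
    have inv_s: "inv s \<in> S" by (rule subgroup.m_inv_closed[OF subgroup_axioms s])
    have "chi x s * chi x (inv s) = c s (inv s)"
      using mult[OF s inv_s] chi_one[OF x] S_carrier[OF s] by (simp add: chi_def)
    then have "cmod (chi x s) * cmod (chi x (inv s)) = 1"
      using c_norm S_carrier[OF s] by (metis inv_closed norm_mult)
    moreover have "cmod (chi x s) * cmod (chi x (inv s)) \<le> cmod (chi x s) * 1"
      by (intro mult_left_mono le inv_s) auto
    ultimately show ?thesis using le[OF s] by simp
  qed
  then show ?thesis using mult by (auto simp: twisted_chars_def chi_def)
qed

lemma Sp_emb:
  assumes x: "x \<in> Sp" and f: "f \<in> CcS" shows "x (emb f) = ev (chi x) f"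
proof -
  have "x (emb f) = (\<Sum>s\<in>J. f s * chi x s)" if "finite J" "J \<subseteq> S" "supp f \<subseteq> J" "f \<in> CcS" for J f
    using that
  proof (induction J arbitrary: f rule: finite_induct)
    case empty
    then have "f = (\<lambda>g. 0 * delta \<one> g)" by auto
    then have "emb f = alg_scale GA.C 0 (emb (delta \<one>))" using delta_Cc[of \<one>] by (simp add: emb_scale)
    then show ?case using SpD(3)[OF x emb_BS[OF delta_CcS[of \<one>]]] by simp
  next
    case (insert t J)
    define h where "h g = (if g = t then 0 else f g)" for g
    have t: "t \<in> S" using insert by auto
    have hS: "h \<in> CcS" using insert.prems(3) by (intro Cc_groupI[of "supp f"]) (auto simp: h_def Cc_group_def split: if_splits)
    have fe: "(\<lambda>g. h g + f t * delta t g) = f" by (auto simp: h_def delta_apply)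
    have "alg_add GA.C (emb h) (alg_scale GA.C (f t) (emb (delta t))) = emb (\<lambda>g. h g + f t * delta t g)"
      using CcS_Cc[OF hS] CcS_Cc[OF delta_CcS[OF t]] by (simp add: emb_scale emb_add Cc_scale)
    then have "emb f = alg_add GA.C (emb h) (alg_scale GA.C (f t) (emb (delta t)))"
      unfolding fe by simp
    then have "x (emb f) = x (emb h) + f t * x (emb (delta t))"
      using SpD(2)[OF x emb_BS[OF hS] BS_op_closed(3)] SpD(3)[OF x] emb_BS[OF delta_CcS[OF t]] by simp
    also have "x (emb h) = (\<Sum>s\<in>J. h s * chi x s)"
      using insert.prems by (intro insert.IH hS) (auto simp: h_def split: if_splits)
    also have "\<dots> = (\<Sum>s\<in>J. f s * chi x s)" using insert.hyps by (intro sum.cong) (auto simp: h_def)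
    finally show ?case using insert.hyps t by (simp add: chi_def)
  qed
  from this[of "supp f" f] show ?thesis
    using f ev_eq[of "supp f" f "chi x"] by (auto simp: Cc_group_def)
qed

lemma Sp_cls:
  assumes x: "x \<in> Sp" and X: "X \<in> alg_Cauchy (group_algebra G c)" "\<And>n. X n \<in> CcS"
  shows "x (GA.cls X) = evC (chi x) (GA.cls X)"
proof -
  have P: "GA.cls X \<in> BS" by (rule BS_clsI[OF X])
  have XB: "emb (X n) \<in> BS" for n by (rule emb_BS[OF X(2)])
  have bd: "cmod (x (GA.cls X) - ev (chi x) (X n)) \<le> alg_dist GA.C (GA.cls X) (emb (X n))" for n
  proof -
    have s: "alg_scale GA.C (-1) (emb (X n)) \<in> BS" by (rule BS_op_closed(3)[OF XB XB])
    have "x (GA.cls X) - ev (chi x) (X n) = x (alg_add GA.C (GA.cls X) (alg_scale GA.C (-1) (emb (X n))))"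
      using SpD(2)[OF x P s] SpD(3)[OF x XB] Sp_emb[OF x X(2)] by simp
    then show ?thesis
      using Sp_contractive[OF x BS_op_closed(1)[OF P s]] by (simp add: alg_dist_def)
  qed
  have "(\<lambda>n. ev (chi x) (X n)) \<longlonglongrightarrow> x (GA.cls X)"
  proof (rule LIMSEQ_I)
    fix e :: real assume "e > 0"
    then obtain M where M: "\<forall>n\<ge>M. alg_dist GA.C (GA.cls X) (emb (X n)) < e"
      using GA.emb_tendsto[OF X(1)] by blast
    have "norm (ev (chi x) (X n) - x (GA.cls X)) < e" if n: "n \<ge> M" for n
      using le_less_trans[OF bd[of n] M[rule_format, OF n]] by (simp add: norm_minus_commute)
    then show "\<exists>M. \<forall>n\<ge>M. norm (ev (chi x) (X n) - x (GA.cls X)) < e" by blast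
  qed
  from LIMSEQ_unique[OF this evC_cls[OF X(1) chi_T[OF x]]] show ?thesis .
qed

lemma char_of_chi: assumes x: "x \<in> Sp" shows "char_of (chi x) = x"
proof
  fix P show "char_of (chi x) P = x P"
  proof (cases "P \<in> BS")
    case True
    then obtain X where X: "X \<in> alg_Cauchy (group_algebra G c)" "\<And>n. X n \<in> CcS" "P = GA.cls X"
      by (rule BS_rep) blast
    then show ?thesis using Sp_cls[OF x X(1,2)] True by (simp add: char_of_def)
  next
    case False
    then show ?thesis using SpD(1)[OF x] by (simp add: char_of_def extensional_def)
  qed
qed

lemma Sp_eq: "Sp = char_of ` T"
  using char_of_Sp char_of_chi chi_T by (auto intro!: image_eqI[OF sym])

text \<open>\<open>ev_sandwich\<close> along a representative of P, followed by the limit. The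
  action on the spectrum thereby becomes \<open>act\<close> on twisted characters.\<close>

lemma dual_homeo_eq:
  assumes x: "x \<in> Sp" and g: "g \<in> carrier G"
  shows "dual_homeo G c S g x = char_of (act g (chi x))"
proof
  fix P
  let ?d = "delta_elt G c g"
  let ?A = "Cr_group G c"
  have A: "?A = GA.C" by (simp add: Cr_group_def)
  have d: "?d = GA.cls (\<lambda>_. delta g)" by (simp add: delta_elt_def GA.emb_eq)
  have dC: "(\<lambda>_. delta g) \<in> alg_Cauchy (group_algebra G c)"
    using g by (intro GA.Cauchy_const) (simp add: group_algebra_simps delta_Cc)
  show "dual_homeo G c S g x P = char_of (act g (chi x)) P"
  proof (cases "P \<in> BS")
    case True
    then obtain X where X: "X \<in> alg_Cauchy (group_algebra G c)" "\<And>n. X n \<in> CcS" "P = GA.cls X"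
      by (rule BS_rep) blast
    define Y where "Y n = twisted_conv G c (twisted_conv G c (twisted_star G c (delta g)) (X n)) (delta g)" for n
    have Y: "alg_mult GA.C (alg_mult GA.C (alg_star GA.C ?d) P) ?d = GA.cls Y" "Y \<in> alg_Cauchy (group_algebra G c)"
      unfolding d X(3) GA.star_cls[OF dC] GA.mult_cls[OF GA.Cauchy_star[OF dC] X(1)]
        GA.mult_cls[OF GA.Cauchy_mult[OF GA.Cauchy_star[OF dC] X(1)] dC]
      using GA.Cauchy_mult[OF GA.Cauchy_mult[OF GA.Cauchy_star[OF dC] X(1)] dC]
      by (simp_all add: Y_def[abs_def] group_algebra_simps)
    have YS: "Y n \<in> CcS" and evY: "ev (chi x) (Y n) = ev (act g (chi x)) (X n)" for n
      unfolding Y_def by (rule ev_sandwich[OF X(2) chi_T[OF x] g])+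
    have "(\<lambda>n. ev (chi x) (Y n)) \<longlonglongrightarrow> evC (act g (chi x)) P"
      unfolding evY X(3) by (rule evC_cls[OF X(1) act_T[OF g chi_T[OF x]]])
    from LIMSEQ_unique[OF evC_cls[OF Y(2) chi_T[OF x]] this]
    have "x (GA.cls Y) = evC (act g (chi x)) P" using Sp_cls[OF x Y(2) YS] by simp
    then show ?thesis using True by (simp add: dual_homeo_def Let_def A Y(1) char_of_def)
  qed (simp add: dual_homeo_def Let_def char_of_def)
qed

lemma dual_action_eq:
  assumes x: "x \<in> Sp" and q: "q \<in> carrier (G Mod S)"
  shows "dual_action G c S q x = char_of (actq q (chi x))"
proof -
  have "dual_homeo G c S g x = char_of (actq q (chi x))" if "g \<in> q" for g
  proof -
    have g: "g \<in> carrier G" "\<kappa> g = q" using that mem_coset[OF q] by auto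
    have "act g (chi x) = actq q (chi x)"
      using g by (intro act_coset rep_closed q chi_T x) (simp_all add: rep_coset q)
    then show ?thesis using dual_homeo_eq[OF x g(1)] by simp
  qed
  then show ?thesis
    unfolding dual_action_def using rep[OF q] by (intro the_equality) auto
qed

text \<open>The product of the three unitaries is a phase times a single \<delta>(k) with k in S.
  Its value at y is \<open>csc q p (chi y)\<close>, already of modulus 1.\<close>

lemma coset_cocycle_eq:
  assumes y: "y \<in> Sp" and q: "q \<in> carrier (G Mod S)" and p: "p \<in> carrier (G Mod S)"
  shows "coset_cocycle G c S r (q, x) (p, y) = csc q p (chi y)"
proof -
  have A: "Cr_group G c = GA.C" by (simp add: Cr_group_def)
  have qp: "q <#> p \<in> carrier (G Mod S)" using Q.m_closed[OF q p] by simp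
  let ?a = "r (q <#> p)" and ?b = "r q" and ?h = "r p"
  have a: "?a \<in> carrier G" and b: "?b \<in> carrier G" and h: "?h \<in> carrier G"
    using q p qp rep_closed by auto
  let ?E = "twisted_conv G c (twisted_conv G c (twisted_star G c (delta ?a)) (delta ?b)) (delta ?h)"
  have EC: "?E \<in> Cc" using a b h by (intro twisted_conv_Cc twisted_star_Cc delta_Cc)
  let ?k = "inv ?a \<otimes> (?b \<otimes> ?h)"
  have k: "?k \<in> S"
    using coset_eq_iff[OF a, of "?b \<otimes> ?h"] b h rep_mult[OF q p] rep_coset[OF qp] by simp
  have val: "?E m = (if m = ?k then c ?b ?h * cnj (c ?a ?k) else 0)" for m
  proof (cases "m \<in> carrier G")
    case m: True
    have "?a \<otimes> m \<otimes> inv ?h = ?b \<longleftrightarrow> m = ?k"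
    proof
      assume "?a \<otimes> m \<otimes> inv ?h = ?b"
      then have "?b \<otimes> ?h = ?a \<otimes> m \<otimes> inv ?h \<otimes> ?h" by simp
      also have "\<dots> = ?a \<otimes> m" using a m h by (simp add: m_assoc)
      finally show "m = ?k" using a m by (simp add: inv_mult_cancel)
    next
      assume "m = ?k"
      then show "?a \<otimes> m \<otimes> inv ?h = ?b" using a b h by (simp add: inv_mult_cancel m_assoc)
    qed
    then show ?thesis
      using sandwich_delta[OF delta_Cc[OF b] a h m] by (auto simp: delta_apply)
  next
    case False
    then have "?E m = 0" using CcD(3)[OF EC] by blast
    moreover have "?k \<in> carrier G" using a b h by simp
    ultimately show ?thesis using False by metis
  qed
  have supp_E: "m \<in> {?k}" if "?E m \<noteq> 0" for m
    using that unfolding val by (simp split: if_splits)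
  have ES: "?E \<in> CcS" by (rule Cc_groupI[OF _ _ supp_E]) (use k in simp_all)
  have "ev (chi y) ?E = (\<Sum>m\<in>{?k}. ?E m * chi y m)"
    by (rule ev_eq[OF _ supp_E]) (use k in simp_all)
  also have "\<dots> = csc q p (chi y)" by (simp add: val csc_def ker_def)
  finally have v: "y (emb ?E) = csc q p (chi y)" unfolding Sp_emb[OF y ES] .
  have "alg_mult GA.C (alg_mult GA.C (alg_star GA.C (emb (delta ?a))) (emb (delta ?b))) (emb (delta ?h)) = emb ?E"
    using a b h by (simp add: emb_star emb_mult delta_Cc twisted_star_Cc twisted_conv_Cc)
  then show ?thesis
    using Tw.cocycle_circle[OF q p chi_T[OF y]]
    by (simp add: coset_cocycle_def Let_def delta_elt_def A v)
qed

section \<open>The topology of the spectrum\<close>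

text \<open>By \<open>Sp_contractive\<close> the characters form a closed subset of a product of
  discs, which is compact.\<close>

lemma compact_Sp: "compact Sp"
proof -
  \<comment> \<open>Off \<open>BS\<close> an extensional function is \<open>undefined\<close>, so a
    singleton factor there lets the product run over the whole type.\<close>
  define K where "K P = (if P \<in> BS then cball 0 (alg_norm GA.C P) else {undefined :: complex})" for P
  have "compactin (product_topology (\<lambda>_. euclidean) UNIV) (PiE UNIV K)"
    unfolding compactin_PiE by (auto simp: K_def)
  then have K: "compact (PiE UNIV K)" by (simp add: euclidean_product_topology)
  have cont: "continuous_on UNIV (\<lambda>x :: _ \<Rightarrow> complex. x P)" for P :: "(nat \<Rightarrow> 'a \<Rightarrow> complex) set"
    by simp
  \<comment> \<open>Being nonzero is not a closed condition; for multiplicative functionals it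
    amounts to the value 1 at the unit, which is.\<close>
  define E where "E = {x. x (emb (delta \<one>)) = (1::complex)} \<inter>
     (\<Inter>P\<in>BS. \<Inter>R\<in>BS. {x. x (alg_add GA.C P R) = x P + x R} \<inter> {x. x (alg_mult GA.C P R) = x P * x R}) \<inter>
     (\<Inter>P\<in>BS. \<Inter>z. {x. x (alg_scale GA.C z P) = z * x P})"
  have "closed E"
    unfolding E_def
    by (intro closed_Int closed_INT ballI closed_Collect_eq continuous_intros cont)
  have "Sp = PiE UNIV K \<inter> E"
  proof (intro equalityI subsetI)
    fix x assume x: "x \<in> Sp"
    have "x P \<in> K P" for P
      using Sp_contractive[OF x, of P] SpD(1)[OF x] by (auto simp: K_def extensional_def)
    then show "x \<in> PiE UNIV K \<inter> E"
      using SpD(2-4)[OF x] chi_one[OF x] by (auto simp: E_def)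
  next
    fix x assume x: "x \<in> PiE UNIV K \<inter> E"
    have "x P = undefined" if "P \<notin> BS" for P
    proof -
      have "x P \<in> K P" using x by (auto simp: PiE_iff)
      then show ?thesis using that by (simp add: K_def)
    qed
    then have "x \<in> extensional BS" by (simp add: extensional_def)
    then show "x \<in> Sp"
      using x emb_BS[OF delta_CcS[of \<one>]]
      by (auto simp: E_def characters_def Cr_subgroup_simps intro!: bexI[of _ "emb (delta \<one>)"])
  qed
  then show ?thesis using K \<open>closed E\<close> by (simp add: compact_Int_closed)
qed

end

text \<open>Extensional functions are constant in all coordinates outside I, so those coordinates
  add nothing to the topology. The weak-star topology becomes a subspace of the function type, where
  \<open>compact\<close> and \<open>continuous_on\<close> apply.\<close>

lemma subtopology_product_extensional:
  fixes I :: "'i set" and Y :: "('i \<Rightarrow> 'b::topological_space) set"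
  assumes "Y \<subseteq> extensional I"
  shows "subtopology (product_topology (\<lambda>_. euclidean) I) Y = top_of_set Y"
proof -
  let ?T1 = "subtopology (product_topology (\<lambda>_. euclidean :: 'b topology) I) Y"
  have top: "topspace ?T1 = Y" using assms by (auto simp: PiE_def extensional_def)
  have 1: "continuous_map ?T1 (top_of_set Y) (\<lambda>x. x)"
  proof -
    have "continuous_map ?T1 (product_topology (\<lambda>_. euclidean) UNIV) (\<lambda>x. x)"
    proof (rule continuous_map_coordinatewise_then_product)
      fix i :: 'i
      show "continuous_map ?T1 euclidean (\<lambda>x. x i)"
      proof (cases "i \<in> I")
        case True
        then show ?thesis
          by (intro continuous_map_from_subtopology continuous_map_product_projection)
      next
        case False
        then have e: "undefined = x i" if "x \<in> topspace ?T1" for x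
          using that assms unfolding top by (force simp: extensional_def)
        have "continuous_map ?T1 euclidean (\<lambda>_. undefined :: 'b)" by simp
        then show ?thesis by (rule continuous_map_eq[OF _ e])
      qed
    qed auto
    then have "continuous_map ?T1 euclidean (\<lambda>x. x)" by (simp add: euclidean_product_topology)
    then show ?thesis using top by (simp add: continuous_map_in_subtopology)
  qed
  have 2: "continuous_map (top_of_set Y) ?T1 (\<lambda>x. x)"
  proof -
    have "continuous_map (top_of_set Y) (product_topology (\<lambda>_. euclidean) I) (\<lambda>x. x)"
    proof (rule continuous_map_coordinatewise_then_product)
      fix i assume "i \<in> I"
      show "continuous_map (top_of_set Y) euclidean (\<lambda>x. x i)"
        by (simp add: continuous_on_subset[OF continuous_on_product_coordinates])
    next
      fix i x assume "i \<notin> I" "x \<in> topspace (top_of_set Y)"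
      then show "x i = undefined" using assms by (auto simp: extensional_def)
    qed
    then show ?thesis by (simp add: continuous_map_in_subtopology)
  qed
  have top2: "topspace (top_of_set Y) = Y" by simp
  show ?thesis
    unfolding topology_eq
  proof
    fix U
    have "openin (top_of_set Y) U" if U: "openin ?T1 U"
    proof -
      have "U \<subseteq> Y" using openin_subset[OF U] top by simp
      then have "{x \<in> topspace (top_of_set Y). x \<in> U} = U" by auto
      then show ?thesis using openin_continuous_map_preimage[OF 2 U] by simp
    qed
    moreover have "openin ?T1 U" if U: "openin (top_of_set Y) U"
    proof -
      have "U \<subseteq> Y" using openin_subset[OF U] by simp
      then have "{x \<in> topspace ?T1. x \<in> U} = U" unfolding top by auto
      then show ?thesis using openin_continuous_map_preimage[OF 1 U] by simp
    qed
    ultimately show "openin ?T1 U = openin (top_of_set Y) U" by blast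
  qed
qed

context cocycle_pair
begin

lemma dual_top_eq: "dual_top G c S = top_of_set Sp"
  unfolding dual_top_def spectrum_top_def
  by (rule subtopology_product_extensional) (auto simp: characters_def)

end

lemma continuous_map_mult_complex:
  fixes f g :: "'x \<Rightarrow> complex"
  assumes "continuous_map X euclidean f" "continuous_map X euclidean g"
  shows "continuous_map X euclidean (\<lambda>x. f x * g x)"
  using assms by (simp add: continuous_map_atin tendsto_mult)

lemma continuous_map_from_discrete_product:
  assumes "\<And>q. q \<in> D \<Longrightarrow> continuous_map Y Z (\<lambda>y. g (q, y))"
  shows "continuous_map (prod_topology (discrete_topology D) Y) Z g"
  unfolding continuous_map_def
proof (intro conjI allI impI)
  show "g \<in> topspace (prod_topology (discrete_topology D) Y) \<rightarrow> topspace Z"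
    using assms continuous_map_image_subset_topspace by fastforce
  fix U assume U: "openin Z U"
  let ?W = "\<lambda>q. {q} \<times> {y \<in> topspace Y. g (q, y) \<in> U}"
  have "{a \<in> topspace (prod_topology (discrete_topology D) Y). g a \<in> U} = (\<Union>q\<in>D. ?W q)"
    by auto
  moreover have "openin (prod_topology (discrete_topology D) Y) (?W q)" if "q \<in> D" for q
    unfolding openin_prod_Times_iff using openin_continuous_map_preimage[OF assms[OF that] U] that by simp
  ultimately show "openin (prod_topology (discrete_topology D) Y) {a \<in> topspace (prod_topology (discrete_topology D) Y). g a \<in> U}"
    by auto
qed

section \<open>The twisted groupoid algebra\<close>

context cocycle_pair
begin

abbreviation Kd where "Kd \<equiv> coset_groupoid G c S"
abbreviation Sg where "Sg \<equiv> cocycle_twist Kd (coset_cocycle G c S r)"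
abbreviation da where "da \<equiv> dual_action G c S"
abbreviation QC where "QC \<equiv> carrier (G Mod S)"

lemma Kd_simps:
  "arrow_top Kd = prod_topology (discrete_topology QC) (top_of_set Sp)"
  "arrows Kd = QC \<times> Sp" "src Kd (q, x) = (S, x)" "rng Kd (q, x) = (S, da q x)"
  "gmult Kd (q, x) (p, y) = (q <#> p, y)"
  by (simp_all add: coset_groupoid_def transformation_groupoid_def arrows_def dual_top_eq)

lemma Sg_simps:
  "arrow_top Sg = prod_topology (arrow_top Kd) (top_of_set circle)"
  "arrows Sg = (QC \<times> Sp) \<times> circle" "proj Sg = fst" "twist.act Sg z ((q, x), t) = ((q, x), z * t)"
  by (simp_all add: cocycle_twist_def arrows_def Kd_simps(1))

lemma Sg_src: "x \<in> Sp \<Longrightarrow> src Sg ((q, x), t) = ((S, x), cnj (csc S S (chi x)))"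
  by (simp add: cocycle_twist_def Kd_simps coset_cocycle_eq unit_coset)

lemma da_closed: "q \<in> QC \<Longrightarrow> x \<in> Sp \<Longrightarrow> da q x \<in> Sp"
  and chi_da: "q \<in> QC \<Longrightarrow> x \<in> Sp \<Longrightarrow> chi (da q x) = actq q (chi x)"
  by (simp_all add: dual_action_eq char_of_Sp chi_char_of act_T rep_closed chi_T)

lemma Sg_rng: "q \<in> QC \<Longrightarrow> x \<in> Sp \<Longrightarrow> rng Sg ((q, x), t) = ((S, da q x), cnj (csc S S (actq q (chi x))))"
  by (simp add: cocycle_twist_def Kd_simps coset_cocycle_eq unit_coset da_closed chi_da)

lemma Sg_mult: "q \<in> QC \<Longrightarrow> p \<in> QC \<Longrightarrow> y \<in> Sp \<Longrightarrow>
    gmult Sg ((q, x), t) ((p, y), s) = ((q <#> p, y), csc q p (chi y) * t * s)"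
  by (simp add: cocycle_twist_def Kd_simps coset_cocycle_eq)

lemma da_mult: "q \<in> QC \<Longrightarrow> p \<in> QC \<Longrightarrow> x \<in> Sp \<Longrightarrow> da (q <#> p) x = da q (da p x)"
  using Tw.act_mult[of q p "chi x"] Q.m_closed[of q p]
  by (simp add: dual_action_eq char_of_Sp chi_char_of act_T rep_closed chi_T)

lemma da_one: "x \<in> Sp \<Longrightarrow> da S x = x"
  using Tw.act_one[of "chi x"] unit_coset by (simp add: dual_action_eq chi_T char_of_chi)

abbreviation qinv where "qinv q \<equiv> inv\<^bsub>G Mod S\<^esub> q"

lemma qinv_simps: "q \<in> QC \<Longrightarrow> qinv q \<in> QC" "q \<in> QC \<Longrightarrow> qinv q <#> q = S" "q \<in> QC \<Longrightarrow> q <#> qinv q = S"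
  "p \<in> QC \<Longrightarrow> q \<in> QC \<Longrightarrow> p <#> q \<in> QC"
  "p \<in> QC \<Longrightarrow> q \<in> QC \<Longrightarrow> p <#> (qinv p <#> q) = q"
  using Q.inv_closed Q.l_inv Q.r_inv Q.m_closed Q.inv_mult_cancel(2) by simp_all

lemma csc_unit: "q \<in> QC \<Longrightarrow> p \<in> QC \<Longrightarrow> \<psi> \<in> T \<Longrightarrow> csc q p \<psi> * cnj (csc q p \<psi>) = 1"
  using Tw.cocycle_circle by (simp add: complex_norm_square[symmetric])

lemma csc_inverse:
  assumes "q \<in> QC" "\<psi> \<in> T"
  shows "csc q (qinv q) (actq q \<psi>) * csc S S (actq q \<psi>) = csc S S \<psi> * csc (qinv q) q \<psi>"
  using Tw.cocycle_inverse[OF assms(1) unit_coset(1) assms(2)] Tw.cocycle_one_right[OF assms] Q.r_one[OF assms(1)]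
  by simp

text \<open>The inverse in the twist must multiply to the unit, whose own phase is the conjugate of
  \<open>csc S S\<close>; this accounts for the factor besides the value at the inverse
  pair.\<close>

definition inv_phase :: "'a set \<Rightarrow> ('a \<Rightarrow> complex) \<Rightarrow> complex" where
  "inv_phase q \<psi> = cnj (csc (qinv q) q \<psi> * csc S S \<psi>)"

lemma circle_cnj: "t \<in> circle \<Longrightarrow> t * cnj t = 1"
  by (simp add: complex_norm_square[symmetric])

text \<open>The phase is forced by the product with the arrow on one side;
  \<open>csc_inverse\<close> makes it right on the other side as well, so the definite description
  in \<open>ginv\<close> has this value.\<close>

lemma ginv_Sg:
  assumes q: "q \<in> QC" and x: "x \<in> Sp" and t: "t \<in> circle"
  shows "ginv Sg ((q, x), t) = ((qinv q, da q x), cnj t * inv_phase q (chi x))"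
proof -
  note \<psi> = chi_T[OF x]
  note iq = qinv_simps(1)[OF q]
  let ?s = "csc (qinv q) q (chi x)" and ?u = "csc S S (chi x)" and ?v = "csc q (qinv q) (actq q (chi x))"
    and ?w = "csc S S (actq q (chi x))"
  have u: "?s * cnj ?s = 1" "?u * cnj ?u = 1" "?v * cnj ?v = 1" "?w * cnj ?w = 1"
    using q iq \<psi> unit_coset(1) act_T[OF rep_closed[OF q] \<psi>] by (simp_all add: csc_unit)
  have vw: "?v * ?w = ?u * ?s" by (rule csc_inverse[OF q \<psi>])
  have tt: "t * cnj t = 1" by (rule circle_cnj[OF t])
  have dax: "da (qinv q) (da q x) = x"
    using da_mult[OF iq q x] by (simp add: qinv_simps q da_one x)
  show ?thesis
    unfolding ginv_def
  proof (rule the_equality)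
    let ?b = "((qinv q, da q x), cnj t * inv_phase q (chi x))"
    have "cmod (inv_phase q (chi x)) = 1"
      using Tw.cocycle_circle[OF iq q \<psi>] Tw.cocycle_circle[OF unit_coset(1,1) \<psi>]
      by (simp add: inv_phase_def norm_mult)
    then have "?b \<in> arrows Sg" using iq t by (simp add: Sg_simps da_closed q x norm_mult)
    moreover have "src Sg ?b = rng Sg ((q, x), t)"
      by (simp add: Sg_src Sg_rng da_closed q x chi_da)
    moreover have "rng Sg ?b = src Sg ((q, x), t)"
      using chi_da[OF iq da_closed[OF q x]] by (simp add: Sg_src Sg_rng da_closed q x iq dax chi_da)
    moreover have "gmult Sg ?b ((q, x), t) = src Sg ((q, x), t)"
    proof -
      have "?s * (cnj t * cnj (?s * ?u)) * t = (?s * cnj ?s) * (t * cnj t) * cnj ?u"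
        by (simp add: mult_ac)
      then show ?thesis by (simp add: Sg_mult Sg_src q iq x qinv_simps inv_phase_def u(1) tt)
    qed
    moreover have "gmult Sg ((q, x), t) ?b = rng Sg ((q, x), t)"
    proof -
      have "?v * t * (cnj t * cnj (?s * ?u)) = ?v * cnj (?v * ?w) * (t * cnj t)"
        using vw by (simp add: mult_ac)
      also have "\<dots> = (?v * cnj ?v) * (t * cnj t) * cnj ?w" by (simp add: mult_ac)
      finally have "?v * t * (cnj t * cnj (?s * ?u)) = cnj ?w" by (simp add: u(3) tt)
      then show ?thesis
        by (simp add: Sg_mult Sg_rng q iq x da_closed qinv_simps inv_phase_def chi_da)
    qed
    ultimately show "?b \<in> arrows Sg \<and> src Sg ?b = rng Sg ((q, x), t) \<and> rng Sg ?b = src Sg ((q, x), t) \<and>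
      gmult Sg ?b ((q, x), t) = src Sg ((q, x), t) \<and> gmult Sg ((q, x), t) ?b = rng Sg ((q, x), t)"
      by blast
  next
    fix b assume b: "b \<in> arrows Sg \<and> src Sg b = rng Sg ((q, x), t) \<and> rng Sg b = src Sg ((q, x), t) \<and>
      gmult Sg b ((q, x), t) = src Sg ((q, x), t) \<and> gmult Sg ((q, x), t) b = rng Sg ((q, x), t)"
    obtain p y s where b_eq: "b = ((p, y), s)" and p: "p \<in> QC" and y: "y \<in> Sp"
      using b by (auto simp: Sg_simps)
    have "y = da q x" using b unfolding b_eq by (simp add: Sg_src Sg_rng q x y)
    moreover have pq: "p <#> q = S" and sc: "csc p q (chi x) * s * t = cnj ?u"
      using b unfolding b_eq by (simp_all add: Sg_src Sg_mult q x p)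
    moreover have p_eq: "p = qinv q" using Q.inv_equality[of p q] pq p q by simp
    moreover have "s = cnj t * inv_phase q (chi x)"
    proof -
      have "s = (?s * cnj ?s) * (t * cnj t) * s" by (simp add: u(1) tt)
      also have "\<dots> = cnj t * cnj ?s * (csc p q (chi x) * s * t)" by (simp add: p_eq mult_ac)
      also have "\<dots> = cnj t * inv_phase q (chi x)" unfolding sc by (simp add: inv_phase_def mult_ac)
      finally show ?thesis .
    qed
    ultimately show "b = ((qinv q, da q x), cnj t * inv_phase q (chi x))" by (simp add: b_eq)
  qed
qed

text \<open>The lift is an unspecified choice and is known only up to its phase; each use of it has
  to be insensitive to that phase.\<close>

lemma lift_Sg:
  assumes "q \<in> QC" "x \<in> Sp"
  shows "\<exists>t\<in>circle. lift Sg (q, x) = ((q, x), t)"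
proof -
  have "((q, x), 1) \<in> arrows Sg \<and> proj Sg ((q, x), 1) = (q, x)" using assms by (simp add: Sg_simps)
  from someI[of "\<lambda>a. a \<in> arrows Sg \<and> proj Sg a = (q, x)", OF this]
  have "lift Sg (q, x) \<in> arrows Sg \<and> fst (lift Sg (q, x)) = (q, x)"
    by (simp add: lift_def Sg_simps)
  then show ?thesis by (cases "lift Sg (q, x)") (auto simp: Sg_simps)
qed

lemma equivariantD:
  assumes "equivariant Sg f" "q \<in> QC" "x \<in> Sp" "t \<in> circle"
  shows "f ((q, x), t) = cnj t * f ((q, x), 1)"
proof -
  have "((q, x), 1) \<in> arrows Sg" using assms by (simp add: Sg_simps)
  then have "f (twist.act Sg t ((q, x), 1)) = cnj t * f ((q, x), 1)"
    using assms(1,4) unfolding equivariant_def by blast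
  then show ?thesis by (simp add: Sg_simps)
qed

text \<open>An equivariant function on the twist is determined by its values at phase 1. These are
  recorded over twisted characters instead of points of the spectrum, in the format of
  \<open>Tw.coeffs\<close>; \<open>unlift\<close> restores the phase.\<close>

definition coef :: "(('a set \<times> ((nat \<Rightarrow> 'a \<Rightarrow> complex) set \<Rightarrow> complex)) \<times> complex \<Rightarrow> complex) \<Rightarrow>
    'a set \<Rightarrow> ('a \<Rightarrow> complex) \<Rightarrow> complex" where
  "coef f q \<psi> = (if q \<in> QC \<and> \<psi> \<in> T then f ((q, char_of \<psi>), 1) else 0)"

lemma coef_chi: "q \<in> QC \<Longrightarrow> x \<in> Sp \<Longrightarrow> coef f q (chi x) = f ((q, x), 1)"
  by (simp add: coef_def chi_T char_of_chi)

definition unlift :: "('a set \<Rightarrow> ('a \<Rightarrow> complex) \<Rightarrow> complex) \<Rightarrow>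
    ('a set \<times> ((nat \<Rightarrow> 'a \<Rightarrow> complex) set \<Rightarrow> complex)) \<times> complex \<Rightarrow> complex" where
  "unlift F a = (case a of ((q, x), t) \<Rightarrow> if a \<in> arrows Sg then cnj t * F q (chi x) else 0)"

lemma unlift_eq: "q \<in> QC \<Longrightarrow> x \<in> Sp \<Longrightarrow> t \<in> circle \<Longrightarrow> unlift F ((q, x), t) = cnj t * F q (chi x)"
  by (simp add: unlift_def Sg_simps)

lemma unlift_off: "a \<notin> arrows Sg \<Longrightarrow> unlift F a = 0"
  by (auto simp: unlift_def split: prod.split)

lemma coef_unlift: "F \<in> Tw.coeffs \<Longrightarrow> coef (unlift F) = F"
proof (intro ext)
  fix q \<psi> assume F: "F \<in> Tw.coeffs"
  show "coef (unlift F) q \<psi> = F q \<psi>"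
  proof (cases "q \<in> QC \<and> \<psi> \<in> T")
    case True
    then show ?thesis by (simp add: coef_def unlift_eq char_of_Sp chi_char_of)
  next
    case False
    then have "F q \<psi> = 0" using Tw.coeffs_nonzeroD[OF F, of q] by (metis (no_types))
    then show ?thesis using False by (auto simp: coef_def)
  qed
qed

lemma unlift_coef:
  assumes "equivariant Sg f" "\<And>a. a \<notin> arrows Sg \<Longrightarrow> f a = 0"
  shows "unlift (coef f) = f"
proof
  fix a show "unlift (coef f) a = f a"
  proof (cases "a \<in> arrows Sg")
    case True
    then obtain q x t where a: "a = ((q, x), t)" "q \<in> QC" "x \<in> Sp" "t \<in> circle"
      by (cases a) (auto simp: Sg_simps)
    show ?thesis unfolding a(1) unlift_eq[OF a(2-4)] coef_chi[OF a(2,3)] equivariantD[OF assms(1) a(2-4)] ..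
  qed (use assms unlift_off in simp)
qed

lemma unlift_equivariant: "equivariant Sg (unlift F)"
  unfolding equivariant_def
proof (intro ballI)
  fix z a assume z: "z \<in> circle" and "a \<in> arrows Sg"
  then obtain q x t where a: "a = ((q, x), t)" "q \<in> QC" "x \<in> Sp" "t \<in> circle"
    by (cases a) (auto simp: Sg_simps)
  have "z * t \<in> circle" using z a by (simp add: norm_mult)
  then show "unlift F (twist.act Sg z a) = cnj z * unlift F a"
    unfolding a(1) Sg_simps(4) by (simp only: unlift_eq[OF a(2,3)] a(4)) simp
qed

lemma range_fibre:
  assumes q: "q \<in> QC" and x: "x \<in> Sp"
  shows "{\<eta> \<in> arrows Kd. rng Kd \<eta> = rng Kd (q, x)} = (\<lambda>p. (p, da (qinv p <#> q) x)) ` QC"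
proof (intro equalityI subsetI)
  fix \<eta> assume "\<eta> \<in> {\<eta> \<in> arrows Kd. rng Kd \<eta> = rng Kd (q, x)}"
  then obtain p z where \<eta>: "\<eta> = (p, z)" "p \<in> QC" "z \<in> Sp" "da p z = da q x" by (auto simp: Kd_simps)
  have "da (qinv p <#> q) x = da (qinv p) (da p z)"
    using \<eta> q x by (simp add: da_mult qinv_simps)
  also have "\<dots> = z" using \<eta> da_mult[of "qinv p" p z] by (simp add: qinv_simps da_one)
  finally show "\<eta> \<in> (\<lambda>p. (p, da (qinv p <#> q) x)) ` QC" using \<eta> by auto
next
  fix \<eta> assume "\<eta> \<in> (\<lambda>p. (p, da (qinv p <#> q) x)) ` QC"
  then obtain p where \<eta>: "\<eta> = (p, da (qinv p <#> q) x)" "p \<in> QC" by auto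
  have "da p (da (qinv p <#> q) x) = da q x"
    using da_mult[of p "qinv p <#> q" x] \<eta> q x by (simp add: qinv_simps)
  then show "\<eta> \<in> {\<eta> \<in> arrows Kd. rng Kd \<eta> = rng Kd (q, x)}"
    using \<eta> q x by (simp add: Kd_simps da_closed qinv_simps)
qed

text \<open>The phase \<tau> of the lift enters through f and, inversely, through h, so it cancels.
  The remaining phases combine to \<open>csc p m\<close> by the cocycle identity at (p^-1, p, m)
  with m = p^-1 q.\<close>

lemma conv_term:
  assumes f: "equivariant Sg f" and h: "equivariant Sg h"
    and q: "q \<in> QC" and p: "p \<in> QC" and x: "x \<in> Sp" and t: "t \<in> circle"
  shows "f (lift Sg (p, da (qinv p <#> q) x)) *
      h (gmult Sg (ginv Sg (lift Sg (p, da (qinv p <#> q) x))) ((q, x), t)) =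
    cnj t * (coef f p (actq (qinv p <#> q) (chi x)) * csc p (qinv p <#> q) (chi x) * h ((qinv p <#> q, x), 1))"
proof -
  define m where "m = qinv p <#> q"
  have m: "m \<in> QC" "p <#> m = q" using p q by (simp_all add: m_def qinv_simps)
  define z where "z = da m x"
  have z: "z \<in> Sp" "chi z = actq m (chi x)" using m x by (simp_all add: z_def da_closed chi_da)
  note ip = qinv_simps(1)[OF p]
  note \<psi> = chi_T[OF x]
  obtain \<tau> where \<tau>: "\<tau> \<in> circle" "lift Sg (p, z) = ((p, z), \<tau>)" using lift_Sg[OF p z(1)] by auto
  let ?s = "csc (qinv p) p (chi z)" and ?u = "csc S S (chi z)" and ?w = "csc (qinv p) q (chi x)"
  have daz: "da p z = da q x" using da_mult[OF p m(1) x] m by (simp add: z_def)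
  have g: "gmult Sg (ginv Sg (lift Sg (p, z))) ((q, x), t) = ((m, x), ?w * (cnj \<tau> * inv_phase p (chi z)) * t)"
    unfolding \<tau>(2) ginv_Sg[OF p z(1) \<tau>(1)] by (simp add: Sg_mult ip q x m_def)
  have circ: "?w * (cnj \<tau> * inv_phase p (chi z)) * t \<in> circle"
    using Tw.cocycle_circle[OF ip q \<psi>] Tw.cocycle_circle[OF ip p chi_T[OF z(1)]]
      Tw.cocycle_circle[OF unit_coset(1,1) chi_T[OF z(1)]] \<tau>(1) t
    by (simp add: inv_phase_def norm_mult)
  have coc: "?w * csc p m (chi x) = ?u * ?s"
    using Tw.cocycle[OF ip p m(1) \<psi>] Tw.cocycle_one_left[OF m(1) \<psi>] m(2) p z(2)
    by (simp add: qinv_simps)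
  have fl: "f (lift Sg (p, z)) = cnj \<tau> * coef f p (actq m (chi x))"
    unfolding \<tau>(2) using equivariantD[OF f p z(1) \<tau>(1)] coef_chi[OF p z(1), of f] z(2) by simp
  have hl: "h (gmult Sg (ginv Sg (lift Sg (p, z))) ((q, x), t)) =
    cnj (?w * (cnj \<tau> * inv_phase p (chi z)) * t) * h ((m, x), 1)"
    unfolding g by (rule equivariantD[OF h m(1) x circ])
  have "cnj ?w * (?s * ?u) = csc p m (chi x)"
  proof -
    have "cnj ?w * (?s * ?u) = (?w * cnj ?w) * csc p m (chi x)"
      using coc by (simp add: mult_ac)
    then show ?thesis using csc_unit[OF ip q \<psi>] by simp
  qed
  moreover have "cnj \<tau> * cnj (?w * (cnj \<tau> * inv_phase p (chi z)) * t) = (\<tau> * cnj \<tau>) * (cnj t * (cnj ?w * (?s * ?u)))"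
    by (simp add: inv_phase_def mult_ac)
  ultimately have e: "cnj \<tau> * cnj (?w * (cnj \<tau> * inv_phase p (chi z)) * t) = cnj t * csc p m (chi x)"
    using circle_cnj[OF \<tau>(1)] by simp
  have gen: "(u * A) * (v * b) = d * (A * w * b)" if "u * v = d * w" for u v A b d w :: complex
  proof -
    have "(u * A) * (v * b) = (u * v) * (A * b)" by (simp add: mult_ac)
    then show ?thesis using that by (simp add: mult_ac)
  qed
  show ?thesis
    unfolding m_def[symmetric] z_def[symmetric] fl hl by (rule gen[OF e])
qed

text \<open>The function h is only required to be equivariant, so the formula serves both the
  product of the algebra and its action on fibre vectors. Only the finitely many cosets in the
  support of f contribute to the sum over the range fibre.\<close>

lemma twist_conv_Sg:
  assumes f: "equivariant Sg f" and F: "coef f \<in> Tw.coeffs" and h: "equivariant Sg h"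
    and q: "q \<in> QC" and x: "x \<in> Sp" and t: "t \<in> circle"
  shows "twist_conv Kd Sg f h ((q, x), t) = cnj t * Tw.reg (chi x) (coef f) (\<lambda>m. h ((m, x), 1)) q"
proof -
  let ?P = "{p. coef f p \<noteq> (\<lambda>_. 0)}"
  have P: "finite ?P" "?P \<subseteq> QC" using Tw.coeffs_supp[OF F] by auto
  define w where "w p = coef f p (actq (qinv p <#> q) (chi x)) * csc p (qinv p <#> q) (chi x) * h ((qinv p <#> q, x), 1)" for p
  have inj: "inj_on (\<lambda>p. (p, da (qinv p <#> q) x)) QC" by (rule inj_onI) simp
  have "twist_conv Kd Sg f h ((q, x), t) =
    (\<Sum>\<^sub>\<infinity>\<eta>\<in>(\<lambda>p. (p, da (qinv p <#> q) x)) ` QC. f (lift Sg \<eta>) * h (gmult Sg (ginv Sg (lift Sg \<eta>)) ((q, x), t)))"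
    using q x t by (simp add: twist_conv_def Sg_simps range_fibre)
  also have "\<dots> = (\<Sum>\<^sub>\<infinity>p\<in>QC. cnj t * w p)"
    unfolding infsum_reindex[OF inj] o_def w_def
    by (intro infsum_cong conv_term f h q x t)
  also have "\<dots> = (\<Sum>\<^sub>\<infinity>p\<in>?P. cnj t * w p)"
    using P by (intro infsum_cong_neutral) (auto simp: w_def)
  also have "\<dots> = cnj t * (\<Sum>p\<in>?P. w p)"
    using P by (simp add: sum_distrib_left)
  also have "(\<Sum>p\<in>?P. w p) = Tw.reg (chi x) (coef f) (\<lambda>m. h ((m, x), 1)) q"
    using q by (simp add: Tw.reg_def w_def)
  finally show ?thesis .
qed

lemma twist_conv_unlift:
  assumes f: "equivariant Sg f" and F: "coef f \<in> Tw.coeffs" and h: "equivariant Sg h"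
  shows "twist_conv Kd Sg f h = unlift (Tw.conv (coef f) (coef h))"
proof
  fix a show "twist_conv Kd Sg f h a = unlift (Tw.conv (coef f) (coef h)) a"
  proof (cases "a \<in> arrows Sg")
    case False then show ?thesis by (simp add: unlift_off twist_conv_def)
  next
    case True
    then obtain q x t where a: "a = ((q, x), t)" "q \<in> QC" "x \<in> Sp" "t \<in> circle"
      by (cases a) (auto simp: Sg_simps)
    have "Tw.reg (chi x) (coef f) (\<lambda>m. coef h m (chi x)) q = Tw.reg (chi x) (coef f) (\<lambda>m. h ((m, x), 1)) q"
    proof -
      have "coef h (qinv p <#> q) (chi x) = h ((qinv p <#> q, x), 1)" if "coef f p \<noteq> (\<lambda>_. 0)" for p
      proof -
        have "p \<in> QC" using Tw.coeffs_nonzeroD(1)[OF F that] .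
        then show ?thesis using a by (simp add: coef_chi qinv_simps)
      qed
      then show ?thesis using a(2) by (auto simp: Tw.reg_def intro!: sum.cong)
    qed
    then show ?thesis
      unfolding a(1) twist_conv_Sg[OF f F h a(2-4)] unlift_eq[OF a(2-4)]
      by (simp add: Tw.conv_def chi_T a(3))
  qed
qed

lemma twist_star_unlift:
  assumes f: "equivariant Sg f"
  shows "twist_star Sg f = unlift (Tw.adj (coef f))"
proof
  fix a show "twist_star Sg f a = unlift (Tw.adj (coef f)) a"
  proof (cases "a \<in> arrows Sg")
    case False then show ?thesis by (simp add: unlift_off twist_star_def)
  next
    case True
    then obtain q x t where a: "a = ((q, x), t)" "q \<in> QC" "x \<in> Sp" "t \<in> circle"
      by (cases a) (auto simp: Sg_simps)
    note iq = qinv_simps(1)[OF a(2)] and z = da_closed[OF a(2,3)]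
    let ?t = "cnj t * inv_phase q (chi x)"
    have circ: "?t \<in> circle"
      using Tw.cocycle_circle[OF iq a(2) chi_T[OF a(3)]] Tw.cocycle_circle[OF unit_coset(1,1) chi_T[OF a(3)]] a(4)
      by (simp add: inv_phase_def norm_mult)
    have "twist_star Sg f a = cnj (f ((qinv q, da q x), ?t))"
      using True by (simp add: twist_star_def a(1) ginv_Sg[OF a(2-4)])
    also have "\<dots> = cnj (cnj ?t * coef f (qinv q) (actq q (chi x)))"
      using equivariantD[OF f iq z circ] coef_chi[OF iq z, of f] chi_da[OF a(2,3)] by simp
    also have "\<dots> = unlift (Tw.adj (coef f)) a"
      unfolding a(1) unlift_eq[OF a(2-4)] using a chi_T[OF a(3)] by (simp add: Tw.adj_def inv_phase_def)
    finally show ?thesis .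
  qed
qed

section \<open>Fibre spaces and the reduced norm\<close>

abbreviation unit_arrow where "unit_arrow x \<equiv> ((S, x), cnj (csc S S (chi x)))"

lemma units_Sg: "units Sg = unit_arrow ` Sp"
proof (intro equalityI subsetI)
  fix u assume "u \<in> units Sg"
  then obtain q x t where "u = src Sg ((q, x), t)" "x \<in> Sp" by (auto simp: units_def Sg_simps)
  then show "u \<in> unit_arrow ` Sp" by (simp add: Sg_src)
next
  fix u assume "u \<in> unit_arrow ` Sp"
  then obtain x where x: "x \<in> Sp" "u = unit_arrow x" by auto
  have "((S, x), 1) \<in> arrows Sg" using x unit_coset by (simp add: Sg_simps)
  moreover have "u = src Sg ((S, x), 1)" using x by (simp add: Sg_src)
  ultimately show "u \<in> units Sg" by (auto simp: units_def)
qed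

lemma source_fibre: "x \<in> Sp \<Longrightarrow> {\<eta> \<in> arrows Kd. src Kd \<eta> = proj Sg (unit_arrow x)} = (\<lambda>m. (m, x)) ` QC"
  by (auto simp: Kd_simps Sg_simps)

lemma fibre_lift_norm:
  assumes "x \<in> Sp" "\<And>m t. m \<in> QC \<Longrightarrow> t \<in> circle \<Longrightarrow> cmod (\<xi> ((m, x), t)) = cmod (\<Xi> m)" "m \<in> QC"
  shows "cmod (\<xi> (lift Sg (m, x))) = cmod (\<Xi> m)"
  using lift_Sg[OF assms(3,1)] assms(2,3) by fastforce

lemma fibre_norm_Sg:
  assumes x: "x \<in> Sp" and "\<And>m t. m \<in> QC \<Longrightarrow> t \<in> circle \<Longrightarrow> cmod (\<xi> ((m, x), t)) = cmod (\<Xi> m)"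
  shows "fibre_norm Kd Sg (unit_arrow x) \<xi> = qnorm \<Xi>"
proof -
  have inj: "inj_on (\<lambda>m. (m, x)) QC" by (rule inj_onI) simp
  have "(\<Sum>\<^sub>\<infinity>m\<in>QC. (cmod (\<xi> (lift Sg (m, x))))\<^sup>2) = (\<Sum>\<^sub>\<infinity>m\<in>QC. (cmod (\<Xi> m))\<^sup>2)"
  proof (rule infsum_cong)
    fix m assume m: "m \<in> QC"
    have "cmod (\<xi> (lift Sg (m, x))) = cmod (\<Xi> m)"
      by (rule fibre_lift_norm[where \<xi> = \<xi> and \<Xi> = \<Xi>, OF x _ m]) (rule assms(2))
    then show "(cmod (\<xi> (lift Sg (m, x))))\<^sup>2 = (cmod (\<Xi> m))\<^sup>2" by simp
  qed
  then show ?thesis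
    unfolding fibre_norm_def source_fibre[OF x] infsum_reindex[OF inj] by (simp add: l2_norm_def o_def)
qed

text \<open>Restriction to phase 1 maps the fibre space norm-preservingly onto the square-summable
  functions on G/S and intertwines the two actions, so both suprema run over the same set of
  numbers.\<close>

lemma op_norm_fibre:
  assumes f: "equivariant Sg f" and F: "coef f \<in> Tw.coeffs" and x: "x \<in> Sp"
  shows "op_norm (fibre_space Kd Sg (unit_arrow x)) (fibre_norm Kd Sg (unit_arrow x)) (twist_conv Kd Sg f)
    = op_norm (l2_space QC) qnorm (Tw.reg (chi x) (coef f))"
proof -
  let ?H = "fibre_space Kd Sg (unit_arrow x)" and ?N = "fibre_norm Kd Sg (unit_arrow x)"
  define \<rho> where "\<rho> \<xi> = (\<lambda>m. \<xi> ((m, x), 1 :: complex))" for \<xi> :: "('a set \<times> ((nat \<Rightarrow> 'a \<Rightarrow> complex) set \<Rightarrow> complex)) \<times> complex \<Rightarrow> complex"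
  have inj: "inj_on (\<lambda>m. (m, x)) QC" by (rule inj_onI) simp
  have fib: "equivariant Sg \<xi>" "?N \<xi> = qnorm (\<rho> \<xi>)" "\<rho> \<xi> \<in> l2_space QC"
    "?N (twist_conv Kd Sg f \<xi>) = qnorm (Tw.reg (chi x) (coef f) (\<rho> \<xi>))" if \<xi>: "\<xi> \<in> ?H" for \<xi>
  proof -
    show eq: "equivariant Sg \<xi>" using \<xi> by (simp add: fibre_space_def)
    have n: "cmod (\<xi> ((m, x), t)) = cmod (\<rho> \<xi> m)" if "m \<in> QC" "t \<in> circle" for m t
      using equivariantD[OF eq that(1) x that(2)] that by (simp add: \<rho>_def norm_mult)
    show "?N \<xi> = qnorm (\<rho> \<xi>)" by (rule fibre_norm_Sg[where \<xi> = \<xi> and \<Xi> = "\<rho> \<xi>", OF x n])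
    have "(\<lambda>\<eta>. (cmod (\<xi> (lift Sg \<eta>)))\<^sup>2) summable_on (\<lambda>m. (m, x)) ` QC"
      using \<xi> by (simp add: fibre_space_def source_fibre[OF x])
    then have "(\<lambda>m. (cmod (\<xi> (lift Sg (m, x))))\<^sup>2) summable_on QC"
      by (simp add: summable_on_reindex[OF inj] o_def)
    then have "(\<lambda>m. (cmod (\<rho> \<xi> m))\<^sup>2) summable_on QC"
      using summable_on_cong[of QC "\<lambda>m. (cmod (\<xi> (lift Sg (m, x))))\<^sup>2" "\<lambda>m. (cmod (\<rho> \<xi> m))\<^sup>2"]
        fibre_lift_norm[where \<xi> = \<xi> and \<Xi> = "\<rho> \<xi>", OF x n] by simp
    moreover have "\<rho> \<xi> m = 0" if "m \<notin> QC" for m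
      using \<xi> that by (simp add: fibre_space_def Sg_simps \<rho>_def)
    ultimately show "\<rho> \<xi> \<in> l2_space QC" by (simp add: l2_space_def)
    show "?N (twist_conv Kd Sg f \<xi>) = qnorm (Tw.reg (chi x) (coef f) (\<rho> \<xi>))"
      by (rule fibre_norm_Sg[OF x]) (simp add: twist_conv_Sg[OF f F eq _ x] norm_mult \<rho>_def)
  qed
  have surj: "\<exists>\<xi>\<in>?H. \<rho> \<xi> = \<Xi>" if \<Xi>: "\<Xi> \<in> l2_space QC" for \<Xi>
  proof
    define \<xi> where "\<xi> a = (case a of ((m, y), t) \<Rightarrow> if a \<in> arrows Sg \<and> y = x then cnj t * \<Xi> m else 0)" for a
    have val: "\<xi> ((m, x), t) = cnj t * \<Xi> m" if "m \<in> QC" "t \<in> circle" for m t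
      using that x by (simp add: \<xi>_def Sg_simps)
    show "\<rho> \<xi> = \<Xi>"
    proof
      fix m show "\<rho> \<xi> m = \<Xi> m"
        using \<Xi> x by (cases "m \<in> QC") (simp_all add: \<rho>_def \<xi>_def Sg_simps l2_space_def)
    qed
    have eq: "equivariant Sg \<xi>"
      unfolding equivariant_def by (auto simp: Sg_simps \<xi>_def norm_mult)
    have n: "cmod (\<xi> ((m, x), t)) = cmod (\<Xi> m)" if "m \<in> QC" "t \<in> circle" for m t
      using val[OF that] that by (simp add: norm_mult)
    have "(\<lambda>m. (cmod (\<Xi> m))\<^sup>2) summable_on QC" using \<Xi> by (simp add: l2_space_def)
    then have "(\<lambda>m. (cmod (\<xi> (lift Sg (m, x))))\<^sup>2) summable_on QC"
      using summable_on_cong[of QC "\<lambda>m. (cmod (\<xi> (lift Sg (m, x))))\<^sup>2" "\<lambda>m. (cmod (\<Xi> m))\<^sup>2"]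
        fibre_lift_norm[where \<xi> = \<xi> and \<Xi> = \<Xi>, OF x n] by simp
    then have "(\<lambda>\<eta>. (cmod (\<xi> (lift Sg \<eta>)))\<^sup>2) summable_on (\<lambda>m. (m, x)) ` QC"
      by (simp add: summable_on_reindex[OF inj] o_def)
    moreover have "\<xi> a = 0" if "\<not> (a \<in> arrows Sg \<and> src Sg a = unit_arrow x)" for a
    proof -
      obtain m y t where a: "a = ((m, y), t)" by (metis surj_pair)
      show ?thesis using that by (auto simp: a \<xi>_def Sg_simps Sg_src)
    qed
    ultimately show "\<xi> \<in> ?H" using eq by (simp add: fibre_space_def source_fibre[OF x])
  qed
  have "(\<lambda>\<xi>. ?N (twist_conv Kd Sg f \<xi>)) ` {\<xi> \<in> ?H. ?N \<xi> \<le> 1} =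
    (\<lambda>\<Xi>. qnorm (Tw.reg (chi x) (coef f) \<Xi>)) ` {\<Xi> \<in> l2_space QC. qnorm \<Xi> \<le> 1}" (is "?A = ?B")
  proof (intro equalityI subsetI)
    fix v assume "v \<in> ?A"
    then obtain \<xi> where \<xi>: "\<xi> \<in> ?H" "?N \<xi> \<le> 1" "v = ?N (twist_conv Kd Sg f \<xi>)" by auto
    then have "\<rho> \<xi> \<in> {\<Xi> \<in> l2_space QC. qnorm \<Xi> \<le> 1}" using fib(2,3)[OF \<xi>(1)] by simp
    then show "v \<in> ?B" using \<xi>(3) fib(4)[OF \<xi>(1)] by blast
  next
    fix v assume "v \<in> ?B"
    then obtain \<Xi> where \<Xi>: "\<Xi> \<in> l2_space QC" "qnorm \<Xi> \<le> 1" "v = qnorm (Tw.reg (chi x) (coef f) \<Xi>)" by auto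
    then obtain \<xi> where \<xi>: "\<xi> \<in> ?H" "\<rho> \<xi> = \<Xi>" using surj by blast
    have "\<xi> \<in> {\<xi> \<in> ?H. ?N \<xi> \<le> 1}" using \<xi> fib(2)[OF \<xi>(1)] \<Xi>(2) by simp
    moreover have "v = ?N (twist_conv Kd Sg f \<xi>)" using \<Xi>(3) fib(4)[OF \<xi>(1)] \<xi>(2) by simp
    ultimately show "v \<in> ?A" by blast
  qed
  then show ?thesis by (simp add: op_norm_def)
qed

lemma twist_norm_eq:
  assumes f: "equivariant Sg f" and F: "coef f \<in> Tw.coeffs"
  shows "alg_norm (twist_algebra Kd Sg) f = Tw.nrm (coef f)"
proof -
  have "alg_norm (twist_algebra Kd Sg) f = (SUP u\<in>units Sg.
      op_norm (fibre_space Kd Sg u) (fibre_norm Kd Sg u) (twist_conv Kd Sg f))"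
    by (simp add: twist_algebra_def)
  also have "\<dots> = (SUP x\<in>Sp. op_norm (l2_space QC) qnorm (Tw.reg (chi x) (coef f)))"
    unfolding units_Sg image_image by (intro arg_cong[where f = Sup] image_cong refl op_norm_fibre f F)
  also have "\<dots> = Tw.nrm (coef f)"
    unfolding Sp_eq Tw.nrm_def image_image by (intro arg_cong[where f = Sup] image_cong refl) (simp add: chi_char_of)
  finally show ?thesis .
qed

end

section \<open>Trigonometric polynomials are dense\<close>

lemma open_coordinate_vimage: "open U \<Longrightarrow> open ((\<lambda>h::'a \<Rightarrow> 'b::topological_space. h x) -` U)"
  using continuous_on_product_coordinates by (auto intro: open_vimage)

text \<open>The instances for t0 and t1 come first, since the library only has them for a countable
  domain and the arity for t2 has to be compatible with those of its superclasses.\<close>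

instance "fun" :: (type, t0_space) t0_space
proof
  fix f g :: "'a \<Rightarrow> 'b" assume "f \<noteq> g"
  then obtain x where "f x \<noteq> g x" by auto
  then obtain U where "open U" "\<not> (f x \<in> U \<longleftrightarrow> g x \<in> U)" by (auto simp: separation_t0)
  then show "\<exists>U. open U \<and> \<not> (f \<in> U \<longleftrightarrow> g \<in> U)"
    by (intro exI[of _ "(\<lambda>h. h x) -` U"]) (auto intro: open_coordinate_vimage)
qed

instance "fun" :: (type, t1_space) t1_space
proof
  fix f g :: "'a \<Rightarrow> 'b" assume "f \<noteq> g"
  then obtain x where "f x \<noteq> g x" by auto
  then obtain U where "open U" "f x \<in> U" "g x \<notin> U" by (meson t1_space)
  then show "\<exists>U. open U \<and> f \<in> U \<and> g \<notin> U"
    by (intro exI[of _ "(\<lambda>h. h x) -` U"]) (auto intro: open_coordinate_vimage)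
qed

instance "fun" :: (type, t2_space) t2_space
proof
  fix f g :: "'a \<Rightarrow> 'b" assume "f \<noteq> g"
  then obtain x where "f x \<noteq> g x" by auto
  then obtain U V where "open U" "open V" "f x \<in> U" "g x \<in> V" "U \<inter> V = {}"
    by (meson hausdorff)
  then show "\<exists>U V. open U \<and> open V \<and> f \<in> U \<and> g \<in> V \<and> U \<inter> V = {}"
    by (intro exI[of _ "(\<lambda>h. h x) -` U"] exI[of _ "(\<lambda>h. h x) -` V"])
       (auto intro: open_coordinate_vimage)
qed

context cocycle_pair
begin

section \<open>Continuity in the spectrum\<close>

lemma continuous_eval: "continuous_on Sp (\<lambda>x. x P)"
  by (rule continuous_on_subset[OF continuous_on_product_coordinates]) simp

lemma continuous_chi: "continuous_on Sp (\<lambda>x. chi x s)"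
  unfolding chi_def by (cases "s \<in> S") (simp_all add: continuous_eval)

lemma continuous_ker: "continuous_on Sp (\<lambda>x. ker g h (chi x))"
  unfolding ker_def by (intro continuous_intros continuous_chi)

lemma continuous_csc: "continuous_on Sp (\<lambda>x. csc q p (chi x))"
  unfolding csc_def by (intro continuous_intros continuous_ker)

lemma continuous_ev: "continuous_on Sp (\<lambda>x. ev (chi x) b)"
  unfolding ev_def by (intro continuous_intros continuous_chi)

text \<open>The coordinate of the translated character at P is the coordinate of x at the conjugate
  of P, and coordinates are continuous by the choice of topology.\<close>

lemma continuous_da: assumes q: "q \<in> QC" shows "continuous_on Sp (da q)"
proof (rule continuous_on_coordinatewise_then_product)
  fix P
  let ?A = "Cr_group G c" and ?d = "delta_elt G c (r q)"
  have "da q x P = (if P \<in> BS then x (alg_mult ?A (alg_mult ?A (alg_star ?A ?d) P) ?d) else undefined)"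
    if x: "x \<in> Sp" for x
  proof -
    have "da q x = dual_homeo G c S (r q) x"
      using dual_action_eq[OF x q] dual_homeo_eq[OF x rep_closed[OF q]] by simp
    then show ?thesis by (simp add: dual_homeo_def Let_def)
  qed
  moreover have "continuous_on Sp (\<lambda>x. if P \<in> BS then x (alg_mult ?A (alg_mult ?A (alg_star ?A ?d) P) ?d) else undefined)"
    by (cases "P \<in> BS") (simp_all add: continuous_eval)
  ultimately show "continuous_on Sp (\<lambda>x. da q x P)" by (simp cong: continuous_on_cong_simp)
qed

text \<open>The Stone-Weierstrass theorem is applied to a ring of real functions, hence only
  polynomials that are real on the spectrum are collected; complex functions are treated by real and
  imaginary parts.\<close>

definition trig_polys :: "(((nat \<Rightarrow> 'a \<Rightarrow> complex) set \<Rightarrow> complex) \<Rightarrow> real) set" where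
  "trig_polys = {\<phi>. \<exists>b\<in>CcS. \<forall>x\<in>Sp. complex_of_real (\<phi> x) = ev (chi x) b}"

lemma delta_one_CcS: "delta \<one> \<in> CcS"
  by (rule delta_CcS) simp

text \<open>The function evaluated is \<delta>(s)*, so conjugates of characters are again
  trigonometric polynomials; real and imaginary parts depend on this.\<close>

lemma ev_cnj_delta:
  assumes \<psi>: "\<psi> \<in> T" and s: "s \<in> S"
  shows "ev \<psi> (\<lambda>g. cnj (c s (inv s)) * delta (inv s) g) = cnj (\<psi> s)"
proof -
  have inv_s: "inv s \<in> S" by (rule subgroup.m_inv_closed[OF subgroup_axioms s])
  note sc = S_carrier[OF s]
  have 1: "\<psi> s * \<psi> (inv s) = c s (inv s)" using T_mult[OF \<psi> s inv_s] T_one[OF \<psi>] sc by simp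
  have 2: "\<psi> s * cnj (\<psi> s) = 1" using T_norm[OF \<psi> s] by (simp add: complex_norm_square[symmetric])
  have 3: "c s (inv s) * cnj (c s (inv s)) = 1" using c_cnj sc by simp
  have "cnj (c s (inv s)) * \<psi> (inv s) = cnj (c s (inv s)) * (\<psi> s * \<psi> (inv s)) * cnj (\<psi> s)"
    using 2 by (simp add: mult_ac)
  also have "\<dots> = cnj (\<psi> s)" using 3 unfolding 1 by (simp add: mult_ac)
  finally have "cnj (c s (inv s)) * \<psi> (inv s) = cnj (\<psi> s)" .
  then show ?thesis using ev_scale[OF CcS_Cc[OF delta_CcS[OF inv_s]] \<psi>] by (simp add: ev_delta inv_s)
qed

lemma function_ring_trig_polys: "function_ring_on trig_polys Sp"
proof
  show "compact Sp" by (rule compact_Sp)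
  fix \<phi> assume "\<phi> \<in> trig_polys"
  then obtain b where b: "b \<in> CcS" "\<And>x. x \<in> Sp \<Longrightarrow> complex_of_real (\<phi> x) = ev (chi x) b"
    by (auto simp: trig_polys_def)
  have "continuous_on Sp (\<lambda>x. Re (ev (chi x) b))" by (intro continuous_intros continuous_ev)
  moreover have "Re (ev (chi x) b) = \<phi> x" if "x \<in> Sp" for x using b(2)[OF that] by (metis Re_complex_of_real)
  ultimately show "continuous_on Sp \<phi>" using continuous_on_cong[of Sp Sp "\<lambda>x. Re (ev (chi x) b)" \<phi>] by simp
  fix \<phi>' assume "\<phi>' \<in> trig_polys"
  then obtain b' where b': "b' \<in> CcS" "\<And>x. x \<in> Sp \<Longrightarrow> complex_of_real (\<phi>' x) = ev (chi x) b'"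
    by (auto simp: trig_polys_def)
  show "(\<lambda>x. \<phi> x + \<phi>' x) \<in> trig_polys"
    unfolding trig_polys_def
    using b b' by (auto intro!: bexI[of _ "\<lambda>g. b g + b' g"] simp: ev_add CcS_Cc chi_T CcS_add)
  show "(\<lambda>x. \<phi> x * \<phi>' x) \<in> trig_polys"
    unfolding trig_polys_def
    using b b' by (auto intro!: bexI[of _ "twisted_conv G c b b'"] simp: ev_mult chi_T CcS_conv)
next
  fix k :: real
  show "(\<lambda>_. k) \<in> trig_polys"
    unfolding trig_polys_def
    by (auto intro!: bexI[of _ "\<lambda>g. k * delta \<one> g"] CcS_scale delta_one_CcS
        simp: ev_scale[OF CcS_Cc[OF delta_one_CcS] chi_T] ev_delta T_one[OF chi_T])
next
  fix x y assume x: "x \<in> Sp" and y: "y \<in> Sp" and "x \<noteq> y"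
  \<comment> \<open>Distinct points differ at some \<delta>(s), hence in the real or in the
    imaginary part of that value, and both parts are real trigonometric polynomials.\<close>
  then have "chi x \<noteq> chi y" using char_of_chi by metis
  then obtain s where s: "chi x s \<noteq> chi y s" by auto
  then have sS: "s \<in> S" by (auto simp: chi_def split: if_splits)
  have inv_s: "inv s \<in> S" by (rule subgroup.m_inv_closed[OF subgroup_axioms sS])
  let ?d = "\<lambda>g. cnj (c s (inv s)) * delta (inv s) g"
  have d: "?d \<in> CcS" "delta s \<in> CcS" by (intro CcS_scale delta_CcS inv_s sS)+
  have sum: "ev (chi z) (\<lambda>g. u * delta s g + v * ?d g) = u * chi z s + v * cnj (chi z s)"
    "(\<lambda>g. u * delta s g + v * ?d g) \<in> CcS" if z: "z \<in> Sp" for z u v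
  proof -
    note C = Cc_scale[OF CcS_Cc[OF d(2)], of u] Cc_scale[OF CcS_Cc[OF d(1)], of v]
    show "ev (chi z) (\<lambda>g. u * delta s g + v * ?d g) = u * chi z s + v * cnj (chi z s)"
      using ev_add[OF C chi_T[OF z]] ev_scale[OF CcS_Cc[OF d(2)] chi_T[OF z], of u]
        ev_scale[OF CcS_Cc[OF d(1)] chi_T[OF z], of v] ev_cnj_delta[OF chi_T[OF z] sS]
      by (simp only: ev_delta[OF sS])
    show "(\<lambda>g. u * delta s g + v * ?d g) \<in> CcS" by (intro CcS_add CcS_scale d)
  qed
  have polyI: "\<phi> \<in> trig_polys" if "\<And>z. z \<in> Sp \<Longrightarrow> complex_of_real (\<phi> z) = u * chi z s + v * cnj (chi z s)" for \<phi> u v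
    unfolding trig_polys_def
  proof (intro CollectI bexI ballI)
    fix z assume z: "z \<in> Sp"
    show "complex_of_real (\<phi> z) = ev (chi z) (\<lambda>g. u * delta s g + v * ?d g)"
      by (rule trans[OF that[OF z] sum(1)[OF z, symmetric]])
  qed (rule sum(2)[OF x])
  have "(\<lambda>z. Re (chi z s)) \<in> trig_polys"
    by (rule polyI[of _ "1/2" "1/2"]) (simp add: complex_eq_iff)
  moreover have "(\<lambda>z. Im (chi z s)) \<in> trig_polys"
    by (rule polyI[of _ "-\<i>/2" "\<i>/2"]) (simp add: complex_eq_iff)
  moreover have "Re (chi x s) \<noteq> Re (chi y s) \<or> Im (chi x s) \<noteq> Im (chi y s)"
    using s by (auto simp: complex_eq_iff)
  ultimately show "\<exists>\<phi>\<in>trig_polys. \<phi> x \<noteq> \<phi> y"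
    by - (erule disjE, rule bexI[of _ "\<lambda>z. Re (chi z s)"], assumption+,
      rule bexI[of _ "\<lambda>z. Im (chi z s)"], assumption+)
qed

lemma trig_approx_real:
  assumes "continuous_on Sp \<phi>" "e > (0::real)"
  shows "\<exists>b\<in>CcS. \<forall>x\<in>Sp. cmod (complex_of_real (\<phi> x) - ev (chi x) b) < e"
proof -
  obtain \<phi>' where \<phi>': "\<phi>' \<in> trig_polys" "\<And>x. x \<in> Sp \<Longrightarrow> \<bar>\<phi> x - \<phi>' x\<bar> < e"
    using function_ring_on.Stone_Weierstrass_basic[OF function_ring_trig_polys assms] by (elim bexE) simp
  then obtain b where b: "b \<in> CcS" "\<And>x. x \<in> Sp \<Longrightarrow> complex_of_real (\<phi>' x) = ev (chi x) b"
    by (auto simp: trig_polys_def)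
  have "cmod (complex_of_real (\<phi> x) - ev (chi x) b) < e" if "x \<in> Sp" for x
    using \<phi>'(2)[OF that] unfolding b(2)[OF that, symmetric] by (simp flip: of_real_diff)
  then show ?thesis using b(1) by blast
qed

lemma trig_approx:
  fixes \<phi> :: "((nat \<Rightarrow> 'a \<Rightarrow> complex) set \<Rightarrow> complex) \<Rightarrow> complex"
  assumes \<phi>: "continuous_on Sp \<phi>" and e: "e > 0"
  shows "\<exists>b\<in>CcS. \<forall>x\<in>Sp. cmod (\<phi> x - ev (chi x) b) < e"
proof -
  obtain b where b: "b \<in> CcS" "\<And>x. x \<in> Sp \<Longrightarrow> cmod (complex_of_real (Re (\<phi> x)) - ev (chi x) b) < e/2"
    using trig_approx_real[of "\<lambda>x. Re (\<phi> x)" "e/2"] e \<phi> by (auto intro: continuous_intros)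
  obtain b' where b': "b' \<in> CcS" "\<And>x. x \<in> Sp \<Longrightarrow> cmod (complex_of_real (Im (\<phi> x)) - ev (chi x) b') < e/2"
    using trig_approx_real[of "\<lambda>x. Im (\<phi> x)" "e/2"] e \<phi> by (auto intro: continuous_intros)
  let ?b = "\<lambda>g. b g + \<i> * b' g"
  have "cmod (\<phi> x - ev (chi x) ?b) < e" if x: "x \<in> Sp" for x
  proof -
    have "ev (chi x) ?b = ev (chi x) b + \<i> * ev (chi x) b'"
      using b(1) b'(1) by (simp add: ev_add ev_scale CcS_Cc Cc_scale chi_T x)
    moreover have "\<phi> x = complex_of_real (Re (\<phi> x)) + \<i> * complex_of_real (Im (\<phi> x))"
      by (simp add: complex_eq)
    ultimately have "\<phi> x - ev (chi x) ?b = (complex_of_real (Re (\<phi> x)) - ev (chi x) b) +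
      \<i> * (complex_of_real (Im (\<phi> x)) - ev (chi x) b')"
      by (simp add: algebra_simps)
    then have "cmod (\<phi> x - ev (chi x) ?b) \<le> cmod (complex_of_real (Re (\<phi> x)) - ev (chi x) b) +
      cmod (complex_of_real (Im (\<phi> x)) - ev (chi x) b')"
      using norm_triangle_ineq[of "complex_of_real (Re (\<phi> x)) - ev (chi x) b" "\<i> * (complex_of_real (Im (\<phi> x)) - ev (chi x) b')"]
      by (simp add: norm_mult)
    then show ?thesis using b(2)[OF x] b'(2)[OF x] by linarith
  qed
  moreover have "?b \<in> CcS" by (intro CcS_add CcS_scale b(1) b'(1))
  ultimately show ?thesis by blast
qed

section \<open>The isomorphism\<close>

definition cont_coeffs :: "('a set \<Rightarrow> ('a \<Rightarrow> complex) \<Rightarrow> complex) set" where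
  "cont_coeffs = {F \<in> Tw.coeffs. \<forall>q\<in>QC. continuous_on Sp (\<lambda>x. F q (chi x))}"

lemma cont_coeffsD: "F \<in> cont_coeffs \<Longrightarrow> F \<in> Tw.coeffs"
  "F \<in> cont_coeffs \<Longrightarrow> q \<in> QC \<Longrightarrow> continuous_on Sp (\<lambda>x. F q (chi x))"
  by (auto simp: cont_coeffs_def)

lemma cont_coeffsI: "F \<in> Tw.coeffs \<Longrightarrow> (\<And>q. q \<in> QC \<Longrightarrow> continuous_on Sp (\<lambda>x. F q (chi x))) \<Longrightarrow> F \<in> cont_coeffs"
  by (simp add: cont_coeffs_def)

lemma Cc_twistD:
  assumes f: "f \<in> Cc_twist Sg"
  shows "equivariant Sg f" "a \<notin> arrows Sg \<Longrightarrow> f a = 0" "unlift (coef f) = f"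
proof -
  have e: "equivariant Sg f" and z: "\<And>a. a \<notin> arrows Sg \<Longrightarrow> f a = 0"
    using f unfolding Cc_twist_def by blast+
  then show "equivariant Sg f" "a \<notin> arrows Sg \<Longrightarrow> f a = 0" "unlift (coef f) = f"
    using unlift_coef[OF e z] by blast+
qed

lemma unlift_Cc_twist:
  assumes F: "F \<in> cont_coeffs" shows "unlift F \<in> Cc_twist Sg"
proof -
  let ?P = "{p. F p \<noteq> (\<lambda>_. 0)}"
  have P: "finite ?P" "?P \<subseteq> QC" using Tw.coeffs_supp[OF cont_coeffsD(1)[OF F]] by auto
  have "continuous_map (arrow_top Sg) euclidean (\<lambda>a. cnj (snd a) * F (fst (fst a)) (chi (snd (fst a))))"
  proof (rule continuous_map_mult_complex)
    have "continuous_map (top_of_set circle) euclidean cnj" by (simp add: continuous_on_cnj)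
    from continuous_map_compose[OF continuous_map_snd this]
    show "continuous_map (arrow_top Sg) euclidean (\<lambda>a. cnj (snd a))"
      by (simp add: Sg_simps o_def)
    have "continuous_map (arrow_top Kd) euclidean (\<lambda>k. F (fst k) (chi (snd k)))"
      unfolding Kd_simps by (rule continuous_map_from_discrete_product) (simp add: cont_coeffsD(2)[OF F])
    from continuous_map_compose[OF continuous_map_fst this]
    show "continuous_map (arrow_top Sg) euclidean (\<lambda>a. F (fst (fst a)) (chi (snd (fst a))))"
      by (simp add: Sg_simps o_def)
  qed
  then have "continuous_map (arrow_top Sg) euclidean (unlift F)"
    by (rule continuous_map_eq) (auto simp: Sg_simps Kd_simps unlift_eq)
  moreover have "compactin (arrow_top Sg) (arrow_top Sg closure_of {a \<in> arrows Sg. unlift F a \<noteq> 0})"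
  proof (rule closed_compactin)
    \<comment> \<open>Finitely many cosets times two compact spaces: compact and closed, so it
      contains the closure of the support.\<close>
    let ?W = "(?P \<times> Sp) \<times> circle"
    have Pc: "compactin (discrete_topology QC) ?P" using P by (simp add: compactin_discrete_topology)
    have "compactin (top_of_set Sp) Sp" "compactin (top_of_set circle) circle"
      using compact_Sp by (simp_all add: compactin_subtopology)
    then show "compactin (arrow_top Sg) ?W"
      unfolding Sg_simps Kd_simps compactin_Times using Pc by blast
    have "closedin (arrow_top Sg) ?W"
      unfolding Sg_simps Kd_simps closedin_prod_Times_iff using P(2) by simp
    moreover have "{a \<in> arrows Sg. unlift F a \<noteq> 0} \<subseteq> ?W"
    proof
      fix a assume "a \<in> {a \<in> arrows Sg. unlift F a \<noteq> 0}"
      then obtain q x t where a: "a = ((q, x), t)" "q \<in> QC" "x \<in> Sp" "t \<in> circle" "unlift F a \<noteq> 0"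
        by (cases a) (auto simp: Sg_simps)
      then have "F q (chi x) \<noteq> 0" by (auto simp: unlift_eq)
      then show "a \<in> ?W" using a by auto
    qed
    ultimately show "arrow_top Sg closure_of {a \<in> arrows Sg. unlift F a \<noteq> 0} \<subseteq> ?W"
      by (intro closure_of_minimal)
  qed simp
  ultimately show ?thesis
    by (simp add: Cc_twist_def unlift_off unlift_equivariant)
qed

text \<open>The compact closure of the support projects to a compact, hence finite, set of cosets in
  the discrete group G/S. Over each of them the coefficient is bounded by compactness of the
  spectrum.\<close>

lemma coef_cont_coeffs:
  assumes f: "f \<in> Cc_twist Sg" shows "coef f \<in> cont_coeffs"
proof -
  have cont: "continuous_on Sp (\<lambda>x. coef f q (chi x))" if q: "q \<in> QC" for q
  proof -
    have "continuous_map (top_of_set Sp) (arrow_top Sg) (\<lambda>x. ((q, x), 1))"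
      unfolding Sg_simps Kd_simps using q by (simp add: continuous_map_paired continuous_map_in_subtopology)
    from continuous_map_compose[OF this, of euclidean f]
    have "continuous_on Sp (\<lambda>x. f ((q, x), 1))" using f by (simp add: Cc_twist_def o_def)
    then show ?thesis using q by (simp add: coef_chi cong: continuous_on_cong_simp)
  qed
  let ?Z = "{a \<in> arrows Sg. f a \<noteq> 0}"
  define P where "P = (fst \<circ> fst) ` (arrow_top Sg closure_of ?Z)"
  have "continuous_map (arrow_top Sg) (discrete_topology QC) (fst \<circ> fst)"
    unfolding Sg_simps Kd_simps by (intro continuous_map_compose[OF continuous_map_fst continuous_map_fst])
  then have "compactin (discrete_topology QC) P"
    unfolding P_def using f by (intro image_compactin[of "arrow_top Sg"]) (auto simp: Cc_twist_def)
  then have P: "finite P" "P \<subseteq> QC" by (simp_all add: compactin_discrete_topology)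
  have inP: "q \<in> P" if "coef f q \<psi> \<noteq> 0" for q \<psi>
  proof -
    have q: "q \<in> QC" "\<psi> \<in> T" "f ((q, char_of \<psi>), 1) \<noteq> 0" using that by (auto simp: coef_def split: if_splits)
    then have "((q, char_of \<psi>), 1) \<in> ?Z" by (simp add: Sg_simps char_of_Sp)
    moreover have "?Z \<subseteq> arrow_top Sg closure_of ?Z"
      by (intro closure_of_subset) (auto simp: arrows_def)
    ultimately have "((q, char_of \<psi>), 1) \<in> arrow_top Sg closure_of ?Z" by blast
    then show ?thesis unfolding P_def by (intro image_eqI[of _ _ "((q, char_of \<psi>), 1)"]) simp_all
  qed
  have "\<exists>K. \<forall>\<psi>\<in>T. cmod (coef f q \<psi>) \<le> K" if "q \<in> P" for q
  proof -
    have "compact ((\<lambda>x. coef f q (chi x)) ` Sp)"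
      using that P by (intro compact_continuous_image cont compact_Sp) auto
    then obtain K where "\<forall>v\<in>(\<lambda>x. coef f q (chi x)) ` Sp. cmod v \<le> K"
      using compact_imp_bounded bounded_iff by metis
    then have "cmod (coef f q \<psi>) \<le> K" if "\<psi> \<in> T" for \<psi>
      using that char_of_Sp[OF that] chi_char_of[OF that] by force
    then show ?thesis by blast
  qed
  then obtain K where "\<And>q \<psi>. q \<in> P \<Longrightarrow> \<psi> \<in> T \<Longrightarrow> cmod (coef f q \<psi>) \<le> K q" by metis
  then have K: "cmod (coef f q \<psi>) \<le> K q" if "q \<in> P" "\<psi> \<in> T" for q \<psi> using that .
  have "coef f \<in> Tw.coeffs"
  proof (rule Tw.coeffsI[OF P _ K])
    show "q \<in> P \<and> \<psi> \<in> T" if "coef f q \<psi> \<noteq> 0" for q \<psi>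
      using inP[OF that] that by (auto simp: coef_def split: if_splits)
  qed
  then show ?thesis using cont by (rule cont_coeffsI)
qed

lemma cont_coeffs_add: "F \<in> cont_coeffs \<Longrightarrow> H \<in> cont_coeffs \<Longrightarrow> (\<lambda>p x. F p x + H p x) \<in> cont_coeffs"
  by (simp add: cont_coeffs_def Tw.coeffs_add continuous_on_add)

lemma cont_coeffs_scale: "F \<in> cont_coeffs \<Longrightarrow> (\<lambda>p x. z * F p x) \<in> cont_coeffs"
  by (simp add: cont_coeffs_def Tw.coeffs_scale continuous_on_mult_left)

lemma continuous_act:
  assumes F: "F \<in> cont_coeffs" and p: "p \<in> QC" and m: "m \<in> QC"
  shows "continuous_on Sp (\<lambda>x. F p (actq m (chi x)))"
proof -
  have "continuous_on Sp (\<lambda>x. F p (chi (da m x)))"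
    by (rule continuous_on_compose2[OF cont_coeffsD(2)[OF F p] continuous_da[OF m]]) (auto simp: da_closed m)
  then show ?thesis by (simp add: chi_da m cong: continuous_on_cong_simp)
qed

lemma cont_coeffs_conv:
  assumes F: "F \<in> cont_coeffs" and H: "H \<in> cont_coeffs" shows "Tw.conv F H \<in> cont_coeffs"
proof -
  have "continuous_on Sp (\<lambda>x. Tw.conv F H q (chi x))" if q: "q \<in> QC" for q
  proof -
    have "continuous_on Sp (\<lambda>x. F p (actq (qinv p <#> q) (chi x)) * csc p (qinv p <#> q) (chi x) * H (qinv p <#> q) (chi x))"
      if "F p \<noteq> (\<lambda>_. 0)" for p
    proof -
      have p: "p \<in> QC" using Tw.coeffs_nonzeroD(1)[OF cont_coeffsD(1)[OF F] that] .
      then have m: "qinv p <#> q \<in> QC" using q by (simp add: qinv_simps)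
      show ?thesis
        by (intro continuous_intros continuous_act[OF F p m] continuous_csc cont_coeffsD(2)[OF H m])
    qed
    then have "continuous_on Sp (\<lambda>x. Tw.reg (chi x) F (\<lambda>m. H m (chi x)) q)"
      using q by (auto simp: Tw.reg_def intro!: continuous_on_sum)
    then show ?thesis by (simp add: Tw.conv_def chi_T cong: continuous_on_cong_simp)
  qed
  then show ?thesis
    by (rule cont_coeffsI[OF Tw.conv_coeffs[OF cont_coeffsD(1)[OF F] cont_coeffsD(1)[OF H]]])
qed

lemma cont_coeffs_adj:
  assumes F: "F \<in> cont_coeffs" shows "Tw.adj F \<in> cont_coeffs"
proof -
  have "continuous_on Sp (\<lambda>x. Tw.adj F q (chi x))" if q: "q \<in> QC" for q
  proof -
    have "continuous_on Sp (\<lambda>x. cnj (csc (qinv q) q (chi x) * csc S S (chi x)) * cnj (F (qinv q) (actq q (chi x))))"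
      using q by (intro continuous_intros continuous_csc continuous_act[OF F]) (simp_all add: qinv_simps)
    then show ?thesis using q by (simp add: Tw.adj_def chi_T cong: continuous_on_cong_simp)
  qed
  then show ?thesis by (rule cont_coeffsI[OF Tw.adj_coeffs[OF cont_coeffsD(1)[OF F]]])
qed

lemma cont_coeffs_tr: assumes f: "f \<in> Cc" shows "tr f \<in> cont_coeffs"
proof -
  have "continuous_on Sp (\<lambda>x. tr f q (chi x))" if q: "q \<in> QC" for q
  proof -
    have "continuous_on Sp (\<lambda>x. \<Sum>g | f g \<noteq> 0 \<and> g \<in> q. f g * ker (r q) g (chi x))"
      by (intro continuous_intros continuous_ker)
    then show ?thesis using q by (simp add: tr_def chi_T cong: continuous_on_cong_simp)
  qed
  then show ?thesis by (rule cont_coeffsI[OF tr_coeffs[OF f]])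
qed

section \<open>The twisted groupoid algebra in terms of coefficients\<close>

lemma twist_algebra_simps:
  "carrier (twist_algebra Kd Sg) = Cc_twist Sg" "alg_mult (twist_algebra Kd Sg) = twist_conv Kd Sg"
  "alg_star (twist_algebra Kd Sg) = twist_star Sg"
  by (simp_all add: twist_algebra_def)

abbreviation tnorm where "tnorm \<equiv> alg_norm (twist_algebra Kd Sg)"

lemma tnorm_eq: "f \<in> Cc_twist Sg \<Longrightarrow> tnorm f = Tw.nrm (coef f)"
  by (rule twist_norm_eq[OF Cc_twistD(1) cont_coeffsD(1)[OF coef_cont_coeffs]])

lemma tnorm_unlift: "F \<in> cont_coeffs \<Longrightarrow> tnorm (unlift F) = Tw.nrm F"
  by (simp add: tnorm_eq unlift_Cc_twist coef_unlift cont_coeffsD)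

lemma unlift_add: "(\<lambda>a. unlift F a + unlift H a) = unlift (\<lambda>p x. F p x + H p x)"
  and unlift_diff: "(\<lambda>a. unlift F a - unlift H a) = unlift (\<lambda>p x. F p x - H p x)"
  and unlift_scale: "(\<lambda>a. z * unlift F a) = unlift (\<lambda>p x. z * F p x)"
  by (auto simp: unlift_def algebra_simps split: prod.split intro!: ext)

lemma twist_conv_unlift2: "F \<in> cont_coeffs \<Longrightarrow> H \<in> cont_coeffs \<Longrightarrow>
    twist_conv Kd Sg (unlift F) (unlift H) = unlift (Tw.conv F H)"
  using twist_conv_unlift[of "unlift F" "unlift H"] by (simp add: unlift_equivariant coef_unlift cont_coeffsD)

lemma twist_star_unlift2: "F \<in> cont_coeffs \<Longrightarrow> twist_star Sg (unlift F) = unlift (Tw.adj F)"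
  using twist_star_unlift[of "unlift F"] by (simp add: unlift_equivariant coef_unlift cont_coeffsD)

lemma Cc_twist_eq: "Cc_twist Sg = unlift ` cont_coeffs"
  using Cc_twistD(3) coef_cont_coeffs unlift_Cc_twist by (auto intro!: image_eqI[OF sym])

lemma cont_coeffs_diff: "F \<in> cont_coeffs \<Longrightarrow> H \<in> cont_coeffs \<Longrightarrow> (\<lambda>p x. F p x - H p x) \<in> cont_coeffs"
  using cont_coeffs_add[OF _ cont_coeffs_scale[of H "-1"], of F] by simp

sublocale TA: seminormed_star_algebra "twist_algebra Kd Sg"
proof
  show "alg_add (twist_algebra Kd Sg) = (\<lambda>f h i. f i + h i)"
    "alg_scale (twist_algebra Kd Sg) = (\<lambda>z f i. z * f i)" by (simp_all add: twist_algebra_def)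
  have "(\<lambda>_ _. 0) \<in> cont_coeffs"
    by (auto simp: cont_coeffs_def intro!: Tw.coeffsI[of "{}"])
  moreover have "unlift (\<lambda>_ _. 0) = (\<lambda>_. 0)" by (auto simp: unlift_def)
  ultimately show "(\<lambda>_. 0) \<in> carrier (twist_algebra Kd Sg)"
    unfolding twist_algebra_simps Cc_twist_eq by (metis imageI)
  fix f assume "f \<in> carrier (twist_algebra Kd Sg)"
  then obtain F where F: "f = unlift F" "F \<in> cont_coeffs" by (auto simp: twist_algebra_simps Cc_twist_eq)
  note F' = cont_coeffsD(1)[OF F(2)]
  show "(\<lambda>i. z * f i) \<in> carrier (twist_algebra Kd Sg)" for z
    by (simp add: F twist_algebra_simps unlift_scale unlift_Cc_twist cont_coeffs_scale)
  show "alg_star (twist_algebra Kd Sg) f \<in> carrier (twist_algebra Kd Sg)"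
    by (simp add: F twist_algebra_simps twist_star_unlift2 unlift_Cc_twist cont_coeffs_adj)
  show "tnorm (\<lambda>i. z * f i) = cmod z * tnorm f" for z
    by (simp add: F unlift_scale tnorm_unlift cont_coeffs_scale Tw.nrm_scale[OF F'])
  show "tnorm (alg_star (twist_algebra Kd Sg) f) = tnorm f"
    by (simp add: F twist_algebra_simps twist_star_unlift2 tnorm_unlift cont_coeffs_adj Tw.nrm_adj[OF F'])
  fix h assume "h \<in> carrier (twist_algebra Kd Sg)"
  then obtain H where H: "h = unlift H" "H \<in> cont_coeffs" by (auto simp: twist_algebra_simps Cc_twist_eq)
  note H' = cont_coeffsD(1)[OF H(2)]
  show "(\<lambda>i. f i + h i) \<in> carrier (twist_algebra Kd Sg)"
    by (simp add: F H twist_algebra_simps unlift_add unlift_Cc_twist cont_coeffs_add)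
  show "alg_mult (twist_algebra Kd Sg) f h \<in> carrier (twist_algebra Kd Sg)"
    by (simp add: F H twist_algebra_simps twist_conv_unlift2 unlift_Cc_twist cont_coeffs_conv)
  show "tnorm (\<lambda>i. f i + h i) \<le> tnorm f + tnorm h"
    by (simp add: F H unlift_add tnorm_unlift cont_coeffs_add Tw.nrm_triangle[OF F' H'])
  show "tnorm (alg_mult (twist_algebra Kd Sg) f h) \<le> tnorm f * tnorm h"
    by (simp add: F H twist_algebra_simps twist_conv_unlift2 tnorm_unlift cont_coeffs_conv Tw.nrm_conv[OF F' H'])
  show "alg_star (twist_algebra Kd Sg) (\<lambda>i. f i - h i) =
    (\<lambda>i. alg_star (twist_algebra Kd Sg) f i - alg_star (twist_algebra Kd Sg) h i)"
    by (simp add: F H twist_algebra_simps unlift_diff twist_star_unlift2 cont_coeffs_diff Tw.adj_diff)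
  fix k assume "k \<in> carrier (twist_algebra Kd Sg)"
  then obtain L where L: "k = unlift L" "L \<in> cont_coeffs" by (auto simp: twist_algebra_simps Cc_twist_eq)
  note L' = cont_coeffsD(1)[OF L(2)]
  show "alg_mult (twist_algebra Kd Sg) (\<lambda>i. f i - h i) k =
    (\<lambda>i. alg_mult (twist_algebra Kd Sg) f k i - alg_mult (twist_algebra Kd Sg) h k i)"
    by (simp add: F H L twist_algebra_simps unlift_diff twist_conv_unlift2 cont_coeffs_diff Tw.conv_diff_left[OF F' H'])
  show "alg_mult (twist_algebra Kd Sg) f (\<lambda>i. h i - k i) =
    (\<lambda>i. alg_mult (twist_algebra Kd Sg) f h i - alg_mult (twist_algebra Kd Sg) f k i)"
    by (simp add: F H L twist_algebra_simps unlift_diff twist_conv_unlift2 cont_coeffs_diff Tw.conv_diff_right)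
qed

text \<open>Left convolution by \<delta>(r q) moves b from S to the coset q, and the transform moves
  it back before evaluating. The coefficients over different cosets can thus be prescribed
  independently.\<close>

lemma tr_translate:
  assumes q: "q \<in> QC" and b: "b \<in> CcS" and \<psi>: "\<psi> \<in> T" and p: "p \<in> QC"
  shows "tr (twisted_conv G c (delta (r q)) b) p \<psi> = (if p = q then ev \<psi> b else 0)"
proof -
  note rq = rep_closed[OF q] rep_coset[OF q]
  let ?f = "twisted_conv G c (delta (r q)) b"
  have fC: "?f \<in> Cc" by (rule twisted_conv_Cc[OF delta_Cc[OF rq(1)] CcS_Cc[OF b]])
  have val: "?f (r q \<otimes> s) = b s * c (r q) s" if "s \<in> S" for s
    using rq S_carrier[OF that] by (simp add: conv_delta_left inv_mult_cancel)
  have supp_b: "supp b \<subseteq> S" "finite (supp b)" using b by (auto simp: Cc_group_def)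
  let ?J = "(\<lambda>s. r q \<otimes> s) ` supp b"
  have suppf: "supp ?f \<subseteq> ?J"
  proof
    fix g assume g: "g \<in> supp ?f"
    then have gc: "g \<in> carrier G" using CcD(3)[OF fC] by blast
    then have "inv (r q) \<otimes> g \<in> supp b" using g rq by (auto simp: conv_delta_left)
    then show "g \<in> ?J" using inv_mult_cancel(2)[OF rq(1) gc] by (metis image_eqI)
  qed
  have inj: "inj_on (\<lambda>s. r q \<otimes> s) (supp b)"
  proof (rule inj_onI)
    fix s t assume st: "s \<in> supp b" "t \<in> supp b" "r q \<otimes> s = r q \<otimes> t"
    have "s \<in> carrier G" "t \<in> carrier G" using st(1,2) supp_b S_carrier by blast+
    then show "s = t" using inv_mult_cancel(1)[OF rq(1)] st(3) by metis
  qed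
  have "tr ?f p \<psi> = (\<Sum>g\<in>?J. if g \<in> p then ?f g * ker (r p) g \<psi> else 0)"
    using supp_b by (intro tr_eq[OF _ suppf p \<psi>]) simp
  also have "\<dots> = (\<Sum>s\<in>supp b. if p = q then b s * \<psi> s else 0)"
    unfolding sum.reindex[OF inj] o_def
  proof (rule sum.cong)
    fix s assume "s \<in> supp b"
    then have s: "s \<in> S" "s \<in> carrier G" using supp_b S_carrier by blast+
    have "r q \<otimes> s \<in> p \<longleftrightarrow> p = q"
      using coset_mult_S[OF s(1) rq(1)] rq s by (auto simp: mem_coset[OF p])
    moreover have "b s * c (r q) s * ker (r q) (r q \<otimes> s) \<psi> = b s * \<psi> s"
    proof -
      have "c (r q) s * cnj (c (r q) s) = 1" using c_cnj rq s by simp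
      then show ?thesis using rq s by (simp add: ker_def inv_mult_cancel mult.left_commute[of _ "\<psi> s"] mult.commute[of "b s"] mult.assoc)
    qed
    ultimately show "(if r q \<otimes> s \<in> p then ?f (r q \<otimes> s) * ker (r p) (r q \<otimes> s) \<psi> else 0) = (if p = q then b s * \<psi> s else 0)"
      using val[OF s(1)] by auto
  qed simp
  also have "\<dots> = (if p = q then ev \<psi> b else 0)"
    using ev_eq[OF supp_b(2) _ supp_b(1), of b \<psi>] by auto
  finally show ?thesis .
qed

text \<open>Each of the finitely many coefficients is approximated uniformly by a trigonometric
  polynomial, and the norm is at most the sum of the uniform errors. The pieces b are exposed in the
  conclusion so that for P = {S} the approximant can be recognized as a function on S.\<close>

lemma tr_dense:
  assumes P: "finite P" "P \<subseteq> QC" and F: "F \<in> cont_coeffs" "\<forall>p x. F p x \<noteq> 0 \<longrightarrow> p \<in> P" and e: "e > 0"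
  shows "\<exists>b. (\<forall>q\<in>P. b q \<in> CcS) \<and>
    Tw.nrm (\<lambda>p x. F p x - tr (\<lambda>g. \<Sum>q\<in>P. twisted_conv G c (delta (r q)) (b q) g) p x) < e"
proof -
  \<comment> \<open>The summand 1 keeps the total of \<open>card P\<close> errors strictly below e
    and covers the empty P.\<close>
  define \<epsilon> where "\<epsilon> = e / (card P + 1)"
  have \<epsilon>: "\<epsilon> > 0" using e by (simp add: \<epsilon>_def)
  have "\<exists>b\<in>CcS. \<forall>x\<in>Sp. cmod (F q (chi x) - ev (chi x) b) < \<epsilon>" if "q \<in> P" for q
    using that P \<epsilon> by (intro trig_approx cont_coeffsD(2)[OF F(1)]) auto
  then obtain b where b: "\<And>q. q \<in> P \<Longrightarrow> b q \<in> CcS"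
    "\<And>q x. q \<in> P \<Longrightarrow> x \<in> Sp \<Longrightarrow> cmod (F q (chi x) - ev (chi x) (b q)) < \<epsilon>" by metis
  let ?t = "\<lambda>q. twisted_conv G c (delta (r q)) (b q)"
  have tC: "?t q \<in> Cc" if "q \<in> P" for q
    using that P b(1) by (intro twisted_conv_Cc delta_Cc rep_closed CcS_Cc) auto
  have sum: "(\<lambda>g. \<Sum>q\<in>R. ?t q g) \<in> Cc \<and> (\<forall>p\<in>QC. \<forall>\<psi>\<in>T. tr (\<lambda>g. \<Sum>q\<in>R. ?t q g) p \<psi> = (if p \<in> R then ev \<psi> (b p) else 0))"
    if "finite R" "R \<subseteq> P" for R
    using that
  proof (induction R rule: finite_induct)
    case empty
    have "(\<lambda>_. 0) \<in> Cc" by (simp add: Cc_group_def)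
    then show ?case by (simp add: tr_def)
  next
    case (insert q R)
    have q: "q \<in> P" "q \<in> QC" using insert P by auto
    have IH: "(\<lambda>g. \<Sum>q\<in>R. ?t q g) \<in> Cc" "\<forall>p\<in>QC. \<forall>\<psi>\<in>T. tr (\<lambda>g. \<Sum>q\<in>R. ?t q g) p \<psi> = (if p \<in> R then ev \<psi> (b p) else 0)"
      using insert by auto
    have eq: "(\<lambda>g. \<Sum>q\<in>insert q R. ?t q g) = (\<lambda>g. ?t q g + (\<Sum>q\<in>R. ?t q g))"
      using insert.hyps by simp
    show ?case
      unfolding eq
      using insert.hyps tr_add[OF tC[OF q(1)] IH(1)] IH(2) tr_translate[OF q(2) b(1)[OF q(1)]]
        Cc_add[OF tC[OF q(1)] IH(1)] by auto
  qed
  define f where "f = (\<lambda>g. \<Sum>q\<in>P. ?t q g)"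
  have f: "f \<in> Cc" "\<And>p \<psi>. p \<in> QC \<Longrightarrow> \<psi> \<in> T \<Longrightarrow> tr f p \<psi> = (if p \<in> P then ev \<psi> (b p) else 0)"
    using sum[OF P(1) order_refl] by (auto simp: f_def)
  have "Tw.nrm (\<lambda>p x. F p x - tr f p x) \<le> (\<Sum>p\<in>P. \<epsilon>)"
  proof (rule Tw.nrm_le_sum[OF P])
    show "(\<lambda>p x. F p x - tr f p x) \<in> Tw.coeffs"
      by (intro Tw.coeffs_diff cont_coeffsD(1)[OF F(1)] tr_coeffs f)
    show "p \<in> P" if "F p \<psi> - tr f p \<psi> \<noteq> 0" for p \<psi>
    proof (rule ccontr)
      assume p: "p \<notin> P"
      then have "F p \<psi> = 0" using F(2) by blast
      moreover have "tr f p \<psi> = 0"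
        using f(2)[of p \<psi>] p by (cases "p \<in> QC \<and> \<psi> \<in> T") (auto simp: tr_def)
      ultimately show False using that by simp
    qed
    show "cmod (F p \<psi> - tr f p \<psi>) \<le> \<epsilon>" if p: "p \<in> P" and \<psi>: "\<psi> \<in> T" for p \<psi>
      using b(2)[OF p char_of_Sp[OF \<psi>]] f(2)[OF _ \<psi>, of p] p P(2)
      by (auto simp: chi_char_of[OF \<psi>] less_imp_le)
  qed
  also have "\<dots> < e" using e by (simp add: \<epsilon>_def field_simps)
  finally show ?thesis using b(1) unfolding f_def by blast
qed

sublocale DI: dense_isometry "group_algebra G c" "twist_algebra Kd Sg" "\<lambda>f. unlift (tr f)"
proof
  fix f :: "'a \<Rightarrow> complex" assume "f \<in> carrier (group_algebra G c)"
  then have f: "f \<in> Cc" by (simp add: group_algebra_simps)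
  note trf = cont_coeffs_tr[OF f]
  show "unlift (tr f) \<in> carrier (twist_algebra Kd Sg)"
    by (simp add: twist_algebra_simps unlift_Cc_twist trf)
  show "unlift (tr (\<lambda>i. z * f i)) = (\<lambda>j. z * unlift (tr f) j)" for z
    unfolding unlift_scale using tr_scale[OF f] by (intro arg_cong[where f = unlift] ext) simp
  show "unlift (tr (alg_star (group_algebra G c) f)) = alg_star (twist_algebra Kd Sg) (unlift (tr f))"
    by (simp add: group_algebra_simps twist_algebra_simps tr_star f twist_star_unlift2 trf)
  show "tnorm (unlift (tr f)) = gnorm f"
    by (simp add: tnorm_unlift trf tr_norm f)
  fix h :: "'a \<Rightarrow> complex" assume "h \<in> carrier (group_algebra G c)"
  then have h: "h \<in> Cc" by (simp add: group_algebra_simps)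
  note trh = cont_coeffs_tr[OF h]
  show "unlift (tr (\<lambda>i. f i + h i)) = (\<lambda>j. unlift (tr f) j + unlift (tr h) j)"
    unfolding unlift_add using tr_add[OF f h] by (intro arg_cong[where f = unlift] ext) simp
  show "unlift (tr (alg_mult (group_algebra G c) f h)) = alg_mult (twist_algebra Kd Sg) (unlift (tr f)) (unlift (tr h))"
    by (simp add: group_algebra_simps twist_algebra_simps tr_mult f h twist_conv_unlift2 trf trh)
next
  fix k and e :: real assume "k \<in> carrier (twist_algebra Kd Sg)" and e: "e > 0"
  then obtain F where F: "k = unlift F" "F \<in> cont_coeffs" by (auto simp: twist_algebra_simps Cc_twist_eq)
  let ?P = "{p. F p \<noteq> (\<lambda>_. 0)}"
  have P: "finite ?P" "?P \<subseteq> QC" using Tw.coeffs_supp[OF cont_coeffsD(1)[OF F(2)]] by auto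
  have supp: "\<forall>p x. F p x \<noteq> 0 \<longrightarrow> p \<in> ?P" by auto
  obtain b where b: "\<forall>q\<in>?P. b q \<in> CcS"
    "Tw.nrm (\<lambda>p x. F p x - tr (\<lambda>g. \<Sum>q\<in>?P. twisted_conv G c (delta (r q)) (b q) g) p x) < e"
    using tr_dense[OF P F(2) supp e] by (elim exE conjE)
  define f where "f = (\<lambda>g. \<Sum>q\<in>?P. twisted_conv G c (delta (r q)) (b q) g)"
  have f: "f \<in> Cc"
  proof -
    have "(\<lambda>g. \<Sum>q\<in>R. twisted_conv G c (delta (r q)) (b q) g) \<in> Cc" if "finite R" "R \<subseteq> ?P" for R
      using that
    proof (induction R rule: finite_induct)
      case empty show ?case by (simp add: Cc_group_def)
    next
      case (insert q R)
      then have "twisted_conv G c (delta (r q)) (b q) \<in> Cc"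
        using P b(1) by (intro twisted_conv_Cc delta_Cc rep_closed CcS_Cc) auto
      then show ?case using insert Cc_add by simp
    qed
    then show ?thesis using P(1) by (simp add: f_def)
  qed
  have "tnorm (\<lambda>j. k j - unlift (tr f) j) < e"
    using b(2) by (simp add: F(1) unlift_diff tnorm_unlift cont_coeffs_diff F(2) cont_coeffs_tr f flip: f_def)
  then show "\<exists>f\<in>carrier (group_algebra G c). tnorm (\<lambda>j. k j - unlift (tr f) j) < e"
    using f by (auto simp: group_algebra_simps)
qed

text \<open>The circle orbits of units fill exactly the part of the twist over the coset S:
  multiplying the unit over x by t \<open>csc S S (chi x)\<close> reaches phase t. Functions living
  there are those whose only nonzero coefficient sits at S.\<close>

lemma unit_functions_eq:
  assumes "F \<in> cont_coeffs"
  shows "(\<forall>a. unlift F a \<noteq> 0 \<longrightarrow> (\<exists>z\<in>circle. \<exists>u\<in>units Sg. a = twist.act Sg z u)) \<longleftrightarrow> (\<forall>p x. F p x \<noteq> 0 \<longrightarrow> p = S)"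
proof (intro iffI allI impI)
  fix p \<psi> assume H: "\<forall>a. unlift F a \<noteq> 0 \<longrightarrow> (\<exists>z\<in>circle. \<exists>u\<in>units Sg. a = twist.act Sg z u)" and nz: "F p \<psi> \<noteq> 0"
  have "p \<in> QC" "\<psi> \<in> T" using nz cont_coeffsD(1)[OF assms] by (auto simp: Tw.coeffs_def)
  then have "unlift F ((p, char_of \<psi>), 1) \<noteq> 0" using nz by (simp add: unlift_eq char_of_Sp chi_char_of)
  then obtain z u where "u \<in> units Sg" "((p, char_of \<psi>), 1) = twist.act Sg z u" using H by blast
  then show "p = S" by (auto simp: units_Sg Sg_simps)
next
  fix a assume H: "\<forall>p x. F p x \<noteq> 0 \<longrightarrow> p = S" and nz: "unlift F a \<noteq> 0"
  obtain q x t where a: "a = ((q, x), t)" "q \<in> QC" "x \<in> Sp" "t \<in> circle"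
    using nz unlift_off[of a F] by (cases a) (auto simp: Sg_simps)
  then have "q = S" using nz H by (auto simp: unlift_eq)
  let ?u = "csc S S (chi x)"
  have u: "cmod ?u = 1" by (rule Tw.cocycle_circle[OF unit_coset(1,1) chi_T[OF a(3)]])
  have "a = twist.act Sg (t * ?u) (unit_arrow x)"
    using csc_unit[OF unit_coset(1,1) chi_T[OF a(3)]] by (simp add: a(1) \<open>q = S\<close> Sg_simps mult.assoc)
  moreover have "t * ?u \<in> circle" using a(4) u by (simp add: norm_mult)
  ultimately show "\<exists>z\<in>circle. \<exists>u\<in>units Sg. a = twist.act Sg z u"
    using a(3) by (auto simp: units_Sg)
qed

text \<open>An instance of \<open>DI.ext_closure\<close> with the functions on S and the functions
  living on circle orbits of units as dense subspaces.\<close>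

lemma iso_subalgebra: "DI.ext ` BS = C0_units Kd Sg"
proof -
  let ?E = "{f \<in> Cc_twist Sg. \<forall>a. f a \<noteq> 0 \<longrightarrow> (\<exists>z\<in>circle. \<exists>u\<in>units Sg. a = twist.act Sg z u)}"
  have "DI.ext ` norm_closure GA.C (emb ` CcS) = norm_closure TA.C (completion_emb (twist_algebra Kd Sg) ` ?E)"
  proof (rule DI.ext_closure[OF CcS_carrier])
    show "?E \<subseteq> carrier (twist_algebra Kd Sg)" by (auto simp: twist_algebra_simps)
    show "(\<lambda>f. unlift (tr f)) ` CcS \<subseteq> ?E"
    proof
      fix k assume "k \<in> (\<lambda>f. unlift (tr f)) ` CcS"
      then obtain f where f: "f \<in> CcS" "k = unlift (tr f)" by auto
      note trf = cont_coeffs_tr[OF CcS_Cc[OF f(1)]]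
      show "k \<in> ?E"
        using unit_functions_eq[OF trf] tr_CcS_nonzeroD[OF f(1)] unlift_Cc_twist[OF trf] by (simp add: f(2))
    qed
    fix k and e :: real assume k: "k \<in> ?E" and e: "e > 0"
    then obtain F where F: "k = unlift F" "F \<in> cont_coeffs" by (auto simp: Cc_twist_eq)
    have supp: "\<forall>p x. F p x \<noteq> 0 \<longrightarrow> p \<in> {S}"
      using k unit_functions_eq[OF F(2)] unfolding F(1) by blast
    obtain b where b: "b S \<in> CcS"
      "Tw.nrm (\<lambda>p x. F p x - tr (twisted_conv G c (delta (r S)) (b S)) p x) < e"
      using tr_dense[OF _ _ F(2) supp e] unit_coset(1) by auto
    let ?f = "twisted_conv G c (delta (r S)) (b S)"
    \<comment> \<open>The representative of the unit coset lies in S, so translating by it does not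
      leave the functions on S.\<close>
    have "r S \<in> S" using rep unit_coset(1) by blast
    then have f: "?f \<in> CcS" by (intro CcS_conv delta_CcS b(1))
    have "tnorm (\<lambda>j. k j - unlift (tr ?f) j) < e"
      using b(2) by (simp add: F(1) unlift_diff tnorm_unlift cont_coeffs_diff F(2) cont_coeffs_tr CcS_Cc[OF f])
    then show "\<exists>f\<in>CcS. tnorm (\<lambda>j. k j - unlift (tr f) j) < e" using f by blast
  qed
  then show ?thesis by (simp add: BS_eq_closure C0_units_def Cr_twist_def)
qed

end

theorem theorem5p8:
  fixes G :: "('a, 'm) monoid_scheme"
    and c :: "'a \<Rightarrow> 'a \<Rightarrow> complex"
    and S :: "'a set"
    and r :: "'a set \<Rightarrow> 'a"
  assumes "group G"
    and "countable (carrier G)"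
    and "group_2cocycle G c"
    and "maximal_symmetric_abelian G c S"
    and "S \<lhd> G"
    and "immediately_centralizing G S"
    and "topologically_free (G Mod S) (dual_top G c S) (dual_action G c S)"
    and "\<forall>q\<in>carrier (G Mod S). r q \<in> q"
  shows "let K = coset_groupoid G c S; \<Sigma> = cocycle_twist K (coset_cocycle G c S r) in
    \<exists>\<Phi>. star_iso (Cr_group G c) (Cr_twist K \<Sigma>) \<Phi> \<and>
      \<Phi> ` carrier (Cr_subgroup G c S) = C0_units K \<Sigma>"
proof -
  interpret normal S G by (rule assms(5))
  interpret cocycle_pair S G c r
    using assms(3,4,8) by unfold_locales (auto simp: maximal_symmetric_abelian_def)
  show ?thesis
    unfolding Let_def
    using DI.star_iso_ext iso_subalgebra by (auto simp: Cr_group_def Cr_twist_def)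
qed

end
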